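(* Let $V,W$ be complex vector spaces of the same dimension $k\ge 1$ and $R=\mathrm{Sym}(V\otimes W^* )$. For any partitions $\lambda^{(0)}\subsetneq\lambda^{(1)}$ (with at most $k$ parts), there exist positive integers $c_0,c_1$ and a torsion, $\mathbf{GL}(V)$-equivariant $R$-module $M$ with $\mathbf{GL}(V)$-equivariant minimal free resolution $$0\leftarrow M\leftarrow \mathbb{S}_{\lambda^{(0)}}(V)^{\oplus c_0}\otimes R\leftarrow \mathbb{S}_{\lambda^{(1)}}(V)^{\oplus c_1}\otimes R\leftarrow 0 .$$
   Context: $R$ is the coordinate ring of the affine space $\mathrm{Hom}(V,W)$ of $k\times k$ matrices, with its natural $\mathbf{GL}(V)$-action; all representations are algebraic. For a partition $\lambda=(\lambda_1\ge\dots\ge\lambda_k\ge0)$, $\mathbb{S}_\lambda(V)$ is the corresponding irreducible $\mathbf{GL}(V)$-representation (Schur functor). $\lambda\subseteq\mu$ means $\lambda_i\le\mu_i$ for all $i$. Minimal means the differential becomes zero after tensoring with $R/\mathfrak{m}$, where $\mathfrak{m}$ is the maximal ideal generated by the matrix entries. *)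

theory Defs
  imports
    "HOL-Analysis.Analysis"
    "HOL-Algebra.Algebra"
    "HOL-Combinatorics.Permutations"
    "HOL-Library.Poly_Mapping"
begin

section \<open>The ring $R = \mathrm{Sym}(V \otimes W^*)$ and the action of $\mathbf{GL}(V)$\<close>

text \<open>
  Bases are fixed: \<open>V = complex ^ 'v\<close> and \<open>W = complex ^ 'w\<close>.  The elements of \<open>GL(V)\<close> are the
  invertible matrices \<open>g :: complex ^ 'v ^ 'v\<close>, acting by \<open>g e\<^sub>j = (\<Sum>i. g $ i $ j e\<^sub>i)\<close>.
  The symmetric algebra on \<open>V \<otimes> W\<^sup>*\<close> is the polynomial ring in the variables \<open>(i, j)\<close>, the
  variable \<open>(i, j)\<close> standing for the basis vector \<open>e\<^sub>i \<otimes> f\<^sub>j\<^sup>*\<close>.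
\<close>

type_synonym 'x mpoly = "('x \<Rightarrow>\<^sub>0 nat) \<Rightarrow>\<^sub>0 complex"

type_synonym ('v, 'w) coord = "('v \<times> 'w) mpoly"

definition Const :: "complex \<Rightarrow> 'x mpoly"
  where "Const c = Poly_Mapping.single 0 c"

definition Var :: "'x \<Rightarrow> 'x mpoly"
  where "Var x = Poly_Mapping.single (Poly_Mapping.single x 1) 1"

definition poly_subst :: "(complex \<Rightarrow> 'a) \<Rightarrow> ('x \<Rightarrow> 'a) \<Rightarrow> 'x mpoly \<Rightarrow> 'a::comm_ring_1"
  where "poly_subst h \<phi> p =
    (\<Sum>m\<in>Poly_Mapping.keys p. h (Poly_Mapping.lookup p m) *
       (\<Prod>x\<in>Poly_Mapping.keys m. \<phi> x ^ Poly_Mapping.lookup m x))"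

definition coord_ring :: "('v, 'w) coord ring"
  where "coord_ring = \<lparr>carrier = UNIV, monoid.mult = (*), one = 1, ring.zero = 0, ring.add = (+)\<rparr>"

definition max_ideal :: "('v, 'w) coord set"
  where "max_ideal = genideal coord_ring (range Var)"

definition GL :: "(complex ^ 'v ^ 'v) set"
  where "GL = {g. invertible g}"

definition coord_act :: "complex ^ 'v ^ 'v \<Rightarrow> ('v::finite, 'w) coord \<Rightarrow> ('v, 'w) coord"
  where "coord_act g =
    poly_subst Const (\<lambda>(i, j). \<Sum>a\<in>UNIV. Const (g $ a $ i) * Var (a, j))"

definition regular_on_GL :: "(complex ^ 'v ^ 'v \<Rightarrow> complex) \<Rightarrow> bool"
  where "regular_on_GL f \<longleftrightarrow>
    (\<exists>(p :: ('v::finite \<times> 'v) mpoly) N. \<forall>g\<in>GL.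
       f g = poly_subst id (\<lambda>(i, j). g $ i $ j) p / det g ^ N)"


section \<open>Equivariant modules and minimal resolutions\<close>

text \<open>
  The last axiom says that the representation is algebraic: every vector \<open>x\<close> has a coaction
  \<open>(\<Sum>i<n. f i \<otimes> y i)\<close> with regular functions \<open>f i\<close> on \<open>GL(V)\<close>.  Linearity over the complex
  numbers is contained in \<open>act_smult\<close>, because \<open>GL(V)\<close> fixes the constants of \<open>R\<close>.
\<close>

locale equivariant_module =
  Module.module coord_ring M
  for M :: "(('v::finite, 'w::finite) coord, 'm) module" (structure)
    and act :: "complex ^ 'v ^ 'v \<Rightarrow> 'm \<Rightarrow> 'm" +
  assumes act_closed: "g \<in> GL \<Longrightarrow> x \<in> carrier M \<Longrightarrow> act g x \<in> carrier M"
    and act_add: "g \<in> GL \<Longrightarrow> x \<in> carrier M \<Longrightarrow> y \<in> carrier M \<Longrightarrow>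
      act g (x \<oplus>\<^bsub>M\<^esub> y) = act g x \<oplus>\<^bsub>M\<^esub> act g y"
    and act_one: "x \<in> carrier M \<Longrightarrow> act (mat 1) x = x"
    and act_mult: "g \<in> GL \<Longrightarrow> h \<in> GL \<Longrightarrow> x \<in> carrier M \<Longrightarrow>
      act (g ** h) x = act g (act h x)"
    and act_smult: "g \<in> GL \<Longrightarrow> x \<in> carrier M \<Longrightarrow>
      act g (r \<odot>\<^bsub>M\<^esub> x) = coord_act g r \<odot>\<^bsub>M\<^esub> act g x"
    and act_algebraic: "x \<in> carrier M \<Longrightarrow>
      \<exists>(n :: nat) f y. (\<forall>i<n. regular_on_GL (f i) \<and> y i \<in> carrier M) \<and>
        (\<forall>g\<in>GL. act g x = (\<Oplus>\<^bsub>M\<^esub>i\<in>{..<n}. Const (f i g) \<odot>\<^bsub>M\<^esub> y i))"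

definition equivariant_hom ::
  "(('v::finite, 'w::finite) coord, 'm) module \<Rightarrow> (complex ^ 'v ^ 'v \<Rightarrow> 'm \<Rightarrow> 'm) \<Rightarrow>
   (('v, 'w) coord, 'n) module \<Rightarrow> (complex ^ 'v ^ 'v \<Rightarrow> 'n \<Rightarrow> 'n) \<Rightarrow> ('m \<Rightarrow> 'n) \<Rightarrow> bool"
  where "equivariant_hom M actM N actN f \<longleftrightarrow>
    f \<in> carrier M \<rightarrow> carrier N \<and>
    (\<forall>x\<in>carrier M. \<forall>y\<in>carrier M. f (x \<oplus>\<^bsub>M\<^esub> y) = f x \<oplus>\<^bsub>N\<^esub> f y) \<and>
    (\<forall>r. \<forall>x\<in>carrier M. f (r \<odot>\<^bsub>M\<^esub> x) = r \<odot>\<^bsub>N\<^esub> f x) \<and>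
    (\<forall>g\<in>GL. \<forall>x\<in>carrier M. f (actM g x) = actN g (f x))"

definition torsion_module :: "(('v, 'w) coord, 'm) module \<Rightarrow> bool"
  where "torsion_module M \<longleftrightarrow> (\<forall>x\<in>carrier M. \<exists>r. r \<noteq> 0 \<and> r \<odot>\<^bsub>M\<^esub> x = \<zero>\<^bsub>M\<^esub>)"

definition max_ideal_smult :: "(('v, 'w) coord, 'm) module \<Rightarrow> 'm set"
  where "max_ideal_smult M =
    generate (add_monoid M) {r \<odot>\<^bsub>M\<^esub> x | r x. r \<in> max_ideal \<and> x \<in> carrier M}"

text \<open>\<open>M \<otimes> R/\<mm>\<close> is formed as \<open>M/\<mm>M\<close>, whose elements are cosets, and \<open>f \<otimes> R/\<mm>\<close> as the
  induced map, sending the coset of \<open>x\<close> to the coset of \<open>f x\<close>.\<close>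

definition residue_module :: "(('v, 'w) coord, 'm) module \<Rightarrow> 'm set monoid"
  where "residue_module M = M A_Mod max_ideal_smult M"

definition residue_map :: "(('v, 'w) coord, 'n) module \<Rightarrow> ('m \<Rightarrow> 'n) \<Rightarrow> 'm set \<Rightarrow> 'n set"
  where "residue_map N f C = (\<Union>x\<in>C. max_ideal_smult N +>\<^bsub>N\<^esub> f x)"

text \<open>\<open>0 \<leftarrow> M \<leftarrow> F\<^sub>0 \<leftarrow> F\<^sub>1 \<leftarrow> 0\<close> with augmentation \<open>\<epsilon> : F\<^sub>0 \<rightarrow> M\<close> and differential
  \<open>d : F\<^sub>1 \<rightarrow> F\<^sub>0\<close>.  Freeness of the terms is not part of this predicate.\<close>

definition equivariant_minimal_resolution where
  "equivariant_minimal_resolution M act F\<^sub>0 act\<^sub>0 F\<^sub>1 act\<^sub>1 \<epsilon> d \<longleftrightarrow>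
    equivariant_module M act \<and>
    equivariant_module F\<^sub>0 act\<^sub>0 \<and>
    equivariant_module F\<^sub>1 act\<^sub>1 \<and>
    equivariant_hom F\<^sub>0 act\<^sub>0 M act \<epsilon> \<and>
    equivariant_hom F\<^sub>1 act\<^sub>1 F\<^sub>0 act\<^sub>0 d \<and>
    \<epsilon> ` carrier F\<^sub>0 = carrier M \<and>
    a_kernel F\<^sub>0 M \<epsilon> = d ` carrier F\<^sub>1 \<and>
    inj_on d (carrier F\<^sub>1) \<and>
    (\<forall>C\<in>carrier (residue_module F\<^sub>1). residue_map F\<^sub>0 d C = \<one>\<^bsub>residue_module F\<^sub>0\<^esub>)"


section \<open>Schur functors\<close>

text \<open>Partitions are decreasing sequences padded with zeros; part \<open>i\<close> of the usual numbering is
  \<open>lam (i - 1)\<close>.\<close>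

definition partition_at_most :: "nat \<Rightarrow> (nat \<Rightarrow> nat) \<Rightarrow> bool"
  where "partition_at_most k lam \<longleftrightarrow> antimono lam \<and> (\<forall>i\<ge>k. lam i = 0)"

definition diagram :: "(nat \<Rightarrow> nat) \<Rightarrow> (nat \<times> nat) set"
  where "diagram lam = {(i, j). j < lam i}"

text \<open>
  The tensor factors of \<open>V\<^sup>\<otimes>\<^sup>n\<close>, \<open>n = |lam|\<close>, are indexed by the boxes of the diagram instead of by
  \<open>1, \<dots>, n\<close>.  A word is a filling of the diagram by basis indices, and a tensor is given
  by its coefficients, a function on words.  The symmetric group on the boxes permutes the factors
  by \<open>(p t) w = t (w \<circ> p)\<close>.
\<close>

type_synonym 'v filling = "nat \<times> nat \<Rightarrow> 'v"

definition words :: "(nat \<Rightarrow> nat) \<Rightarrow> 'v filling set"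
  where "words lam = (diagram lam \<rightarrow>\<^sub>E UNIV)"

definition tensors :: "(nat \<Rightarrow> nat) \<Rightarrow> ('v filling \<Rightarrow> complex) set"
  where "tensors lam = {t. \<forall>w. w \<notin> words lam \<longrightarrow> t w = 0}"

definition row_group :: "(nat \<Rightarrow> nat) \<Rightarrow> (nat \<times> nat \<Rightarrow> nat \<times> nat) set"
  where "row_group lam = {p. p permutes diagram lam \<and> (\<forall>b. fst (p b) = fst b)}"

definition column_group :: "(nat \<Rightarrow> nat) \<Rightarrow> (nat \<times> nat \<Rightarrow> nat \<times> nat) set"
  where "column_group lam = {q. q permutes diagram lam \<and> (\<forall>b. snd (q b) = snd b)}"

text \<open>Row symmetrization after column antisymmetrization.\<close>

definition young_symmetrizer ::
  "(nat \<Rightarrow> nat) \<Rightarrow> ('v filling \<Rightarrow> complex) \<Rightarrow> ('v filling \<Rightarrow> complex)"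
  where "young_symmetrizer lam t =
    (\<lambda>w. \<Sum>p\<in>row_group lam. \<Sum>q\<in>column_group lam. of_int (sign q) * t (w \<circ> p \<circ> q))"

definition schur :: "(nat \<Rightarrow> nat) \<Rightarrow> ('v filling \<Rightarrow> complex) set"
  where "schur lam = young_symmetrizer lam ` tensors lam"

text \<open>The matrix of \<open>g\<^sup>\<otimes>\<^sup>n\<close> in the basis of words.\<close>

definition tensor_matrix ::
  "(nat \<Rightarrow> nat) \<Rightarrow> complex ^ 'v ^ 'v \<Rightarrow> 'v filling \<Rightarrow> 'v filling \<Rightarrow> complex"
  where "tensor_matrix lam g w u =
    (if w \<in> words lam then \<Prod>b\<in>diagram lam. g $ w b $ u b else 0)"

text \<open>
  For a subspace \<open>S\<close> of the complex functions on \<open>'i\<close>, the module \<open>S \<otimes> R\<close> is realised inside the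
  \<open>R\<close>-valued functions on \<open>'i\<close>, with \<open>s \<otimes> r\<close> being the function \<open>i \<mapsto> r s(i)\<close>.
\<close>

definition extend_scalars ::
  "('i \<Rightarrow> complex) set \<Rightarrow> ('i \<Rightarrow> ('v, 'w) coord) set"
  where "extend_scalars S =
    {(\<lambda>i. \<Sum>s\<in>A. r s * Const (s i)) | A r. finite A \<and> A \<subseteq> S}"

text \<open>The direct sum of \<open>c\<close> copies of \<open>S \<otimes> R\<close>, where \<open>S = schur lam\<close>: sequences in \<open>S \<otimes> R\<close>
  supported on the indices below \<open>c\<close>.  The multiplicative fields of the record play no role in
  a module.\<close>

definition schur_free ::
  "(nat \<Rightarrow> nat) \<Rightarrow> nat \<Rightarrow> (('v, 'w) coord, nat \<Rightarrow> 'v filling \<Rightarrow> ('v, 'w) coord) module"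
  where "schur_free lam c =
    \<lparr>carrier = {F. (\<forall>n<c. F n \<in> extend_scalars (schur lam)) \<and> (\<forall>n\<ge>c. F n = (\<lambda>_. 0))},
     monoid.mult = undefined, one = undefined,
     ring.zero = (\<lambda>_ _. 0), ring.add = (\<lambda>F G n w. F n w + G n w),
     module.smult = (\<lambda>r F n w. r * F n w)\<rparr>"

text \<open>The diagonal action \<open>g (s \<otimes> r) = g s \<otimes> g r\<close>, on each summand.\<close>

definition schur_free_act ::
  "(nat \<Rightarrow> nat) \<Rightarrow> complex ^ 'v ^ 'v \<Rightarrow>
   (nat \<Rightarrow> 'v filling \<Rightarrow> ('v, 'w) coord) \<Rightarrow> (nat \<Rightarrow> 'v::finite filling \<Rightarrow> ('v, 'w) coord)"
  where "schur_free_act lam g F =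
    (\<lambda>n w. \<Sum>u\<in>words lam. Const (tensor_matrix lam g w u) * coord_act g (F n u))"

end

theory Submission
  imports "Jordan_Normal_Form.Determinant" Defs "HOL-Library.Function_Algebras"
begin

text \<open>Write \<open>S\<^sub>\<lambda>\<close> for the image of the Young symmetrizer. Contracting a tensor on the boxes of \<open>\<lambda>\<^sup>1\<close> with
  the words \<open>v\<close> on the nonempty skew shape \<open>\<lambda>\<^sup>1 / \<lambda>\<^sup>0\<close>, and symmetrizing again, gives linear maps
  \<open>S\<^bsub>\<lambda>\<^sup>1\<^esub> \<rightarrow> S\<^bsub>\<lambda>\<^sup>0\<^esub>\<close>; putting the monomials \<open>\<Prod>b. Var (v' b, v b)\<close> in place of scalars turns them into
  equivariant maps of free modules which vanish modulo the maximal ideal.  Choose \<open>c\<^sub>0 dim S\<^bsub>\<lambda>\<^sup>0\<^esub> = c\<^sub>1 dim S\<^bsub>\<lambda>\<^sup>1\<^esub>\<close>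
  and a generic \<open>c\<^sub>0 \<times> c\<^sub>1\<close> matrix with entries in the span of these maps. If the square matrix of this map
  has nonzero determinant, the map is injective and the determinant annihilates its cokernel, so it
  suffices to show invertibility at one point, the identity matrix, where one finds a generic blow-up of
  the contractions.

  For a space \<open>L\<close> of linear maps on \<open>S\<^bsub>\<lambda>\<^sup>1\<^esub>\<close> that is stable under \<open>GL(V)\<close>, consider the slope
  \<open>dim L(K) / dim K\<close> of subspaces \<open>K\<close>. On a subspace of minimal slope and, among these, of minimal dimension,
  counting the parameters of a kernel vector shows that the generic blow-up is injective. Translates of \<open>K\<close>
  have the same slope and together span \<open>S\<^bsub>\<lambda>\<^sup>1\<^esub>\<close> by irreducibility, and their images span \<open>S\<^bsub>\<lambda>\<^sup>0\<^esub>\<close>, so a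
  blow-up whose size is balanced on \<open>K\<close> is onto and, the slope of \<open>K\<close> being minimal, bijective.\<close>

section \<open>Determinants of square matrices of functions\<close>

no_notation vec_index (infixl "$" 100)

text \<open>Equal total rank forces several copies of each Schur functor, and the obstacle is that a
  generic square block matrix over a space \<open>L\<close> of linear maps may still be singular: a
  subspace \<open>K\<close> with too small an image \<open>L(K)\<close> defeats every balanced block
  size. Parameter counts need strict stability, since at equal slopes they have no slack. With a =
  dim \<open>K\<close>, b = dim \<open>L(K)\<close>, b N block columns and a N block rows, a kernel
  vector spanning an s-dimensional subspace with image of dimension r > b s / a meets a N r
  conditions, at least N more than its b N s coordinates; a large N also pays for the choice of the
  subspace. When the span is all of \<open>K\<close>, the counts agree, and rescaling removes the
  one parameter that decides. Counts become nonzero polynomials in the block coefficients by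
  algebraic dependence, in place of dimension theory. The block coefficients may be arbitrary
  because \<open>GL(V)\<close> does not act on \<open>W\<close>: the word on that side is a mere
  label. The inclusion of the partitions enters through positivity of a Hermitian form, which shows
  that the contractions do not all vanish.\<close>

definition square_det :: "nat \<Rightarrow> (nat \<Rightarrow> nat \<Rightarrow> 'a::comm_ring_1) \<Rightarrow> 'a"
  where "square_det n A = Determinant.det (Matrix.mat n n (\<lambda>(i, j). A i j))"

text \<open>The adjugate entry as a signed minor, with row \<open>j\<close> and column
  \<open>i\<close> deleted. Written over plain functions, it is visibly polynomial in the entries of
  \<open>A\<close>.\<close>

definition square_adj :: "nat \<Rightarrow> (nat \<Rightarrow> nat \<Rightarrow> 'a::comm_ring_1) \<Rightarrow> nat \<Rightarrow> nat \<Rightarrow> 'a"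
  where "square_adj n A i j =
    (- 1) ^ (i + j) * square_det (n - 1) (\<lambda>r s. A (if r < j then r else Suc r) (if s < i then s else Suc s))"

lemma square_det_sum:
  "square_det n A = (\<Sum>p | p permutes {0..<n}. signof p * (\<Prod>i = 0..<n. A i (p i)))"
proof -
  have "square_det n A = (\<Sum>p | p permutes {0..<n}. signof p *
      (\<Prod>i = 0..<n. Matrix.mat n n (\<lambda>(i, j). A i j) $$ (i, p i)))"
    unfolding square_det_def by (rule det_def') simp
  also have "\<dots> = (\<Sum>p | p permutes {0..<n}. signof p * (\<Prod>i = 0..<n. A i (p i)))"
    by (rule sum.cong[OF refl], rule arg_cong2[where f="(*)"], simp, rule prod.cong[OF refl])
       auto
  finally show ?thesis .
qed

lemma square_adj_eq:
  assumes "i < n" "j < n"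
  shows "adj_mat (Matrix.mat n n (\<lambda>(i, j). A i j)) $$ (i, j) = square_adj n A i j"
proof -
  have "mat_delete (Matrix.mat n n (\<lambda>(i, j). A i j)) j i =
    Matrix.mat (n - 1) (n - 1) (\<lambda>(r, s). A (if r < j then r else Suc r) (if s < i then s else Suc s))"
    unfolding mat_delete_def by (rule eq_matI) auto
  then show ?thesis
    using assms by (simp add: adj_mat_def cofactor_def square_adj_def square_det_def add.commute)
qed

lemma square_adj_left:
  assumes "i < n" "k < n"
  shows "(\<Sum>j<n. square_adj n A i j * A j k) = (if i = k then square_det n A else 0)"
proof -
  let ?M = "Matrix.mat n n (\<lambda>(i, j). A i j)"
  have M: "?M \<in> carrier_mat n n" by simp
  have "(adj_mat ?M * ?M) $$ (i, k) = (\<Sum>j<n. adj_mat ?M $$ (i, j) * ?M $$ (j, k))"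
    using assms adj_mat(1)[OF M] by (auto simp: times_mat_def scalar_prod_def atLeast0LessThan intro!: sum.cong)
  also have "\<dots> = (\<Sum>j<n. square_adj n A i j * A j k)"
    using assms by (intro sum.cong) (auto simp: square_adj_eq)
  finally show ?thesis
    using adj_mat(3)[OF M] assms by (cases "i = k") (simp_all add: square_det_def)
qed

lemma square_adj_right:
  assumes "i < n" "k < n"
  shows "(\<Sum>j<n. A i j * square_adj n A j k) = (if i = k then square_det n A else 0)"
proof -
  let ?M = "Matrix.mat n n (\<lambda>(i, j). A i j)"
  have M: "?M \<in> carrier_mat n n" by simp
  have "(?M * adj_mat ?M) $$ (i, k) = (\<Sum>j<n. ?M $$ (i, j) * adj_mat ?M $$ (j, k))"
    using assms adj_mat(1)[OF M] by (auto simp: times_mat_def scalar_prod_def atLeast0LessThan intro!: sum.cong)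
  also have "\<dots> = (\<Sum>j<n. A i j * square_adj n A j k)"
    using assms by (intro sum.cong) (auto simp: square_adj_eq)
  finally show ?thesis
    using adj_mat(2)[OF M] assms by (cases "i = k") (simp_all add: square_det_def)
qed

lemma square_det_nonzero:
  fixes A :: "nat \<Rightarrow> nat \<Rightarrow> 'a::field"
  assumes "\<And>x. (\<And>i. i < n \<Longrightarrow> (\<Sum>j<n. A i j * x j) = 0) \<Longrightarrow> (\<forall>j<n. x j = 0)"
  shows "square_det n A \<noteq> 0"
proof
  let ?M = "Matrix.mat n n (\<lambda>(i, j). A i j)"
  assume "square_det n A = 0"
  then obtain v where v: "v \<in> carrier_vec n" "v \<noteq> 0\<^sub>v n" "?M *\<^sub>v v = 0\<^sub>v n"
    using det_0_iff_vec_prod_zero_field[of ?M n] by (auto simp: square_det_def)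
  have "(\<Sum>j<n. A i j * vec_index v j) = 0" if "i < n" for i
  proof -
    have "vec_index (?M *\<^sub>v v) i = (\<Sum>j<n. A i j * vec_index v j)"
      using that v(1) by (auto simp: mult_mat_vec_def scalar_prod_def atLeast0LessThan intro!: sum.cong)
    then show ?thesis using v(3) that by simp
  qed
  then have "\<forall>j<n. vec_index v j = 0" using assms by blast
  then have "v = 0\<^sub>v n" using v(1) by (intro eq_vecI) auto
  then show False using v(2) by simp
qed

lemma square_det_hom:
  assumes "h 1 = 1" "\<And>x y. h (x + y) = h x + h y" "\<And>x y. h (x * y) = h x * h y"
  shows "h (square_det n A) = square_det n (\<lambda>i j. h (A i j))"
proof -
  have h0: "h 0 = 0" using assms(2)[of 0 0] by simp
  have hm: "h (- x) = - h x" for x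
    using assms(2)[of x "- x"] h0 by (simp add: eq_neg_iff_add_eq_0 add.commute)
  interpret comm_ring_hom h by standard (use assms h0 in auto)
  show ?thesis
    unfolding square_det_def hom_det[symmetric]
    by (rule arg_cong[where f=Determinant.det]) (rule eq_matI, auto)
qed

section \<open>Polynomial functions\<close>

text \<open>All vector spaces below consist of complex functions on some index type, so that one
  notion of span, independence and dimension serves tensors, blocks of tensors and polynomial
  functions alike.\<close>

definition cscale :: "complex \<Rightarrow> ('i \<Rightarrow> complex) \<Rightarrow> 'i \<Rightarrow> complex"
  where "cscale c f = (\<lambda>i. c * f i)"

interpretation fs: vector_space "cscale :: complex \<Rightarrow> ('i \<Rightarrow> complex) \<Rightarrow> 'i \<Rightarrow> complex"
  by standard (auto simp: cscale_def fun_eq_iff algebra_simps)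

lemma sum_fun_apply: "(\<Sum>a\<in>A. f a) x = (\<Sum>a\<in>A. f a (x :: 'i) :: 'b::comm_monoid_add)"
  by (induction A rule: infinite_finite_induct) auto

lemma cscale_apply: "cscale c f i = c * f i"
  by (simp add: cscale_def)

lemma zero_eq: "(\<lambda>_. 0) = (0 :: 'i \<Rightarrow> complex)"
  by (simp add: zero_fun_def)

text \<open>Polynomials are kept as functions together with a set \<open>I\<close> of admissible
  variables: only their values matter, and \<open>I\<close> is what the parameter counts refer
  to.\<close>

inductive polyfun :: "'i set \<Rightarrow> (('i \<Rightarrow> complex) \<Rightarrow> complex) \<Rightarrow> bool" for I
  where
    polyfun_const: "polyfun I (\<lambda>_. c)"
  | polyfun_var: "i \<in> I \<Longrightarrow> polyfun I (\<lambda>x. x i)"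
  | polyfun_add: "polyfun I f \<Longrightarrow> polyfun I g \<Longrightarrow> polyfun I (\<lambda>x. f x + g x)"
  | polyfun_mult: "polyfun I f \<Longrightarrow> polyfun I g \<Longrightarrow> polyfun I (\<lambda>x. f x * g x)"

lemma polyfun_sum: "(\<And>a. a \<in> A \<Longrightarrow> polyfun I (f a)) \<Longrightarrow> polyfun I (\<lambda>x. \<Sum>a\<in>A. f a x)"
  by (induction A rule: infinite_finite_induct) (auto intro: polyfun.intros)

lemma polyfun_prod: "(\<And>a. a \<in> A \<Longrightarrow> polyfun I (f a)) \<Longrightarrow> polyfun I (\<lambda>x. \<Prod>a\<in>A. f a x)"
  by (induction A rule: infinite_finite_induct) (auto intro: polyfun.intros)

lemma polyfun_minus: "polyfun I f \<Longrightarrow> polyfun I (\<lambda>x. - f x)"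
  using polyfun_mult[OF polyfun_const[of I "-1"], of f] by simp

lemma polyfun_power: "polyfun I f \<Longrightarrow> polyfun I (\<lambda>x. f x ^ n)"
  by (induction n) (auto intro: polyfun.intros)

lemma polyfun_square_det:
  "(\<And>i j. i < n \<Longrightarrow> j < n \<Longrightarrow> polyfun I (A i j)) \<Longrightarrow> polyfun I (\<lambda>x. square_det n (\<lambda>i j. A i j x))"
  unfolding square_det_sum
  by (intro polyfun_sum polyfun_mult polyfun_const polyfun_prod) auto

lemma polyfun_square_adj:
  assumes "\<And>i j. i < n \<Longrightarrow> j < n \<Longrightarrow> polyfun I (A i j)" "i < n" "j < n"
  shows "polyfun I (\<lambda>x. square_adj n (\<lambda>i j. A i j x) i j)"
  unfolding square_adj_def
proof (intro polyfun_mult polyfun_const)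
  show "polyfun I (\<lambda>x. square_det (n - 1)
     (\<lambda>r s. A (if r < j then r else Suc r) (if s < i then s else Suc s) x))"
    by (rule polyfun_square_det[where A="\<lambda>r s. A (if r < j then r else Suc r) (if s < i then s else Suc s)"])
       (use assms in auto)
qed

lemma polyfun_compose:
  assumes "polyfun J f" "\<And>j. j \<in> J \<Longrightarrow> polyfun I (\<lambda>x. g x j)"
  shows "polyfun I (\<lambda>x. f (g x))"
  using assms(1) by induction (auto intro: polyfun.intros assms(2))

lemma polyfun_line:
  assumes "polyfun I f"
  shows "\<exists>P. \<forall>t. f (\<lambda>i. y i + t * z i) = poly P t"
  using assms
proof induction
  case (polyfun_const c)
  show ?case by (rule exI[of _ "[:c:]"]) simp
next
  case (polyfun_var i)
  show ?case by (rule exI[of _ "[:y i, z i:]"]) simp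
next
  case (polyfun_add f g)
  then obtain P Q where "\<forall>t. f (\<lambda>i. y i + t * z i) = poly P t" "\<forall>t. g (\<lambda>i. y i + t * z i) = poly Q t"
    by blast
  then show ?case by (intro exI[of _ "P + Q"]) simp
next
  case (polyfun_mult f g)
  then obtain P Q where "\<forall>t. f (\<lambda>i. y i + t * z i) = poly P t" "\<forall>t. g (\<lambda>i. y i + t * z i) = poly Q t"
    by blast
  then show ?case by (intro exI[of _ "P * Q"]) simp
qed

text \<open>Along \<open>y + t (z - y)\<close> both functions are nonzero polynomials in
  \<open>t\<close>, and their product has finitely many roots. Finitely many generic conditions can
  therefore be met by one choice.\<close>

lemma polyfun_common_nonzero:
  assumes "polyfun I f" "polyfun I g" "f y \<noteq> 0" "g z \<noteq> 0"
  shows "\<exists>x. f x * g x \<noteq> 0"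
proof -
  obtain P Q where P: "\<And>t. f (\<lambda>i. y i + t * (z i - y i)) = poly P t"
    and Q: "\<And>t. g (\<lambda>i. y i + t * (z i - y i)) = poly Q t"
    using polyfun_line[OF assms(1)] polyfun_line[OF assms(2)] by metis
  have "poly P 0 \<noteq> 0" "poly Q 1 \<noteq> 0" using P[of 0] Q[of 1] assms(3,4) by simp_all
  then have "P * Q \<noteq> 0" by auto
  then have "finite {t. poly (P * Q) t = 0}" by (rule poly_roots_finite)
  then obtain t where "poly (P * Q) t \<noteq> 0"
    using infinite_UNIV_char_0 by (metis (mono_tags, lifting) UNIV_eq_I mem_Collect_eq)
  then show ?thesis using P Q by (metis poly_mult)
qed

lemma polyfun_prod_nonzero:
  assumes "finite S" "\<And>a. a \<in> S \<Longrightarrow> polyfun I (f a)" "\<And>a. a \<in> S \<Longrightarrow> \<exists>x. f a x \<noteq> 0"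
  shows "\<exists>x. (\<Prod>a\<in>S. f a x) \<noteq> 0"
  using assms
proof (induction S)
  case empty
  then show ?case by simp
next
  case (insert a S)
  then obtain y z where "f a y \<noteq> 0" "(\<Prod>a\<in>S. f a z) \<noteq> 0" by (metis insertCI)
  moreover have "polyfun I (f a)" "polyfun I (\<lambda>x. \<Prod>a\<in>S. f a x)"
    using insert.prems by (auto intro: polyfun_prod)
  ultimately have "\<exists>x. f a x * (\<Prod>a\<in>S. f a x) \<noteq> 0"
    using polyfun_common_nonzero by blast
  then show ?case using insert by simp
qed

section \<open>Monomials and degree bounds\<close>

definition monomial_fun :: "'i set \<Rightarrow> ('i \<Rightarrow> nat) \<Rightarrow> ('i \<Rightarrow> complex) \<Rightarrow> complex"
  where "monomial_fun I \<alpha> x = (\<Prod>i\<in>I. x i ^ \<alpha> i)"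

text \<open>Induction on the variables: with the others fixed, the sum is a polynomial in
  \<open>x i\<close> that vanishes everywhere, so the coefficient of each power of
  \<open>x i\<close> is a relation between monomials in the other variables.\<close>

lemma monomial_fun_linear_independent:
  assumes "finite I" "finite S" "S \<subseteq> I \<rightarrow>\<^sub>E UNIV"
    and "\<And>x. (\<Sum>\<alpha>\<in>S. c \<alpha> * monomial_fun I \<alpha> x) = 0"
  shows "\<alpha> \<in> S \<Longrightarrow> c \<alpha> = 0"
  using assms
proof (induction I arbitrary: S c \<alpha> rule: finite_induct)
  case empty
  then have S: "S = {\<lambda>_. undefined}" by auto
  have "(\<Sum>\<alpha>\<in>S. c \<alpha> * monomial_fun {} \<alpha> (\<lambda>_. 0)) = 0" by (rule empty.prems(4))
  then show ?case using empty.prems(1) by (simp add: S monomial_fun_def)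
next
  case (insert i I)
  \<comment> \<open>Some bound on the exponents of \<open>i\<close>, which makes the polynomial
    \<open>P\<close> below a finite sum.\<close>
  define D where "D = (\<Sum>\<beta>\<in>S. \<beta> i)"
  have D: "\<beta> i \<le> D" if "\<beta> \<in> S" for \<beta>
    using member_le_sum[OF that, of "\<lambda>\<beta>. \<beta> i"] insert.prems(2) by (auto simp: D_def)
  have coeff0: "(\<Sum>\<beta>\<in>{\<beta>\<in>S. \<beta> i = e}. c \<beta> * monomial_fun I \<beta> x) = 0" for e x
  proof -
    define P where "P = (\<Sum>e\<le>D. Polynomial.monom (\<Sum>\<beta>\<in>{\<beta>\<in>S. \<beta> i = e}. c \<beta> * monomial_fun I \<beta> x) e)"
    have "poly P t = 0" for t
    proof -
      have "poly P t = (\<Sum>e\<le>D. (\<Sum>\<beta>\<in>{\<beta>\<in>S. \<beta> i = e}. c \<beta> * monomial_fun I \<beta> x) * t ^ e)"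
        by (simp add: P_def poly_sum poly_monom)
      also have "\<dots> = (\<Sum>e\<le>D. \<Sum>\<beta>\<in>{\<beta>\<in>S. \<beta> i = e}. c \<beta> * monomial_fun (insert i I) \<beta> (x(i := t)))"
      proof (intro sum.cong refl, subst sum_distrib_right, intro sum.cong refl)
        fix e \<beta> assume "\<beta> \<in> {\<beta>\<in>S. \<beta> i = e}"
        moreover have "(\<Prod>j\<in>I. (x(i := t)) j ^ \<beta> j) = (\<Prod>j\<in>I. x j ^ \<beta> j)"
          using insert.hyps(2) by (intro prod.cong) auto
        ultimately show "c \<beta> * monomial_fun I \<beta> x * t ^ e = c \<beta> * monomial_fun (insert i I) \<beta> (x(i := t))"
          using insert.hyps by (simp add: monomial_fun_def)
      qed
      also have "\<dots> = (\<Sum>\<beta>\<in>S. c \<beta> * monomial_fun (insert i I) \<beta> (x(i := t)))"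
        by (rule sum.group) (use D insert.prems(2) in auto)
      finally show ?thesis using insert.prems(4) by simp
    qed
    then have "P = 0" using poly_all_0_iff_0 by blast
    moreover have "poly.coeff P e = (if e \<le> D then (\<Sum>\<beta>\<in>{\<beta>\<in>S. \<beta> i = e}. c \<beta> * monomial_fun I \<beta> x) else 0)"
      by (simp add: P_def coeff_sum)
    moreover have "{\<beta>\<in>S. \<beta> i = e} = {}" if "\<not> e \<le> D" using D that by blast
    ultimately show ?thesis by (metis (no_types, lifting) coeff_0 sum.empty)
  qed
  define Y where "Y = {\<beta>\<in>S. \<beta> i = \<alpha> i}"
  \<comment> \<open>Monomials with the same exponent at \<open>i\<close> differ in the other
    variables. Resetting that exponent to \<open>undefined\<close> makes them extensional on
    \<open>I\<close>, as the induction hypothesis demands.\<close>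
  define r where "r \<beta> = \<beta>(i := undefined)" for \<beta> :: "'a \<Rightarrow> nat"
  have inj: "inj_on r Y"
  proof (rule inj_onI)
    fix \<beta> \<beta>' assume "\<beta> \<in> Y" "\<beta>' \<in> Y" "r \<beta> = r \<beta>'"
    then show "\<beta> = \<beta>'" unfolding r_def Y_def by (metis (mono_tags, lifting) fun_upd_triv fun_upd_upd mem_Collect_eq)
  qed
  have mon: "monomial_fun I (r \<beta>) x = monomial_fun I \<beta> x" for \<beta> x
    unfolding monomial_fun_def r_def using insert.hyps(2) by (intro prod.cong) auto
  define c' where "c' \<beta> = c (\<beta>(i := \<alpha> i))" for \<beta>
  have c': "c' (r \<beta>) = c \<beta>" if "\<beta> \<in> Y" for \<beta>
    using that by (auto simp: c'_def r_def Y_def simp del: fun_upd_apply)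
       (metis fun_upd_triv)
  have "c' (r \<alpha>) = 0"
  proof (rule insert.IH[of "r \<alpha>" "r ` Y" c'])
    show "r \<alpha> \<in> r ` Y" using insert.prems(1) by (simp add: Y_def)
    show "finite (r ` Y)" using insert.prems(2) by (simp add: Y_def)
    show "r ` Y \<subseteq> I \<rightarrow>\<^sub>E UNIV"
      using insert.prems(3) insert.hyps(2) by (auto simp: r_def Y_def PiE_def extensional_def)
    show "(\<Sum>\<beta>\<in>r ` Y. c' \<beta> * monomial_fun I \<beta> x) = 0" for x
    proof -
      have "(\<Sum>\<beta>\<in>r ` Y. c' \<beta> * monomial_fun I \<beta> x) = (\<Sum>\<beta>\<in>Y. c \<beta> * monomial_fun I \<beta> x)"
        by (subst sum.reindex[OF inj]) (auto simp: c' mon intro!: sum.cong)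
      then show ?thesis using coeff0[where e="\<alpha> i" and x=x] by (simp add: Y_def)
    qed
  qed
  then show ?case using c' insert.prems(1) by (simp add: Y_def)
qed

text \<open>The degree is bounded in each variable separately, so that the spanning monomials form a
  box of \<open>(d + 1) ^ card I\<close> exponents.\<close>

definition bounded_degree :: "'i set \<Rightarrow> nat \<Rightarrow> (('i \<Rightarrow> complex) \<Rightarrow> complex) set"
  where "bounded_degree I d = fs.span (monomial_fun I ` (I \<rightarrow>\<^sub>E {..d}))"

lemma bounded_degree_mono: "d \<le> e \<Longrightarrow> bounded_degree I d \<subseteq> bounded_degree I e"
  unfolding bounded_degree_def by (intro fs.span_mono image_mono PiE_mono) auto

lemma monomial_fun_bounded_degree:
  assumes "\<forall>i\<in>I. \<alpha> i \<le> d"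
  shows "monomial_fun I \<alpha> \<in> bounded_degree I d"
proof -
  have "monomial_fun I \<alpha> = monomial_fun I (restrict \<alpha> I)"
    by (auto simp: monomial_fun_def fun_eq_iff intro!: prod.cong)
  moreover have "restrict \<alpha> I \<in> I \<rightarrow>\<^sub>E {..d}" using assms by auto
  ultimately show ?thesis unfolding bounded_degree_def using fs.span_base by (metis imageI)
qed

lemma bounded_degree_mult:
  assumes f: "f \<in> bounded_degree I d" and g: "g \<in> bounded_degree I e"
  shows "(\<lambda>x. f x * g x) \<in> bounded_degree I (d + e)"
  using f[unfolded bounded_degree_def]
  proof (induction rule: fs.span_induct_alt)
    case base
    show ?case by (simp add: zero_eq bounded_degree_def fs.span_zero)
  next
    case (step c h h')
    then obtain \<alpha> where \<alpha>: "\<alpha> \<in> I \<rightarrow>\<^sub>E {..d}" "h = monomial_fun I \<alpha>" by auto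
    have "(\<lambda>x. h x * g x) \<in> bounded_degree I (d + e)"
      using g[unfolded bounded_degree_def]
    proof (induction rule: fs.span_induct_alt)
      case base
      show ?case by (simp add: zero_eq bounded_degree_def fs.span_zero)
    next
      case (step c k k')
      then obtain \<beta> where \<beta>: "\<beta> \<in> I \<rightarrow>\<^sub>E {..e}" "k = monomial_fun I \<beta>" by auto
      have "monomial_fun I (\<lambda>i. \<alpha> i + \<beta> i) \<in> bounded_degree I (d + e)"
        by (rule monomial_fun_bounded_degree) (use \<alpha> \<beta> in \<open>auto simp: PiE_def Pi_def intro: add_mono\<close>)
      moreover have "monomial_fun I (\<lambda>i. \<alpha> i + \<beta> i) = (\<lambda>x. h x * k x)"
        by (auto simp: \<alpha> \<beta> monomial_fun_def power_add prod.distrib)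
      ultimately have "cscale c (\<lambda>x. h x * k x) + (\<lambda>x. h x * k' x) \<in> bounded_degree I (d + e)"
        using step by (auto simp: bounded_degree_def intro: fs.span_add fs.span_scale)
      moreover have "cscale c (\<lambda>x. h x * k x) + (\<lambda>x. h x * k' x) = (\<lambda>x. h x * (cscale c k + k') x)"
        by (auto simp: cscale_apply fun_eq_iff algebra_simps)
      ultimately show ?case by simp
    qed
    then have "cscale c (\<lambda>x. h x * g x) + (\<lambda>x. h' x * g x) \<in> bounded_degree I (d + e)"
      using step by (auto simp: bounded_degree_def intro: fs.span_add fs.span_scale)
    moreover have "cscale c (\<lambda>x. h x * g x) + (\<lambda>x. h' x * g x) = (\<lambda>x. (cscale c h + h') x * g x)"
      by (auto simp: cscale_apply fun_eq_iff algebra_simps)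
    ultimately show ?case by simp
  qed

lemma polyfun_bounded_degree:
  assumes "polyfun I f" "finite I"
  shows "\<exists>d. f \<in> bounded_degree I d"
  using assms(1)
proof induction
  case (polyfun_const c)
  have "cscale c (monomial_fun I (\<lambda>_. 0)) \<in> bounded_degree I 0"
    by (intro fs.span_scale[of _ "monomial_fun I ` (I \<rightarrow>\<^sub>E {..0})", folded bounded_degree_def] monomial_fun_bounded_degree) auto
  moreover have "cscale c (monomial_fun I (\<lambda>_. 0)) = (\<lambda>_. c)"
    by (auto simp: monomial_fun_def cscale_apply)
  ultimately show ?case by (intro exI[of _ 0]) simp
next
  case (polyfun_var i)
  have "monomial_fun I (\<lambda>j. if j = i then 1 else 0) \<in> bounded_degree I 1"
    by (rule monomial_fun_bounded_degree) auto
  moreover have "x j ^ (if j = i then 1 else 0) = (if j = i then x j else 1)" for x :: "'a \<Rightarrow> complex" and j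
    by simp
  then have "monomial_fun I (\<lambda>j. if j = i then 1 else 0) = (\<lambda>x. x i)"
    using polyfun_var assms(2) by (auto simp: monomial_fun_def prod.delta)
  ultimately show ?case by auto
next
  case (polyfun_add f g)
  then obtain d e where d: "f \<in> bounded_degree I d"
    and e: "g \<in> bounded_degree I e" by blast
  have "f + g \<in> bounded_degree I (max d e)"
    using d e bounded_degree_mono[of d "max d e" I] bounded_degree_mono[of e "max d e" I]
      by (auto simp: bounded_degree_def intro: fs.span_add)
  then show ?case by (auto simp: plus_fun_def)
next
  case (polyfun_mult f g)
  then show ?case using bounded_degree_mult by blast
qed

section \<open>Algebraic dependence\<close>

text \<open>The relation is between indices and not between values: two indices with the same value
  already give one, which is the second case.\<close>

lemma family_dependent:
  assumes "finite B" "F ` B \<subseteq> fs.span T" "finite T" "card T < card B"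
  shows "\<exists>c. (\<exists>\<beta>\<in>B. c \<beta> \<noteq> 0) \<and> (\<Sum>\<beta>\<in>B. cscale (c \<beta>) (F \<beta>)) = 0"
proof (cases "inj_on F B")
  case True
  have "\<not> fs.independent (F ` B)"
    using fs.independent_span_bound[of T "F ` B"] assms True by (auto simp: card_image)
  then obtain u where u: "\<exists>v\<in>F ` B. u v \<noteq> 0" "(\<Sum>v\<in>F ` B. cscale (u v) v) = 0"
    using fs.dependent_finite[of "F ` B"] assms(1) by auto
  then have "(\<Sum>\<beta>\<in>B. cscale (u (F \<beta>)) (F \<beta>)) = 0"
    by (simp add: sum.reindex[OF True])
  then show ?thesis using u(1) by (intro exI[of _ "u \<circ> F"]) auto
next
  case False
  then obtain \<alpha> \<beta> where ab: "\<alpha> \<in> B" "\<beta> \<in> B" "\<alpha> \<noteq> \<beta>" "F \<alpha> = F \<beta>"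
    by (auto simp: inj_on_def)
  define c where "c x = (if x = \<alpha> then 1 else if x = \<beta> then -1 else 0 :: complex)" for x
  have "(\<Sum>x\<in>B. cscale (c x) (F x)) = (\<Sum>x\<in>{\<alpha>, \<beta>}. cscale (c x) (F x))"
    by (rule sum.mono_neutral_right) (use assms(1) ab in \<open>auto simp: c_def cscale_def fun_eq_iff\<close>)
  also have "\<dots> = 0" using ab by (simp add: c_def cscale_def fun_eq_iff)
  finally have "(\<Sum>x\<in>B. cscale (c x) (F x)) = 0" .
  then show ?thesis using ab(1) by (intro exI[of _ c]) (auto simp: c_def)
qed

lemma one_bounded_degree: "(\<lambda>_. 1) \<in> bounded_degree I 0"
  using monomial_fun_bounded_degree[of I "\<lambda>_. 0" 0] by (simp add: monomial_fun_def[abs_def])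

lemma bounded_degree_power: "f \<in> bounded_degree I d \<Longrightarrow> (\<lambda>x. f x ^ k) \<in> bounded_degree I (k * d)"
proof (induction k)
  case 0
  then show ?case by (simp add: one_bounded_degree)
next
  case (Suc k)
  then show ?case using bounded_degree_mult[of f I d "\<lambda>x. f x ^ k" "k * d"] by simp
qed

lemma bounded_degree_prod:
  "finite J \<Longrightarrow> (\<And>j. j \<in> J \<Longrightarrow> f j \<in> bounded_degree I d) \<Longrightarrow>
    (\<lambda>x. \<Prod>j\<in>J. f j x) \<in> bounded_degree I (card J * d)"
proof (induction J rule: finite_induct)
  case empty
  then show ?case by (simp add: one_bounded_degree)
next
  case (insert j J)
  then show ?case using bounded_degree_mult[of "f j" I d "\<lambda>x. \<Prod>j\<in>J. f j x" "card J * d"] by simp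
qed

text \<open>There are more monomials of bounded degree in the \<open>f j\<close> than in the variables.\<close>

lemma polyfun_algebraic_dependence:
  assumes "finite P" "finite J" "card P < card J" "\<And>j. j \<in> J \<Longrightarrow> polyfun P (f j)"
  shows "\<exists>\<Phi>. polyfun J \<Phi> \<and> (\<exists>y. \<Phi> y \<noteq> 0) \<and> (\<forall>x. \<Phi> (\<lambda>j. f j x) = 0)"
proof -
  obtain d0 where d0: "\<And>j. j \<in> J \<Longrightarrow> f j \<in> bounded_degree P (d0 j)"
    using polyfun_bounded_degree[OF assms(4) assms(1)] by metis
  define d where "d = (\<Sum>j\<in>J. d0 j)"
  have d: "f j \<in> bounded_degree P d" if "j \<in> J" for j
    using d0[OF that] bounded_degree_mono[of "d0 j" d P] member_le_sum[OF that, of d0] assms(2)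
    by (auto simp: d_def)
  define n where "n = card J"
  define m where "m = card P"
  \<comment> \<open>With exponents below \<open>D\<close> there are \<open>D ^ n\<close> products of
    the \<open>f j\<close>, lying in a space spanned by at most
    \<open>(n * d + 1) ^ m * D ^ m\<close> monomials. As \<open>m < n\<close>, it is enough that
    \<open>D\<close> exceeds \<open>(n * d + 1) ^ m\<close>.\<close>
  define D where "D = (n * d + 1) ^ m + 1"
  define B where "B = J \<rightarrow>\<^sub>E {..<D}"
  define F where "F \<beta> = (\<lambda>x. \<Prod>j\<in>J. f j x ^ \<beta> j)" for \<beta>
  define T where "T = monomial_fun P ` (P \<rightarrow>\<^sub>E {..n * (D * d)})"
  have fin: "finite B" "finite T" using assms(1,2) by (auto simp: B_def T_def intro!: finite_PiE)
  have "F \<beta> \<in> fs.span T" if "\<beta> \<in> B" for \<beta>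
  proof -
    have "F \<beta> \<in> bounded_degree P (n * (D * d))"
      unfolding F_def n_def
    proof (rule bounded_degree_prod[OF assms(2)])
      fix j assume j: "j \<in> J"
      then have "\<beta> j * d \<le> D * d" using that by (auto simp: B_def PiE_def Pi_def intro!: mult_right_mono less_imp_le)
      then show "(\<lambda>x. f j x ^ \<beta> j) \<in> bounded_degree P (D * d)"
        using bounded_degree_power[OF d[OF j], of "\<beta> j"] bounded_degree_mono by blast
    qed
    then show ?thesis by (simp add: bounded_degree_def T_def)
  qed
  moreover have "card T < card B"
  proof -
    have D1: "D \<ge> 1" by (simp add: D_def)
    have "card T \<le> (n * (D * d) + 1) ^ m"
      using card_image_le[of "P \<rightarrow>\<^sub>E {..n * (D * d)}" "monomial_fun P"] assms(1)
      by (simp add: T_def m_def card_PiE finite_PiE)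
    also have "\<dots> \<le> ((n * d + 1) * D) ^ m"
      using D1 by (intro power_mono) (auto simp: algebra_simps)
    also have "\<dots> = (n * d + 1) ^ m * D ^ m" by (rule power_mult_distrib)
    also have "\<dots> < D * D ^ m" using D1 by (intro mult_strict_right_mono) (auto simp: D_def)
    also have "\<dots> = D ^ Suc m" by simp
    also have "\<dots> \<le> D ^ n" using D1 assms(3) by (intro power_increasing) (auto simp: n_def m_def)
    also have "\<dots> = card B" using assms(2) by (simp add: B_def n_def card_PiE)
    finally show ?thesis .
  qed
  ultimately obtain c where c: "\<exists>\<beta>\<in>B. c \<beta> \<noteq> 0" "(\<Sum>\<beta>\<in>B. cscale (c \<beta>) (F \<beta>)) = 0"
    using family_dependent[OF fin(1) _ fin(2), of F] by blast
  define \<Phi> where "\<Phi> y = (\<Sum>\<beta>\<in>B. c \<beta> * monomial_fun J \<beta> y)" for y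
  have "polyfun J \<Phi>"
    unfolding \<Phi>_def monomial_fun_def
    by (intro polyfun_sum polyfun_mult polyfun_const polyfun_prod polyfun_power polyfun_var)
  moreover have "\<exists>y. \<Phi> y \<noteq> 0"
  proof (rule ccontr)
    assume "\<not> (\<exists>y. \<Phi> y \<noteq> 0)"
    then have "\<beta> \<in> B \<Longrightarrow> c \<beta> = 0" for \<beta>
      using monomial_fun_linear_independent[OF assms(2) fin(1), of c \<beta>] by (auto simp: \<Phi>_def B_def PiE_mono)
    then show False using c(1) by blast
  qed
  moreover have "\<Phi> (\<lambda>j. f j x) = 0" for x
  proof -
    have "\<Phi> (\<lambda>j. f j x) = (\<Sum>\<beta>\<in>B. cscale (c \<beta>) (F \<beta>)) x"
      by (simp add: \<Phi>_def F_def monomial_fun_def sum_fun_apply cscale_apply)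
    then show ?thesis using c(2) by simp
  qed
  ultimately show ?thesis by blast
qed

section \<open>Kernels depending on parameters\<close>

lemma polyfun_cong: "polyfun I f \<Longrightarrow> (\<And>i. i \<in> I \<Longrightarrow> x i = y i) \<Longrightarrow> f x = f y"
  by (induction rule: polyfun.induct) auto

definition unit_fun :: "'i \<Rightarrow> 'i \<Rightarrow> complex"
  where "unit_fun j = (\<lambda>i. if i = j then 1 else 0)"

lemma inj_unit_fun: "inj unit_fun"
proof (rule injI)
  fix a b :: 'a
  assume "unit_fun a = unit_fun b"
  then have "unit_fun a a = unit_fun b a" by simp
  then show "a = b" by (auto simp: unit_fun_def split: if_splits)
qed

lemma independent_unit_fun: "finite J \<Longrightarrow> fs.independent (unit_fun ` J)"
proof (rule fs.independent_if_scalars_zero)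
  fix f :: "('a \<Rightarrow> complex) \<Rightarrow> complex" and x
  assume J: "finite J" and s: "(\<Sum>x\<in>unit_fun ` J. cscale (f x) x) = 0" and x: "x \<in> unit_fun ` J"
  obtain j where j: "j \<in> J" "x = unit_fun j" using x by auto
  have "0 = (\<Sum>i\<in>J. cscale (f (unit_fun i)) (unit_fun i)) j"
    using s by (simp add: sum.reindex[OF inj_on_subset[OF inj_unit_fun]])
  also have "\<dots> = (\<Sum>i\<in>J. if j = i then f (unit_fun i) else 0)"
    by (auto simp: sum_fun_apply cscale_apply unit_fun_def intro!: sum.cong)
  also have "\<dots> = f x" using J j by simp
  finally show "f x = 0" by simp
qed simp

lemma supported_in_span_unit_fun:
  assumes "finite J" "\<And>i. i \<notin> J \<Longrightarrow> f i = 0"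
  shows "f \<in> fs.span (unit_fun ` J)"
proof -
  have "f = (\<Sum>j\<in>J. cscale (f j) (unit_fun j))"
  proof
    fix i
    have "(\<Sum>j\<in>J. cscale (f j) (unit_fun j)) i = (\<Sum>j\<in>J. if i = j then f j else 0)"
      by (auto simp: sum_fun_apply cscale_apply unit_fun_def intro!: sum.cong)
    then show "f i = (\<Sum>j\<in>J. cscale (f j) (unit_fun j)) i" using assms by auto
  qed
  also have "\<dots> \<in> fs.span (unit_fun ` J)"
    by (intro fs.span_sum fs.span_scale fs.span_base) auto
  finally show ?thesis .
qed

text \<open>Steinitz exchange: independent vectors are completed to a basis by coordinate vectors.
  Independence is spelled out as triviality of the solutions of a square linear system, the form in
  which \<open>square_det_nonzero\<close> consumes it.\<close>

lemma complete_by_unit_vectors: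
  fixes y :: "'r \<Rightarrow> 'j \<Rightarrow> complex"
  assumes "finite J" "finite R" "inj_on y R" "fs.independent (y ` R)"
    and supp: "\<And>\<rho> j. \<rho> \<in> R \<Longrightarrow> j \<notin> J \<Longrightarrow> y \<rho> j = 0"
  obtains T where "T \<subseteq> J" "card R + card T = card J"
    "\<forall>c e. (\<forall>j\<in>J. (\<Sum>\<rho>\<in>R. c \<rho> * y \<rho> j) + (if j \<in> T then e j else 0) = 0) \<longrightarrow>
       (\<forall>\<rho>\<in>R. c \<rho> = 0) \<and> (\<forall>j\<in>T. e j = 0)"
proof -
  obtain B where B: "y ` R \<subseteq> B" "B \<subseteq> y ` R \<union> unit_fun ` J" "fs.independent B"
    "y ` R \<union> unit_fun ` J \<subseteq> fs.span B"
    using fs.maximal_independent_subset_extend[of "y ` R" "y ` R \<union> unit_fun ` J"] assms(4) by auto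
  have finB: "finite B" using B(2) assms(1,2) by (meson finite_UnI finite_imageI finite_subset)
  have "B \<subseteq> fs.span (unit_fun ` J)"
    using B(2) supported_in_span_unit_fun[OF assms(1)] supp fs.span_base by blast
  then have "card B \<le> card J"
    using fs.independent_span_bound[of "unit_fun ` J" B] B(3) assms(1)
    by (metis card_image finite_imageI inj_on_subset inj_unit_fun subset_UNIV)
  moreover have "card J \<le> card B"
    using fs.independent_span_bound[OF finB independent_unit_fun[OF assms(1)]] B(4)
    by (metis Un_subset_iff card_image inj_on_subset inj_unit_fun subset_UNIV)
  ultimately have cB: "card B = card J" by simp
  \<comment> \<open>A unit vector that already occurs among the \<open>y \<rho>\<close> is left out,
    so that the two parts of the basis are disjoint and their sizes add up.\<close>
  define T where "T = {j\<in>J. unit_fun j \<in> B - y ` R}"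
  have img: "unit_fun ` T = B - y ` R" using B(2) by (auto simp: T_def)
  have "card B = card (y ` R) + card (B - y ` R)"
    using card_Diff_subset[of "y ` R" B] B(1) assms(2) card_mono[OF finB B(1)] by simp
  then have cT: "card R + card T = card J"
    using cB img card_image[OF assms(3)] card_image[OF inj_on_subset[OF inj_unit_fun subset_UNIV], of T]
    by simp
  have T: "T \<subseteq> J" "finite T" using assms(1) by (auto simp: T_def)
  show ?thesis
  proof (rule that[OF T(1) cT], intro allI impI)
    fix c e
    assume eq: "\<forall>j\<in>J. (\<Sum>\<rho>\<in>R. c \<rho> * y \<rho> j) + (if j \<in> T then e j else 0) = 0"
    define u where "u v = (if v \<in> y ` R then c (the_inv_into R y v) else e (the_inv_into T unit_fun v))" for v
    have uy: "u (y \<rho>) = c \<rho>" if "\<rho> \<in> R" for \<rho>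
      using that by (simp add: u_def the_inv_into_f_f[OF assms(3)])
    have ue: "u (unit_fun j) = e j" if "j \<in> T" for j
      using that img the_inv_into_f_f[OF inj_on_subset[OF inj_unit_fun subset_UNIV] that]
      by (auto simp: u_def)
    have "(\<Sum>v\<in>B. cscale (u v) v) = (\<Sum>v\<in>y ` R. cscale (u v) v) + (\<Sum>v\<in>unit_fun ` T. cscale (u v) v)"
      unfolding img using sum.subset_diff[OF B(1) finB, of "\<lambda>v. cscale (u v) v"] by (simp add: add.commute)
    also have "\<dots> = (\<Sum>\<rho>\<in>R. cscale (c \<rho>) (y \<rho>)) + (\<Sum>j\<in>T. cscale (e j) (unit_fun j))"
      by (simp add: sum.reindex[OF assms(3)] sum.reindex[OF inj_on_subset[OF inj_unit_fun subset_UNIV]] uy ue)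
    also have "\<dots> = 0"
    proof
      fix j
      have "(\<Sum>i\<in>T. cscale (e i) (unit_fun i)) j = (\<Sum>i\<in>T. if j = i then e i else 0)"
        by (auto simp: sum_fun_apply cscale_apply unit_fun_def intro!: sum.cong)
      then have e: "(\<Sum>i\<in>T. cscale (e i) (unit_fun i)) j = (if j \<in> T then e j else 0)" using T by simp
      have c: "(\<Sum>\<rho>\<in>R. cscale (c \<rho>) (y \<rho>)) j = (\<Sum>\<rho>\<in>R. c \<rho> * y \<rho> j)"
        by (simp add: sum_fun_apply cscale_apply)
      show "((\<Sum>\<rho>\<in>R. cscale (c \<rho>) (y \<rho>)) + (\<Sum>j\<in>T. cscale (e j) (unit_fun j))) j = 0 j"
      proof (cases "j \<in> J")
        case True
        then show ?thesis using bspec[OF eq True] e c by simp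
      next
        case False
        then show ?thesis using e c T supp by auto
      qed
    qed
    finally have "(\<Sum>v\<in>B. cscale (u v) v) = 0" .
    then have "\<forall>v\<in>B. u v = 0" using B(3) finB fs.dependent_finite by blast
    then show "(\<forall>\<rho>\<in>R. c \<rho> = 0) \<and> (\<forall>j\<in>T. e j = 0)"
      using B(1) uy ue img by (metis DiffD1 imageI subset_iff)
  qed
qed

text \<open>The kernel of \<open>r\<close> independent linear conditions depending on parameters is parametrised,
  by Cramer's rule, by the parameters and the remaining coordinates.\<close>

lemma kernel_hypersurface_chart:
  fixes y :: "'r \<Rightarrow> 'j \<Rightarrow> ('p \<Rightarrow> complex) \<Rightarrow> complex"
  assumes "finite P" "finite K" "finite J" "card P < q * card R" "R \<subseteq> K" "T \<subseteq> J"
    and "card R + card T = card J"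
    and poly: "\<And>\<rho> j. \<rho> \<in> K \<Longrightarrow> j \<in> J \<Longrightarrow> polyfun P (y \<rho> j)"
  shows "\<exists>\<Phi>. polyfun ({..<q} \<times> K) \<Phi> \<and> (\<exists>\<gamma>. \<Phi> \<gamma> \<noteq> 0) \<and> (\<forall>\<gamma> x.
      (\<forall>c e. (\<forall>j\<in>J. (\<Sum>\<rho>\<in>R. c \<rho> * y \<rho> j x) + (if j \<in> T then e j else 0) = 0) \<longrightarrow>
         (\<forall>\<rho>\<in>R. c \<rho> = 0) \<and> (\<forall>j\<in>T. e j = 0)) \<longrightarrow>
      (\<forall>n<q. \<forall>j\<in>J. (\<Sum>\<rho>\<in>K. \<gamma> (n, \<rho>) * y \<rho> j x) = 0) \<longrightarrow> \<Phi> \<gamma> = 0)"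
proof -
  have fin: "finite R" "finite T" using assms finite_subset by blast+
  define N where "N = card J"
  have "card (R <+> T) = N" using fin assms(7) by (simp add: N_def card_Plus)
  then obtain g where g: "bij_betw g {..<N} (R <+> T)"
    using fin by (metis finite_Plus ex_bij_betw_nat_finite atLeast0LessThan)
  obtain h where h: "bij_betw h {..<N} J"
    using assms(3) by (metis N_def ex_bij_betw_nat_finite atLeast0LessThan)
  have hJ: "h i \<in> J" if "i < N" for i using h that by (auto simp: bij_betw_def)
  have gRT: "g i \<in> R <+> T" if "i < N" for i using g that by (auto simp: bij_betw_def)
  \<comment> \<open>The square matrix with rows indexed by \<open>J\<close> and with columns the
    vectors \<open>y \<rho>\<close> for \<open>\<rho>\<close> in \<open>R\<close>, completed by the
    unit vectors at \<open>T\<close>.\<close>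
  define A where "A i k x = (case g k of Inl \<rho> \<Rightarrow> y \<rho> (h i) x | Inr t \<Rightarrow> if h i = t then 1 else 0)" for i k x
  define pos where "pos \<rho> = the_inv_into {..<N} g (Inl \<rho>)" for \<rho>
  have pos: "pos \<rho> < N" "g (pos \<rho>) = Inl \<rho>" if "\<rho> \<in> R" for \<rho>
  proof -
    have "Inl \<rho> \<in> g ` {..<N}" using that g by (auto simp: bij_betw_def)
    then show "pos \<rho> < N" "g (pos \<rho>) = Inl \<rho>"
      using the_inv_into_into[of g "{..<N}" "Inl \<rho>" "{..<N}"] f_the_inv_into_f[of g "{..<N}" "Inl \<rho>"] g
      by (auto simp: pos_def bij_betw_def)
  qed
  have sumg: "(\<Sum>k<N. A i k x * c k) = (\<Sum>\<rho>\<in>R. c (pos \<rho>) * y \<rho> (h i) x) +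
      (if h i \<in> T then c (the_inv_into {..<N} g (Inr (h i))) else 0)" for c i x
  proof -
    let ?F = "\<lambda>s. (case s of Inl \<rho> \<Rightarrow> y \<rho> (h i) x | Inr t \<Rightarrow> if h i = t then 1 else 0) * c (the_inv_into {..<N} g s)"
    have "(\<Sum>k<N. A i k x * c k) = (\<Sum>k<N. ?F (g k))"
      using g by (intro sum.cong) (auto simp: A_def bij_betw_def the_inv_into_f_f)
    also have "\<dots> = (\<Sum>s\<in>R <+> T. ?F s)" by (rule sum.reindex_bij_betw[OF g])
    also have "\<dots> = (\<Sum>\<rho>\<in>R. ?F (Inl \<rho>)) + (\<Sum>t\<in>T. ?F (Inr t))" using sum.Plus[OF fin, of ?F] by (simp add: comp_def)
    also have "(\<Sum>t\<in>T. ?F (Inr t)) = (\<Sum>t\<in>T. if h i = t then c (the_inv_into {..<N} g (Inr (h i))) else 0)"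
      by (intro sum.cong) auto
    finally show ?thesis using fin by (simp add: pos_def mult.commute)
  qed
  have polyA: "polyfun P (A i k)" if "i < N" "k < N" for i k
    using gRT[OF that(2)] poly[of _ "h i"] hJ[OF that(1)] assms(5) polyfun_const
    by (auto simp: A_def[abs_def])
  define dt where "dt x = square_det N (\<lambda>i k. A i k x)" for x
  define ad where "ad k i x = square_adj N (\<lambda>i k. A i k x) k i" for k i x
  \<comment> \<open>A kernel vector in each of the \<open>q\<close> rows is determined by the point
    and by its coordinates outside \<open>R\<close>; these are the parameters, and there are fewer
    of them than coefficients \<open>\<gamma>\<close>.\<close>
  define Q where "Q = Inl ` P \<union> Inr ` ({..<q} \<times> (K - R))"
  define par where "par z = (\<lambda>p. z (Inl p))" for z :: "'p + nat \<times> 'r \<Rightarrow> complex"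
  \<comment> \<open>Cramer's rule without denominators: the free coordinates are entered divided by
    the determinant, so multiplication by \<open>dt\<close> restores them, and the adjugate alone
    gives the coordinates in \<open>R\<close>.\<close>
  define f where "f = (\<lambda>(n, \<rho>) z. if \<rho> \<in> R
      then (\<Sum>i<N. ad (pos \<rho>) i (par z) * (- (\<Sum>\<sigma>\<in>K - R. z (Inr (n, \<sigma>)) * y \<sigma> (h i) (par z))))
      else dt (par z) * z (Inr (n, \<rho>)))"
  have par_poly: "polyfun Q (\<lambda>z. F (par z))" if "polyfun P F" for F
    unfolding par_def by (rule polyfun_compose[OF that]) (auto intro!: polyfun_var simp: Q_def)
  have fpoly: "polyfun Q (f \<kappa>)" if "\<kappa> \<in> {..<q} \<times> K" for \<kappa>
  proof -
    obtain n \<rho> where \<kappa>: "\<kappa> = (n, \<rho>)" "n < q" "\<rho> \<in> K" 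
      using \<open>\<kappa> \<in> {..<q} \<times> K\<close> by auto
    show ?thesis
    proof (cases "\<rho> \<in> R")
      case True
      have "polyfun P (ad (pos \<rho>) i)" if "i < N" for i
        unfolding ad_def[abs_def] using polyfun_square_adj[of N P A "pos \<rho>" i] polyA that pos[OF True] by simp
      then have "polyfun Q (\<lambda>z. \<Sum>i<N. ad (pos \<rho>) i (par z) * (- (\<Sum>\<sigma>\<in>K - R. z (Inr (n, \<sigma>)) * y \<sigma> (h i) (par z))))"
        using \<kappa> poly hJ
        by (intro polyfun_sum polyfun_mult polyfun_minus par_poly polyfun_var) (auto simp: Q_def)
      then show ?thesis using True by (simp add: f_def \<kappa>)
    next
      case False
      have "polyfun P dt" unfolding dt_def[abs_def] using polyfun_square_det[of N P A] polyA by simp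
      then have "polyfun Q (\<lambda>z. dt (par z) * z (Inr (n, \<rho>)))"
        using \<kappa> False by (intro polyfun_mult par_poly polyfun_var) (auto simp: Q_def)
      then show ?thesis using False by (simp add: f_def \<kappa>)
    qed
  qed
  have "card Q < card ({..<q} \<times> K)"
  proof -
    have "card Q \<le> card P + q * card (K - R)"
      unfolding Q_def using card_Un_le[of "Inl ` P" "Inr ` ({..<q} \<times> (K - R))"]
      by (simp add: card_image card_cartesian_product)
    also have "\<dots> < q * card R + q * card (K - R)" using assms(4) by simp
    also have "\<dots> = q * card K"
    proof -
      have "card K = card R + card (K - R)"
        using card_Diff_subset[OF fin(1) assms(5)] card_mono[OF assms(2,5)] by linarith
      then show ?thesis by (simp add: distrib_left)
    qed
    finally show ?thesis by (simp add: card_cartesian_product)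
  qed
  moreover have "finite Q" using assms(1,2) by (simp add: Q_def)
  ultimately obtain \<Phi> where \<Phi>: "polyfun ({..<q} \<times> K) \<Phi>" "\<exists>\<gamma>. \<Phi> \<gamma> \<noteq> 0" "\<And>z. \<Phi> (\<lambda>\<kappa>. f \<kappa> z) = 0"
    using polyfun_algebraic_dependence[of Q "{..<q} \<times> K" f] fpoly assms(2) by auto
  have "\<Phi> \<gamma> = 0"
    if ind: "\<forall>c e. (\<forall>j\<in>J. (\<Sum>\<rho>\<in>R. c \<rho> * y \<rho> j x) + (if j \<in> T then e j else 0) = 0) \<longrightarrow>
         (\<forall>\<rho>\<in>R. c \<rho> = 0) \<and> (\<forall>j\<in>T. e j = 0)"
      and ker: "\<forall>n<q. \<forall>j\<in>J. (\<Sum>\<rho>\<in>K. \<gamma> (n, \<rho>) * y \<rho> j x) = 0" for \<gamma> x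
  proof -
    have dt0: "dt x \<noteq> 0"
      unfolding dt_def
    proof (rule square_det_nonzero)
      fix c assume c: "\<And>i. i < N \<Longrightarrow> (\<Sum>k<N. A i k x * c k) = 0"
      have "(\<Sum>\<rho>\<in>R. c (pos \<rho>) * y \<rho> j x) + (if j \<in> T then c (the_inv_into {..<N} g (Inr j)) else 0) = 0"
        if "j \<in> J" for j
      proof -
        obtain i where i: "i < N" "h i = j" using h \<open>j \<in> J\<close> by (auto simp: bij_betw_def)
        show ?thesis using sumg[of i x c, symmetric] c[OF i(1)] unfolding i(2) by (rule trans)
      qed
      then have "(\<forall>\<rho>\<in>R. c (pos \<rho>) = 0) \<and> (\<forall>j\<in>T. c (the_inv_into {..<N} g (Inr j)) = 0)"
        using ind[THEN spec[where x="\<lambda>\<rho>. c (pos \<rho>)"], THEN spec[where x="\<lambda>j. c (the_inv_into {..<N} g (Inr j))"]]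
        by blast
      then have z: "\<forall>\<rho>\<in>R. c (pos \<rho>) = 0" "\<forall>j\<in>T. c (the_inv_into {..<N} g (Inr j)) = 0"
        by blast+
      show "\<forall>k<N. c k = 0"
      proof (intro allI impI)
        fix k assume k: "k < N"
        have inv: "the_inv_into {..<N} g (g k) = k" using g k by (auto simp: bij_betw_def the_inv_into_f_f)
        show "c k = 0"
          using gRT[OF k] z inv by (auto simp: pos_def)
      qed
    qed
    define z where "z s = (case s of Inl p \<Rightarrow> x p | Inr \<kappa> \<Rightarrow> \<gamma> \<kappa> / dt x)" for s
    have par: "par z = x" by (simp add: par_def z_def)
    have "f \<kappa> z = \<gamma> \<kappa>" if "\<kappa> \<in> {..<q} \<times> K" for \<kappa>
    proof -
      obtain n \<rho> where \<kappa>: "\<kappa> = (n, \<rho>)" "n < q" "\<rho> \<in> K" 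
      using \<open>\<kappa> \<in> {..<q} \<times> K\<close> by auto
      show ?thesis
      proof (cases "\<rho> \<in> R")
        case False
        then show ?thesis using dt0 by (simp add: f_def \<kappa> par) (simp add: z_def)
      next
        case True
        \<comment> \<open>The unit columns receive the coefficient \<open>0\<close>: the kernel
          equations hold at all of \<open>J\<close>, so the coordinates in \<open>R\<close> alone
          solve the square system.\<close>
        define c where "c k = (case g k of Inl \<sigma> \<Rightarrow> \<gamma> (n, \<sigma>) | Inr t \<Rightarrow> 0)" for k
        have cpos: "c (pos \<sigma>) = \<gamma> (n, \<sigma>)" if "\<sigma> \<in> R" for \<sigma> using pos[OF that] by (simp add: c_def)
        have sys: "(\<Sum>k<N. A i k x * c k) = - (\<Sum>\<sigma>\<in>K - R. \<gamma> (n, \<sigma>) * y \<sigma> (h i) x)" if i: "i < N" for i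
        proof -
          have "c (the_inv_into {..<N} g (Inr (h i))) = 0" if "h i \<in> T"
          proof -
            have "Inr (h i) \<in> g ` {..<N}" using that g by (auto simp: bij_betw_def)
            then have "g (the_inv_into {..<N} g (Inr (h i))) = Inr (h i)"
              using g by (intro f_the_inv_into_f) (auto simp: bij_betw_def)
            then show ?thesis by (simp add: c_def)
          qed
          then have "(\<Sum>k<N. A i k x * c k) = (\<Sum>\<sigma>\<in>R. \<gamma> (n, \<sigma>) * y \<sigma> (h i) x)"
            using sumg[of i x c] by (simp add: cpos)
          moreover have "(\<Sum>\<sigma>\<in>K. \<gamma> (n, \<sigma>) * y \<sigma> (h i) x) = 0" using ker \<kappa>(2) hJ[OF i] by blast
          ultimately show ?thesis
            using sum.subset_diff[OF assms(5,2), of "\<lambda>\<sigma>. \<gamma> (n, \<sigma>) * y \<sigma> (h i) x"]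
            by (simp add: eq_neg_iff_add_eq_0 add.commute)
        qed
        have "f \<kappa> z = (\<Sum>i<N. ad (pos \<rho>) i x * (- (\<Sum>\<sigma>\<in>K - R. \<gamma> (n, \<sigma>) / dt x * y \<sigma> (h i) x)))"
          using True by (simp add: f_def \<kappa> par) (simp add: z_def)
        also have "\<dots> = (\<Sum>i<N. ad (pos \<rho>) i x * (- (\<Sum>\<sigma>\<in>K - R. \<gamma> (n, \<sigma>) * y \<sigma> (h i) x))) / dt x"
          by (simp add: sum_divide_distrib[symmetric] sum_negf)
        also have "(\<Sum>i<N. ad (pos \<rho>) i x * (- (\<Sum>\<sigma>\<in>K - R. \<gamma> (n, \<sigma>) * y \<sigma> (h i) x))) =
            (\<Sum>i<N. ad (pos \<rho>) i x * (\<Sum>k<N. A i k x * c k))"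
          by (intro sum.cong) (auto simp: sys)
        also have "\<dots> = (\<Sum>k<N. (\<Sum>i<N. ad (pos \<rho>) i x * A i k x) * c k)"
          unfolding sum_distrib_left sum_distrib_right by (subst sum.swap) (simp add: mult.assoc)
        also have "\<dots> = (\<Sum>k<N. (if pos \<rho> = k then dt x * c k else 0))"
          using square_adj_left[OF pos(1)[OF True], of _ "\<lambda>i k. A i k x"]
          by (intro sum.cong) (auto simp: ad_def dt_def)
        also have "\<dots> = dt x * \<gamma> \<kappa>" using pos[OF True] cpos[OF True] \<kappa> by simp
        finally show ?thesis using dt0 by simp
      qed
    qed
    then show ?thesis using polyfun_cong[OF \<Phi>(1), of "\<lambda>\<kappa>. f \<kappa> z" \<gamma>] \<Phi>(3)[of z] by simp
  qed
  then show ?thesis using \<Phi>(1,2) by blast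
qed

text \<open>Which \<open>R\<close> is independent, and which unit vectors complete it, depends on
  the point; but there are only finitely many choices, so the polynomials of all charts are
  multiplied.\<close>

lemma kernel_hypersurface:
  fixes y :: "'r \<Rightarrow> 'j \<Rightarrow> ('p \<Rightarrow> complex) \<Rightarrow> complex"
  assumes "finite P" "finite K" "finite J" "card P < q * r"
    and poly: "\<And>\<rho> j. \<rho> \<in> K \<Longrightarrow> j \<in> J \<Longrightarrow> polyfun P (y \<rho> j)"
    and supp: "\<And>\<rho> j x. \<rho> \<in> K \<Longrightarrow> j \<notin> J \<Longrightarrow> y \<rho> j x = 0"
  shows "\<exists>\<Phi>. polyfun ({..<q} \<times> K) \<Phi> \<and> (\<exists>\<gamma>. \<Phi> \<gamma> \<noteq> 0) \<and> (\<forall>\<gamma> x R.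
      R \<subseteq> K \<longrightarrow> card R = r \<longrightarrow> inj_on (\<lambda>\<rho> j. y \<rho> j x) R \<longrightarrow>
      fs.independent ((\<lambda>\<rho> j. y \<rho> j x) ` R) \<longrightarrow>
      (\<forall>n<q. \<forall>j\<in>J. (\<Sum>\<rho>\<in>K. \<gamma> (n, \<rho>) * y \<rho> j x) = 0) \<longrightarrow> \<Phi> \<gamma> = 0)"
proof -
  define C where "C = {(R, T). R \<subseteq> K \<and> T \<subseteq> J \<and> card R = r \<and> card R + card T = card J}"
  define good where "good = (\<lambda>(R, T) \<Phi>. polyfun ({..<q} \<times> K) \<Phi> \<and> (\<exists>\<gamma>. \<Phi> \<gamma> \<noteq> 0) \<and> (\<forall>\<gamma> x.
      (\<forall>c e. (\<forall>j\<in>J. (\<Sum>\<rho>\<in>R. c \<rho> * y \<rho> j x) + (if j \<in> T then e j else 0) = 0) \<longrightarrow>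
         (\<forall>\<rho>\<in>R. c \<rho> = 0) \<and> (\<forall>j\<in>T. e j = 0)) \<longrightarrow>
      (\<forall>n<q. \<forall>j\<in>J. (\<Sum>\<rho>\<in>K. \<gamma> (n, \<rho>) * y \<rho> j x) = 0) \<longrightarrow> \<Phi> \<gamma> = 0))"
  have "\<exists>\<Phi>. good \<kappa> \<Phi>" if "\<kappa> \<in> C" for \<kappa>
  proof -
    obtain R T where \<kappa>: "\<kappa> = (R, T)" "R \<subseteq> K" "T \<subseteq> J" "card R = r" "card R + card T = card J"
      using \<open>\<kappa> \<in> C\<close> by (auto simp: C_def)
    have "card P < q * card R" using assms(4) \<kappa>(4) by simp
    from kernel_hypersurface_chart[OF assms(1-3) this \<kappa>(2,3,5) poly]
    show ?thesis by (auto simp: good_def \<kappa>(1))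
  qed
  then obtain \<Phi> where \<Phi>: "\<And>\<kappa>. \<kappa> \<in> C \<Longrightarrow> good \<kappa> (\<Phi> \<kappa>)" by metis
  have "C \<subseteq> Pow K \<times> Pow J" by (auto simp: C_def)
  then have finC: "finite C" using assms(2,3) by (meson finite_Pow_iff finite_SigmaI finite_subset)
  define \<Psi> where "\<Psi> \<gamma> = (\<Prod>\<kappa>\<in>C. \<Phi> \<kappa> \<gamma>)" for \<gamma>
  have \<Phi>2: "polyfun ({..<q} \<times> K) (\<Phi> \<kappa>)" "\<exists>\<gamma>. \<Phi> \<kappa> \<gamma> \<noteq> 0" if "\<kappa> \<in> C" for \<kappa>
    using \<Phi>[OF that] unfolding good_def prod.case_eq_if by blast+
  have "\<Psi> \<gamma> = 0"
    if R: "R \<subseteq> K" "card R = r" "inj_on (\<lambda>\<rho> j. y \<rho> j x) R" "fs.independent ((\<lambda>\<rho> j. y \<rho> j x) ` R)"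
      and ker: "\<forall>n<q. \<forall>j\<in>J. (\<Sum>\<rho>\<in>K. \<gamma> (n, \<rho>) * y \<rho> j x) = 0" for \<gamma> x R
  proof -
    have fR: "finite R" using R(1) assms(2) finite_subset by blast
    have sp: "\<And>\<rho> j. \<rho> \<in> R \<Longrightarrow> j \<notin> J \<Longrightarrow> y \<rho> j x = 0" using supp R(1) by blast
    obtain T where T: "T \<subseteq> J" "card R + card T = card J"
      "\<forall>c e. (\<forall>j\<in>J. (\<Sum>\<rho>\<in>R. c \<rho> * y \<rho> j x) + (if j \<in> T then e j else 0) = 0) \<longrightarrow>
         (\<forall>\<rho>\<in>R. c \<rho> = 0) \<and> (\<forall>j\<in>T. e j = 0)"
      by (rule complete_by_unit_vectors[OF assms(3) fR R(3,4) sp], assumption, assumption, rule that)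
    have "(R, T) \<in> C" using R T(1,2) by (simp add: C_def)
    moreover have "\<Phi> (R, T) \<gamma> = 0"
      using \<Phi>[OF calculation] T(3) ker unfolding good_def prod.case by blast
    ultimately show ?thesis using finC by (auto simp: \<Psi>_def)
  qed
  moreover have "polyfun ({..<q} \<times> K) \<Psi>"
    unfolding \<Psi>_def by (intro polyfun_prod \<Phi>2)
  moreover have "\<exists>\<gamma>. \<Psi> \<gamma> \<noteq> 0"
    unfolding \<Psi>_def by (rule polyfun_prod_nonzero[OF finC \<Phi>2])
  ultimately show ?thesis by blast
qed

section \<open>Generic blow-ups of a space of matrices\<close>

text \<open>Functions are mostly treated as vectors from here on, so evaluation of sums at a point
  is done on demand only, by the collection \<open>pointwise\<close>.\<close>

declare zero_fun_apply [simp del] plus_fun_apply [simp del]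

lemmas pointwise = zero_fun_apply plus_fun_apply cscale_apply sum_fun_apply

definition supported :: "'i set \<Rightarrow> ('i \<Rightarrow> complex) set"
  where "supported I = {x. \<forall>i. i \<notin> I \<longrightarrow> x i = 0}"

lemma subspace_supported: "fs.subspace (supported I)"
  by (auto simp: fs.subspace_def supported_def pointwise)

lemma supported_subset_span: "finite I \<Longrightarrow> supported I \<subseteq> fs.span (unit_fun ` I)"
  using supported_in_span_unit_fun by (auto simp: supported_def)

text \<open>The ambient space of all functions may be infinite-dimensional; finiteness of a basis
  comes from the finite support \<open>I\<close>.\<close>

lemma finite_basis:
  assumes "finite I" "K \<subseteq> supported I" "fs.subspace K"
  obtains B where "B \<subseteq> K" "finite B" "fs.independent B" "fs.span B = K" "card B = fs.dim K"
proof -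
  obtain B where B: "B \<subseteq> K" "fs.independent B" "K \<subseteq> fs.span B" "card B = fs.dim K"
    using fs.basis_exists by blast
  have "B \<subseteq> fs.span (unit_fun ` I)" using B(1) assms supported_subset_span by blast
  then have "finite B" using fs.independent_span_bound[OF _ B(2)] assms(1) by blast
  moreover have "fs.span B = K" using B(1,3) assms(3) by (metis fs.span_minimal subset_antisym)
  ultimately show ?thesis using that B by blast
qed

lemma dim_mono:
  assumes "finite I" "K \<subseteq> supported I" "fs.subspace K" "fs.subspace S" "S \<subseteq> K"
  shows "fs.dim S \<le> fs.dim K"
proof -
  obtain B where B: "B \<subseteq> K" "finite B" "fs.independent B" "fs.span B = K" "card B = fs.dim K"
    by (rule finite_basis[OF assms(1-3)])
  obtain C where C: "C \<subseteq> S" "finite C" "fs.independent C" "fs.span C = S" "card C = fs.dim S"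
    using finite_basis[OF assms(1) _ assms(4)] assms(2,5) by blast
  show ?thesis using fs.independent_span_bound[OF B(2) C(3)] B C assms(5) by auto
qed

lemma dim_eq_imp_eq:
  assumes "finite I" "K \<subseteq> supported I" "fs.subspace K" "fs.subspace S" "S \<subseteq> K"
    and "fs.dim K \<le> fs.dim S"
  shows "S = K"
proof (rule ccontr)
  assume "S \<noteq> K"
  then obtain x where x: "x \<in> K" "x \<notin> S" using assms(5) by blast
  obtain B where B: "B \<subseteq> K" "finite B" "fs.independent B" "fs.span B = K" "card B = fs.dim K"
    by (rule finite_basis[OF assms(1-3)])
  obtain C where C: "C \<subseteq> S" "finite C" "fs.independent C" "fs.span C = S" "card C = fs.dim S"
    using finite_basis[OF assms(1) _ assms(4)] assms(2,5) by blast
  have "fs.independent (insert x C)" using C x by (simp add: fs.independent_insert)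
  moreover have "insert x C \<subseteq> fs.span B" using x C(1) assms(5) B(4) by auto
  ultimately have "card (insert x C) \<le> card B" using fs.independent_span_bound[OF B(2)] by blast
  moreover have "x \<notin> C" using x C(1) by auto
  ultimately show False using C(2,5) B(5) assms(6) by simp
qed

lemma dim_pos:
  assumes "finite I" "K \<subseteq> supported I" "fs.subspace K" "K \<noteq> {0}"
  shows "fs.dim K > 0"
proof (rule ccontr)
  assume "\<not> fs.dim K > 0"
  then obtain B where "finite B" "fs.span B = K" "card B = 0"
    using finite_basis[OF assms(1-3)] by (metis gr0I)
  then show False using assms(4) by simp
qed

text \<open>A basis chosen among the values is lifted back to indices, because the hypersurface
  lemmas select rows of a parametrised family and not vectors.\<close>

lemma independent_subfamily:
  assumes "finite B" "r \<le> fs.dim (fs.span (F ` B))"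
  obtains R where "R \<subseteq> B" "card R = r" "inj_on F R" "fs.independent (F ` R)"
proof -
  obtain C where C: "C \<subseteq> F ` B" "fs.independent C" "F ` B \<subseteq> fs.span C"
    using fs.maximal_independent_subset[of "F ` B"] by auto
  have finC: "finite C" using C(1) assms(1) finite_subset by blast
  have "fs.span (F ` B) = fs.span C"
    using C by (metis fs.span_eq fs.span_superset subset_trans)
  then have "r \<le> card C" using assms(2) fs.dim_eq_card_independent[OF C(2)] by simp
  then obtain D where D: "D \<subseteq> C" "card D = r" using obtain_subset_with_card_n by metis
  define g where "g d = (SOME x. x \<in> B \<and> F x = d)" for d
  have g: "g d \<in> B" "F (g d) = d" if "d \<in> D" for d
  proof -
    have "\<exists>x. x \<in> B \<and> F x = d" using C(1) D(1) \<open>d \<in> D\<close> by blast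
    then show "g d \<in> B" "F (g d) = d" unfolding g_def by (metis (mono_tags, lifting) someI_ex)+
  qed
  have inj: "inj_on g D" using g(2) by (metis inj_onI)
  have img: "F ` g ` D = D" using g(2) by force
  show ?thesis
  proof (rule that[of "g ` D"])
    show "g ` D \<subseteq> B" using g(1) by blast
    show "card (g ` D) = r" using card_image[OF inj] D(2) by simp
    show "inj_on F (g ` D)" using g(2) by (auto simp: inj_on_def)
    show "fs.independent (F ` g ` D)" unfolding img using C(2) D(1) fs.independent_mono by blast
  qed
qed

section \<open>Finite families of matrices and their block matrices\<close>

locale matrix_family =
  fixes I :: "'i set" and J :: "'j set" and U :: "'u set"
    and \<Lambda> :: "'u \<Rightarrow> 'j \<Rightarrow> 'i \<Rightarrow> complex"
  assumes finI: "finite I" and finJ: "finite J" and finU: "finite U"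
    and supp: "j \<notin> J \<Longrightarrow> \<Lambda> u j i = 0"
begin

definition app :: "'u \<Rightarrow> ('i \<Rightarrow> complex) \<Rightarrow> 'j \<Rightarrow> complex"
  where "app u x = (\<lambda>j. \<Sum>i\<in>I. \<Lambda> u j i * x i)"

text \<open>The sum of the images of \<open>K\<close> under all members of the family: the space
  \<open>L(K)\<close> whose dimension is the numerator of the slope.\<close>

definition img :: "('i \<Rightarrow> complex) set \<Rightarrow> ('j \<Rightarrow> complex) set"
  where "img K = fs.span (\<Union>u\<in>U. app u ` K)"

text \<open>Component \<open>n\<close> of the product of a block matrix with the column of the
  \<open>x m\<close>, where the block at \<open>(n, m)\<close> is the combination of the matrices
  \<open>\<Lambda> u\<close> with coefficients \<open>\<gamma> (n, m, u)\<close>.\<close>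

definition blowup :: "nat \<Rightarrow> (nat \<times> nat \<times> 'u \<Rightarrow> complex) \<Rightarrow> (nat \<Rightarrow> 'i \<Rightarrow> complex) \<Rightarrow> nat \<Rightarrow> 'j \<Rightarrow> complex"
  where "blowup p \<gamma> x n = (\<lambda>j. \<Sum>(m, u)\<in>{..<p} \<times> U. \<gamma> (n, m, u) * app u (x m) j)"

lemma app_add: "app u (x + y) = app u x + app u y"
  by (auto simp: app_def fun_eq_iff pointwise algebra_simps sum.distrib)

lemma app_cscale: "app u (cscale c x) = cscale c (app u x)"
  by (auto simp: app_def cscale_def sum_distrib_left algebra_simps)

lemma app_zero: "app u 0 = 0"
  by (simp add: app_def fun_eq_iff pointwise)

lemma app_sum: "app u (\<Sum>a\<in>A. f a) = (\<Sum>a\<in>A. app u (f a))"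
  by (induction A rule: infinite_finite_induct) (auto simp: app_zero app_add)

lemma app_supported: "app u x \<in> supported J"
  by (auto simp: app_def supported_def supp)

lemma subspace_img: "fs.subspace (img K)"
  by (simp add: img_def)

lemma img_supported: "img K \<subseteq> supported J"
  unfolding img_def by (rule fs.span_minimal) (auto simp: subspace_supported app_supported)

lemma img_mono: "K \<subseteq> L \<Longrightarrow> img K \<subseteq> img L"
  unfolding img_def by (rule fs.span_mono) auto

lemma app_in_img: "u \<in> U \<Longrightarrow> x \<in> K \<Longrightarrow> app u x \<in> img K"
  unfolding img_def by (rule fs.span_base) auto

lemma img_span: "img (fs.span S) = fs.span ((\<lambda>(x, u). app u x) ` (S \<times> U))"
proof
  have "app u x \<in> fs.span ((\<lambda>(x, u). app u x) ` (S \<times> U))" if "u \<in> U" "x \<in> fs.span S" for u x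
    using that(2)
  proof (induction rule: fs.span_induct_alt)
    case base
    show ?case by (simp add: app_zero fs.span_zero)
  next
    case (step c x y)
    then have "app u x \<in> fs.span ((\<lambda>(x, u). app u x) ` (S \<times> U))"
      using \<open>u \<in> U\<close> by (intro fs.span_base) force
    then show ?case using step by (auto simp: app_add app_cscale intro: fs.span_add fs.span_scale)
  qed
  then show "img (fs.span S) \<subseteq> fs.span ((\<lambda>(x, u). app u x) ` (S \<times> U))"
    unfolding img_def by (intro fs.span_minimal) auto
  show "fs.span ((\<lambda>(x, u). app u x) ` (S \<times> U)) \<subseteq> img (fs.span S)"
    unfolding img_def by (rule fs.span_mono) (auto intro: fs.span_base)
qed

lemma blowup_eq: "blowup p \<gamma> x n j = (\<Sum>\<rho>\<in>{..<p} \<times> U. \<gamma> (n, \<rho>) * app (snd \<rho>) (x (fst \<rho>)) j)"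
  unfolding blowup_def by (rule sum.cong) auto

lemma blowup_scale: "blowup p \<gamma> (\<lambda>m. cscale c (x m)) n j = c * blowup p \<gamma> x n j"
  by (simp add: blowup_eq app_cscale cscale_apply sum_distrib_left algebra_simps)

text \<open>By \<open>img_span\<close> the image of the span is generated by the vectors
  \<open>app u (x m)\<close>, which are exactly the columns that the coefficients of a blow-up
  combine.\<close>

lemma independent_in_image:
  fixes p :: nat
  assumes "r \<le> fs.dim (img (fs.span (x ` {..<p})))"
  obtains R where "R \<subseteq> {..<p} \<times> U" "card R = r" "inj_on (\<lambda>\<rho> j. app (snd \<rho>) (x (fst \<rho>)) j) R"
    "fs.independent ((\<lambda>\<rho> j. app (snd \<rho>) (x (fst \<rho>)) j) ` R)"
proof -
  have "(\<lambda>(x, u). app u x) ` (x ` {..<p} \<times> U) = (\<lambda>\<rho> j. app (snd \<rho>) (x (fst \<rho>)) j) ` ({..<p} \<times> U)"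
    by force
  then have "r \<le> fs.dim (fs.span ((\<lambda>\<rho> j. app (snd \<rho>) (x (fst \<rho>)) j) ` ({..<p} \<times> U)))"
    using assms by (simp add: img_span)
  note r = this
  have f: "finite ({..<p} \<times> U)" using finU by simp
  show ?thesis using that by (rule independent_subfamily[OF f r])
qed

text \<open>Families spanning a space of dimension \<open>s\<close> have \<open>s |I|\<close> parameters for a basis and \<open>p s\<close>
  for the coordinates.\<close>

lemma low_rank_hypersurface:
  assumes "s * card I + p * s < q * r"
  shows "\<exists>\<Phi>. polyfun ({..<q} \<times> {..<p} \<times> U) \<Phi> \<and> (\<exists>\<gamma>. \<Phi> \<gamma> \<noteq> 0) \<and> (\<forall>\<gamma> x.
      (\<forall>m<p. x m \<in> supported I) \<longrightarrow> fs.dim (fs.span (x ` {..<p})) = s \<longrightarrow>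
      r \<le> fs.dim (img (fs.span (x ` {..<p}))) \<longrightarrow>
      (\<forall>n<q. \<forall>j\<in>J. blowup p \<gamma> x n j = 0) \<longrightarrow> \<Phi> \<gamma> = 0)"
proof -
  define P where "P = Inl ` ({..<s} \<times> I) \<union> Inr ` ({..<p} \<times> {..<s})"
  define y where "y \<rho> j z = (\<Sum>i<s. z (Inr (fst \<rho>, i)) * (\<Sum>e\<in>I. \<Lambda> (snd \<rho>) j e * z (Inl (i, e))))"
    for \<rho> :: "nat \<times> 'u" and j and z :: "nat \<times> 'i + nat \<times> nat \<Rightarrow> complex"
  have "card P \<le> s * card I + p * s"
    unfolding P_def using card_Un_le[of "Inl ` ({..<s} \<times> I)" "Inr ` ({..<p} \<times> {..<s})"]
    by (simp add: card_image card_cartesian_product)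
  then have cP: "card P < q * r" using assms by simp
  have finP: "finite P" using finI by (simp add: P_def)
  have fin: "finite ({..<p} \<times> U)" using finU by simp
  have "\<exists>\<Phi>. polyfun ({..<q} \<times> {..<p} \<times> U) \<Phi> \<and> (\<exists>\<gamma>. \<Phi> \<gamma> \<noteq> 0) \<and> (\<forall>\<gamma> z R.
      R \<subseteq> {..<p} \<times> U \<longrightarrow> card R = r \<longrightarrow> inj_on (\<lambda>\<rho> j. y \<rho> j z) R \<longrightarrow>
      fs.independent ((\<lambda>\<rho> j. y \<rho> j z) ` R) \<longrightarrow>
      (\<forall>n<q. \<forall>j\<in>J. (\<Sum>\<rho>\<in>{..<p} \<times> U. \<gamma> (n, \<rho>) * y \<rho> j z) = 0) \<longrightarrow> \<Phi> \<gamma> = 0)"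
  proof (rule kernel_hypersurface[OF finP fin finJ cP])
    show "polyfun P (y \<rho> j)" if "\<rho> \<in> {..<p} \<times> U" for \<rho> j
      unfolding y_def by (intro polyfun_sum polyfun_mult polyfun_const polyfun_var)
        (use that in \<open>auto simp: P_def\<close>)
    show "y \<rho> j z = 0" if "j \<notin> J" for \<rho> j z using supp[OF that] by (simp add: y_def)
  qed
  then obtain \<Phi> where \<Phi>: "polyfun ({..<q} \<times> {..<p} \<times> U) \<Phi>" "\<exists>\<gamma>. \<Phi> \<gamma> \<noteq> 0"
    "\<forall>\<gamma> z R. R \<subseteq> {..<p} \<times> U \<longrightarrow> card R = r \<longrightarrow> inj_on (\<lambda>\<rho> j. y \<rho> j z) R \<longrightarrow>
      fs.independent ((\<lambda>\<rho> j. y \<rho> j z) ` R) \<longrightarrow>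
      (\<forall>n<q. \<forall>j\<in>J. (\<Sum>\<rho>\<in>{..<p} \<times> U. \<gamma> (n, \<rho>) * y \<rho> j z) = 0) \<longrightarrow> \<Phi> \<gamma> = 0"
    by blast
  have "\<Phi> \<gamma> = 0"
    if x: "\<forall>m<p. x m \<in> supported I" "fs.dim (fs.span (x ` {..<p})) = s"
      "r \<le> fs.dim (img (fs.span (x ` {..<p})))"
      and ker: "\<forall>n<q. \<forall>j\<in>J. blowup p \<gamma> x n j = 0" for \<gamma> x
  proof -
    have "fs.span (x ` {..<p}) \<subseteq> supported I"
      using x(1) by (intro fs.span_minimal) (auto simp: subspace_supported)
    then obtain B where B: "B \<subseteq> fs.span (x ` {..<p})" "finite B" "fs.independent B"
      "fs.span B = fs.span (x ` {..<p})" "card B = s"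
      using finite_basis[OF finI _ fs.subspace_span] x(2) by metis
    obtain k where k: "bij_betw k {..<s} B"
      using B(2,5) by (metis ex_bij_betw_nat_finite atLeast0LessThan)
    define z where "z \<pi> = (case \<pi> of Inl (i, e) \<Rightarrow> k i e | Inr (m, i) \<Rightarrow> fs.representation B (x m) (k i))" for \<pi>
    have xk: "x m = (\<Sum>i<s. cscale (fs.representation B (x m) (k i)) (k i))" if "m < p" for m
    proof -
      have "x m \<in> fs.span B" using that B(4) fs.span_base[of "x m" "x ` {..<p}"] by auto
      then have "x m = (\<Sum>b\<in>B. cscale (fs.representation B (x m) b) b)"
        using fs.sum_representation_eq[OF B(3) _ B(2) order.refl] by simp
      also have "\<dots> = (\<Sum>i<s. cscale (fs.representation B (x m) (k i)) (k i))"
        by (rule sum.reindex_bij_betw[OF k, symmetric])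
      finally show ?thesis .
    qed
    have y: "y \<rho> j z = app (snd \<rho>) (x (fst \<rho>)) j" if "\<rho> \<in> {..<p} \<times> U" for \<rho> j
    proof -
      have "app (snd \<rho>) (x (fst \<rho>)) j =
          app (snd \<rho>) (\<Sum>i<s. cscale (fs.representation B (x (fst \<rho>)) (k i)) (k i)) j"
        using that xk[of "fst \<rho>"] by (metis lessThan_iff mem_Times_iff)
      also have "\<dots> = (\<Sum>i<s. fs.representation B (x (fst \<rho>)) (k i) * app (snd \<rho>) (k i) j)"
        by (simp add: app_sum app_cscale sum_fun_apply cscale_apply)
      also have "\<dots> = y \<rho> j z" by (simp add: y_def z_def app_def)
      finally show ?thesis by simp
    qed
    obtain R where R: "R \<subseteq> {..<p} \<times> U" "card R = r" "inj_on (\<lambda>\<rho> j. app (snd \<rho>) (x (fst \<rho>)) j) R"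
      "fs.independent ((\<lambda>\<rho> j. app (snd \<rho>) (x (fst \<rho>)) j) ` R)"
      by (rule independent_in_image[OF x(3)])
    have Ry: "(\<lambda>j. y \<rho> j z) = (\<lambda>j. app (snd \<rho>) (x (fst \<rho>)) j)" if "\<rho> \<in> R" for \<rho>
      using y R(1) that by blast
    show ?thesis
    proof (rule \<Phi>(3)[rule_format, of R z])
      show "inj_on (\<lambda>\<rho> j. y \<rho> j z) R" using R(3) Ry by (simp add: inj_on_def)
      show "fs.independent ((\<lambda>\<rho> j. y \<rho> j z) ` R)" using R(4) Ry by (simp cong: image_cong)
      show "(\<Sum>\<rho>\<in>{..<p} \<times> U. \<gamma> (n, \<rho>) * y \<rho> j z) = 0" if "n < q" "j \<in> J" for n j
        using ker y that by (simp add: blowup_eq cong: sum.cong)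
    qed (use R in auto)
  qed
  then show ?thesis using \<Phi>(1,2) by blast
qed

text \<open>Families spanning the whole of \<open>K\<close> have \<open>p dim K\<close> parameters, one of which is normalised
  to \<open>1\<close>.\<close>

lemma full_rank_hypersurface:
  assumes K: "K \<subseteq> supported I" "fs.subspace K" and "p * fs.dim K = q * fs.dim (img K)"
    and pos: "p * fs.dim K > 0"
  shows "\<exists>\<Phi>. polyfun ({..<q} \<times> {..<p} \<times> U) \<Phi> \<and> (\<exists>\<gamma>. \<Phi> \<gamma> \<noteq> 0) \<and> (\<forall>\<gamma> x.
      fs.span (x ` {..<p}) = K \<longrightarrow> (\<forall>n<q. \<forall>j\<in>J. blowup p \<gamma> x n j = 0) \<longrightarrow> \<Phi> \<gamma> = 0)"
proof -
  define a where "a = fs.dim K"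
  define r where "r = fs.dim (img K)"
  obtain B where B: "B \<subseteq> K" "finite B" "fs.independent B" "fs.span B = K" "card B = a"
    using finite_basis[OF finI K] unfolding a_def by metis
  obtain k where k: "bij_betw k {..<a} B"
    using B(2,5) by (metis ex_bij_betw_nat_finite atLeast0LessThan)
  \<comment> \<open>The basis of \<open>K\<close> is fixed here, so only coordinates are parameters.
    Setting the one at \<open>\<pi>\<close> to \<open>1\<close> leaves \<open>p * a - 1\<close> of
    them, one less than \<open>q * r\<close>, the number of conditions.\<close>
  define P where "P \<pi> = {..<p} \<times> {..<a} - {\<pi>}" for \<pi> :: "nat \<times> nat"
  define y where "y \<pi> \<rho> j z = (\<Sum>e<a. (if (fst \<rho>, e) = \<pi> then 1 else z (fst \<rho>, e)) * app (snd \<rho>) (k e) j)"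
    for \<pi> :: "nat \<times> nat" and \<rho> :: "nat \<times> 'u" and j and z :: "nat \<times> nat \<Rightarrow> complex"
  have fin: "finite ({..<p} \<times> U)" using finU by simp
  define good where "good \<pi> \<Phi> \<longleftrightarrow> polyfun ({..<q} \<times> {..<p} \<times> U) \<Phi> \<and> (\<exists>\<gamma>. \<Phi> \<gamma> \<noteq> 0) \<and> (\<forall>\<gamma> z R.
      R \<subseteq> {..<p} \<times> U \<longrightarrow> card R = r \<longrightarrow> inj_on (\<lambda>\<rho> j. y \<pi> \<rho> j z) R \<longrightarrow>
      fs.independent ((\<lambda>\<rho> j. y \<pi> \<rho> j z) ` R) \<longrightarrow>
      (\<forall>n<q. \<forall>j\<in>J. (\<Sum>\<rho>\<in>{..<p} \<times> U. \<gamma> (n, \<rho>) * y \<pi> \<rho> j z) = 0) \<longrightarrow> \<Phi> \<gamma> = 0)" for \<pi> \<Phi>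
  have "\<exists>\<Phi>. good \<pi> \<Phi>" if \<pi>: "\<pi> \<in> {..<p} \<times> {..<a}" for \<pi>
    unfolding good_def
  proof (rule kernel_hypersurface[of "P \<pi>"])
    have "card (P \<pi>) = p * a - 1" using \<pi> by (simp add: P_def card_cartesian_product)
    then show "card (P \<pi>) < q * r" using assms(3) pos by (simp add: a_def r_def)
    show "polyfun (P \<pi>) (y \<pi> \<rho> j)" if "\<rho> \<in> {..<p} \<times> U" for \<rho> j
      unfolding y_def
    proof (intro polyfun_sum polyfun_mult polyfun_const)
      fix e assume "e \<in> {..<a}"
      then show "polyfun (P \<pi>) (\<lambda>z. if (fst \<rho>, e) = \<pi> then 1 else z (fst \<rho>, e))"
        using \<open>\<rho> \<in> {..<p} \<times> U\<close>
        by (cases "(fst \<rho>, e) = \<pi>") (auto simp: P_def intro!: polyfun_const polyfun_var)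
    qed
    show "y \<pi> \<rho> j z = 0" if "j \<notin> J" for \<rho> j z
      using supp[OF that] by (simp add: y_def app_def)
  qed (auto simp: P_def fin finJ finU)
  then have "\<forall>\<pi>\<in>{..<p} \<times> {..<a}. \<exists>\<Phi>. good \<pi> \<Phi>" by blast
  then obtain \<Phi> where "\<forall>\<pi>\<in>{..<p} \<times> {..<a}. good \<pi> (\<Phi> \<pi>)" using bchoice by blast
  then have \<Phi>: "polyfun ({..<q} \<times> {..<p} \<times> U) (\<Phi> \<pi>)" "\<exists>\<gamma>. \<Phi> \<pi> \<gamma> \<noteq> 0"
    "\<forall>\<gamma> z R. R \<subseteq> {..<p} \<times> U \<longrightarrow> card R = r \<longrightarrow> inj_on (\<lambda>\<rho> j. y \<pi> \<rho> j z) R \<longrightarrow>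
      fs.independent ((\<lambda>\<rho> j. y \<pi> \<rho> j z) ` R) \<longrightarrow>
      (\<forall>n<q. \<forall>j\<in>J. (\<Sum>\<rho>\<in>{..<p} \<times> U. \<gamma> (n, \<rho>) * y \<pi> \<rho> j z) = 0) \<longrightarrow> \<Phi> \<pi> \<gamma> = 0"
    if "\<pi> \<in> {..<p} \<times> {..<a}" for \<pi>
    using that unfolding good_def by blast+
  \<comment> \<open>The coordinate that can be normalised depends on the vectors \<open>x m\<close>,
    so the polynomials for all positions are multiplied.\<close>
  define \<Psi> where "\<Psi> \<gamma> = (\<Prod>\<pi>\<in>{..<p} \<times> {..<a}. \<Phi> \<pi> \<gamma>)" for \<gamma>
  have "\<Psi> \<gamma> = 0"
    if x: "fs.span (x ` {..<p}) = K" and ker: "\<forall>n<q. \<forall>j\<in>J. blowup p \<gamma> x n j = 0" for \<gamma> x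
  proof -
    define \<xi> where "\<xi> m e = fs.representation B (x m) (k e)" for m e
    have xk: "x m = (\<Sum>e<a. cscale (\<xi> m e) (k e))" if "m < p" for m
    proof -
      have "x m \<in> fs.span B" using that B(4) x fs.span_base[of "x m" "x ` {..<p}"] by auto
      then have "x m = (\<Sum>b\<in>B. cscale (fs.representation B (x m) b) b)"
        using fs.sum_representation_eq[OF B(3) _ B(2) order.refl] by simp
      also have "\<dots> = (\<Sum>e<a. cscale (\<xi> m e) (k e))"
        unfolding \<xi>_def by (rule sum.reindex_bij_betw[OF k, symmetric])
      finally show ?thesis .
    qed
    have "\<exists>m<p. \<exists>e<a. \<xi> m e \<noteq> 0"
    proof (rule ccontr)
      assume "\<not> ?thesis"
      then have "x m = 0" if "m < p" for m using xk[OF that] that by (simp add: cscale_def zero_eq)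
      then have "x ` {..<p} \<subseteq> {0}" by auto
      then have "K \<subseteq> {0}" using x fs.span_mono[of "x ` {..<p}" "{0}"] by simp
      then have "fs.dim K = 0" using fs.dim_le_card[of K "{}"] by simp
      then show False using pos by simp
    qed
    then obtain m0 e0 where me: "m0 < p" "e0 < a" "\<xi> m0 e0 \<noteq> 0" by blast
    define c where "c = 1 / \<xi> m0 e0"
    define x' where "x' m = cscale c (x m)" for m
    have c0: "c \<noteq> 0" using me by (simp add: c_def)
    have "x m = cscale (1 / c) (x' m)" for m using c0 by (simp add: x'_def cscale_def)
    then have "fs.span (x ` {..<p}) \<subseteq> fs.span (x' ` {..<p})"
      by (intro fs.span_minimal) (auto intro: fs.span_scale fs.span_base)
    moreover have "fs.span (x' ` {..<p}) \<subseteq> fs.span (x ` {..<p})"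
      by (intro fs.span_minimal) (auto simp: x'_def intro: fs.span_scale fs.span_base)
    ultimately have "fs.span (x' ` {..<p}) = K" using x by simp
    then have "r \<le> fs.dim (img (fs.span (x' ` {..<p})))" by (simp add: r_def)
    then obtain R where R: "R \<subseteq> {..<p} \<times> U" "card R = r"
      "inj_on (\<lambda>\<rho> j. app (snd \<rho>) (x' (fst \<rho>)) j) R"
      "fs.independent ((\<lambda>\<rho> j. app (snd \<rho>) (x' (fst \<rho>)) j) ` R)"
      by (rule independent_in_image)
    define z where "z = (\<lambda>(m, e). c * \<xi> m e)"
    have zme: "(if (m, e) = (m0, e0) then 1 else z (m, e)) = c * \<xi> m e" for m e
      using me by (auto simp: z_def c_def)
    have y: "y (m0, e0) \<rho> j z = app (snd \<rho>) (x' (fst \<rho>)) j" if "\<rho> \<in> {..<p} \<times> U" for \<rho> j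
    proof -
      have "app (snd \<rho>) (x' (fst \<rho>)) j = c * app (snd \<rho>) (\<Sum>e<a. cscale (\<xi> (fst \<rho>) e) (k e)) j"
        using that xk[of "fst \<rho>"] by (metis lessThan_iff mem_Times_iff x'_def app_cscale cscale_apply)
      also have "\<dots> = y (m0, e0) \<rho> j z"
        unfolding y_def zme
        by (simp add: app_sum app_cscale sum_fun_apply cscale_apply sum_distrib_left mult.assoc)
      finally show ?thesis by simp
    qed
    have Ry: "(\<lambda>j. y (m0, e0) \<rho> j z) = (\<lambda>j. app (snd \<rho>) (x' (fst \<rho>)) j)" if "\<rho> \<in> R" for \<rho>
      using y R(1) that by blast
    have ker': "blowup p \<gamma> x' n j = 0" if "n < q" "j \<in> J" for n j
      using ker that by (simp add: x'_def[abs_def] blowup_scale)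
    have "\<Phi> (m0, e0) \<gamma> = 0"
    proof (rule \<Phi>(3)[rule_format, of _ R z])
      show "inj_on (\<lambda>\<rho> j. y (m0, e0) \<rho> j z) R" using R(3) Ry by (simp add: inj_on_def)
      show "fs.independent ((\<lambda>\<rho> j. y (m0, e0) \<rho> j z) ` R)" using R(4) Ry by (simp cong: image_cong)
      show "(\<Sum>\<rho>\<in>{..<p} \<times> U. \<gamma> (n, \<rho>) * y (m0, e0) \<rho> j z) = 0" if "n < q" "j \<in> J" for n j
        using ker' y that by (simp add: blowup_eq cong: sum.cong)
    qed (use R me in auto)
    then show ?thesis using me unfolding \<Psi>_def by (intro prod_zero) auto
  qed
  moreover have "polyfun ({..<q} \<times> {..<p} \<times> U) \<Psi>"
    unfolding \<Psi>_def by (intro polyfun_prod \<Phi>(1))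
  moreover have "\<exists>\<gamma>. \<Psi> \<gamma> \<noteq> 0"
    unfolding \<Psi>_def by (rule polyfun_prod_nonzero) (auto intro: \<Phi>)
  ultimately show ?thesis by blast
qed

text \<open>The components of a kernel vector span a subspace \<open>S\<close> of \<open>K\<close>.
  If \<open>S\<close> is proper and nonzero, stability makes its image large and the count for low
  rank applies with its dimension; if \<open>S\<close> is \<open>K\<close>, the count for full rank
  applies. One polynomial per possible dimension of \<open>S\<close> excludes all nonzero kernel
  vectors.\<close>

lemma stable_generic_injective:
  assumes K: "K \<subseteq> supported I" "fs.subspace K" "K \<noteq> {0}"
    and stable: "\<And>S. fs.subspace S \<Longrightarrow> S \<subseteq> K \<Longrightarrow> S \<noteq> {0} \<Longrightarrow> S \<noteq> K \<Longrightarrow>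
      fs.dim K * fs.dim (img S) > fs.dim (img K) * fs.dim S"
    and b: "fs.dim (img K) > 0" and N: "N > fs.dim K * card I"
    and p: "p = fs.dim (img K) * N" and q: "q = fs.dim K * N"
  shows "\<exists>\<Phi>. polyfun ({..<q} \<times> {..<p} \<times> U) \<Phi> \<and> (\<exists>\<gamma>. \<Phi> \<gamma> \<noteq> 0) \<and> (\<forall>\<gamma> x.
      (\<forall>m<p. x m \<in> K) \<longrightarrow> (\<forall>n<q. \<forall>j\<in>J. blowup p \<gamma> x n j = 0) \<longrightarrow> \<Phi> \<gamma> \<noteq> 0 \<longrightarrow>
      (\<forall>m<p. x m = 0))"
proof -
  define a where "a = fs.dim K"
  define b' where "b' = fs.dim (img K)"
  have a0: "a > 0" using dim_pos[OF finI K] by (simp add: a_def)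
  \<comment> \<open>The least integer above \<open>b' * s / a\<close>, hence a lower bound for the
    dimension of the image of a proper nonzero \<open>S\<close> of dimension
    \<open>s\<close>.\<close>
  define r where "r s = b' * s div a + 1" for s
  \<comment> \<open>As \<open>a * r s\<close> exceeds \<open>b' * s\<close> by at least one,
    \<open>q * r s - p * s\<close> is at least \<open>N\<close>, which was chosen larger than the
    cost \<open>s * card I\<close> of selecting a basis.\<close>
  have "s * card I + p * s < q * r s" if "s \<in> {1..<a}" for s
  proof -
    have "b' * s = a * (b' * s div a) + b' * s mod a" by simp
    then have "b' * s < a * (b' * s div a) + a"
      using mod_less_divisor[OF a0, of "b' * s"] by linarith
    then have "b' * s < a * r s" by (simp add: r_def)
    then have "N * (b' * s + 1) \<le> N * (a * r s)" by (intro mult_le_mono2) simp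
    moreover have "s * card I \<le> a * card I" using that by (intro mult_right_mono) auto
    moreover have "a * card I < N" using N by (simp add: a_def)
    ultimately have "s * card I + N * b' * s < N * (a * r s)"
      unfolding distrib_left mult.assoc mult_1_right by linarith
    then show ?thesis by (simp add: p q a_def b'_def algebra_simps)
  qed
  note low = low_rank_hypersurface[OF this]
  define good where "good s \<Phi> \<longleftrightarrow> polyfun ({..<q} \<times> {..<p} \<times> U) \<Phi> \<and> (\<exists>\<gamma>. \<Phi> \<gamma> \<noteq> 0) \<and> (\<forall>\<gamma> x.
      (\<forall>m<p. x m \<in> supported I) \<longrightarrow> fs.dim (fs.span (x ` {..<p})) = s \<longrightarrow>
      r s \<le> fs.dim (img (fs.span (x ` {..<p}))) \<longrightarrow>
      (\<forall>n<q. \<forall>j\<in>J. blowup p \<gamma> x n j = 0) \<longrightarrow> \<Phi> \<gamma> = 0)" for s \<Phi>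
  have "\<forall>s\<in>{1..<a}. \<exists>\<Phi>. good s \<Phi>" unfolding good_def using low by blast
  then obtain \<Phi> where "\<forall>s\<in>{1..<a}. good s (\<Phi> s)" using bchoice by blast
  then have \<Phi>: "polyfun ({..<q} \<times> {..<p} \<times> U) (\<Phi> s)" "\<exists>\<gamma>. \<Phi> s \<gamma> \<noteq> 0"
    "\<forall>\<gamma> x. (\<forall>m<p. x m \<in> supported I) \<longrightarrow> fs.dim (fs.span (x ` {..<p})) = s \<longrightarrow>
      r s \<le> fs.dim (img (fs.span (x ` {..<p}))) \<longrightarrow>
      (\<forall>n<q. \<forall>j\<in>J. blowup p \<gamma> x n j = 0) \<longrightarrow> \<Phi> s \<gamma> = 0"
    if "s \<in> {1..<a}" for s
    using that unfolding good_def by blast+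
  have "p * fs.dim K = q * fs.dim (img K)" by (simp add: p q)
  moreover have "p * fs.dim K > 0" using b a0 N by (simp add: p a_def)
  ultimately obtain \<Theta> where \<Theta>: "polyfun ({..<q} \<times> {..<p} \<times> U) \<Theta>" "\<exists>\<gamma>. \<Theta> \<gamma> \<noteq> 0"
    "\<And>\<gamma> x. fs.span (x ` {..<p}) = K \<Longrightarrow> \<forall>n<q. \<forall>j\<in>J. blowup p \<gamma> x n j = 0 \<Longrightarrow> \<Theta> \<gamma> = 0"
    using full_rank_hypersurface[OF K(1,2)] by metis
  define \<Psi> where "\<Psi> \<gamma> = (\<Prod>s\<in>{1..<a}. \<Phi> s \<gamma>) * \<Theta> \<gamma>" for \<gamma>
  have poly: "polyfun ({..<q} \<times> {..<p} \<times> U) (\<lambda>\<gamma>. \<Prod>s\<in>{1..<a}. \<Phi> s \<gamma>)"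
    by (intro polyfun_prod \<Phi>(1))
  have "\<exists>\<gamma>. (\<Prod>s\<in>{1..<a}. \<Phi> s \<gamma>) \<noteq> 0"
    by (rule polyfun_prod_nonzero) (auto intro: \<Phi>)
  then have "\<exists>\<gamma>. \<Psi> \<gamma> \<noteq> 0"
    unfolding \<Psi>_def using polyfun_common_nonzero[OF poly \<Theta>(1)] \<Theta>(2) by blast
  moreover have "polyfun ({..<q} \<times> {..<p} \<times> U) \<Psi>"
    unfolding \<Psi>_def by (rule polyfun_mult[OF poly \<Theta>(1)])
  moreover have "\<forall>m<p. x m = 0"
    if x: "\<forall>m<p. x m \<in> K" and ker: "\<forall>n<q. \<forall>j\<in>J. blowup p \<gamma> x n j = 0" and nz: "\<Psi> \<gamma> \<noteq> 0" for \<gamma> x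
  proof (rule ccontr)
    assume ne: "\<not> (\<forall>m<p. x m = 0)"
    define S where "S = fs.span (x ` {..<p})"
    have "S \<subseteq> K" unfolding S_def by (rule fs.span_minimal) (use x K(2) in auto)
    then have S: "fs.subspace S" "S \<subseteq> K" by (simp_all add: S_def)
    obtain m where "m < p" "x m \<noteq> 0" using ne by blast
    then have "x m \<in> S" "x m \<noteq> 0" by (auto simp: S_def intro: fs.span_base)
    then have S0: "S \<noteq> {0}" by auto
    have "S \<noteq> K" using \<Theta>(3)[of x \<gamma>] ker nz by (auto simp: S_def \<Psi>_def)
    have "fs.dim S > 0" using dim_pos[OF finI _ S(1) S0] S(2) K(1) by auto
    moreover have "fs.dim S < a"
      using dim_eq_imp_eq[OF finI K(1,2) S] \<open>S \<noteq> K\<close> by (force simp: a_def)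
    ultimately have s: "fs.dim S \<in> {1..<a}" by simp
    have "b' * fs.dim S < a * fs.dim (img S)"
      using stable[OF S S0 \<open>S \<noteq> K\<close>] by (simp add: a_def b'_def)
    then have "b' * fs.dim S div a < fs.dim (img S)"
      using a0 by (simp add: div_less_iff_less_mult mult.commute)
    then have "r (fs.dim S) \<le> fs.dim (img S)" by (simp add: r_def)
    then have "\<Phi> (fs.dim S) \<gamma> = 0"
      using \<Phi>(3)[OF s, rule_format, of x \<gamma>] x K(1) ker by (auto simp: S_def)
    then have "(\<Prod>s\<in>{1..<a}. \<Phi> s \<gamma>) = 0" using s by (intro prod_zero) auto
    then show False using nz by (simp add: \<Psi>_def)
  qed
  ultimately show ?thesis by blast
qed

end

section \<open>Stability of blow-ups\<close>

interpretation fsp: vector_space_pair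
  "cscale :: complex \<Rightarrow> ('i \<Rightarrow> complex) \<Rightarrow> 'i \<Rightarrow> complex"
  "cscale :: complex \<Rightarrow> ('j \<Rightarrow> complex) \<Rightarrow> 'j \<Rightarrow> complex"
  by standard

abbreviation clinear :: "(('i \<Rightarrow> complex) \<Rightarrow> 'j \<Rightarrow> complex) \<Rightarrow> bool"
  where "clinear \<equiv> Vector_Spaces.linear cscale cscale"

lemma clinearI:
  assumes "\<And>x y. T (x + y) = T x + T y" "\<And>c x. T (cscale c x) = cscale c (T x)"
  shows "clinear T"
  by unfold_locales (use assms in auto)

lemma injective_imp_onto:
  assumes "clinear T" "finite I" "V \<subseteq> supported I" "fs.subspace V"
    and "finite J" "W \<subseteq> supported J" "fs.subspace W" "T ` V \<subseteq> W" "fs.dim W \<le> fs.dim V"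
    and "\<And>x. x \<in> V \<Longrightarrow> T x = 0 \<Longrightarrow> x = 0"
  shows "T ` V = W"
proof -
  obtain B where B: "B \<subseteq> V" "finite B" "fs.independent B" "fs.span B = V" "card B = fs.dim V"
    by (rule finite_basis[OF assms(2-4)])
  have inj: "inj_on T V"
    using assms(10) fsp.linear_inj_on_iff_eq_0[OF assms(1,4)] by blast
  have "fs.independent (T ` B)"
    using fsp.linear_independent_injective_image[OF assms(1) B(3)] inj B(4) by simp
  moreover have "fs.span (T ` B) = T ` V" using fsp.linear_span_image[OF assms(1), of B] B(4) by simp
  moreover have "card (T ` B) = fs.dim V" using card_image[OF inj_on_subset[OF inj B(1)]] B(5) by simp
  ultimately have "fs.dim (T ` V) = fs.dim V" by (metis fs.dim_span_eq_card_independent)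
  then show ?thesis
    using dim_eq_imp_eq[OF assms(5-7) _ assms(8)] fsp.linear_subspace_image[OF assms(1,4)] assms(9) by simp
qed

lemma dim_image_le:
  assumes "clinear T" "finite I" "V \<subseteq> supported I" "fs.subspace V"
  shows "fs.dim (T ` V) \<le> fs.dim V"
proof -
  obtain B where B: "B \<subseteq> V" "finite B" "fs.independent B" "fs.span B = V" "card B = fs.dim V"
    by (rule finite_basis[OF assms(2-4)])
  have "fs.dim (T ` V) \<le> card (T ` B)"
    using fs.dim_le_card[of "T ` V" "T ` B"] fsp.linear_span_image[OF assms(1), of B] B by auto
  then show ?thesis using card_image_le[OF B(2), of T] B(5) by simp
qed

lemma onto_imp_injective:
  assumes "clinear T" "finite I" "V \<subseteq> supported I" "fs.subspace V"
    and "fs.dim V \<le> fs.dim (T ` V)" "x \<in> V" "T x = 0"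
  shows "x = 0"
proof (rule ccontr)
  assume "x \<noteq> 0"
  then have "fs.independent {x}" by simp
  then obtain B where B: "{x} \<subseteq> B" "B \<subseteq> V" "fs.independent B" "V \<subseteq> fs.span B"
    using fs.maximal_independent_subset_extend[of "{x}" V] assms(6) by auto
  have "finite B"
    using fs.independent_span_bound[OF _ B(3), of "unit_fun ` I"] assms(2)
      subset_trans[OF B(2) subset_trans[OF assms(3) supported_subset_span[OF assms(2)]]] by simp
  have "T ` V \<subseteq> fs.span (T ` B)" using fsp.linear_span_image[OF assms(1), of B] B(4) by auto
  also have "T ` B = insert 0 (T ` (B - {x}))" using B(1) assms(7) by auto
  also have "fs.span (insert 0 (T ` (B - {x}))) = fs.span (T ` (B - {x}))" by (rule fs.span_insert_0)
  finally have "fs.dim (T ` V) \<le> card (T ` (B - {x}))"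
    using fs.dim_le_card[of "T ` V" "T ` (B - {x})"] \<open>finite B\<close> by simp
  also have "\<dots> \<le> card (B - {x})" using \<open>finite B\<close> by (intro card_image_le) auto
  also have "\<dots> < card B" using B(1) \<open>finite B\<close> by (intro psubset_card_mono) auto
  also have "card B = fs.dim V"
    using fs.dim_unique[OF B(2,4,3) refl] by simp
  finally show False using assms(5) by simp
qed

text \<open>The direct sum of \<open>p\<close> copies of \<open>K\<close>, encoded as functions on
  pairs so that the dimension theory of supported functions applies to it.\<close>

definition power_space :: "nat \<Rightarrow> ('i \<Rightarrow> complex) set \<Rightarrow> (nat \<times> 'i \<Rightarrow> complex) set"
  where "power_space p K = {x. (\<forall>m<p. (\<lambda>i. x (m, i)) \<in> K) \<and> (\<forall>m\<ge>p. \<forall>i. x (m, i) = 0)}"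

lemma power_space_supported:
  assumes "K \<subseteq> supported I"
  shows "power_space p K \<subseteq> supported ({..<p} \<times> I)"
proof
  fix x assume x: "x \<in> power_space p K"
  have "x (m, i) = 0" if "(m, i) \<notin> {..<p} \<times> I" for m i
  proof (cases "m < p")
    case True
    then have "(\<lambda>i. x (m, i)) \<in> supported I" using x assms by (auto simp: power_space_def)
    then show ?thesis using True that by (simp add: supported_def)
  next
    case False
    then show ?thesis using x by (simp add: power_space_def)
  qed
  then show "x \<in> supported ({..<p} \<times> I)" by (auto simp: supported_def)
qed

lemma subspace_power_space:
  assumes "fs.subspace K"
  shows "fs.subspace (power_space p K)"
  unfolding fs.subspace_def
proof (intro conjI ballI allI)
  show "0 \<in> power_space p K"
    using fs.subspace_0[OF assms] by (simp add: power_space_def pointwise zero_eq)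
next
  fix x y assume "x \<in> power_space p K" "y \<in> power_space p K"
  then have "(\<lambda>i. x (m, i)) + (\<lambda>i. y (m, i)) \<in> K" if "m < p" for m
    using that fs.subspace_add[OF assms] by (simp add: power_space_def)
  then show "x + y \<in> power_space p K"
    using \<open>x \<in> power_space p K\<close> \<open>y \<in> power_space p K\<close>
    by (simp add: power_space_def pointwise plus_fun_def)
next
  fix c x assume "x \<in> power_space p K"
  then have "cscale c (\<lambda>i. x (m, i)) \<in> K" if "m < p" for m
    using that fs.subspace_scale[OF assms] by (simp add: power_space_def)
  then show "cscale c x \<in> power_space p K"
    using \<open>x \<in> power_space p K\<close> by (simp add: power_space_def cscale_def)
qed

lemma power_space_mono: "K \<subseteq> L \<Longrightarrow> power_space p K \<subseteq> power_space p L"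
  by (auto simp: power_space_def)

definition slot :: "nat \<Rightarrow> ('i \<Rightarrow> complex) \<Rightarrow> nat \<times> 'i \<Rightarrow> complex"
  where "slot m x = (\<lambda>(m', i). if m' = m then x i else 0)"

lemma slot_in_power_space:
  assumes "fs.subspace K" "m < p" "x \<in> K"
  shows "slot m x \<in> power_space p K"
proof -
  have "(\<lambda>i. slot m x (m', i)) = (if m' = m then x else 0)" for m'
    by (auto simp: slot_def pointwise)
  then show ?thesis
    using assms fs.subspace_0[OF assms(1)] by (auto simp: power_space_def) (simp add: slot_def pointwise)
qed

lemma slot_decompose:
  assumes "x \<in> power_space p K"
  shows "x = (\<Sum>m<p. slot m (\<lambda>i. x (m, i)))"
proof
  fix mi :: "nat \<times> 'a"
  obtain m i where mi: "mi = (m, i)" by fastforce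
  have "(\<Sum>m<p. slot m (\<lambda>i. x (m, i))) mi = (\<Sum>m'<p. if m = m' then x (m', i) else 0)"
    by (auto simp: pointwise slot_def mi intro!: sum.cong)
  also have "\<dots> = x mi" using assms by (auto simp: mi power_space_def)
  finally show "x mi = (\<Sum>m<p. slot m (\<lambda>i. x (m, i))) mi" by simp
qed

lemma clinear_slot: "clinear (slot m)"
  by (rule clinearI) (auto simp: slot_def fun_eq_iff pointwise)

lemma dim_power_space:
  assumes "finite I" "K \<subseteq> supported I" "fs.subspace K"
  shows "fs.dim (power_space p K) = p * fs.dim K"
proof -
  obtain B where B: "B \<subseteq> K" "finite B" "fs.independent B" "fs.span B = K" "card B = fs.dim K"
    by (rule finite_basis[OF assms])
  define C where "C = (\<lambda>(m, b). slot m b) ` ({..<p} \<times> B)"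
  have B0: "b \<noteq> 0" if "b \<in> B" for b using that B(3) fs.dependent_zero by auto
  have inj: "inj_on (\<lambda>(m, b). slot m b) ({..<p} \<times> B)"
  proof (rule inj_onI, clarify)
    fix m b m' b'
    assume "b \<in> B" "b' \<in> B" and eq: "slot m b = slot m' b'"
    obtain i where i: "b i \<noteq> 0" using B0[OF \<open>b \<in> B\<close>] by (metis ext zero_fun_apply)
    have "slot m b (m, i) = slot m' b' (m, i)" using eq by simp
    then have "m = m'" using i by (auto simp: slot_def split: if_splits)
    moreover have "b i = b' i" for i
      using fun_cong[OF eq, of "(m, i)"] \<open>m = m'\<close> by (simp add: slot_def)
    ultimately show "m = m' \<and> b = b'" by auto
  qed
  have "fs.independent C"
  proof (rule fs.independent_if_scalars_zero)
    show "finite C" using B(2) by (simp add: C_def)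
    fix f x assume s: "(\<Sum>x\<in>C. cscale (f x) x) = 0" and "x \<in> C"
    then obtain m b where mb: "m < p" "b \<in> B" "x = slot m b" by (auto simp: C_def)
    have "(\<Sum>m'<p. \<Sum>b\<in>B. cscale (f (slot m' b)) (slot m' b)) = 0"
      using s unfolding C_def sum.reindex[OF inj]
      by (simp add: sum.cartesian_product comp_def case_prod_beta)
    then have "(\<Sum>m'<p. \<Sum>b\<in>B. cscale (f (slot m' b)) (slot m' b)) (m, i) = 0" for i
      by (simp add: pointwise)
    moreover have "(\<Sum>m'<p. \<Sum>b\<in>B. cscale (f (slot m' b)) (slot m' b)) (m, i)
        = (\<Sum>b\<in>B. cscale (f (slot m b)) b) i" for i
    proof -
      have "(\<Sum>m'<p. \<Sum>b\<in>B. cscale (f (slot m' b)) (slot m' b)) (m, i)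
          = (\<Sum>m'<p. if m = m' then (\<Sum>b\<in>B. f (slot m' b) * b i) else 0)"
        unfolding pointwise by (intro sum.cong refl) (simp add: slot_def)
      also have "\<dots> = (\<Sum>b\<in>B. f (slot m b) * b i)" using mb(1) by simp
      finally show ?thesis by (simp add: pointwise)
    qed
    ultimately have "(\<Sum>b\<in>B. cscale (f (slot m b)) b) = 0" by (auto simp: fun_eq_iff pointwise)
    then have "f (slot m b) = 0"
      using fs.independentD[OF B(3,2) order.refl, of "\<lambda>b. f (slot m b)"] mb(2) by blast
    then show "f x = 0" using mb(3) by simp
  qed
  moreover have "C \<subseteq> power_space p K"
    using slot_in_power_space[OF assms(3)] B(1) by (auto simp: C_def)
  moreover have "power_space p K \<subseteq> fs.span C"
  proof
    fix x assume x: "x \<in> power_space p K"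
    have "slot m (\<lambda>i. x (m, i)) \<in> fs.span C" if "m < p" for m
    proof -
      have "(\<lambda>i. x (m, i)) \<in> fs.span B" using x that B(4) by (simp add: power_space_def)
      then have "slot m (\<lambda>i. x (m, i)) \<in> slot m ` fs.span B" by blast
      also have "\<dots> = fs.span (slot m ` B)" using fsp.linear_span_image[OF clinear_slot, of m B] by simp
      also have "\<dots> \<subseteq> fs.span C" by (rule fs.span_mono) (use that in \<open>auto simp: C_def\<close>)
      finally show ?thesis .
    qed
    then show "x \<in> fs.span C" by (subst slot_decompose[OF x]) (auto intro: fs.span_sum)
  qed
  moreover have "card C = p * fs.dim K"
    unfolding C_def by (simp add: card_image[OF inj] card_cartesian_product B(5))
  ultimately show ?thesis using fs.dim_unique by blast
qed

section \<open>Blow-ups along the translates of a stable subspace\<close>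

context matrix_family
begin

definition blowup_map :: "nat \<Rightarrow> nat \<Rightarrow> (nat \<times> nat \<times> 'u \<Rightarrow> complex) \<Rightarrow> (nat \<times> 'i \<Rightarrow> complex) \<Rightarrow> nat \<times> 'j \<Rightarrow> complex"
  where "blowup_map p q \<gamma> x = (\<lambda>(n, j). if n < q then blowup p \<gamma> (\<lambda>m i. x (m, i)) n j else 0)"

lemma blowup_in_img:
  assumes "\<And>m. m < p \<Longrightarrow> x m \<in> K"
  shows "blowup p \<gamma> x n \<in> img K"
proof -
  have "blowup p \<gamma> x n = (\<Sum>\<rho>\<in>{..<p} \<times> U. cscale (\<gamma> (n, \<rho>)) (app (snd \<rho>) (x (fst \<rho>))))"
    by (auto simp: blowup_eq pointwise)
  also have "\<dots> \<in> img K"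
    by (intro fs.subspace_sum subspace_img fs.subspace_scale app_in_img) (use assms in auto)
  finally show ?thesis .
qed

lemma clinear_blowup_map: "clinear (blowup_map p q \<gamma>)"
proof (rule clinearI)
  fix x y :: "nat \<times> 'i \<Rightarrow> complex"
  have "(\<lambda>i. (x + y) (m, i)) = (\<lambda>i. x (m, i)) + (\<lambda>i. y (m, i))" for m
    by (auto simp: pointwise plus_fun_def)
  then show "blowup_map p q \<gamma> (x + y) = blowup_map p q \<gamma> x + blowup_map p q \<gamma> y"
    by (auto simp: blowup_map_def blowup_eq app_add pointwise sum.distrib distrib_left)
next
  fix c and x :: "nat \<times> 'i \<Rightarrow> complex"
  have "(\<lambda>i. cscale c x (m, i)) = cscale c (\<lambda>i. x (m, i))" for m by (auto simp: cscale_def)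
  then show "blowup_map p q \<gamma> (cscale c x) = cscale c (blowup_map p q \<gamma> x)"
    by (auto simp: blowup_map_def blowup_scale pointwise)
qed

lemma blowup_map_image: "blowup_map p q \<gamma> ` power_space p K \<subseteq> power_space q (img K)"
proof clarify
  fix x assume "x \<in> power_space p K"
  then have "blowup p \<gamma> (\<lambda>m i. x (m, i)) n \<in> img K" for n
    by (intro blowup_in_img) (simp add: power_space_def)
  then show "blowup_map p q \<gamma> x \<in> power_space q (img K)"
    by (auto simp: power_space_def blowup_map_def)
qed

text \<open>Among the subspaces of minimal slope \<open>dim (img K) / dim K\<close> one of minimal dimension is stable,
  so a generic blow-up is injective on each of its translates, hence onto; the translates span.\<close>

theorem generic_blowup_injective:
  fixes \<G> :: "'g set" and gA :: "'g \<Rightarrow> ('i \<Rightarrow> complex) \<Rightarrow> 'i \<Rightarrow> complex"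
    and gB :: "'g \<Rightarrow> ('j \<Rightarrow> complex) \<Rightarrow> 'j \<Rightarrow> complex" and \<mu> \<mu>' :: "'g \<Rightarrow> 'u \<Rightarrow> 'u \<Rightarrow> complex"
  assumes A: "A \<subseteq> supported I" "fs.subspace A" "img A \<noteq> {0}"
    and linA: "\<And>g. g \<in> \<G> \<Longrightarrow> clinear (gA g)" and linB: "\<And>g. g \<in> \<G> \<Longrightarrow> clinear (gB g)"
    and stab: "\<And>g x. g \<in> \<G> \<Longrightarrow> x \<in> A \<Longrightarrow> gA g x \<in> A"
    and injA: "\<And>g x. g \<in> \<G> \<Longrightarrow> x \<in> A \<Longrightarrow> gA g x = 0 \<Longrightarrow> x = 0"
    and injB: "\<And>g y. g \<in> \<G> \<Longrightarrow> y \<in> supported J \<Longrightarrow> gB g y = 0 \<Longrightarrow> y = 0"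
    and suppB: "\<And>g y. g \<in> \<G> \<Longrightarrow> y \<in> supported J \<Longrightarrow> gB g y \<in> supported J"
    and mult: "\<And>g h. g \<in> \<G> \<Longrightarrow> h \<in> \<G> \<Longrightarrow> \<exists>f\<in>\<G>. \<forall>x\<in>A. gA g (gA h x) = gA f x"
    and unit: "\<exists>g\<in>\<G>. \<forall>x\<in>A. gA g x = x"
    and equiv: "\<And>g u x. g \<in> \<G> \<Longrightarrow> u \<in> U \<Longrightarrow> x \<in> A \<Longrightarrow>
      app u (gA g x) = gB g (\<Sum>v\<in>U. cscale (\<mu> g u v) (app v x))"
    and inverse: "\<And>g u v. g \<in> \<G> \<Longrightarrow> u \<in> U \<Longrightarrow> v \<in> U \<Longrightarrow>
      (\<Sum>w\<in>U. \<mu>' g u w * \<mu> g w v) = (if u = v then 1 else 0)"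
    and irred: "\<And>K. fs.subspace K \<Longrightarrow> K \<subseteq> A \<Longrightarrow> K \<noteq> {0} \<Longrightarrow>
      (\<And>g x. g \<in> \<G> \<Longrightarrow> x \<in> K \<Longrightarrow> gA g x \<in> K) \<Longrightarrow> K = A"
  shows "\<exists>p q \<gamma>. p > 0 \<and> q > 0 \<and> p * fs.dim A = q * fs.dim (img A) \<and>
    (\<forall>x. (\<forall>m<p. x m \<in> A) \<longrightarrow> (\<forall>n<q. \<forall>j\<in>J. blowup p \<gamma> x n j = 0) \<longrightarrow> (\<forall>m<p. x m = 0))"
proof -
  define sub where "sub K \<longleftrightarrow> fs.subspace K \<and> K \<subseteq> A \<and> K \<noteq> {0}" for K
  define sl where "sl K = real (fs.dim (img K)) / real (fs.dim K)" for K
  have A0: "A \<noteq> {0}"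
  proof
    assume "A = {0}"
    then have "(\<Union>u\<in>U. app u ` A) \<subseteq> {0}" by (auto simp: app_zero)
    then have "img A \<subseteq> {0}" unfolding img_def using fs.span_mono[of _ "{0}"] by simp
    then show False using A(3) fs.subspace_0[OF subspace_img, of A] by auto
  qed
  have dpos: "fs.dim K > 0" if "sub K" for K
    using dim_pos[OF finI, of K] that A(1) subset_trans[of K A "supported I"] by (simp add: sub_def)
  \<comment> \<open>There may be infinitely many subspaces, but there are only finitely many pairs
    of dimensions, so the minimal slope is attained.\<close>
  define D where "D = (\<lambda>K. (fs.dim (img K), fs.dim K)) ` Collect sub"
  have "D \<subseteq> {..fs.dim (img A)} \<times> {..fs.dim A}"
    using dim_mono[OF finI A(1,2)] dim_mono[OF finJ img_supported subspace_img subspace_img img_mono]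
    by (auto simp: D_def sub_def)
  then have finD: "finite D" using finite_subset by blast
  have "(\<lambda>K. sl K) ` Collect sub = (\<lambda>(l, s). real l / real s) ` D"
    by (force simp: D_def sl_def)
  then have fin: "finite (sl ` Collect sub)" using finD by simp
  have "sub A" using A A0 by (simp add: sub_def)
  define \<kappa> where "\<kappa> = Min (sl ` Collect sub)"
  have \<kappa>_le: "\<kappa> \<le> sl K" if "sub K" for K using that fin by (simp add: \<kappa>_def)
  have "\<kappa> \<in> sl ` Collect sub" unfolding \<kappa>_def using fin \<open>sub A\<close> by (intro Min_in) auto
  then have ex: "\<exists>s K. sub K \<and> sl K = \<kappa> \<and> fs.dim K = s" by auto
  define s0 where "s0 = (LEAST s. \<exists>K. sub K \<and> sl K = \<kappa> \<and> fs.dim K = s)"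
  obtain K where K: "sub K" "sl K = \<kappa>" "fs.dim K = s0"
    using LeastI_ex[OF ex] unfolding s0_def by blast
  have least: "s0 \<le> fs.dim S" if "sub S" "sl S = \<kappa>" for S
    unfolding s0_def by (rule Least_le) (use that in blast)
  have KA: "fs.subspace K" "K \<subseteq> A" "K \<noteq> {0}" using K(1) by (auto simp: sub_def)
  have KI: "K \<subseteq> supported I" using KA(2) A(1) by blast
  define a where "a = fs.dim K"
  define b where "b = fs.dim (img K)"
  have a0: "a > 0" using dpos[OF K(1)] by (simp add: a_def)
  have slope: "b * fs.dim S \<le> a * fs.dim (img S)" if "sub S" for S
  proof -
    have "real b / real a \<le> sl S" using \<kappa>_le[OF that] K(2) by (simp add: sl_def a_def b_def)
    then have "real (b * fs.dim S) \<le> real (a * fs.dim (img S))"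
      using a0 dpos[OF that] by (simp add: sl_def field_simps)
    then show ?thesis by (simp only: of_nat_le_iff)
  qed
  have stable: "fs.dim (img K) * fs.dim S < fs.dim K * fs.dim (img S)"
    if S: "fs.subspace S" "S \<subseteq> K" "S \<noteq> {0}" "S \<noteq> K" for S
  proof -
    have "sub S" using S KA by (auto simp: sub_def)
    have "fs.dim S < s0"
      using dim_eq_imp_eq[OF finI KI KA(1) S(1,2)] S(4) K(3) by force
    then have "sl S \<noteq> \<kappa>" using least[OF \<open>sub S\<close>] by auto
    then have "real b / real a < sl S" using \<kappa>_le[OF \<open>sub S\<close>] K(2) by (simp add: sl_def a_def b_def)
    then have "real (b * fs.dim S) < real (a * fs.dim (img S))"
      using a0 dpos[OF \<open>sub S\<close>] by (simp add: sl_def field_simps)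
    then show ?thesis unfolding a_def b_def by (simp only: of_nat_less_iff)
  qed
  \<comment> \<open>If every matrix of the family killed \<open>K\<close>, the common kernel in
    \<open>A\<close> would be a nonzero invariant subspace, hence all of \<open>A\<close>, and
    \<open>img A\<close> would vanish.\<close>
  have b0: "b > 0"
  proof (rule ccontr)
    assume "\<not> b > 0"
    then have "img K = {0}" using dim_pos[OF finJ img_supported subspace_img, of K] by (auto simp: b_def)
    then have KZ: "app u x = 0" if "u \<in> U" "x \<in> K" for u x using app_in_img[OF that] by simp
    define Z where "Z = {x\<in>A. \<forall>u\<in>U. app u x = 0}"
    have "Z = A"
    proof (rule irred)
      show "fs.subspace Z" using A(2)
        by (auto simp: fs.subspace_def Z_def app_zero app_add app_cscale)
      show "Z \<subseteq> A" by (auto simp: Z_def)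
      have "K \<subseteq> Z" using KZ KA(2) by (auto simp: Z_def)
      then show "Z \<noteq> {0}" using KA(3) fs.subspace_0[OF KA(1)] by auto
      show "gA g x \<in> Z" if "g \<in> \<G>" "x \<in> Z" for g x
      proof -
        have "(\<Sum>v\<in>U. cscale (\<mu> g u v) (app v x)) = 0" for u
          using that(2) by (intro sum.neutral) (auto simp: Z_def)
        then show ?thesis
          using that equiv[OF that(1)] stab[OF that(1)] fsp.linear_0[OF linB[OF that(1)]] by (auto simp: Z_def)
      qed
    qed
    then have "(\<Union>u\<in>U. app u ` A) \<subseteq> {0}" by (auto simp: Z_def)
    then have "img A \<subseteq> {0}" unfolding img_def using fs.span_mono[of _ "{0}"] by simp
    then show False using A(3) fs.subspace_0[OF subspace_img, of A] by auto
  qed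
  define N where "N = a * card I + 1"
  define p where "p = b * N"
  define q where "q = a * N"
  have pq: "p > 0" "q > 0" using a0 b0 by (simp_all add: p_def q_def N_def)
  have "\<exists>\<Phi>. polyfun ({..<q} \<times> {..<p} \<times> U) \<Phi> \<and> (\<exists>\<gamma>. \<Phi> \<gamma> \<noteq> 0) \<and> (\<forall>\<gamma> x.
      (\<forall>m<p. x m \<in> K) \<longrightarrow> (\<forall>n<q. \<forall>j\<in>J. blowup p \<gamma> x n j = 0) \<longrightarrow> \<Phi> \<gamma> \<noteq> 0 \<longrightarrow>
      (\<forall>m<p. x m = 0))"
    by (rule stable_generic_injective[OF KI KA(1,3) stable, of N])
       (use b0 in \<open>auto simp: p_def q_def a_def b_def N_def\<close>)
  then obtain \<Phi> where \<Phi>: "polyfun ({..<q} \<times> {..<p} \<times> U) \<Phi>" "\<exists>\<gamma>. \<Phi> \<gamma> \<noteq> 0"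
    "\<forall>\<gamma> x. (\<forall>m<p. x m \<in> K) \<longrightarrow> (\<forall>n<q. \<forall>j\<in>J. blowup p \<gamma> x n j = 0) \<longrightarrow> \<Phi> \<gamma> \<noteq> 0 \<longrightarrow>
      (\<forall>m<p. x m = 0)"
    by blast
  \<comment> \<open>Blowing up a translate of \<open>K\<close> with coefficients
    \<open>\<gamma>\<close> amounts to blowing up \<open>K\<close> itself with coefficients
    \<open>tr g \<gamma>\<close>. Since \<open>\<mu>'\<close> inverts \<open>\<mu>\<close>, every
    relevant coefficient vector is some \<open>tr g \<gamma>'\<close>, so genericity survives the
    change.\<close>
  define tr where "tr g \<gamma> = (\<lambda>(n, m, v). \<Sum>u\<in>U. \<gamma> (n, m, u) * \<mu> g u v)"
    for g and \<gamma> :: "nat \<times> nat \<times> 'u \<Rightarrow> complex"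
  have tr_poly: "polyfun ({..<q} \<times> {..<p} \<times> U) (\<lambda>\<gamma>. \<Phi> (tr g \<gamma>))" for g
    by (rule polyfun_compose[OF \<Phi>(1)])
       (auto simp: tr_def intro!: polyfun_sum polyfun_mult polyfun_var polyfun_const)
  have tr_nz: "\<exists>\<gamma>. \<Phi> (tr g \<gamma>) \<noteq> 0" if g: "g \<in> \<G>" for g
  proof -
    obtain \<gamma> where \<gamma>: "\<Phi> \<gamma> \<noteq> 0" using \<Phi>(2) by blast
    define \<gamma>' where "\<gamma>' = (\<lambda>(n, m, u). \<Sum>w\<in>U. \<gamma> (n, m, w) * \<mu>' g w u)"
    have "tr g \<gamma>' (n, m, v) = \<gamma> (n, m, v)" if "v \<in> U" for n m v
    proof -
      have "tr g \<gamma>' (n, m, v) = (\<Sum>w\<in>U. \<gamma> (n, m, w) * (\<Sum>u\<in>U. \<mu>' g w u * \<mu> g u v))"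
        unfolding tr_def \<gamma>'_def prod.case sum_distrib_left sum_distrib_right
        by (subst sum.swap) (simp add: mult.assoc)
      also have "\<dots> = (\<Sum>w\<in>U. if w = v then \<gamma> (n, m, w) else 0)"
        using inverse[OF g] that by (intro sum.cong) auto
      also have "\<dots> = \<gamma> (n, m, v)" using finU that by simp
      finally show ?thesis .
    qed
    then have "\<Phi> (tr g \<gamma>') = \<Phi> \<gamma>" by (intro polyfun_cong[OF \<Phi>(1)]) auto
    then show ?thesis using \<gamma> by metis
  qed
  have blow: "blowup p \<gamma> (\<lambda>m. gA g (x m)) n = gB g (blowup p (tr g \<gamma>) x n)"
    if g: "g \<in> \<G>" and x: "\<And>m. m < p \<Longrightarrow> x m \<in> A" for g x \<gamma> n
  proof -
    have "blowup p \<gamma> (\<lambda>m. gA g (x m)) n = (\<Sum>m<p. \<Sum>u\<in>U. cscale (\<gamma> (n, m, u)) (app u (gA g (x m))))"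
      by (rule ext) (simp add: blowup_def pointwise case_prod_beta sum.cartesian_product)
    also have "\<dots> = (\<Sum>m<p. \<Sum>u\<in>U. gB g (cscale (\<gamma> (n, m, u)) (\<Sum>v\<in>U. cscale (\<mu> g u v) (app v (x m)))))"
      using equiv[OF g] x by (intro sum.cong) (auto simp: fsp.linear_scale[OF linB[OF g]])
    also have "\<dots> = gB g (\<Sum>m<p. \<Sum>u\<in>U. cscale (\<gamma> (n, m, u)) (\<Sum>v\<in>U. cscale (\<mu> g u v) (app v (x m))))"
      by (simp add: fsp.linear_sum[OF linB[OF g]])
    also have "(\<Sum>m<p. \<Sum>u\<in>U. cscale (\<gamma> (n, m, u)) (\<Sum>v\<in>U. cscale (\<mu> g u v) (app v (x m)))) =
        blowup p (tr g \<gamma>) x n"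
    proof
      fix j
      have "(\<Sum>u\<in>U. \<Sum>v\<in>U. \<gamma> (n, m, u) * \<mu> g u v * app v (x m) j) =
          (\<Sum>v\<in>U. tr g \<gamma> (n, m, v) * app v (x m) j)" for m
        unfolding tr_def prod.case sum_distrib_right by (rule sum.swap)
      then show "(\<Sum>m<p. \<Sum>u\<in>U. cscale (\<gamma> (n, m, u)) (\<Sum>v\<in>U. cscale (\<mu> g u v) (app v (x m)))) j =
          blowup p (tr g \<gamma>) x n j"
        by (simp add: blowup_def pointwise sum_distrib_left mult.assoc flip: sum.cartesian_product)
    qed
    finally show ?thesis .
  qed
  \<comment> \<open>The span of all translates of \<open>K\<close> is invariant and nonzero, so
    irreducibility makes it the whole of \<open>A\<close>.\<close>
  define T where "T = (\<Union>g\<in>\<G>. gA g ` K)"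
  have spanT: "fs.span T = A"
  proof (rule irred)
    have TA: "T \<subseteq> A" using stab KA(2) by (auto simp: T_def)
    then show "fs.span T \<subseteq> A" using A(2) by (rule fs.span_minimal)
    obtain x where "x \<in> K" "x \<noteq> 0" using KA(3) fs.subspace_0[OF KA(1)] by blast
    then have "x \<in> T" using unit KA(2) by (force simp: T_def)
    then show "fs.span T \<noteq> {0}" using \<open>x \<noteq> 0\<close> fs.span_base by blast
    show "gA g x \<in> fs.span T" if "g \<in> \<G>" "x \<in> fs.span T" for g x
    proof -
      have "gA g y \<in> fs.span T" if "y \<in> T" for y
      proof -
        obtain h z where h: "h \<in> \<G>" "z \<in> K" "y = gA h z" using \<open>y \<in> T\<close> by (auto simp: T_def)
        then obtain f where "f \<in> \<G>" "gA g y = gA f z" using mult[OF \<open>g \<in> \<G>\<close> h(1)] KA(2) by blast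
        then show ?thesis using h(2) by (auto simp: T_def intro: fs.span_base)
      qed
      then have "gA g ` T \<subseteq> fs.span T" by blast
      then have "fs.span (gA g ` T) \<subseteq> fs.span T" by (intro fs.span_minimal) auto
      then show ?thesis using fsp.linear_span_image[OF linA[OF that(1)], of T] that(2) by blast
    qed
  qed simp
  \<comment> \<open>A basis taken from the translates: finitely many group elements suffice, and one
    \<open>\<gamma>\<close> is generic for all of them.\<close>
  obtain B where B: "B \<subseteq> T" "fs.independent B" "T \<subseteq> fs.span B"
    using fs.maximal_independent_subset[of T] by auto
  have "B \<subseteq> fs.span (unit_fun ` I)"
    using B(1) spanT fs.span_base A(1) supported_subset_span[OF finI] by blast
  then have finB: "finite B" using fs.independent_span_bound[OF _ B(2)] finI by blast
  have spanB: "fs.span B = A" using B spanT by (metis fs.span_eq fs.span_superset subset_trans fs.span_mono)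
  have "\<forall>y\<in>B. \<exists>g. g \<in> \<G> \<and> y \<in> gA g ` K" using B(1) unfolding T_def by blast
  then obtain c where c: "\<And>y. y \<in> B \<Longrightarrow> c y \<in> \<G> \<and> y \<in> gA (c y) ` K" by metis
  have "\<exists>\<gamma>. (\<Prod>y\<in>B. \<Phi> (tr (c y) \<gamma>)) \<noteq> 0"
    by (rule polyfun_prod_nonzero[OF finB tr_poly]) (use c tr_nz in blast)
  then obtain \<gamma> where \<gamma>: "\<And>y. y \<in> B \<Longrightarrow> \<Phi> (tr (c y) \<gamma>) \<noteq> 0" using finB by auto
  \<comment> \<open>On the translate \<open>L\<close> the blow-up is injective, since a kernel
    vector moves back to one on \<open>K\<close>. Source and target have dimensions
    \<open>p * a\<close> and at most \<open>q * b\<close>, which agree, so it is also onto.\<close>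
  have img_sup: "power_space q (img L) \<subseteq> blowup_map p q \<gamma> ` power_space p A"
    if y: "y \<in> B" and L: "L = gA (c y) ` K" for y L
  proof -
    have g: "c y \<in> \<G>" using c[OF y] by blast
    have LA: "L \<subseteq> A" "fs.subspace L"
      using stab[OF g] KA fsp.linear_subspace_image[OF linA[OF g] KA(1)] by (auto simp: L)
    have LI: "L \<subseteq> supported I" using LA A(1) by blast
    have dL: "fs.dim L \<le> a \<and> a \<le> fs.dim L"
    proof
      show "fs.dim L \<le> a" unfolding L a_def by (rule dim_image_le[OF linA[OF g] finI KI KA(1)])
      obtain C where C: "C \<subseteq> K" "finite C" "fs.independent C" "fs.span C = K" "card C = fs.dim K"
        by (rule finite_basis[OF finI KI KA(1)])
      have inj: "inj_on (gA (c y)) (fs.span C)"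
        using injA[OF g] KA(2) C(4) fsp.linear_inj_on_iff_eq_0[OF linA[OF g] KA(1)] by auto
      have "fs.independent (gA (c y) ` C)"
        by (rule fsp.linear_independent_injective_image[OF linA[OF g] C(3) inj])
      moreover have "fs.span (gA (c y) ` C) = L"
        using fsp.linear_span_image[OF linA[OF g], of C] C(4) by (simp add: L)
      moreover have "card (gA (c y) ` C) = a"
        using card_image[OF inj_on_subset[OF inj]] C(1,4,5) by (simp add: a_def)
      ultimately show "a \<le> fs.dim L" by (metis fs.dim_span_eq_card_independent order.refl)
    qed
    have "img L \<subseteq> gB (c y) ` img K"
      unfolding img_def[of L]
    proof (rule fs.span_minimal)
      show "fs.subspace (gB (c y) ` img K)" by (rule fsp.linear_subspace_image[OF linB[OF g] subspace_img])
      show "(\<Union>u\<in>U. app u ` L) \<subseteq> gB (c y) ` img K"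
      proof clarify
        fix u x assume "u \<in> U" "x \<in> L"
        then obtain z where z: "z \<in> K" "x = gA (c y) z" by (auto simp: L)
        have "(\<Sum>v\<in>U. cscale (\<mu> (c y) u v) (app v z)) \<in> img K"
          by (intro fs.subspace_sum subspace_img fs.subspace_scale app_in_img z)
        then show "app u x \<in> gB (c y) ` img K"
          using equiv[OF g \<open>u \<in> U\<close>, of z] z KA(2) by auto
      qed
    qed
    then have "fs.dim (img L) \<le> fs.dim (gB (c y) ` img K)"
      using suppB[OF g] img_supported
      by (intro dim_mono[OF finJ _ fsp.linear_subspace_image[OF linB[OF g] subspace_img] subspace_img]) blast+
    also have "\<dots> \<le> b" unfolding b_def by (rule dim_image_le[OF linB[OF g] finJ img_supported subspace_img])
    finally have dimL: "fs.dim (img L) \<le> b" .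
    have "blowup_map p q \<gamma> ` power_space p L = power_space q (img L)"
    proof (rule injective_imp_onto[OF clinear_blowup_map _ power_space_supported[OF LI]
          subspace_power_space[OF LA(2)] _ power_space_supported[OF img_supported]
          subspace_power_space[OF subspace_img] blowup_map_image])
      have "fs.dim (power_space q (img L)) \<le> q * b"
        using dimL by (simp add: dim_power_space[OF finJ img_supported subspace_img])
      also have "\<dots> = p * fs.dim L" using dL by (simp add: p_def q_def)
      also have "\<dots> = fs.dim (power_space p L)" by (simp add: dim_power_space[OF finI LI LA(2)])
      finally show "fs.dim (power_space q (img L)) \<le> fs.dim (power_space p L)" .
      fix x assume x: "x \<in> power_space p L" "blowup_map p q \<gamma> x = 0"
      have "\<forall>m. \<exists>z. m < p \<longrightarrow> z \<in> K \<and> (\<lambda>i. x (m, i)) = gA (c y) z"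
        using x(1) by (auto simp: power_space_def L)
      then obtain z where z: "\<And>m. m < p \<Longrightarrow> z m \<in> K \<and> (\<lambda>i. x (m, i)) = gA (c y) (z m)" by metis
      have "blowup p (tr (c y) \<gamma>) z n = 0" if "n < q" for n
      proof (rule injB[OF g])
        show "blowup p (tr (c y) \<gamma>) z n \<in> supported J"
          using blowup_in_img[of p z K "tr (c y) \<gamma>" n] z img_supported by blast
        have "blowup p \<gamma> (\<lambda>m i. x (m, i)) n = blowup p \<gamma> (\<lambda>m. gA (c y) (z m)) n"
          using z by (auto simp: blowup_def intro!: sum.cong)
        also have "blowup p \<gamma> (\<lambda>m i. x (m, i)) n = 0"
        proof
          fix j show "blowup p \<gamma> (\<lambda>m i. x (m, i)) n j = 0 j"
            using fun_cong[OF x(2), of "(n, j)"] that by (simp add: blowup_map_def pointwise)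
        qed
        finally show "gB (c y) (blowup p (tr (c y) \<gamma>) z n) = 0"
          using blow[OF g, of z \<gamma> n] z KA(2) by auto
      qed
      then have "\<forall>m<p. z m = 0"
        using \<Phi>(3)[rule_format, of z "tr (c y) \<gamma>"] z \<gamma>[OF y] by (auto simp: pointwise)
      then have "x (m, i) = 0" if "m < p" for m i
        using z[OF that] that fsp.linear_0[OF linA[OF g]] by (metis zero_fun_apply)
      moreover have "x (m, i) = 0" if "\<not> m < p" for m i
        using x(1) that by (simp add: power_space_def)
      ultimately have "x (m, i) = 0" for m i by blast
      then show "x = 0" by (auto simp: fun_eq_iff pointwise)
    qed (use finI finJ in auto)
    then show ?thesis using power_space_mono[OF LA(1), of p] by blast
  qed
  \<comment> \<open>\<open>img A\<close> is generated by the \<open>app u x\<close> with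
    \<open>x\<close> in \<open>B\<close>. Each of them lies in the image of the translate containing
    \<open>x\<close>, where surjectivity is known.\<close>
  have onto: "power_space q (img A) \<subseteq> blowup_map p q \<gamma> ` power_space p A"
  proof
    fix w assume w: "w \<in> power_space q (img A)"
    define Y where "Y = blowup_map p q \<gamma> ` power_space p A"
    have Y: "fs.subspace Y" unfolding Y_def
      by (rule fsp.linear_subspace_image[OF clinear_blowup_map subspace_power_space[OF A(2)]])
    have "slot n v \<in> Y" if n: "n < q" and v: "v \<in> img A" for n v
    proof -
      have "img A = fs.span ((\<lambda>(x, u). app u x) ` (B \<times> U))" using img_span[of B] spanB by simp
      then have "slot n v \<in> slot n ` fs.span ((\<lambda>(x, u). app u x) ` (B \<times> U))" using v by blast
      also have "\<dots> = fs.span (slot n ` (\<lambda>(x, u). app u x) ` (B \<times> U))"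
        by (rule fsp.linear_span_image[OF clinear_slot, symmetric])
      also have "\<dots> \<subseteq> Y"
      proof (rule fs.span_minimal[OF _ Y], clarify)
        fix x u assume x: "x \<in> B" and u: "u \<in> U"
        have "app u x \<in> img (gA (c x) ` K)" by (rule app_in_img[OF u]) (use c[OF x] in simp)
        then have "slot n (app u x) \<in> power_space q (img (gA (c x) ` K))"
          by (rule slot_in_power_space[OF subspace_img n])
        then show "slot n (app u x) \<in> Y" using img_sup[OF x refl] unfolding Y_def by blast
      qed
      finally show ?thesis .
    qed
    then have "(\<Sum>n<q. slot n (\<lambda>j. w (n, j))) \<in> Y"
      using w by (intro fs.subspace_sum[OF Y]) (auto simp: power_space_def)
    then show "w \<in> blowup_map p q \<gamma> ` power_space p A" using slot_decompose[OF w] by (simp add: Y_def)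
  qed
  have im: "blowup_map p q \<gamma> ` power_space p A = power_space q (img A)"
    using onto blowup_map_image by blast
  \<comment> \<open>Surjectivity bounds the dimension of the target by that of the source, while
    minimality of the slope of \<open>K\<close> gives the reverse inequality. Equality then turns
    surjectivity into injectivity.\<close>
  have "fs.dim (blowup_map p q \<gamma> ` power_space p A) \<le> fs.dim (power_space p A)"
    by (rule dim_image_le[OF clinear_blowup_map _ power_space_supported[OF A(1)] subspace_power_space[OF A(2)]])
       (use finI in auto)
  then have "q * fs.dim (img A) \<le> p * fs.dim A"
    unfolding im by (simp add: dim_power_space[OF finI A(1,2)] dim_power_space[OF finJ img_supported subspace_img])
  moreover have "p * fs.dim A \<le> q * fs.dim (img A)"
    using slope[OF \<open>sub A\<close>] by (simp add: p_def q_def)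
  ultimately have dim_eq: "p * fs.dim A = q * fs.dim (img A)" by simp
  have "x m = 0" if x: "\<forall>m<p. x m \<in> A" "\<forall>n<q. \<forall>j\<in>J. blowup p \<gamma> x n j = 0" and m: "m < p" for x m
  proof -
    \<comment> \<open>Elements of \<open>power_space\<close> vanish beyond the first
      \<open>p\<close> slots, while nothing is known about \<open>x\<close> there; the cut-off does
      not affect the blow-up.\<close>
    define X' where "X' = (\<lambda>(m, i). if m < p then x m i else 0)"
    have "X' = 0"
    proof (rule onto_imp_injective[OF clinear_blowup_map _ power_space_supported[OF A(1)] subspace_power_space[OF A(2)]])
      show "X' \<in> power_space p A" using x(1) by (auto simp: X'_def power_space_def)
      show "fs.dim (power_space p A) \<le> fs.dim (blowup_map p q \<gamma> ` power_space p A)"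
        unfolding im using dim_eq
        by (simp add: dim_power_space[OF finI A(1,2)] dim_power_space[OF finJ img_supported subspace_img])
      have "blowup p \<gamma> (\<lambda>m i. X' (m, i)) n = blowup p \<gamma> x n" for n
        by (auto simp: blowup_def X'_def intro!: sum.cong)
      moreover have "blowup p \<gamma> x n j = 0" if "n < q" for n j
      proof (cases "j \<in> J")
        case False
        then show ?thesis using blowup_in_img[of p x A \<gamma> n] x(1) img_supported by (force simp: supported_def)
      qed (use x(2) that in blast)
      ultimately show "blowup_map p q \<gamma> X' = 0" by (auto simp: blowup_map_def fun_eq_iff pointwise)
    qed (use finI in auto)
    then have "X' (m, i) = 0" for i by (simp add: pointwise)
    then show ?thesis using m by (auto simp: X'_def fun_eq_iff pointwise)
  qed
  then show ?thesis using pq dim_eq by blast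
qed

end

section \<open>Young symmetrizers\<close>

no_notation m_inv (\<open>(\<open>open_block notation=\<open>prefix inv\<close>\<close>inv\<index> _)\<close> [81] 80)

text \<open>Row symmetrization and column antisymmetrization are handled as one case: a permutation
  group with a character of values \<open>1\<close> and \<open>-1\<close>.\<close>

locale signed_group =
  fixes D :: "'b set" and G :: "('b \<Rightarrow> 'b) set" and \<epsilon> :: "('b \<Rightarrow> 'b) \<Rightarrow> int"
  assumes finD: "finite D" and perm: "p \<in> G \<Longrightarrow> p permutes D" and id_mem: "id \<in> G"
    and comp_mem: "p \<in> G \<Longrightarrow> q \<in> G \<Longrightarrow> p \<circ> q \<in> G" and inv_mem: "p \<in> G \<Longrightarrow> inv p \<in> G"
    and \<epsilon>_comp: "p \<in> G \<Longrightarrow> q \<in> G \<Longrightarrow> \<epsilon> (p \<circ> q) = \<epsilon> p * \<epsilon> q"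
    and \<epsilon>_square: "p \<in> G \<Longrightarrow> \<epsilon> p * \<epsilon> p = 1"
begin

lemma finite_group: "finite G"
  using finite_permutations[OF finD] perm by (metis (mono_tags, lifting) finite_subset mem_Collect_eq subsetI)

lemma inv_comp: "p \<in> G \<Longrightarrow> inv p \<circ> p = id" "p \<in> G \<Longrightarrow> p \<circ> inv p = id"
  using permutes_inv_o[OF perm] by auto

lemma \<epsilon>_id: "\<epsilon> id = 1"
proof -
  have "\<epsilon> id = \<epsilon> id * \<epsilon> id" using \<epsilon>_comp[OF id_mem id_mem] by simp
  then show ?thesis using \<epsilon>_square[OF id_mem] by simp
qed

lemma \<epsilon>_inv: "p \<in> G \<Longrightarrow> \<epsilon> (inv p) = \<epsilon> p"
proof -
  assume p: "p \<in> G"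
  have "\<epsilon> (inv p) * \<epsilon> p = 1" using \<epsilon>_comp[OF inv_mem[OF p] p] inv_comp(1)[OF p] \<epsilon>_id by simp
  then have "\<epsilon> (inv p) * (\<epsilon> p * \<epsilon> p) = \<epsilon> p" by (simp add: mult.assoc[symmetric])
  then show ?thesis using \<epsilon>_square[OF p] by simp
qed

lemma bij_right: "q \<in> G \<Longrightarrow> bij_betw (\<lambda>p. p \<circ> q) G G"
proof (rule bij_betw_byWitness[where f'="\<lambda>p. p \<circ> inv q"])
  assume q: "q \<in> G"
  show "\<forall>p\<in>G. p \<circ> q \<circ> inv q = p" "\<forall>p\<in>G. p \<circ> inv q \<circ> q = p"
    using inv_comp[OF q] by (simp_all add: comp_assoc)
qed (auto intro: comp_mem inv_mem)

lemma bij_left: "q \<in> G \<Longrightarrow> bij_betw (\<lambda>p. q \<circ> p) G G"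
proof (rule bij_betw_byWitness[where f'="\<lambda>p. inv q \<circ> p"])
  assume q: "q \<in> G"
  show "\<forall>p\<in>G. inv q \<circ> (q \<circ> p) = p" "\<forall>p\<in>G. q \<circ> (inv q \<circ> p) = p"
    using inv_comp[OF q] by (simp_all add: comp_assoc[symmetric])
qed (auto intro: comp_mem inv_mem)

lemma bij_inv: "bij_betw inv G G"
proof (rule bij_betw_byWitness[where f'=inv])
  show "\<forall>p\<in>G. inv (inv p) = p" using permutes_inv_inv[OF perm] by blast
  then show "\<forall>p\<in>G. inv (inv p) = p" .
qed (auto intro: inv_mem)

end

definition perm_sum :: "('b \<Rightarrow> 'b) set \<Rightarrow> (('b \<Rightarrow> 'b) \<Rightarrow> int) \<Rightarrow> (('b \<Rightarrow> 'v) \<Rightarrow> 'a::comm_ring_1) \<Rightarrow> ('b \<Rightarrow> 'v) \<Rightarrow> 'a"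
  where "perm_sum G \<epsilon> t = (\<lambda>w. \<Sum>p\<in>G. of_int (\<epsilon> p) * t (w \<circ> p))"

text \<open>Each inner permutation merely reindexes the outer sum, and its sign is multiplied in
  twice. With \<open>G0 = G\<close> this makes \<open>perm_sum\<close> a multiple of an idempotent;
  with the groups of a smaller diagram it lets the larger symmetrizer absorb the smaller
  one.\<close>

lemma perm_sum_absorb:
  assumes "signed_group D G \<epsilon>" "G0 \<subseteq> G" "finite G0"
  shows "perm_sum G \<epsilon> (perm_sum G0 \<epsilon> t) w = of_nat (card G0) * perm_sum G \<epsilon> t w"
proof -
  interpret signed_group D G \<epsilon> by fact
  have "perm_sum G \<epsilon> (perm_sum G0 \<epsilon> t) w = (\<Sum>q\<in>G0. \<Sum>p\<in>G. of_int (\<epsilon> (p \<circ> q)) * t (w \<circ> (p \<circ> q)))"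
    unfolding perm_sum_def sum_distrib_left
    by (subst sum.swap, intro sum.cong refl) (use assms(2) in \<open>auto simp: \<epsilon>_comp comp_assoc mult.assoc\<close>)
  also have "\<dots> = (\<Sum>q\<in>G0. \<Sum>p\<in>G. of_int (\<epsilon> p) * t (w \<circ> p))"
    using assms(2) by (intro sum.cong refl sum.reindex_bij_betw bij_right) auto
  finally show ?thesis by (simp add: perm_sum_def)
qed

section \<open>The Hermitian form on tensors\<close>

definition word_inner :: "'b set \<Rightarrow> (('b \<Rightarrow> 'v) \<Rightarrow> complex) \<Rightarrow> (('b \<Rightarrow> 'v) \<Rightarrow> complex) \<Rightarrow> complex"
  where "word_inner D s t = (\<Sum>w\<in>D \<rightarrow>\<^sub>E UNIV. s w * cnj (t w))"

lemma comp_permutes_word: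
  assumes "p permutes D"
  shows "w \<circ> p \<in> D \<rightarrow>\<^sub>E UNIV \<longleftrightarrow> w \<in> D \<rightarrow>\<^sub>E (UNIV :: 'v set)"
proof -
  have *: "w \<circ> p \<in> D \<rightarrow>\<^sub>E UNIV" if "p permutes D" "w \<in> D \<rightarrow>\<^sub>E (UNIV :: 'v set)" for p and w :: "_ \<Rightarrow> 'v"
    using that by (simp add: PiE_def extensional_def permutes_not_in)
  show ?thesis
  proof
    assume "w \<circ> p \<in> D \<rightarrow>\<^sub>E UNIV"
    then have "w \<circ> p \<circ> inv p \<in> D \<rightarrow>\<^sub>E UNIV" by (rule *[OF permutes_inv[OF assms]])
    then show "w \<in> D \<rightarrow>\<^sub>E UNIV" by (simp only: comp_assoc permutes_inv_o(1)[OF assms] comp_id)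
  qed (rule *[OF assms])
qed

lemma bij_comp_words:
  assumes "p permutes D"
  shows "bij_betw (\<lambda>w. w \<circ> p) (D \<rightarrow>\<^sub>E (UNIV :: 'v set)) (D \<rightarrow>\<^sub>E UNIV)"
proof (rule bij_betw_byWitness[where f'="\<lambda>w. w \<circ> inv p"])
  show "\<forall>w\<in>D \<rightarrow>\<^sub>E (UNIV :: 'v set). w \<circ> p \<circ> inv p = w" "\<forall>w\<in>D \<rightarrow>\<^sub>E (UNIV :: 'v set). w \<circ> inv p \<circ> p = w"
    using permutes_inv_o[OF assms] by (simp_all add: comp_assoc)
  show "(\<lambda>w. w \<circ> p) ` (D \<rightarrow>\<^sub>E (UNIV :: 'v set)) \<subseteq> D \<rightarrow>\<^sub>E UNIV"
    by (rule image_subsetI) (simp only: comp_permutes_word[OF assms])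
  show "(\<lambda>w. w \<circ> inv p) ` (D \<rightarrow>\<^sub>E (UNIV :: 'v set)) \<subseteq> D \<rightarrow>\<^sub>E UNIV"
    by (rule image_subsetI) (simp only: comp_permutes_word[OF permutes_inv[OF assms]])
qed

lemma word_inner_self:
  "finite D \<Longrightarrow> word_inner D s s = 0 \<Longrightarrow> w \<in> D \<rightarrow>\<^sub>E (UNIV :: 'v::finite set) \<Longrightarrow> s w = 0"
proof -
  assume fin: "finite D" and z: "word_inner D s s = 0" and w: "w \<in> D \<rightarrow>\<^sub>E (UNIV :: 'v set)"
  have "word_inner D s s = of_real (\<Sum>w\<in>D \<rightarrow>\<^sub>E UNIV. (cmod (s w))\<^sup>2)"
    by (simp add: word_inner_def complex_norm_square flip: of_real_power)
  then have "(\<Sum>w\<in>D \<rightarrow>\<^sub>E UNIV. (cmod (s w))\<^sup>2) = 0" using z by (metis of_real_eq_0_iff)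
  then show "s w = 0" using fin w by (subst (asm) sum_nonneg_eq_0_iff) (auto intro: finite_PiE)
qed

text \<open>A permutation of the factors is an isometry with its inverse as adjoint, and inversion
  preserves both the group and the sign.\<close>

lemma perm_sum_adjoint:
  assumes "signed_group D G \<epsilon>"
  shows "word_inner D (perm_sum G \<epsilon> s) t = word_inner D s (perm_sum G \<epsilon> t)"
proof -
  interpret signed_group D G \<epsilon> by fact
  have "word_inner D (perm_sum G \<epsilon> s) t =
      (\<Sum>p\<in>G. \<Sum>w\<in>D \<rightarrow>\<^sub>E UNIV. of_int (\<epsilon> p) * s (w \<circ> p) * cnj (t w))"
    unfolding word_inner_def perm_sum_def sum_distrib_right by (rule sum.swap)
  also have "\<dots> = (\<Sum>p\<in>G. \<Sum>w\<in>D \<rightarrow>\<^sub>E UNIV. of_int (\<epsilon> (inv p)) * s w * cnj (t (w \<circ> inv p)))"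
  proof (rule sum.cong[OF refl])
    fix p assume p: "p \<in> G"
    have "(\<Sum>w\<in>D \<rightarrow>\<^sub>E UNIV. of_int (\<epsilon> p) * s w * cnj (t (w \<circ> inv p))) =
        (\<Sum>w\<in>D \<rightarrow>\<^sub>E UNIV. of_int (\<epsilon> p) * s (w \<circ> p) * cnj (t (w \<circ> p \<circ> inv p)))"
      by (rule sum.reindex_bij_betw[OF bij_comp_words[OF perm[OF p]], symmetric])
    then show "(\<Sum>w\<in>D \<rightarrow>\<^sub>E UNIV. of_int (\<epsilon> p) * s (w \<circ> p) * cnj (t w)) =
        (\<Sum>w\<in>D \<rightarrow>\<^sub>E UNIV. of_int (\<epsilon> (inv p)) * s w * cnj (t (w \<circ> inv p)))"
      using inv_comp(2)[OF p] \<epsilon>_inv[OF p] by (simp add: comp_assoc)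
  qed
  also have "\<dots> = (\<Sum>p\<in>G. \<Sum>w\<in>D \<rightarrow>\<^sub>E UNIV. of_int (\<epsilon> p) * s w * cnj (t (w \<circ> p)))"
    by (rule sum.reindex_bij_betw[OF bij_inv])
  also have "\<dots> = word_inner D s (perm_sum G \<epsilon> t)"
    unfolding word_inner_def perm_sum_def cnj_sum sum_distrib_left
    by (subst sum.swap) (simp add: mult.assoc mult.left_commute)
  finally show ?thesis .
qed

lemma perm_sum_supported:
  assumes "signed_group D G \<epsilon>" "\<And>w. w \<notin> D \<rightarrow>\<^sub>E UNIV \<Longrightarrow> t w = 0" "w \<notin> D \<rightarrow>\<^sub>E UNIV"
  shows "perm_sum G \<epsilon> t w = 0"
proof -
  interpret signed_group D G \<epsilon> by fact
  show ?thesis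
    unfolding perm_sum_def
  proof (intro sum.neutral ballI)
    fix p assume "p \<in> G"
    then have "w \<circ> p \<notin> D \<rightarrow>\<^sub>E UNIV"
      using assms(3) comp_permutes_word[OF perm[OF \<open>p \<in> G\<close>], of w] by simp
    then have "t (w \<circ> p) = 0" by (rule assms(2))
    then show "of_int (\<epsilon> p) * t (w \<circ> p) = 0" by simp
  qed
qed

text \<open>With \<open>\<Sum>p \<epsilon> p p\<close> a multiple of an orthogonal projection, \<open>x\<close> is killed by it as soon as
  \<open>\<langle>perm_sum x, x\<rangle> = 0\<close>.\<close>

lemma perm_sum_zero_if_inner_zero:
  fixes x :: "('b \<Rightarrow> 'v::finite) \<Rightarrow> complex"
  assumes "signed_group D G \<epsilon>" "word_inner D (perm_sum G \<epsilon> x) x = 0" "\<And>w. w \<notin> D \<rightarrow>\<^sub>E UNIV \<Longrightarrow> x w = 0"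
  shows "perm_sum G \<epsilon> x = 0"
proof
  interpret signed_group D G \<epsilon> by fact
  have "card G \<noteq> 0" using finite_group id_mem by auto
  have "word_inner D (perm_sum G \<epsilon> x) (perm_sum G \<epsilon> x) =
      word_inner D (perm_sum G \<epsilon> (perm_sum G \<epsilon> x)) x"
    by (rule perm_sum_adjoint[OF assms(1), symmetric])
  also have "\<dots> = of_nat (card G) * word_inner D (perm_sum G \<epsilon> x) x"
    unfolding word_inner_def
    by (simp add: perm_sum_absorb[OF assms(1) order.refl finite_group] sum_distrib_left mult.assoc)
  also have "\<dots> = 0" using assms(2) by simp
  finally have z: "word_inner D (perm_sum G \<epsilon> x) (perm_sum G \<epsilon> x) = 0" .
  fix w
  show "perm_sum G \<epsilon> x w = 0 w"
    unfolding pointwise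
    by (cases "w \<in> D \<rightarrow>\<^sub>E UNIV") (rule word_inner_self[OF finD z], assumption, rule perm_sum_supported[OF assms(1,3)])
qed

section \<open>Row and column groups of a diagram\<close>

lemma finite_diagram: "partition_at_most k lam \<Longrightarrow> finite (diagram lam)"
proof -
  assume p: "partition_at_most k lam"
  have "diagram lam \<subseteq> {..<k} \<times> {..<lam 0}"
  proof clarify
    fix i j assume "(i, j) \<in> diagram lam"
    then have "j < lam i" by (simp add: diagram_def)
    moreover have "lam i \<le> lam 0" using p by (auto simp: partition_at_most_def antimono_def)
    moreover have "i < k" using p \<open>j < lam i\<close> by (metis partition_at_most_def not_less not_less_zero)
    ultimately show "i \<in> {..<k} \<and> j \<in> {..<lam 0}" by simp
  qed
  then show ?thesis using finite_subset by blast
qed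

lemma row_groupI: "p permutes diagram lam \<Longrightarrow> (\<And>b. fst (p b) = fst b) \<Longrightarrow> p \<in> row_group lam"
  unfolding row_group_def by blast

lemma row_groupD: "p \<in> row_group lam \<Longrightarrow> p permutes diagram lam" "p \<in> row_group lam \<Longrightarrow> fst (p b) = fst b"
  unfolding row_group_def by blast+

lemma column_groupI: "p permutes diagram lam \<Longrightarrow> (\<And>b. snd (p b) = snd b) \<Longrightarrow> p \<in> column_group lam"
  unfolding column_group_def by blast

lemma column_groupD: "p \<in> column_group lam \<Longrightarrow> p permutes diagram lam" "p \<in> column_group lam \<Longrightarrow> snd (p b) = snd b"
  unfolding column_group_def by blast+

lemma row_signed_group:
  assumes "finite (diagram lam)"
  shows "signed_group (diagram lam) (row_group lam) (\<lambda>_. 1)"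
proof
  fix p assume p: "p \<in> row_group lam"
  show "inv p \<in> row_group lam"
  proof (rule row_groupI[OF permutes_inv[OF row_groupD(1)[OF p]]])
    show "fst (inv p b) = fst b" for b
      using row_groupD(2)[OF p, of "inv p b"] permutes_inverses(1)[OF row_groupD(1)[OF p]] by simp
  qed
  show "p \<circ> q \<in> row_group lam" if "q \<in> row_group lam" for q
    by (rule row_groupI[OF permutes_compose])
       (simp_all add: row_groupD(1) row_groupD(2)[OF p] row_groupD(2)[OF that] p that)
qed (simp_all add: row_groupD row_groupI assms permutes_id)

lemma column_signed_group:
  assumes "finite (diagram lam)"
  shows "signed_group (diagram lam) (column_group lam) sign"
proof
  fix p assume p: "p \<in> column_group lam"
  show "inv p \<in> column_group lam"
  proof (rule column_groupI[OF permutes_inv[OF column_groupD(1)[OF p]]])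
    show "snd (inv p b) = snd b" for b
      using column_groupD(2)[OF p, of "inv p b"] permutes_inverses(1)[OF column_groupD(1)[OF p]] by simp
  qed
  fix q assume q: "q \<in> column_group lam"
  show "p \<circ> q \<in> column_group lam"
    by (rule column_groupI[OF permutes_compose])
       (simp_all add: column_groupD(1) column_groupD(2)[OF p] column_groupD(2)[OF q] p q)
  show "sign (p \<circ> q) = sign p * sign q"
    using permutation_permutes assms column_groupD(1)[OF p] column_groupD(1)[OF q] sign_compose by blast
qed (simp_all add: column_groupD column_groupI assms permutes_id)

definition rows :: "(nat \<Rightarrow> nat) \<Rightarrow> ('v filling \<Rightarrow> 'a::comm_ring_1) \<Rightarrow> 'v filling \<Rightarrow> 'a"
  where "rows lam = perm_sum (row_group lam) (\<lambda>_. 1)"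

definition columns :: "(nat \<Rightarrow> nat) \<Rightarrow> ('v filling \<Rightarrow> 'a::comm_ring_1) \<Rightarrow> 'v filling \<Rightarrow> 'a"
  where "columns lam = perm_sum (column_group lam) sign"

text \<open>Coefficients in an arbitrary commutative ring allow the same operator on complex tensors
  and on tensors over the polynomial ring.\<close>

definition young :: "(nat \<Rightarrow> nat) \<Rightarrow> ('v filling \<Rightarrow> 'a::comm_ring_1) \<Rightarrow> 'v filling \<Rightarrow> 'a"
  where "young lam t = rows lam (columns lam t)"

lemma young_eq: "young lam t w =
    (\<Sum>p\<in>row_group lam. \<Sum>q\<in>column_group lam. of_int (sign q) * t (w \<circ> p \<circ> q))"
  by (simp add: young_def rows_def columns_def perm_sum_def)

lemma young_symmetrizer_eq: "young_symmetrizer lam = young lam"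
  by (intro ext) (simp add: young_symmetrizer_def young_eq)

lemma group_mono:
  assumes "lam0 \<le> lam1"
  shows "diagram lam0 \<subseteq> diagram lam1" "row_group lam0 \<subseteq> row_group lam1" "column_group lam0 \<subseteq> column_group lam1"
proof -
  show D: "diagram lam0 \<subseteq> diagram lam1"
    using assms by (auto simp: diagram_def le_fun_def intro: less_le_trans)
  then show "row_group lam0 \<subseteq> row_group lam1" "column_group lam0 \<subseteq> column_group lam1"
    by (auto simp: row_group_def column_group_def intro: permutes_subset)
qed

lemma young_supported:
  assumes "finite (diagram lam)" "\<And>w. w \<notin> words lam \<Longrightarrow> t w = 0" "w \<notin> words lam"
  shows "young lam t w = 0"
  unfolding young_def rows_def columns_def
  by (rule perm_sum_supported[OF row_signed_group], fact, rule perm_sum_supported[OF column_signed_group])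
     (use assms in \<open>auto simp: words_def\<close>)

text \<open>Write \<open>a0\<close>, \<open>b0\<close>, \<open>a1\<close>, \<open>b1\<close> for the
  row and column operators and x = a1 b1 t. From a0 b0 x = 0 follows a1 b0 x = 0, as
  \<open>a1\<close> absorbs \<open>a0\<close>; pairing with b1 t gives <b0 x, x> = 0, so b0 x = 0 by
  positivity. Then \<open>b1\<close> absorbs \<open>b0\<close>, so b1 x = 0; pairing with t gives
  <a1 b1 t, b1 t> = 0, so x = 0. For equal shapes this says that \<open>young\<close> is injective
  on its image; for nested ones it keeps the contractions from vanishing.\<close>

lemma young_young_zero:
  fixes t :: "'v::finite filling \<Rightarrow> complex"
  assumes "finite (diagram lam1)" "lam0 \<le> lam1" "t \<in> tensors lam1" "young lam0 (young lam1 t) = 0"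
  shows "young lam1 t = 0"
proof -
  let ?D = "diagram lam1" and ?a0 = "rows lam0" and ?b0 = "columns lam0"
    and ?a1 = "rows lam1" and ?b1 = "columns lam1"
  have fin0: "finite (diagram lam0)" using group_mono(1)[OF assms(2)] assms(1) finite_subset by blast
  note R1 = row_signed_group[OF assms(1)] and C1 = column_signed_group[OF assms(1)]
  have finR0: "finite (row_group lam0)" using signed_group.finite_group[OF row_signed_group[OF fin0]] .
  have finC0: "finite (column_group lam0)" using signed_group.finite_group[OF column_signed_group[OF fin0]] .
  \<comment> \<open>The smaller column group is made to act on the words of the larger diagram,
    where the Hermitian form lives.\<close>
  have C0: "signed_group ?D (column_group lam0) sign"
  proof -
    interpret c: signed_group "diagram lam0" "column_group lam0" sign by (rule column_signed_group[OF fin0])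
    show ?thesis
      by unfold_locales (use assms(1) c.perm permutes_subset[OF _ group_mono(1)[OF assms(2)]] c.id_mem c.comp_mem
          c.inv_mem c.\<epsilon>_comp c.\<epsilon>_square in auto)
  qed
  have cardR0: "of_nat (card (row_group lam0)) \<noteq> (0::complex)"
    using finR0 signed_group.id_mem[OF row_signed_group[OF fin0]] by auto
  have cardC0: "of_nat (card (column_group lam0)) \<noteq> (0::complex)"
    using finC0 signed_group.id_mem[OF column_signed_group[OF fin0]] by auto
  have inner0: "word_inner ?D 0 s = 0" for s :: "'v filling \<Rightarrow> complex"
    by (simp add: word_inner_def pointwise)
  have zero: "perm_sum G \<epsilon> 0 = (0 :: 'v filling \<Rightarrow> complex)"
    for G :: "(nat \<times> nat \<Rightarrow> nat \<times> nat) set" and \<epsilon>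
    by (auto simp: perm_sum_def pointwise)
  have t: "t w = 0" if "w \<notin> ?D \<rightarrow>\<^sub>E UNIV" for w
    using assms(3) that by (simp add: tensors_def words_def)
  have b1t: "?b1 t w = 0" if "w \<notin> ?D \<rightarrow>\<^sub>E UNIV" for w
    unfolding columns_def using perm_sum_supported[OF C1 t that] .
  define x where "x = ?a1 (?b1 t)"
  have x: "x w = 0" if "w \<notin> ?D \<rightarrow>\<^sub>E UNIV" for w
    unfolding x_def rows_def using perm_sum_supported[OF R1 b1t that] .
  have "?a0 (?b0 x) = 0" using assms(4) by (simp add: young_def x_def)
  then have "?a1 (?a0 (?b0 x)) = 0" by (simp add: zero rows_def)
  then have "?a1 (?b0 x) = 0"
    using perm_sum_absorb[OF R1 group_mono(2)[OF assms(2)] finR0, of "?b0 x"] cardR0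
    by (auto simp: rows_def fun_eq_iff pointwise)
  then have "word_inner ?D (?a1 (?b0 x)) (?b1 t) = 0" by (simp add: inner0)
  then have "word_inner ?D (?b0 x) x = 0"
    unfolding x_def rows_def by (simp add: perm_sum_adjoint[OF R1])
  then have "?b0 x = 0"
    unfolding columns_def by (rule perm_sum_zero_if_inner_zero[OF C0 _ x])
  then have "?b1 (?b0 x) = 0" by (simp add: zero columns_def)
  then have "?b1 x = 0"
    using perm_sum_absorb[OF C1 group_mono(3)[OF assms(2)] finC0, of x] cardC0
    by (auto simp: columns_def fun_eq_iff pointwise)
  then have "word_inner ?D (?b1 x) t = 0" by (simp add: inner0)
  then have "word_inner ?D (?a1 (?b1 t)) (?b1 t) = 0"
    unfolding x_def columns_def by (simp add: perm_sum_adjoint[OF C1])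
  then have "?a1 (?b1 t) = 0"
    unfolding rows_def by (rule perm_sum_zero_if_inner_zero[OF R1 _ b1t])
  then show ?thesis by (simp add: young_def)
qed

text \<open>Counting the boxes mapped to the first \<open>c\<close> columns shows that \<open>\<sigma>\<close> maps every row of length
  \<open>c\<close> into them.\<close>

lemma column_bound:
  assumes fin: "finite (diagram lam)" and \<sigma>: "\<sigma> permutes diagram lam"
    and distinct: "\<And>x y. x \<in> diagram lam \<Longrightarrow> y \<in> diagram lam \<Longrightarrow> x \<noteq> y \<Longrightarrow> fst x = fst y \<Longrightarrow> snd (\<sigma> x) \<noteq> snd (\<sigma> y)"
    and b: "b \<in> diagram lam"
  shows "snd (\<sigma> b) < lam (fst b)"
proof (rule ccontr)
  define c where "c = lam (fst b)"
  define D where "D = diagram lam"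
  \<comment> \<open>\<open>A i\<close> collects the boxes of row \<open>i\<close> in the first
    \<open>c\<close> columns, \<open>B i\<close> those which \<open>\<sigma>\<close> sends
    there.\<close>
  define A where "A i = {x\<in>D. fst x = i \<and> snd x < c}" for i
  define B where "B i = {x\<in>D. fst x = i \<and> snd (\<sigma> x) < c}" for i
  assume "\<not> snd (\<sigma> b) < lam (fst b)"
  then have nb: "\<not> snd (\<sigma> b) < c" by (simp add: c_def)
  have finD: "finite D" using fin by (simp add: D_def)
  define F where "F = fst ` D"
  have finF: "finite F" using finD by (simp add: F_def)
  have A: "A i = Pair i ` {..<min (lam i) c}" for i by (auto simp: A_def D_def diagram_def)
  have cA: "card (A i) = min (lam i) c" for i unfolding A by (simp add: card_image inj_on_def)
  have row: "{x\<in>D. fst x = i} = Pair i ` {..<lam i}" for i by (auto simp: D_def diagram_def)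
  have crow: "card {x\<in>D. fst x = i} = lam i" for i unfolding row by (simp add: card_image inj_on_def)
  \<comment> \<open>Boxes of one row are sent to distinct columns, so at most \<open>c\<close> of
    them land in the first \<open>c\<close> columns.\<close>
  have cB: "card (B i) \<le> card (A i)" for i
  proof -
    have "card (B i) \<le> lam i"
      using card_mono[of "{x\<in>D. fst x = i}" "B i"] finD crow by (auto simp: B_def)
    moreover have "inj_on (\<lambda>x. snd (\<sigma> x)) (B i)"
      using distinct by (intro inj_onI) (auto simp: B_def D_def)
    then have "card (B i) \<le> card {..<c}" by (rule card_inj_on_le) (auto simp: B_def)
    ultimately show ?thesis by (simp add: cA)
  qed
  \<comment> \<open>As \<open>\<sigma>\<close> is a bijection, both totals count the boxes in the
    first \<open>c\<close> columns; hence the inequality is an equality in every row. In the row of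
    \<open>b\<close> the count is the full length \<open>c\<close>, so \<open>b\<close> itself lands
    in the first \<open>c\<close> columns.\<close>
  have total: "(\<Sum>i\<in>F. card (B i)) = (\<Sum>i\<in>F. card (A i))"
  proof -
    have "(\<Sum>i\<in>F. card (A i)) = card (\<Union>i\<in>F. A i)"
      using finF finD by (intro card_UN_disjoint[symmetric]) (auto simp: A_def)
    also have "(\<Union>i\<in>F. A i) = {x\<in>D. snd x < c}" by (auto simp: A_def F_def)
    also have "\<dots> = \<sigma> ` {x\<in>D. snd (\<sigma> x) < c}"
    proof -
      have "x \<in> \<sigma> ` {x \<in> D. snd (\<sigma> x) < c}" if "x \<in> D" "snd x < c" for x
      proof (rule image_eqI[of _ _ "inv \<sigma> x"])
        show "x = \<sigma> (inv \<sigma> x)" using permutes_inverses(1)[OF \<sigma>] by simp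
        then show "inv \<sigma> x \<in> {x \<in> D. snd (\<sigma> x) < c}"
          using that permutes_in_image[OF permutes_inv[OF \<sigma>]] by (simp add: D_def)
      qed
      then show ?thesis using permutes_in_image[OF \<sigma>] by (auto simp: D_def)
    qed
    also have "card \<dots> = card {x\<in>D. snd (\<sigma> x) < c}"
      by (rule card_image) (use permutes_inj[OF \<sigma>] in \<open>auto simp: inj_on_def\<close>)
    also have "{x\<in>D. snd (\<sigma> x) < c} = (\<Union>i\<in>F. B i)" by (auto simp: B_def F_def)
    also have "card \<dots> = (\<Sum>i\<in>F. card (B i))"
      using finF finD by (intro card_UN_disjoint) (auto simp: B_def)
    finally show ?thesis by simp
  qed
  have bD: "b \<in> D" "fst b \<in> F" using b by (auto simp: D_def F_def)
  have "card (B (fst b)) = card (A (fst b))"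
  proof (rule ccontr)
    assume "card (B (fst b)) \<noteq> card (A (fst b))"
    then have "card (B (fst b)) < card (A (fst b))" using cB[of "fst b"] by simp
    then have "(\<Sum>i\<in>F. card (B i)) < (\<Sum>i\<in>F. card (A i))"
      using finF cB bD(2) by (intro sum_strict_mono_ex1) auto
    then show False using total by simp
  qed
  then have "card (B (fst b)) = card {x\<in>D. fst x = fst b}" by (simp add: cA crow c_def)
  then have "B (fst b) = {x\<in>D. fst x = fst b}"
    using finD by (intro card_subset_eq) (auto simp: B_def)
  then have "b \<in> B (fst b)" using bD by simp
  then show False using nb by (simp add: B_def)
qed

text \<open>\<open>p\<close> moves each box within its row to the column to which
  \<open>\<sigma>\<close> sends it, and \<open>column_bound\<close> keeps it inside the diagram.
  What remains, \<open>\<sigma> \<circ> inv p\<close>, preserves columns.\<close>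

lemma row_column_factorization:
  assumes fin: "finite (diagram lam)" and \<sigma>: "\<sigma> permutes diagram lam"
    and distinct: "\<And>x y. x \<in> diagram lam \<Longrightarrow> y \<in> diagram lam \<Longrightarrow> x \<noteq> y \<Longrightarrow> fst x = fst y \<Longrightarrow> snd (\<sigma> x) \<noteq> snd (\<sigma> y)"
  shows "\<exists>q\<in>column_group lam. \<exists>p\<in>row_group lam. \<sigma> = q \<circ> p"
proof -
  define D where "D = diagram lam"
  define p where "p x = (if x \<in> D then (fst x, snd (\<sigma> x)) else x)" for x
  have pD: "p x \<in> D" if "x \<in> D" for x
  proof -
    have "snd (\<sigma> x) < lam (fst x)"
      by (rule column_bound[OF fin \<sigma>]) (use distinct that in \<open>auto simp: D_def\<close>)
    then show ?thesis using that by (simp add: p_def diagram_def D_def)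
  qed
  have "inj_on p D"
    using distinct by (intro inj_onI) (auto simp: p_def D_def)
  then have "p ` D = D" using fin pD by (intro card_subset_eq card_image) (auto simp: D_def)
  then have "bij_betw p D D" using \<open>inj_on p D\<close> by (simp add: bij_betw_def)
  then have perm: "p permutes D" by (rule bij_imp_permutes) (simp add: p_def)
  then have p: "p \<in> row_group lam" by (intro row_groupI) (simp_all add: p_def D_def)
  define q where "q = \<sigma> \<circ> inv p"
  have "q permutes D" unfolding q_def
    using permutes_compose[OF permutes_inv[OF perm]] \<sigma> by (simp add: D_def)
  moreover have "snd (q b) = snd b" for b
  proof (cases "b \<in> D")
    case True
    define a where "a = inv p b"
    have a: "p a = b" "a \<in> D"
      using permutes_inverses(1)[OF perm] permutes_in_image[OF permutes_inv[OF perm]] True by (auto simp: a_def)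
    then show ?thesis by (auto simp: q_def a_def[symmetric] p_def)
  next
    case False
    then show ?thesis using \<open>q permutes D\<close> by (simp add: permutes_not_in)
  qed
  ultimately have "q \<in> column_group lam" by (intro column_groupI) (simp_all add: D_def)
  moreover have "\<sigma> = q \<circ> p" using permutes_inv_o(2)[OF perm] by (simp add: q_def comp_assoc)
  ultimately show ?thesis using p by blast
qed

text \<open>The column of \<open>q (p b)\<close> is that of \<open>p b\<close>, and the row of
  \<open>p b\<close> is that of \<open>b\<close>; hence the product determines
  \<open>p\<close>.\<close>

lemma row_column_unique:
  assumes "q \<in> column_group lam" "q' \<in> column_group lam" "p \<in> row_group lam" "p' \<in> row_group lam"
    and "q \<circ> p = q' \<circ> p'"
  shows "q = q' \<and> p = p'"
proof -
  have pq: "p permutes diagram lam" "q permutes diagram lam" "q' permutes diagram lam"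
    using assms by (simp_all add: row_groupD column_groupD)
  have eq: "q (p b) = q' (p' b)" for b using fun_cong[OF assms(5), of b] by simp
  have "p b = p' b" for b
  proof (rule prod_eqI)
    show "fst (p b) = fst (p' b)" using assms(3,4) by (simp add: row_groupD)
    have "snd (q (p b)) = snd (p b)" "snd (q' (p' b)) = snd (p' b)"
      using assms(1,2) by (simp_all add: column_groupD)
    then show "snd (p b) = snd (p' b)" using eq[of b] by simp
  qed
  then have "p = p'" by blast
  moreover have "q b = q' b" for b
    using eq[of "inv p b"] permutes_inverses(1)[OF pq(1)] \<open>p = p'\<close> by simp
  ultimately show ?thesis by blast
qed

text \<open>The coefficient of \<open>\<sigma>\<close> in the group algebra element given by the sum
  of all \<open>sign q\<close> times \<open>q \<circ> p\<close>. By uniqueness of the factorization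
  the sum has at most one term.\<close>

definition young_coeff :: "(nat \<Rightarrow> nat) \<Rightarrow> (nat \<times> nat \<Rightarrow> nat \<times> nat) \<Rightarrow> int"
  where "young_coeff lam \<sigma> = (\<Sum>(q, p)\<in>{(q, p). q \<in> column_group lam \<and> p \<in> row_group lam \<and> \<sigma> = q \<circ> p}. sign q)"

text \<open>A factor in the row group is absorbed by the row sum and one in the column group by the
  column sum, up to sign. If \<open>\<sigma>\<close> has no factorization, some two boxes of one row
  are sent to one column, and the corresponding transpositions show that the left side equals its
  own negative.\<close>

lemma columns_perm_rows:
  fixes t :: "'v filling \<Rightarrow> complex"
  assumes fin: "finite (diagram lam)" and \<sigma>: "\<sigma> permutes diagram lam"
  shows "columns lam (\<lambda>w. rows lam t (w \<circ> \<sigma>)) w = of_int (young_coeff lam \<sigma>) * columns lam (rows lam t) w"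
proof (cases "\<exists>q\<in>column_group lam. \<exists>p\<in>row_group lam. \<sigma> = q \<circ> p")
  case True
  interpret r: signed_group "diagram lam" "row_group lam" "\<lambda>_. 1" by (rule row_signed_group[OF fin])
  interpret c: signed_group "diagram lam" "column_group lam" sign by (rule column_signed_group[OF fin])
  from True obtain q0 p0 where qp: "q0 \<in> column_group lam" "p0 \<in> row_group lam" "\<sigma> = q0 \<circ> p0" by blast
  have "{(q, p). q \<in> column_group lam \<and> p \<in> row_group lam \<and> \<sigma> = q \<circ> p} = {(q0, p0)}"
    using qp row_column_unique by fast
  then have m: "young_coeff lam \<sigma> = sign q0" by (simp add: young_coeff_def)
  have "rows lam t (w \<circ> q0 \<circ> p0) = rows lam t (w \<circ> q0)" for w
    unfolding rows_def perm_sum_def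
    using sum.reindex_bij_betw[OF r.bij_left[OF qp(2)], of "\<lambda>p. of_int 1 * t (w \<circ> q0 \<circ> p)"]
    by (simp add: comp_assoc)
  then have "columns lam (\<lambda>w. rows lam t (w \<circ> \<sigma>)) w =
      (\<Sum>q\<in>column_group lam. of_int (sign q) * rows lam t (w \<circ> (q \<circ> q0)))"
    by (simp add: columns_def perm_sum_def qp(3) comp_assoc[symmetric])
  also have "\<dots> = (\<Sum>q\<in>column_group lam. of_int (sign q0) * (of_int (sign (q \<circ> q0)) * rows lam t (w \<circ> (q \<circ> q0))))"
    using qp(1) c.\<epsilon>_square[OF qp(1)] by (intro sum.cong) (auto simp: c.\<epsilon>_comp mult.assoc mult.left_commute simp flip: of_int_mult)
  also have "\<dots> = of_int (sign q0) * columns lam (rows lam t) w"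
    unfolding sum_distrib_left[symmetric] columns_def perm_sum_def
    by (subst sum.reindex_bij_betw[OF c.bij_right[OF qp(1)]]) simp
  finally show ?thesis by (simp add: m)
next
  case False
  interpret r: signed_group "diagram lam" "row_group lam" "\<lambda>_. 1" by (rule row_signed_group[OF fin])
  interpret c: signed_group "diagram lam" "column_group lam" sign by (rule column_signed_group[OF fin])
  have m: "young_coeff lam \<sigma> = 0"
    unfolding young_coeff_def by (rule sum.neutral) (use False in auto)
  obtain x y where xy: "x \<in> diagram lam" "y \<in> diagram lam" "x \<noteq> y" "fst x = fst y" "snd (\<sigma> x) = snd (\<sigma> y)"
  proof -
    have "\<exists>x\<in>diagram lam. \<exists>y\<in>diagram lam. x \<noteq> y \<and> fst x = fst y \<and> snd (\<sigma> x) = snd (\<sigma> y)"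
    proof (rule ccontr)
      assume d: "\<not> ?thesis"
      have "\<exists>q\<in>column_group lam. \<exists>p\<in>row_group lam. \<sigma> = q \<circ> p"
        by (rule row_column_factorization[OF fin \<sigma>]) (use d in blast)
      then show False using False by contradiction
    qed
    then show thesis using that by blast
  qed
  define \<tau> where "\<tau> = Transposition.transpose x y"
  define \<tau>' where "\<tau>' = Transposition.transpose (\<sigma> x) (\<sigma> y)"
  have \<tau>: "\<tau> \<in> row_group lam"
  proof -
    have "fst (\<tau> b) = fst b" for b
      unfolding \<tau>_def Transposition.transpose_def using xy(4) by simp
    then show ?thesis using permutes_swap_id[OF xy(1,2)] by (intro row_groupI) (simp_all add: \<tau>_def)
  qed
  have "\<sigma> x \<in> diagram lam" "\<sigma> y \<in> diagram lam" using permutes_in_image[OF \<sigma>] xy(1,2) by simp_all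
  have \<tau>': "\<tau>' \<in> column_group lam"
  proof -
    have "snd (\<tau>' b) = snd b" for b
      unfolding \<tau>'_def Transposition.transpose_def using xy(5) by simp
    then show ?thesis
      using permutes_swap_id[OF \<open>\<sigma> x \<in> diagram lam\<close> \<open>\<sigma> y \<in> diagram lam\<close>]
      by (intro column_groupI) (simp_all add: \<tau>'_def)
  qed
  have "\<sigma> x \<noteq> \<sigma> y" using xy(3) inj_eq[OF permutes_inj[OF \<sigma>]] by simp
  then have sg: "sign \<tau>' = -1" by (simp add: \<tau>'_def sign_swap_id)
  \<comment> \<open>A row transposition before \<open>\<sigma>\<close> becomes a column
    transposition after it: the first is invisible to the row sum, the second changes the sign of
    the column sum.\<close>
  have comm: "\<sigma> \<circ> \<tau> = \<tau>' \<circ> \<sigma>"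
    using permutes_inj[OF \<sigma>] by (auto simp: \<tau>_def \<tau>'_def Transposition.transpose_def inj_eq fun_eq_iff)
  have "rows lam t (w \<circ> \<sigma>) = rows lam t (w \<circ> \<tau>' \<circ> \<sigma>)" for w
  proof -
    have "rows lam t (w \<circ> \<sigma> \<circ> \<tau>) = rows lam t (w \<circ> \<sigma>)"
      unfolding rows_def perm_sum_def
      using sum.reindex_bij_betw[OF r.bij_left[OF \<tau>], of "\<lambda>p. of_int 1 * t (w \<circ> \<sigma> \<circ> p)"]
      by (simp add: comp_assoc)
    then show ?thesis by (simp add: comp_assoc comm)
  qed
  note inv = this
  let ?S = "columns lam (\<lambda>w. rows lam t (w \<circ> \<sigma>)) w"
  have "?S = (\<Sum>q\<in>column_group lam. of_int (sign q) * rows lam t (w \<circ> q \<circ> \<tau>' \<circ> \<sigma>))"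
    unfolding columns_def perm_sum_def by (intro sum.cong refl) (use inv in metis)
  also have "\<dots> = (\<Sum>q\<in>column_group lam. - (of_int (sign (q \<circ> \<tau>')) * rows lam t (w \<circ> (q \<circ> \<tau>') \<circ> \<sigma>)))"
    using \<tau>' sg by (intro sum.cong) (auto simp: c.\<epsilon>_comp comp_assoc)
  also have "\<dots> = - ?S"
    unfolding sum_negf columns_def perm_sum_def
    by (subst sum.reindex_bij_betw[OF c.bij_right[OF \<tau>'], of "\<lambda>q. of_int (sign q) * rows lam t (w \<circ> q \<circ> \<sigma>)"]) simp
  finally have "?S = 0" by simp
  then show ?thesis by (simp add: m)
qed

section \<open>Irreducibility of Schur functors\<close>

lemma young_sum_scale:
  "young lam (\<lambda>w. \<Sum>a\<in>A. c a * t a w) w = (\<Sum>a\<in>A. c a * young lam (t a) w)"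
proof -
  have "young lam (\<lambda>w. \<Sum>a\<in>A. c a * t a w) w =
      (\<Sum>p\<in>row_group lam. \<Sum>a\<in>A. \<Sum>q\<in>column_group lam. c a * (of_int (sign q) * t a (w \<circ> p \<circ> q)))"
    unfolding young_eq sum_distrib_left
    by (intro sum.cong refl, subst sum.swap) (simp add: mult.left_commute)
  also have "\<dots> = (\<Sum>a\<in>A. c a * young lam (t a) w)"
    by (subst sum.swap) (simp add: young_eq sum_distrib_left)
  finally show ?thesis .
qed

lemma young_add: "young lam (\<lambda>w. s w + t w) w = young lam s w + young lam t w"
  unfolding young_eq by (simp add: distrib_left sum.distrib)

lemma young_scale: "young lam (\<lambda>w. c * t w) w = c * young lam t w"
  using young_sum_scale[of lam "\<lambda>_. c" "\<lambda>_. t" "{()}" w] by simp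

lemma clinear_young: "clinear (young lam)"
  by (rule clinearI) (auto simp: fun_eq_iff pointwise plus_fun_def cscale_def young_add young_scale)

section \<open>The action of matrices on tensors\<close>

definition tensor_act :: "'b set \<Rightarrow> ('v \<Rightarrow> 'v \<Rightarrow> 'a::comm_ring_1) \<Rightarrow> (('b \<Rightarrow> 'v) \<Rightarrow> 'a) \<Rightarrow> ('b \<Rightarrow> 'v) \<Rightarrow> 'a"
  where "tensor_act D A t w =
    (if w \<in> D \<rightarrow>\<^sub>E UNIV then \<Sum>u\<in>D \<rightarrow>\<^sub>E UNIV. (\<Prod>b\<in>D. A (w b) (u b)) * t u else 0)"

lemma tensor_act_perm:
  assumes "p permutes D"
  shows "tensor_act D A (\<lambda>w. t (w \<circ> p)) w = tensor_act D A t (w \<circ> p)"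
proof (cases "w \<in> D \<rightarrow>\<^sub>E UNIV")
  case True
  have pr: "(\<Prod>b\<in>D. A (w (p b)) (u (p b))) = (\<Prod>b\<in>D. A (w b) (u b))" for u
    using prod.permute[OF assms, of "\<lambda>b. A (w b) (u b)"] by (simp add: comp_def)
  have "tensor_act D A t (w \<circ> p) = (\<Sum>u\<in>D \<rightarrow>\<^sub>E UNIV. (\<Prod>b\<in>D. A ((w \<circ> p) b) (u b)) * t u)"
    using True comp_permutes_word[OF assms, of w] by (simp add: tensor_act_def)
  also have "\<dots> = (\<Sum>u\<in>D \<rightarrow>\<^sub>E UNIV. (\<Prod>b\<in>D. A ((w \<circ> p) b) ((u \<circ> p) b)) * t (u \<circ> p))"
    by (rule sum.reindex_bij_betw[OF bij_comp_words[OF assms], symmetric])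
  finally show ?thesis using True by (simp add: tensor_act_def pr)
next
  case False
  then show ?thesis using comp_permutes_word[OF assms, of w] by (simp add: tensor_act_def)
qed

lemma tensor_act_sum_scale:
  "tensor_act D A (\<lambda>w. \<Sum>a\<in>S. c a * t a w) w = (\<Sum>a\<in>S. c a * tensor_act D A (t a) w)"
proof (cases "w \<in> D \<rightarrow>\<^sub>E UNIV")
  case True
  then show ?thesis
    unfolding tensor_act_def by (simp add: sum_distrib_left mult.left_commute) (rule sum.swap)
qed (simp add: tensor_act_def)

lemma clinear_tensor_act: "clinear (tensor_act D A)"
  by (rule clinearI)
     (auto simp: fun_eq_iff tensor_act_def pointwise distrib_left sum.distrib sum_distrib_left mult.left_commute)

text \<open>A tensor power of one matrix commutes with every permutation of the factors, hence with
  any combination of permutations.\<close>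

lemma tensor_act_young: "tensor_act (diagram lam) A (young lam t) w = young lam (tensor_act (diagram lam) A t) w"
proof -
  have "young lam t = (\<lambda>w. \<Sum>pq\<in>row_group lam \<times> column_group lam. of_int (sign (snd pq)) * t (w \<circ> (fst pq \<circ> snd pq)))"
    by (intro ext) (simp add: young_eq sum.cartesian_product case_prod_beta comp_assoc)
  then have "tensor_act (diagram lam) A (young lam t) w =
      (\<Sum>pq\<in>row_group lam \<times> column_group lam. of_int (sign (snd pq)) *
        tensor_act (diagram lam) A (\<lambda>w. t (w \<circ> (fst pq \<circ> snd pq))) w)"
    by (simp only: tensor_act_sum_scale)
  also have "\<dots> = (\<Sum>pq\<in>row_group lam \<times> column_group lam. of_int (sign (snd pq)) *
        tensor_act (diagram lam) A t (w \<circ> (fst pq \<circ> snd pq)))"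
  proof (intro sum.cong refl)
    fix pq assume "pq \<in> row_group lam \<times> column_group lam"
    then have "fst pq \<circ> snd pq permutes diagram lam"
      by (intro permutes_compose) (auto dest: row_groupD column_groupD)
    then show "of_int (sign (snd pq)) * tensor_act (diagram lam) A (\<lambda>w. t (w \<circ> (fst pq \<circ> snd pq))) w =
        of_int (sign (snd pq)) * tensor_act (diagram lam) A t (w \<circ> (fst pq \<circ> snd pq))"
      by (simp add: tensor_act_perm)
  qed
  also have "\<dots> = young lam (tensor_act (diagram lam) A t) w"
    by (simp add: young_eq sum.cartesian_product case_prod_beta comp_assoc)
  finally show ?thesis .
qed

lemma tensor_act_comp:
  fixes A B :: "'v::finite \<Rightarrow> 'v \<Rightarrow> 'a::comm_ring_1"
  assumes "finite D"
  shows "tensor_act D A (tensor_act D B t) = tensor_act D (\<lambda>i j. \<Sum>l\<in>UNIV. A i l * B l j) t"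
proof
  fix w :: "'b \<Rightarrow> 'v"
  show "tensor_act D A (tensor_act D B t) w = tensor_act D (\<lambda>i j. \<Sum>l\<in>UNIV. A i l * B l j) t w"
  proof (cases "w \<in> D \<rightarrow>\<^sub>E UNIV")
    case True
    have "tensor_act D A (tensor_act D B t) w =
        (\<Sum>u\<in>D \<rightarrow>\<^sub>E UNIV. (\<Prod>b\<in>D. A (w b) (u b)) * (\<Sum>v\<in>D \<rightarrow>\<^sub>E UNIV. (\<Prod>b\<in>D. B (u b) (v b)) * t v))"
      using True by (simp add: tensor_act_def)
    also have "\<dots> = (\<Sum>v\<in>D \<rightarrow>\<^sub>E UNIV. (\<Sum>u\<in>D \<rightarrow>\<^sub>E UNIV. \<Prod>b\<in>D. A (w b) (u b) * B (u b) (v b)) * t v)"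
      unfolding sum_distrib_left sum_distrib_right by (subst sum.swap) (simp add: prod.distrib mult.assoc)
    also have "\<dots> = (\<Sum>v\<in>D \<rightarrow>\<^sub>E UNIV. (\<Prod>b\<in>D. \<Sum>l\<in>UNIV. A (w b) l * B l (v b)) * t v)"
      by (simp add: prod_sum_PiE[OF assms])
    finally show ?thesis using True by (simp add: tensor_act_def)
  qed (simp add: tensor_act_def)
qed

lemma tensor_act_id:
  fixes t :: "('b \<Rightarrow> 'v::finite) \<Rightarrow> 'a::comm_ring_1"
  assumes "finite D" "\<And>w. w \<notin> D \<rightarrow>\<^sub>E UNIV \<Longrightarrow> t w = 0"
  shows "tensor_act D (\<lambda>i j. if i = j then 1 else 0) t = t"
proof
  fix w
  show "tensor_act D (\<lambda>i j. if i = j then 1 else 0) t w = t w"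
  proof (cases "w \<in> D \<rightarrow>\<^sub>E UNIV")
    case True
    have "(\<Prod>b\<in>D. if w b = u b then 1 else (0::'a)) = (if u = w then 1 else 0)" if u: "u \<in> D \<rightarrow>\<^sub>E UNIV" for u
    proof (cases "u = w")
      case False
      then obtain b where "b \<in> D" "w b \<noteq> u b" using PiE_ext[OF u True] by metis
      then have "(\<Prod>b\<in>D. if w b = u b then 1 else (0::'a)) = 0" using assms(1) by (intro prod_zero) auto
      then show ?thesis using False by simp
    qed simp
    then have "tensor_act D (\<lambda>i j. if i = j then 1 else 0) t w =
        (\<Sum>u\<in>D \<rightarrow>\<^sub>E UNIV. if u = w then t u else 0)"
      using True unfolding tensor_act_def by (simp cong: sum.cong) (intro sum.cong refl, simp)
    also have "\<dots> = t w" using True assms(1) by (subst sum.delta) (auto intro: finite_PiE)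
    finally show ?thesis .
  qed (simp add: tensor_act_def assms(2))
qed

interpretation fsc: vector_space_pair
  "cscale :: complex \<Rightarrow> ('i \<Rightarrow> complex) \<Rightarrow> 'i \<Rightarrow> complex"
  "(*) :: complex \<Rightarrow> complex \<Rightarrow> complex"
  by unfold_locales (auto simp: algebra_simps)

lemma supported_sum_unit_fun:
  assumes "finite W" "t \<in> supported W"
  shows "t = (\<Sum>w\<in>W. cscale (t w) (unit_fun w))"
proof
  fix i
  have "(\<Sum>j\<in>W. cscale (t j) (unit_fun j)) i = (\<Sum>j\<in>W. if i = j then t j else 0)"
    unfolding pointwise by (intro sum.cong) (auto simp: unit_fun_def)
  then show "t i = (\<Sum>j\<in>W. cscale (t j) (unit_fun j)) i" using assms by (auto simp: supported_def)
qed

lemma separating_functional: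
  assumes "finite W" "fs.subspace U" "U \<subseteq> supported W" "y \<in> supported W" "y \<notin> U"
  obtains \<kappa> where "\<And>t. t \<in> U \<Longrightarrow> (\<Sum>w\<in>W. \<kappa> w * t w) = 0" "(\<Sum>w\<in>W. \<kappa> w * y w) \<noteq> 0"
proof -
  obtain B where B: "B \<subseteq> U" "finite B" "fs.independent B" "fs.span B = U" "card B = fs.dim U"
    by (rule finite_basis[OF assms(1,3,2)])
  have "fs.independent (insert y B)" using B assms(5) by (simp add: fs.independent_insert)
  then obtain g where g: "Vector_Spaces.linear cscale (*) g" "\<forall>x\<in>insert y B. g x = (if x = y then 1 else 0)"
    using fsc.linear_independent_extend[of "insert y B" "\<lambda>x. if x = y then 1 else 0"] by blast
  have gB: "g x = 0" if "x \<in> B" for x using g(2) that B(1) assms(5) by auto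
  have eval: "(\<Sum>w\<in>W. g (unit_fun w) * t w) = g t" if "t \<in> supported W" for t
    by (subst (2) supported_sum_unit_fun[OF assms(1) that])
       (simp add: fsc.linear_sum[OF g(1)] fsc.linear_scale[OF g(1)] mult.commute)
  show ?thesis
  proof (rule that[of "\<lambda>w. g (unit_fun w)"])
    fix t assume "t \<in> U"
    then have "g t = 0" using fsc.linear_eq_0_on_span[OF g(1), of B t] gB B(4) by simp
    then show "(\<Sum>w\<in>W. g (unit_fun w) * t w) = 0" using eval \<open>t \<in> U\<close> assms(3) by auto
  next
    show "(\<Sum>w\<in>W. g (unit_fun w) * y w) \<noteq> 0" using eval[OF assms(4)] g(2) by simp
  qed
qed

text \<open>The symmetrised product of the \<open>E d\<close> is the coefficient of \<open>\<Prod>d. z d\<close> in the tensor power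
  of \<open>\<Sum>d. z d E d\<close>; adding a multiple of the identity makes that matrix invertible.\<close>

lemma stable_under_symmetrized_product:
  fixes U :: "(('b \<Rightarrow> 'v::finite) \<Rightarrow> complex) set" and E :: "'b \<Rightarrow> 'v \<Rightarrow> 'v \<Rightarrow> complex"
  assumes D: "finite D" and U: "fs.subspace U" "U \<subseteq> supported (D \<rightarrow>\<^sub>E UNIV)"
    and stable: "\<And>(g :: complex ^ 'v ^ 'v) x. invertible g \<Longrightarrow> x \<in> U \<Longrightarrow> tensor_act D (\<lambda>i j. g $ i $ j) x \<in> U"
    and x: "x \<in> U"
  shows "(\<lambda>w. if w \<in> D \<rightarrow>\<^sub>E UNIV then
      \<Sum>u\<in>D \<rightarrow>\<^sub>E UNIV. (\<Sum>\<sigma> | \<sigma> permutes D. \<Prod>b\<in>D. E (\<sigma> b) (w b) (u b)) * x u else 0) \<in> U"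
    (is "?\<Theta> \<in> U")
proof (rule ccontr)
  define W where "W = D \<rightarrow>\<^sub>E (UNIV :: 'v set)"
  have finW: "finite W" using D by (auto simp: W_def intro: finite_PiE)
  assume nU: "?\<Theta> \<notin> U"
  have sW: "?\<Theta> \<in> supported W" by (simp add: supported_def W_def)
  obtain \<kappa> where \<kappa>: "\<And>t. t \<in> U \<Longrightarrow> (\<Sum>w\<in>W. \<kappa> w * t w) = 0" "(\<Sum>w\<in>W. \<kappa> w * ?\<Theta> w) \<noteq> 0"
    by (rule separating_functional[OF finW U(1) U(2)[folded W_def] sW nU]) (rule that)
  \<comment> \<open>The variable \<open>None\<close> scales the identity and serves only to make the
    determinant a nonzero polynomial; it is set to \<open>0\<close> afterwards.\<close>
  define M where "M z i j = z None * (if i = j then 1 else 0) + (\<Sum>d\<in>D. z (Some d) * E d i j)" for z i j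
  define P where "P z = (\<Sum>w\<in>W. \<kappa> w * (\<Sum>u\<in>W. (\<Prod>b\<in>D. M z (w b) (u b)) * x u))" for z
  define dt where "dt z = Determinants.det (\<chi> i j. M z i j)" for z
  let ?V = "insert None (Some ` D)"
  have polyM: "polyfun ?V (\<lambda>z. M z i j)" for i j
    unfolding M_def by (intro polyfun_add polyfun_mult polyfun_sum polyfun_const polyfun_var) auto
  have polyP: "polyfun ?V P"
    unfolding P_def[abs_def] by (intro polyfun_sum polyfun_mult polyfun_prod polyfun_const polyM)
  have polyD: "polyfun ?V dt"
    unfolding dt_def[abs_def] Determinants.det_def vec_lambda_beta
    by (intro polyfun_sum polyfun_mult polyfun_prod polyfun_const polyM)
  have "P z * dt z = 0" for z
  proof (cases "dt z = 0")
    case False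
    then have "invertible (\<chi> i j. M z i j)" by (simp add: dt_def invertible_det_nz)
    then have "tensor_act D (\<lambda>i j. (\<chi> i j. M z i j) $ i $ j) x \<in> U" using stable x by blast
    then have "(\<Sum>w\<in>W. \<kappa> w * tensor_act D (M z) x w) = 0"
      using \<kappa>(1)[of "tensor_act D (M z) x"] by simp
    then show ?thesis by (simp add: P_def tensor_act_def W_def)
  qed simp
  moreover have "dt (\<lambda>v. if v = None then 1 else 0) \<noteq> 0"
  proof -
    have "(\<chi> i j. M (\<lambda>v. if v = None then 1 else 0) i j) = Finite_Cartesian_Product.mat 1"
      by (simp add: M_def Finite_Cartesian_Product.mat_def vec_eq_iff)
    then show ?thesis by (simp add: dt_def)
  qed
  \<comment> \<open>\<open>P\<close> vanishes wherever the matrix is invertible, so its product with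
    the determinant vanishes identically. The determinant is not the zero polynomial, hence
    \<open>P\<close> vanishes at singular matrices too.\<close>
  ultimately have P0: "P z = 0" for z using polyfun_common_nonzero[OF polyP polyD] by metis
  define F where "F = D \<rightarrow>\<^sub>E D"
  have finF: "finite F" using D by (auto simp: F_def intro: finite_PiE)
  define h where "h f = (\<Sum>w\<in>W. \<kappa> w * (\<Sum>u\<in>W. (\<Prod>b\<in>D. E (f b) (w b) (u b)) * x u))" for f
  \<comment> \<open>The exponents of the monomial that arises when the summand
    \<open>E (f b)\<close> is picked at each box \<open>b\<close>.\<close>
  define cnt where "cnt f = (\<lambda>d\<in>D. card {b\<in>D. f b = d})" for f :: "'b \<Rightarrow> 'b"
  have mono: "(\<Prod>b\<in>D. t (f b)) = monomial_fun D (cnt f) t" if "f \<in> F" for f t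
  proof -
    have "(\<Prod>b\<in>D. t (f b)) = (\<Prod>d\<in>D. \<Prod>b\<in>{b\<in>D. f b = d}. t (f b))"
      by (rule prod.group[symmetric]) (use D that in \<open>auto simp: F_def\<close>)
    also have "\<dots> = monomial_fun D (cnt f) t"
      unfolding monomial_fun_def by (intro prod.cong) (auto simp: cnt_def)
    finally show ?thesis .
  qed
  have expand: "(\<Sum>f\<in>F. h f * monomial_fun D (cnt f) t) = 0" for t
  proof -
    define z where "z v = (case v of None \<Rightarrow> 0 | Some d \<Rightarrow> t d)" for v
    have "(\<Prod>b\<in>D. M z (w b) (u b)) = (\<Sum>f\<in>F. (\<Prod>b\<in>D. t (f b)) * (\<Prod>b\<in>D. E (f b) (w b) (u b)))" for w u
      by (simp add: M_def z_def F_def prod_sum_PiE D prod.distrib)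
    then have "P z = (\<Sum>w\<in>W. \<kappa> w * (\<Sum>u\<in>W. \<Sum>f\<in>F. (\<Prod>b\<in>D. t (f b)) * ((\<Prod>b\<in>D. E (f b) (w b) (u b)) * x u)))"
      by (simp add: P_def sum_distrib_right mult.assoc)
    also have "\<dots> = (\<Sum>w\<in>W. \<Sum>f\<in>F. (\<Prod>b\<in>D. t (f b)) * (\<kappa> w * (\<Sum>u\<in>W. (\<Prod>b\<in>D. E (f b) (w b) (u b)) * x u)))"
      by (subst sum.swap) (simp add: sum_distrib_left mult.left_commute)
    also have "\<dots> = (\<Sum>f\<in>F. (\<Prod>b\<in>D. t (f b)) * h f)"
      by (subst sum.swap) (simp add: h_def sum_distrib_left)
    finally show ?thesis using P0[of z] mono by (simp add: mult.commute)
  qed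
  \<comment> \<open>In the multilinear monomial every \<open>E d\<close> is used exactly once, which
    singles out the choices \<open>f\<close> that are permutations of \<open>D\<close>.\<close>
  define one where "one = (\<lambda>d\<in>D. 1 :: nat)"
  have "(\<Sum>f\<in>{f\<in>F. cnt f = one}. h f) = 0"
  proof (cases "one \<in> cnt ` F")
    case True
    show ?thesis
    proof (rule monomial_fun_linear_independent[of D "cnt ` F" "\<lambda>\<alpha>. \<Sum>f\<in>{f\<in>F. cnt f = \<alpha>}. h f" one])
      show "(\<Sum>\<alpha>\<in>cnt ` F. (\<Sum>f\<in>{f\<in>F. cnt f = \<alpha>}. h f) * monomial_fun D \<alpha> t) = 0" for t
      proof -
        have "(\<Sum>\<alpha>\<in>cnt ` F. (\<Sum>f\<in>{f\<in>F. cnt f = \<alpha>}. h f) * monomial_fun D \<alpha> t) =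
            (\<Sum>\<alpha>\<in>cnt ` F. \<Sum>f\<in>{f\<in>F. cnt f = \<alpha>}. h f * monomial_fun D (cnt f) t)"
          by (simp add: sum_distrib_right)
        also have "\<dots> = (\<Sum>f\<in>F. h f * monomial_fun D (cnt f) t)"
          by (rule sum.group) (use finF in auto)
        finally show ?thesis using expand by simp
      qed
    qed (use D finF True in \<open>auto simp: cnt_def\<close>)
  next
    case False
    then have "{f\<in>F. cnt f = one} = {}" by auto
    then show ?thesis by (simp only: sum.empty)
  qed
  \<comment> \<open>The two sides differ only outside \<open>D\<close>: choices are
    \<open>undefined\<close> there, permutations are the identity.\<close>
  moreover have "(\<Sum>f\<in>{f\<in>F. cnt f = one}. h f) = (\<Sum>\<sigma> | \<sigma> permutes D. h \<sigma>)"
  proof (rule sum.reindex_bij_witness[where i="\<lambda>\<sigma>. restrict \<sigma> D" and j="\<lambda>f b. if b \<in> D then f b else b"])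
    fix f assume f: "f \<in> {f\<in>F. cnt f = one}"
    then have fD: "f b \<in> D" if "b \<in> D" for b using that by (auto simp: F_def)
    have one_pre: "card {b\<in>D. f b = d} = 1" if "d \<in> D" for d
    proof -
      have "cnt f d = one d" using f by simp
      then show ?thesis using that by (simp add: cnt_def one_def)
    qed
    have "inj_on f D"
    proof (rule inj_onI)
      fix a b assume ab: "a \<in> D" "b \<in> D" "f a = f b"
      obtain c where "{b'\<in>D. f b' = f b} = {c}" using one_pre[OF fD[OF ab(2)]] by (rule card_1_singletonE)
      then show "a = b" using ab by (metis (mono_tags, lifting) mem_Collect_eq singletonD)
    qed
    moreover have "f ` D = D"
      using card_image[OF \<open>inj_on f D\<close>] fD D by (intro card_subset_eq) auto
    ultimately have "bij_betw f D D" by (simp add: bij_betw_def)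
    then have "bij_betw (\<lambda>b. if b \<in> D then f b else b) D D" by (simp cong: bij_betw_cong)
    then show "(\<lambda>b. if b \<in> D then f b else b) \<in> {\<sigma>. \<sigma> permutes D}"
      by (auto intro: bij_imp_permutes)
    show "restrict (\<lambda>b. if b \<in> D then f b else b) D = f"
      using f by (auto simp: F_def PiE_def extensional_def fun_eq_iff)
    show "h (\<lambda>b. if b \<in> D then f b else b) = h f" by (simp add: h_def)
  next
    fix \<sigma> assume "\<sigma> \<in> {\<sigma>. \<sigma> permutes D}"
    then have \<sigma>: "\<sigma> permutes D" by simp
    show "(\<lambda>b. if b \<in> D then restrict \<sigma> D b else b) = \<sigma>"
      using \<sigma> by (auto simp: fun_eq_iff permutes_not_in)
    have "{b \<in> D. restrict \<sigma> D b = d} = {inv \<sigma> d}" if "d \<in> D" for d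
    proof -
      have "inv \<sigma> d \<in> D" using permutes_in_image[OF permutes_inv[OF \<sigma>]] that by simp
      then have mem: "b \<in> {b \<in> D. restrict \<sigma> D b = d} \<longleftrightarrow> b \<in> {inv \<sigma> d}" for b
        using permutes_inv_eq[OF \<sigma>, of d b] by (cases "b \<in> D") auto
      show ?thesis by (rule Set.set_eqI) (rule mem)
    qed
    then have "card {b \<in> D. restrict \<sigma> D b = d} = 1" if "d \<in> D" for d using that by simp
    then have "cnt (restrict \<sigma> D) = one" unfolding cnt_def one_def by (rule restrict_ext)
    moreover have "restrict \<sigma> D \<in> F" using permutes_in_image[OF \<sigma>] by (simp add: F_def)
    ultimately show "restrict \<sigma> D \<in> {f\<in>F. cnt f = one}" by simp
  qed
  moreover have "(\<Sum>\<sigma> | \<sigma> permutes D. h \<sigma>) = (\<Sum>w\<in>W. \<kappa> w * ?\<Theta> w)"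
  proof -
    have "(\<Sum>\<sigma> | \<sigma> permutes D. h \<sigma>) = (\<Sum>w\<in>W. \<kappa> w * (\<Sum>\<sigma> | \<sigma> permutes D. \<Sum>u\<in>W. (\<Prod>b\<in>D. E (\<sigma> b) (w b) (u b)) * x u))"
      unfolding h_def sum_distrib_left by (rule sum.swap)
    also have "\<dots> = (\<Sum>w\<in>W. \<kappa> w * (\<Sum>u\<in>W. (\<Sum>\<sigma> | \<sigma> permutes D. \<Prod>b\<in>D. E (\<sigma> b) (w b) (u b)) * x u))"
      unfolding sum_distrib_right by (subst sum.swap) (rule refl)
    also have "\<dots> = (\<Sum>w\<in>W. \<kappa> w * ?\<Theta> w)" by (intro sum.cong) (auto simp: W_def)
    finally show ?thesis .
  qed
  ultimately show False using \<kappa>(2) by simp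
qed

lemma tensors_eq_supported: "tensors lam = supported (words lam)"
  by (simp add: tensors_def supported_def)

lemma schur_eq: "schur lam = young lam ` supported (words lam)"
  by (simp add: schur_def young_symmetrizer_eq tensors_eq_supported)

lemma subspace_schur: "fs.subspace (schur lam)"
  unfolding schur_eq by (rule fsp.linear_subspace_image[OF clinear_young subspace_supported])

lemma schur_supported: "finite (diagram lam) \<Longrightarrow> schur lam \<subseteq> supported (words lam)"
  unfolding schur_eq using young_supported by (auto simp: supported_def)

lemma finite_words: "finite (diagram lam) \<Longrightarrow> finite (words lam :: 'v::finite filling set)"
  by (auto simp: words_def intro: finite_PiE)

lemma young_nonzero_on_schur:
  fixes x :: "'v::finite filling \<Rightarrow> complex"
  assumes "finite (diagram lam1)" "lam0 \<le> lam1" "x \<in> schur lam1" "young lam0 x = 0"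
  shows "x = 0"
  using assms young_young_zero[OF assms(1,2)] by (auto simp: schur_eq tensors_eq_supported)

lemma young_coeff_sum:
  fixes F :: "(nat \<times> nat \<Rightarrow> nat \<times> nat) \<Rightarrow> complex"
  assumes "finite (diagram lam)"
  shows "(\<Sum>\<sigma> | \<sigma> permutes diagram lam. of_int (young_coeff lam \<sigma>) * F \<sigma>) =
    (\<Sum>q\<in>column_group lam. \<Sum>p\<in>row_group lam. of_int (sign q) * F (q \<circ> p))"
proof -
  interpret r: signed_group "diagram lam" "row_group lam" "\<lambda>_. 1" by (rule row_signed_group[OF assms])
  interpret c: signed_group "diagram lam" "column_group lam" sign by (rule column_signed_group[OF assms])
  have "of_int (young_coeff lam \<sigma>) * F \<sigma> =
      (\<Sum>qp\<in>{qp \<in> column_group lam \<times> row_group lam. fst qp \<circ> snd qp = \<sigma>}. of_int (sign (fst qp)) * F (fst qp \<circ> snd qp))" for \<sigma>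
  proof -
    have "{(q, p). q \<in> column_group lam \<and> p \<in> row_group lam \<and> \<sigma> = q \<circ> p} =
        {qp \<in> column_group lam \<times> row_group lam. fst qp \<circ> snd qp = \<sigma>}" by auto
    then show ?thesis by (simp add: young_coeff_def case_prod_beta sum_distrib_right)
  qed
  then have "(\<Sum>\<sigma> | \<sigma> permutes diagram lam. of_int (young_coeff lam \<sigma>) * F \<sigma>) =
      (\<Sum>\<sigma> | \<sigma> permutes diagram lam. \<Sum>qp\<in>{qp \<in> column_group lam \<times> row_group lam. fst qp \<circ> snd qp = \<sigma>}.
        of_int (sign (fst qp)) * F (fst qp \<circ> snd qp))" by simp
  also have "\<dots> = (\<Sum>qp\<in>column_group lam \<times> row_group lam. of_int (sign (fst qp)) * F (fst qp \<circ> snd qp))"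
  proof (rule sum.group)
    show "(\<lambda>qp. fst qp \<circ> snd qp) ` (column_group lam \<times> row_group lam) \<subseteq> {\<sigma>. \<sigma> permutes diagram lam}"
      using permutes_compose[OF r.perm c.perm] by auto
  qed (use r.finite_group c.finite_group finite_permutations[OF assms] in auto)
  also have "\<dots> = (\<Sum>q\<in>column_group lam. \<Sum>p\<in>row_group lam. of_int (sign q) * F (q \<circ> p))"
    by (simp add: sum.cartesian_product case_prod_beta)
  finally show ?thesis .
qed

text \<open>For the Young symmetrizer e this is the rule that e \<sigma> e is a multiple of e e:
  inside the two outer factors stands a column sum, then \<sigma>, then a row sum, so
  \<open>columns_perm_rows\<close> applies. It plays the part of Schur's lemma below.\<close>

lemma young_perm_young:
  fixes t :: "'v filling \<Rightarrow> complex"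
  assumes "finite (diagram lam)" "\<sigma> permutes diagram lam"
  shows "young lam (\<lambda>w. young lam t (w \<circ> \<sigma>)) w = of_int (young_coeff lam \<sigma>) * young lam (young lam t) w"
proof -
  have "columns lam (\<lambda>w. young lam t (w \<circ> \<sigma>)) = (\<lambda>w. of_int (young_coeff lam \<sigma>) * columns lam (young lam t) w)"
    unfolding young_def using columns_perm_rows[OF assms] by blast
  then have "young lam (\<lambda>w. young lam t (w \<circ> \<sigma>)) w =
      rows lam (\<lambda>w. of_int (young_coeff lam \<sigma>) * columns lam (young lam t) w) w"
    by (simp add: young_def[of lam "\<lambda>w. young lam t (w \<circ> \<sigma>)"])
  also have "\<dots> = of_int (young_coeff lam \<sigma>) * rows lam (columns lam (young lam t)) w"
    by (simp add: rows_def perm_sum_def sum_distrib_left)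
  finally show ?thesis by (simp add: young_def[of lam "young lam t"])
qed

text \<open>\<open>young\<close> evaluates at \<open>w \<circ> p \<circ> q\<close>, while
  \<open>young_coeff\<close> refers to the products \<open>q \<circ> p\<close>; inversion exchanges
  the two orders and keeps the signs.\<close>

lemma young_eq_inverse_coeffs:
  fixes x :: "'v filling \<Rightarrow> complex"
  assumes "finite (diagram lam)"
  shows "young lam x w = (\<Sum>\<sigma> | \<sigma> permutes diagram lam. of_int (young_coeff lam (inv \<sigma>)) * x (w \<circ> \<sigma>))"
proof -
  interpret r: signed_group "diagram lam" "row_group lam" "\<lambda>_. 1" by (rule row_signed_group[OF assms])
  interpret c: signed_group "diagram lam" "column_group lam" sign by (rule column_signed_group[OF assms])
  have "(\<Sum>\<sigma> | \<sigma> permutes diagram lam. of_int (young_coeff lam (inv \<sigma>)) * x (w \<circ> \<sigma>)) =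
      (\<Sum>\<sigma> | \<sigma> permutes diagram lam. of_int (young_coeff lam (inv \<sigma>)) * x (w \<circ> inv (inv \<sigma>)))"
    by (intro sum.cong) (auto simp: permutes_inv_inv)
  also have "\<dots> = (\<Sum>\<sigma> | \<sigma> permutes diagram lam. of_int (young_coeff lam \<sigma>) * x (w \<circ> inv \<sigma>))"
    by (rule sum_permutations_inverse[symmetric])
  also have "\<dots> = (\<Sum>q\<in>column_group lam. \<Sum>p\<in>row_group lam. of_int (sign q) * x (w \<circ> inv (q \<circ> p)))"
    by (rule young_coeff_sum[OF assms])
  also have "\<dots> = (\<Sum>q\<in>column_group lam. \<Sum>p\<in>row_group lam. of_int (sign (inv q)) * x (w \<circ> inv p \<circ> inv q))"
  proof (intro sum.cong refl)
    fix q p assume "q \<in> column_group lam" "p \<in> row_group lam"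
    then show "of_int (sign q) * x (w \<circ> inv (q \<circ> p)) = of_int (sign (inv q)) * x (w \<circ> inv p \<circ> inv q)"
      using permutes_bij[OF c.perm] permutes_bij[OF r.perm] by (simp add: o_inv_distrib c.\<epsilon>_inv comp_assoc)
  qed
  also have "\<dots> = (\<Sum>q\<in>column_group lam. \<Sum>p\<in>row_group lam. of_int (sign q) * x (w \<circ> inv p \<circ> q))"
    by (rule sum.reindex_bij_betw[OF c.bij_inv])
  also have "\<dots> = (\<Sum>p\<in>row_group lam. \<Sum>q\<in>column_group lam. of_int (sign q) * x (w \<circ> inv p \<circ> q))"
    by (rule sum.swap)
  also have "\<dots> = (\<Sum>p\<in>row_group lam. \<Sum>q\<in>column_group lam. of_int (sign q) * x (w \<circ> p \<circ> q))"
    by (rule sum.reindex_bij_betw[OF r.bij_inv])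
  finally show ?thesis by (simp add: young_eq)
qed

text \<open>From one nonzero \<open>x\<close> in \<open>U\<close> every \<open>z\<close> of the
  Schur functor is produced: symmetrized products of matrix units put a sum of permuted copies of
  \<open>z\<close>, weighted by coefficients of \<open>x\<close>, into \<open>U\<close>. The
  symmetrizer turns each permutation into a scalar, so this sum is a multiple of \<open>z\<close>,
  and the multiple is a nonzero coefficient of \<open>young lam x\<close>.\<close>

theorem schur_irreducible:
  fixes U :: "('v::finite filling \<Rightarrow> complex) set"
  assumes fin: "finite (diagram lam)" and U: "fs.subspace U" "U \<subseteq> schur lam" "U \<noteq> {0}"
    and stable: "\<And>(g :: complex ^ 'v ^ 'v) x. invertible g \<Longrightarrow> x \<in> U \<Longrightarrow>
      tensor_act (diagram lam) (\<lambda>i j. g $ i $ j) x \<in> U"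
  shows "U = schur lam"
proof
  define D where "D = diagram lam"
  define W where "W = (words lam :: 'v filling set)"
  have WD: "W = D \<rightarrow>\<^sub>E UNIV" by (simp add: W_def D_def words_def)
  have finD: "finite D" and finW: "finite W" using fin finite_words[OF fin] by (simp_all add: D_def W_def)
  obtain x where x: "x \<in> U" "x \<noteq> 0" using U(3) fs.subspace_0[OF U(1)] by blast
  have "young lam x \<noteq> 0" using young_nonzero_on_schur[OF fin order.refl, of x] x U(2) by blast
  \<comment> \<open>A coefficient of \<open>x\<close> that survives symmetrization; the last step
    divides by it.\<close>
  then obtain w0 where w0: "young lam x w0 \<noteq> 0" by (auto simp: fun_eq_iff pointwise)
  have "x w = 0" if "w \<notin> words lam" for w
    using schur_supported[OF fin] U(2) x(1) that by (auto simp: supported_def)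
  then have "w0 \<in> W" using young_supported[OF fin, of x w0] w0 by (auto simp: W_def)
  show "schur lam \<subseteq> U"
  proof
    fix z :: "'v filling \<Rightarrow> complex"
    assume z: "z \<in> schur lam"
    then obtain t where t: "z = young lam t" by (auto simp: schur_eq)
    have zsup: "z w = 0" if "w \<notin> W" for w
      using schur_supported[OF fin] z that by (auto simp: supported_def W_def)
    \<comment> \<open>Visibly a combination of permuted copies of \<open>z\<close>. It is shown to
      lie in \<open>U\<close>, and then to be a multiple of \<open>z\<close>.\<close>
    define T where "T w = (\<Sum>\<sigma> | \<sigma> permutes D. x (w0 \<circ> \<sigma>) * z (w \<circ> inv \<sigma>))" for w
    have "T \<in> U"
    proof -
      \<comment> \<open>\<open>E u d\<close> is the matrix unit taking the basis vector
        \<open>w0 d\<close> to \<open>u d\<close>. Its symmetrized product reads the coefficients of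
        \<open>x\<close> at the permutations of \<open>w0\<close> and writes them at the
        permutations of \<open>u\<close>.\<close>
      define E where "E u d i j = (if i = u d \<and> j = w0 d then 1 else 0 :: complex)" for u :: "'v filling" and d i j
      define \<Theta> where "\<Theta> u w = (if w \<in> D \<rightarrow>\<^sub>E UNIV then
        \<Sum>v\<in>D \<rightarrow>\<^sub>E UNIV. (\<Sum>\<sigma> | \<sigma> permutes D. \<Prod>b\<in>D. E u (\<sigma> b) (w b) (v b)) * x v else 0)" for u w
      have \<Theta>U: "\<Theta> u \<in> U" for u
        unfolding \<Theta>_def
        by (rule stable_under_symmetrized_product[OF finD U(1) _ _ x(1)])
           (use U(2) schur_supported[OF fin] stable in \<open>auto simp: D_def words_def\<close>)
      have \<Theta>: "\<Theta> u w = (\<Sum>\<sigma> | \<sigma> permutes D. if w = u \<circ> \<sigma> then x (w0 \<circ> \<sigma>) else 0)"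
        if u: "u \<in> W" and w: "w \<in> W" for u w
      proof -
        have pr: "(\<Prod>b\<in>D. E u (\<sigma> b) (w b) (v b)) = (if v = w0 \<circ> \<sigma> then if w = u \<circ> \<sigma> then 1 else 0 else 0)"
          if \<sigma>: "\<sigma> permutes D" and v: "v \<in> W" for \<sigma> v
        proof (cases "w = u \<circ> \<sigma> \<and> v = w0 \<circ> \<sigma>")
          case False
          have "u \<circ> \<sigma> \<in> W" "w0 \<circ> \<sigma> \<in> W"
            using comp_permutes_word[OF \<sigma>, of u] comp_permutes_word[OF \<sigma>, of w0] u \<open>w0 \<in> W\<close>
            unfolding WD by simp_all
          then have "\<exists>b\<in>D. \<not> (w b = u (\<sigma> b) \<and> v b = w0 (\<sigma> b))"
            using False w v unfolding WD by (metis PiE_ext comp_apply)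
          then have "(\<Prod>b\<in>D. E u (\<sigma> b) (w b) (v b)) = 0"
            using finD by (intro prod_zero) (auto simp: E_def)
          then show ?thesis using False by (simp only: if_split) blast
        qed (simp add: E_def)
        have "\<Theta> u w = (\<Sum>v\<in>W. \<Sum>\<sigma> | \<sigma> permutes D. (if v = w0 \<circ> \<sigma> then if w = u \<circ> \<sigma> then x v else 0 else 0))"
          unfolding \<Theta>_def WD[symmetric] sum_distrib_right if_P[OF w]
        proof (intro sum.cong refl)
          fix v \<sigma> assume v: "v \<in> W" and "\<sigma> \<in> {\<sigma>. \<sigma> permutes D}"
          then have \<sigma>: "\<sigma> permutes D" by simp
          show "(\<Prod>b\<in>D. E u (\<sigma> b) (w b) (v b)) * x v =
              (if v = w0 \<circ> \<sigma> then if w = u \<circ> \<sigma> then x v else 0 else 0)"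
            unfolding pr[OF \<sigma> v] by simp
        qed
        also have "\<dots> = (\<Sum>\<sigma> | \<sigma> permutes D. \<Sum>v\<in>W. (if v = w0 \<circ> \<sigma> then if w = u \<circ> \<sigma> then x v else 0 else 0))"
          by (rule sum.swap)
        also have "\<dots> = (\<Sum>\<sigma> | \<sigma> permutes D. if w = u \<circ> \<sigma> then x (w0 \<circ> \<sigma>) else 0)"
        proof (intro sum.cong refl)
          fix \<sigma> assume "\<sigma> \<in> {\<sigma>. \<sigma> permutes D}"
          then have "w0 \<circ> \<sigma> \<in> W" using comp_permutes_word[of \<sigma> D w0] \<open>w0 \<in> W\<close> unfolding WD by simp
          then show "(\<Sum>v\<in>W. (if v = w0 \<circ> \<sigma> then if w = u \<circ> \<sigma> then x v else 0 else 0)) =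
              (if w = u \<circ> \<sigma> then x (w0 \<circ> \<sigma>) else 0)" using finW by (simp add: sum.delta)
        qed
        finally show ?thesis .
      qed
      have "T = (\<Sum>u\<in>W. cscale (z u) (\<Theta> u))"
      proof
        fix w
        show "T w = (\<Sum>u\<in>W. cscale (z u) (\<Theta> u)) w"
        proof (cases "w \<in> W")
          case True
          have "(\<Sum>u\<in>W. cscale (z u) (\<Theta> u)) w =
              (\<Sum>u\<in>W. \<Sum>\<sigma> | \<sigma> permutes D. if w = u \<circ> \<sigma> then x (w0 \<circ> \<sigma>) * z u else 0)"
            unfolding pointwise by (intro sum.cong refl) (auto simp: \<Theta> True sum_distrib_left intro!: sum.cong)
          also have "\<dots> = (\<Sum>\<sigma> | \<sigma> permutes D. \<Sum>u\<in>W. if w = u \<circ> \<sigma> then x (w0 \<circ> \<sigma>) * z u else 0)"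
            by (rule sum.swap)
          also have "\<dots> = T w"
            unfolding T_def
          proof (intro sum.cong refl)
            fix \<sigma> assume "\<sigma> \<in> {\<sigma>. \<sigma> permutes D}"
            then have \<sigma>: "\<sigma> permutes D" by simp
            have "w = u \<circ> \<sigma> \<longleftrightarrow> u = w \<circ> inv \<sigma>" for u
              using permutes_inv_o[OF \<sigma>] by (metis comp_assoc comp_id)
            moreover have "w \<circ> inv \<sigma> \<in> W"
              using comp_permutes_word[OF permutes_inv[OF \<sigma>], of w] True unfolding WD by simp
            ultimately show "(\<Sum>u\<in>W. if w = u \<circ> \<sigma> then x (w0 \<circ> \<sigma>) * z u else 0) =
                x (w0 \<circ> \<sigma>) * z (w \<circ> inv \<sigma>)" using finW by simp
          qed
          finally show ?thesis by simp
        next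
          case False
          have "z (w \<circ> inv \<sigma>) = 0" if "\<sigma> permutes D" for \<sigma>
            using comp_permutes_word[OF permutes_inv[OF that], of w] False zsup unfolding WD by blast
          then have "T w = 0" by (simp add: T_def)
          then show ?thesis using False by (simp add: pointwise \<Theta>_def WD)
        qed
      qed
      also have "\<dots> \<in> U" by (intro fs.subspace_sum[OF U(1)] fs.subspace_scale[OF U(1)] \<Theta>U)
      finally show ?thesis .
    qed
    \<comment> \<open>Moving \<open>young\<close> past \<open>\<sigma>\<close> costs the factor
      \<open>young_coeff lam (inv \<sigma>)\<close>, and the sum of these factors against
      \<open>x (w0 \<circ> \<sigma>)\<close> is again the symmetrizer, by
      \<open>young_eq_inverse_coeffs\<close>.\<close>
    define c where "c = young lam x w0"
    have "young lam T w = c * young lam z w" for w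
    proof -
      have "young lam T w = (\<Sum>\<sigma> | \<sigma> permutes D. x (w0 \<circ> \<sigma>) * young lam (\<lambda>w. z (w \<circ> inv \<sigma>)) w)"
        unfolding T_def[abs_def] by (rule young_sum_scale)
      also have "\<dots> = (\<Sum>\<sigma> | \<sigma> permutes D. of_int (young_coeff lam (inv \<sigma>)) * x (w0 \<circ> \<sigma>) * young lam z w)"
        by (intro sum.cong refl) (simp add: t young_perm_young[OF fin] permutes_inv D_def)
      also have "\<dots> = c * young lam z w"
        by (simp add: c_def young_eq_inverse_coeffs[OF fin, of x] D_def sum_distrib_right)
      finally show ?thesis .
    qed
    then have "young lam T = cscale c (young lam z)" by (simp add: fun_eq_iff cscale_apply)
    then have "young lam (T - cscale c z) = 0"
      by (simp add: fsp.linear_diff[OF clinear_young] fsp.linear_scale[OF clinear_young])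
    moreover have "T - cscale c z \<in> schur lam"
      using \<open>T \<in> U\<close> U(2) z by (intro fs.subspace_diff fs.subspace_scale subspace_schur) auto
    ultimately have "T = cscale c z" using young_nonzero_on_schur[OF fin order.refl] by fastforce
    then have "z = cscale (1 / c) T" using w0 by (auto simp: c_def cscale_def)
    then show "z \<in> U" using fs.subspace_scale[OF U(1) \<open>T \<in> U\<close>] by simp
  qed
qed (rule U(2))

section \<open>Contractions with skew words\<close>

definition skew :: "(nat \<Rightarrow> nat) \<Rightarrow> (nat \<Rightarrow> nat) \<Rightarrow> (nat \<times> nat) set"
  where "skew lam0 lam1 = diagram lam1 - diagram lam0"

definition skew_words :: "(nat \<Rightarrow> nat) \<Rightarrow> (nat \<Rightarrow> nat) \<Rightarrow> 'v filling set"
  where "skew_words lam0 lam1 = (skew lam0 lam1 \<rightarrow>\<^sub>E UNIV)"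

definition glue :: "(nat \<Rightarrow> nat) \<Rightarrow> 'v filling \<Rightarrow> 'v filling \<Rightarrow> 'v filling"
  where "glue lam0 w v = (\<lambda>b. if b \<in> diagram lam0 then w b else v b)"

text \<open>Pairing the tensor factors outside the smaller diagram with the dual basis vectors given
  by \<open>v\<close>.\<close>

definition contract :: "(nat \<Rightarrow> nat) \<Rightarrow> 'v filling \<Rightarrow> ('v filling \<Rightarrow> 'a::zero) \<Rightarrow> 'v filling \<Rightarrow> 'a"
  where "contract lam0 v t = (\<lambda>w. if w \<in> words lam0 then t (glue lam0 w v) else 0)"

lemma bij_glue:
  assumes "lam0 \<le> lam1"
  shows "bij_betw (\<lambda>(w, v). glue lam0 w v) (words lam0 \<times> skew_words lam0 lam1) (words lam1)"
proof (rule bij_betw_byWitness[where f'="\<lambda>u. (restrict u (diagram lam0), restrict u (skew lam0 lam1))"])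
  note D = group_mono(1)[OF assms]
  show "\<forall>wv\<in>words lam0 \<times> skew_words lam0 lam1. (restrict (case wv of (w, v) \<Rightarrow> glue lam0 w v) (diagram lam0),
      restrict (case wv of (w, v) \<Rightarrow> glue lam0 w v) (skew lam0 lam1)) = wv"
    by (auto simp: words_def skew_words_def glue_def skew_def PiE_def extensional_def fun_eq_iff)
  show "\<forall>u\<in>words lam1. (case (restrict u (diagram lam0), restrict u (skew lam0 lam1)) of (w, v) \<Rightarrow> glue lam0 w v) = u"
    using D by (auto simp: words_def skew_words_def glue_def skew_def PiE_def extensional_def fun_eq_iff)
  show "(\<lambda>(w, v). glue lam0 w v) ` (words lam0 \<times> skew_words lam0 lam1) \<subseteq> words lam1"
    using D by (auto simp: words_def skew_words_def glue_def skew_def PiE_def extensional_def)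
  show "(\<lambda>u. (restrict u (diagram lam0), restrict u (skew lam0 lam1))) ` words lam1 \<subseteq> words lam0 \<times> skew_words lam0 lam1"
    by (auto simp: words_def skew_words_def)
qed

lemma glue_in_words:
  "lam0 \<le> lam1 \<Longrightarrow> w \<in> words lam0 \<Longrightarrow> v \<in> skew_words lam0 lam1 \<Longrightarrow> glue lam0 w v \<in> words lam1"
  using bij_betw_imp_surj_on[OF bij_glue] by blast

lemma sum_words_split:
  assumes "lam0 \<le> lam1"
  shows "(\<Sum>u\<in>words lam1. f u) = (\<Sum>w\<in>words lam0. \<Sum>v\<in>skew_words lam0 lam1. f (glue lam0 w v))"
  using sum.reindex_bij_betw[OF bij_glue[OF assms], of f] by (simp add: sum.cartesian_product case_prod_beta)

lemma prod_diagram_split: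
  assumes "finite (diagram lam1)" "lam0 \<le> lam1"
  shows "(\<Prod>b\<in>diagram lam1. F b (glue lam0 w v b) (glue lam0 w' v' b)) =
    (\<Prod>b\<in>diagram lam0. F b (w b) (w' b)) * (\<Prod>b\<in>skew lam0 lam1. F b (v b) (v' b))"
proof -
  have "(\<Prod>b\<in>diagram lam1. F b (glue lam0 w v b) (glue lam0 w' v' b)) =
      (\<Prod>b\<in>skew lam0 lam1. F b (glue lam0 w v b) (glue lam0 w' v' b)) *
      (\<Prod>b\<in>diagram lam0. F b (glue lam0 w v b) (glue lam0 w' v' b))"
    unfolding skew_def by (rule prod.subset_diff[OF group_mono(1)[OF assms(2)] assms(1)])
  also have "\<dots> = (\<Prod>b\<in>skew lam0 lam1. F b (v b) (v' b)) * (\<Prod>b\<in>diagram lam0. F b (w b) (w' b))"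
    by (intro arg_cong2[where f="(*)"] prod.cong refl) (auto simp: glue_def skew_def)
  finally show ?thesis by (simp add: mult.commute)
qed

text \<open>The matrix entries at the boxes of the skew shape factor out of the product.
  Contractions are thus equivariant up to mixing the words \<open>v\<close> by the tensor power on
  the skew boxes, the matrix called \<open>\<mu>\<close> in the abstract argument.\<close>

lemma contract_tensor_act:
  fixes t :: "'v::finite filling \<Rightarrow> 'a::comm_ring_1"
  assumes "finite (diagram lam1)" "lam0 \<le> lam1" "v \<in> skew_words lam0 lam1"
  shows "contract lam0 v (tensor_act (diagram lam1) A t) =
    tensor_act (diagram lam0) A (\<lambda>w. \<Sum>v'\<in>skew_words lam0 lam1.
      (\<Prod>b\<in>skew lam0 lam1. A (v b) (v' b)) * contract lam0 v' t w)"
proof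
  fix w
  show "contract lam0 v (tensor_act (diagram lam1) A t) w =
    tensor_act (diagram lam0) A (\<lambda>w. \<Sum>v'\<in>skew_words lam0 lam1.
      (\<Prod>b\<in>skew lam0 lam1. A (v b) (v' b)) * contract lam0 v' t w) w"
  proof (cases "w \<in> words lam0")
    case True
    have "contract lam0 v (tensor_act (diagram lam1) A t) w =
        (\<Sum>u\<in>words lam1. (\<Prod>b\<in>diagram lam1. A (glue lam0 w v b) (u b)) * t u)"
      using True glue_in_words[OF assms(2) True assms(3)] by (simp add: contract_def tensor_act_def words_def)
    also have "\<dots> = (\<Sum>w'\<in>words lam0. \<Sum>v'\<in>skew_words lam0 lam1.
        (\<Prod>b\<in>diagram lam0. A (w b) (w' b)) * ((\<Prod>b\<in>skew lam0 lam1. A (v b) (v' b)) * t (glue lam0 w' v')))"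
      unfolding sum_words_split[OF assms(2)] prod_diagram_split[OF assms(1,2), of "\<lambda>_. A"] by (simp add: mult.assoc)
    also have "\<dots> = (\<Sum>w'\<in>words lam0. (\<Prod>b\<in>diagram lam0. A (w b) (w' b)) * (\<Sum>v'\<in>skew_words lam0 lam1.
        (\<Prod>b\<in>skew lam0 lam1. A (v b) (v' b)) * contract lam0 v' t w'))"
      by (intro sum.cong refl) (simp add: contract_def sum_distrib_left)
    finally show ?thesis using True by (simp add: tensor_act_def words_def)
  qed (simp add: contract_def tensor_act_def words_def)
qed

lemma clinear_contract: "clinear (contract lam0 v)"
  by (rule clinearI) (auto simp: contract_def fun_eq_iff pointwise)

text \<open>Permutations of the smaller diagram fix the boxes of the skew shape, so symmetrizing
  before or after contracting makes no difference.\<close>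

lemma young_glue:
  assumes "w \<in> words lam0"
  shows "young lam0 (contract lam0 v t) w = young lam0 t (glue lam0 w v)"
  unfolding young_eq
proof (intro sum.cong refl)
  fix p q assume "p \<in> row_group lam0" "q \<in> column_group lam0"
  then have pq: "p permutes diagram lam0" "q permutes diagram lam0" by (simp_all add: row_groupD column_groupD)
  have w: "w \<circ> p \<circ> q \<in> words lam0"
    using comp_permutes_word[OF pq(1), of w] comp_permutes_word[OF pq(2), of "w \<circ> p"] assms
    by (simp add: words_def)
  have "glue lam0 (w \<circ> p \<circ> q) v = glue lam0 w v \<circ> p \<circ> q"
  proof
    fix b show "glue lam0 (w \<circ> p \<circ> q) v b = (glue lam0 w v \<circ> p \<circ> q) b"
    proof (cases "b \<in> diagram lam0")
      case True
      then have "p (q b) \<in> diagram lam0" using permutes_in_image[OF pq(1)] permutes_in_image[OF pq(2)] by simp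
      then show ?thesis using True by (simp add: glue_def)
    next
      case False
      then have "p (q b) = b" using permutes_not_in[OF pq(1)] permutes_not_in[OF pq(2)] by simp
      then show ?thesis using False by (simp add: glue_def)
    qed
  qed
  then show "of_int (sign q) * contract lam0 v t (w \<circ> p \<circ> q) = of_int (sign q) * t (glue lam0 w v \<circ> p \<circ> q)"
    using w by (simp add: contract_def)
qed

text \<open>For the word that puts the same basis vector along each row and different ones in
  different rows, row permutations do nothing and no column permutation but the identity fixes it.
  The symmetrized word has itself as coefficient the order of the row group. Having at most as many
  rows as the dimension of \<open>V\<close> is essential.\<close>

lemma schur_nonzero:
  assumes "partition_at_most k lam" "CARD('v::finite) = k"
  shows "schur lam \<noteq> {0 :: 'v filling \<Rightarrow> complex}"
proof -
  note fin = finite_diagram[OF assms(1)]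
  obtain e :: "nat \<Rightarrow> 'v" where e: "bij_betw e {..<k} UNIV"
    using ex_bij_betw_nat_finite[of "UNIV :: 'v set"] assms(2) by (auto simp: atLeast0LessThan)
  define w where "w = (\<lambda>b\<in>diagram lam. e (fst b))"
  have row: "fst b < k" if "b \<in> diagram lam" for b
    using that assms(1) by (auto simp: diagram_def partition_at_most_def) (metis not_less not_less_zero)
  have ww: "w \<in> words lam" by (simp add: w_def words_def)
  have "young lam (unit_fun w) w = (\<Sum>p\<in>row_group lam. \<Sum>q\<in>column_group lam. if q = id then 1 else 0)"
    unfolding young_eq
  proof (intro sum.cong refl)
    fix p q assume p: "p \<in> row_group lam" and q: "q \<in> column_group lam"
    note pp = row_groupD[OF p] and qq = column_groupD[OF q]
    have val: "(w \<circ> p \<circ> q) b = e (fst (q b))" if "b \<in> diagram lam" for b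
      using that permutes_in_image[OF pp(1)] permutes_in_image[OF qq(1)] pp(2) by (simp add: w_def)
    have "w \<circ> p \<circ> q = w \<longleftrightarrow> q = id"
    proof
      assume eq: "w \<circ> p \<circ> q = w"
      have "q b = b" for b
      proof (cases "b \<in> diagram lam")
        case True
        have "w b = e (fst b)" using True by (simp add: w_def)
        then have "e (fst (q b)) = e (fst b)" using val[OF True] by (simp only: eq)
        moreover have "q b \<in> diagram lam" using True permutes_in_image[OF qq(1)] by simp
        ultimately have "fst (q b) = fst b"
          using e row True by (auto simp: bij_betw_def inj_on_def)
        then show ?thesis using qq(2) by (simp add: prod_eq_iff)
      qed (simp add: permutes_not_in[OF qq(1)])
      then show "q = id" by auto
    next
      assume "q = id"
      moreover have "w \<circ> p \<in> words lam" using comp_permutes_word[OF pp(1), of w] ww by (simp add: words_def)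
      moreover have "(w \<circ> p \<circ> q) b = w b" if "b \<in> diagram lam" for b
      proof -
        have "w b = e (fst b)" using that by (simp add: w_def)
        then show ?thesis using val[OF that] \<open>q = id\<close> by (simp only: id_apply)
      qed
      ultimately show "w \<circ> p \<circ> q = w"
        using ww unfolding words_def by (intro PiE_ext[of "w \<circ> p \<circ> q" "diagram lam" "\<lambda>_. UNIV" w]) simp_all
    qed
    then show "of_int (sign q) * unit_fun w (w \<circ> p \<circ> q) = (if q = id then 1 else 0 :: complex)"
      by (simp add: unit_fun_def)
  qed
  also have "\<dots> = of_nat (card (row_group lam))"
    using signed_group.finite_group[OF column_signed_group[OF fin]] signed_group.id_mem[OF column_signed_group[OF fin]]
    by simp
  also have "\<dots> \<noteq> 0"
    using signed_group.finite_group[OF row_signed_group[OF fin]] signed_group.id_mem[OF row_signed_group[OF fin]]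
    by auto
  finally have "young lam (unit_fun w) \<noteq> 0" by (auto simp: pointwise)
  moreover have "young lam (unit_fun w) \<in> schur lam"
    using ww by (auto simp: schur_eq supported_def unit_fun_def)
  ultimately show ?thesis by auto
qed

lemma schur_tensor_act:
  assumes "x \<in> schur lam"
  shows "tensor_act (diagram lam) A x \<in> schur lam"
proof -
  obtain t where t: "x = young lam t" using assms by (auto simp: schur_eq)
  have "tensor_act (diagram lam) A x = young lam (tensor_act (diagram lam) A t)"
    unfolding t by (rule ext) (rule tensor_act_young)
  moreover have "tensor_act (diagram lam) A t \<in> supported (words lam)"
    by (simp add: supported_def tensor_act_def words_def)
  ultimately show ?thesis by (simp add: schur_eq)
qed

lemma tensor_act_inverse:
  fixes g h :: "complex ^ 'v::finite ^ 'v"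
  assumes "finite D" "g ** h = Finite_Cartesian_Product.mat 1" "\<And>w. w \<notin> D \<rightarrow>\<^sub>E UNIV \<Longrightarrow> t w = 0"
  shows "tensor_act D (\<lambda>i j. g $ i $ j) (tensor_act D (\<lambda>i j. h $ i $ j) t) = t"
proof -
  have "(\<Sum>l\<in>UNIV. g $ i $ l * h $ l $ j) = (if i = j then 1 else 0)" for i j
    using assms(2) by (simp add: matrix_matrix_mult_def Finite_Cartesian_Product.mat_def vec_eq_iff)
  then show ?thesis by (simp add: tensor_act_comp[OF assms(1)] tensor_act_id[OF assms(1,3)])
qed

text \<open>Tensor powers of inverse matrices are inverse, read off at a basis word. This inverts
  the matrix by which a group element mixes the contractions.\<close>

lemma skew_power_inverse:
  fixes g h :: "complex ^ 'v::finite ^ 'v"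
  assumes "finite S" "g ** h = Finite_Cartesian_Product.mat 1" "u \<in> S \<rightarrow>\<^sub>E UNIV" "v \<in> S \<rightarrow>\<^sub>E UNIV"
  shows "(\<Sum>w\<in>S \<rightarrow>\<^sub>E UNIV. (\<Prod>b\<in>S. g $ u b $ w b) * (\<Prod>b\<in>S. h $ w b $ v b)) = (if u = v then 1 else 0)"
proof -
  have "tensor_act S (\<lambda>i j. g $ i $ j) (tensor_act S (\<lambda>i j. h $ i $ j) (unit_fun v)) u = unit_fun v u"
  proof -
    have "unit_fun v w = 0" if "w \<notin> S \<rightarrow>\<^sub>E UNIV" for w using assms(4) that by (auto simp: unit_fun_def)
    from fun_cong[OF tensor_act_inverse[OF assms(1,2) this]] show ?thesis .
  qed
  moreover have "tensor_act S (\<lambda>i j. h $ i $ j) (unit_fun v) w = (\<Prod>b\<in>S. h $ w b $ v b)"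
    if "w \<in> S \<rightarrow>\<^sub>E UNIV" for w
  proof -
    have "tensor_act S (\<lambda>i j. h $ i $ j) (unit_fun v) w =
        (\<Sum>u\<in>S \<rightarrow>\<^sub>E UNIV. if u = v then \<Prod>b\<in>S. h $ w b $ u b else 0)"
      using that unfolding tensor_act_def by (simp add: unit_fun_def if_distrib cong: if_cong)
    then show ?thesis using assms(1,4) by (simp add: finite_PiE)
  qed
  ultimately show ?thesis using assms(3) by (simp add: tensor_act_def unit_fun_def)
qed

text \<open>The abstract blow-up theorem for the family of symmetrized contractions. Its target is
  all of the smaller Schur functor: the contractions have an invariant image, and this image is
  nonzero by \<open>young_young_zero\<close>, so irreducibility applies to it.\<close>

theorem skew_blowup_injective:
  fixes lam0 lam1 :: "nat \<Rightarrow> nat"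
  assumes card: "CARD('v::finite) = k" and part: "partition_at_most k lam0" "partition_at_most k lam1"
    and le: "lam0 \<le> lam1"
  shows "\<exists>p q (\<gamma> :: nat \<times> nat \<times> 'v filling \<Rightarrow> complex). p > 0 \<and> q > 0 \<and>
    p * fs.dim (schur lam1 :: ('v filling \<Rightarrow> complex) set) = q * fs.dim (schur lam0 :: ('v filling \<Rightarrow> complex) set) \<and>
    (\<forall>x. (\<forall>m<p. x m \<in> schur lam1) \<longrightarrow>
      (\<forall>n<q. \<forall>w\<in>words lam0. (\<Sum>(m, v)\<in>{..<p} \<times> skew_words lam0 lam1.
         \<gamma> (n, m, v) * young lam0 (contract lam0 v (x m)) w) = 0) \<longrightarrow> (\<forall>m<p. x m = 0))"
proof -
  note fin0 = finite_diagram[OF part(1)] and fin1 = finite_diagram[OF part(2)]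
  let ?D0 = "diagram lam0" and ?D1 = "diagram lam1" and ?S = "skew lam0 lam1"
  define U where "U = (skew_words lam0 lam1 :: 'v filling set)"
  \<comment> \<open>The matrix, in the basis of words, of contraction with \<open>v\<close> followed
    by symmetrization.\<close>
  define \<Lambda> where "\<Lambda> v j i = young lam0 (contract lam0 v (unit_fun i)) j" for v i j :: "'v filling"
  have finS: "finite ?S" using fin1 by (simp add: skew_def)
  have finU: "finite U" using finS by (auto simp: U_def skew_words_def intro: finite_PiE)
  interpret matrix_family "words lam1 :: 'v filling set" "words lam0 :: 'v filling set" U \<Lambda>
  proof
    show "\<Lambda> v j i = 0" if "j \<notin> words lam0" for v i j
      unfolding \<Lambda>_def by (rule young_supported[OF fin0 _ that]) (simp add: contract_def)
  qed (use finite_words fin0 fin1 finU in auto)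
  have app: "app v x = young lam0 (contract lam0 v x)" if "x \<in> supported (words lam1)" for v x
  proof -
    have "young lam0 (contract lam0 v x) =
        (\<Sum>i\<in>words lam1. cscale (x i) (young lam0 (contract lam0 v (unit_fun i))))"
      by (subst supported_sum_unit_fun[OF finite_words[OF fin1] that])
         (simp add: fsp.linear_sum[OF clinear_contract] fsp.linear_scale[OF clinear_contract]
            fsp.linear_sum[OF clinear_young] fsp.linear_scale[OF clinear_young])
    then show ?thesis by (auto simp: app_def \<Lambda>_def pointwise mult.commute)
  qed
  define A where "A = (schur lam1 :: ('v filling \<Rightarrow> complex) set)"
  have A: "A \<subseteq> supported (words lam1)" "fs.subspace A"
    using schur_supported[OF fin1] subspace_schur by (auto simp: A_def)
  define gA where "gA g = tensor_act ?D1 (\<lambda>i j. g $ i $ j)" for g :: "complex ^ 'v ^ 'v"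
  define gB where "gB g = tensor_act ?D0 (\<lambda>i j. g $ i $ j)" for g :: "complex ^ 'v ^ 'v"
  define \<mu> where "\<mu> g v v' = (\<Prod>b\<in>?S. g $ v b $ v' b)" for g :: "complex ^ 'v ^ 'v" and v v' :: "'v filling"
  define \<G> where "\<G> = {g :: complex ^ 'v ^ 'v. invertible g}"
  have gAA: "gA g x \<in> A" if "x \<in> A" for g x
    using schur_tensor_act that by (auto simp: A_def gA_def)
  have equiv: "app u (gA g x) = gB g (\<Sum>v\<in>U. cscale (\<mu> g u v) (app v x))"
    if "u \<in> U" "x \<in> A" for g u x
  proof -
    have xs: "x \<in> supported (words lam1)" "gA g x \<in> supported (words lam1)" using A(1) that gAA by blast+
    have sum_eq: "(\<lambda>w. \<Sum>v\<in>U. \<mu> g u v * contract lam0 v x w) = (\<Sum>v\<in>U. cscale (\<mu> g u v) (contract lam0 v x))"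
      by (auto simp: pointwise)
    have "contract lam0 u (gA g x) = tensor_act ?D0 (\<lambda>i j. g $ i $ j)
        (\<lambda>w. \<Sum>v\<in>U. \<mu> g u v * contract lam0 v x w)"
      unfolding gA_def \<mu>_def U_def by (rule contract_tensor_act[OF fin1 le]) (use that(1) in \<open>simp add: U_def\<close>)
    then have "app u (gA g x) = young lam0 (tensor_act ?D0 (\<lambda>i j. g $ i $ j)
        (\<Sum>v\<in>U. cscale (\<mu> g u v) (contract lam0 v x)))"
      by (simp only: app[OF xs(2)] sum_eq)
    also have "\<dots> = gB g (young lam0 (\<Sum>v\<in>U. cscale (\<mu> g u v) (contract lam0 v x)))"
      by (simp add: fun_eq_iff tensor_act_young gB_def)
    also have "\<dots> = gB g (\<Sum>v\<in>U. cscale (\<mu> g u v) (app v x))"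
      by (simp add: app[OF xs(1)] fsp.linear_sum[OF clinear_young] fsp.linear_scale[OF clinear_young])
    finally show ?thesis .
  qed
  have mi: "g ** matrix_inv g = Finite_Cartesian_Product.mat 1" "matrix_inv g ** g = Finite_Cartesian_Product.mat 1"
    "matrix_inv g \<in> \<G>" if "g \<in> \<G>" for g
  proof -
    have "invertible g" using that by (simp add: \<G>_def)
    then show "g ** matrix_inv g = Finite_Cartesian_Product.mat 1" "matrix_inv g ** g = Finite_Cartesian_Product.mat 1"
      using someI_ex[of "\<lambda>h. g ** h = Finite_Cartesian_Product.mat 1 \<and> h ** g = Finite_Cartesian_Product.mat 1"]
      unfolding matrix_inv_def invertible_def by blast+
    then show "matrix_inv g \<in> \<G>" unfolding \<G>_def invertible_def by blast
  qed
  have inverse: "(\<Sum>w\<in>U. \<mu> (matrix_inv g) u w * \<mu> g w v) = (if u = v then 1 else 0)"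
    if "g \<in> \<G>" "u \<in> U" "v \<in> U" for g u v
    unfolding \<mu>_def U_def skew_words_def
    by (rule skew_power_inverse[OF finS mi(2)[OF that(1)]]) (use that in \<open>simp_all add: U_def skew_words_def\<close>)
  have linA: "clinear (gA g)" and linB: "clinear (gB g)" for g
    by (simp_all add: gA_def gB_def clinear_tensor_act)
  have imgA: "img A = schur lam0"
  proof (rule schur_irreducible[OF fin0 subspace_img])
    show "img A \<subseteq> schur lam0"
      unfolding img_def
    proof (rule fs.span_minimal[OF _ subspace_schur], clarify)
      fix u x assume "u \<in> U" "x \<in> A"
      then have "app u x = young lam0 (contract lam0 u x)" using A(1) app by blast
      moreover have "contract lam0 u x \<in> supported (words lam0)" by (simp add: supported_def contract_def)
      ultimately show "app u x \<in> schur lam0" by (simp add: schur_eq)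
    qed
    show "img A \<noteq> {0}"
    proof -
      obtain x where x: "x \<in> A" "x \<noteq> 0"
        using schur_nonzero[OF part(2) card] fs.subspace_0[OF A(2)] by (auto simp: A_def)
      \<comment> \<open>The symmetrizer of the smaller shape does not kill \<open>x\<close>;
        splitting a word at which this shows into its two parts exhibits the contraction that does
        not vanish.\<close>
      have "young lam0 x \<noteq> 0" using young_nonzero_on_schur[OF fin1 le] x by (auto simp: A_def)
      then obtain w1 where w1: "young lam0 x w1 \<noteq> 0" by (auto simp: fun_eq_iff pointwise)
      have "w1 \<in> words lam1"
      proof (rule ccontr)
        assume nw: "w1 \<notin> words lam1"
        have "x (w1 \<circ> p \<circ> q) = 0" if "p \<in> row_group lam0" "q \<in> column_group lam0" for p q
        proof -
          have pq: "p permutes ?D1" "q permutes ?D1"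
            using row_groupD(1)[OF that(1)] column_groupD(1)[OF that(2)] permutes_subset group_mono(1)[OF le] by blast+
          have "w1 \<circ> p \<circ> q \<notin> words lam1"
            using nw comp_permutes_word[OF pq(1), of w1] comp_permutes_word[OF pq(2), of "w1 \<circ> p"]
            by (simp add: words_def)
          then show ?thesis using x(1) A(1) by (auto simp: supported_def)
        qed
        then have "young lam0 x w1 = 0" by (simp add: young_eq)
        then show False using w1 by simp
      qed
      then have "w1 \<in> (\<lambda>(w, v). glue lam0 w v) ` (words lam0 \<times> U)"
        unfolding U_def bij_betw_imp_surj_on[OF bij_glue[OF le]] .
      then obtain y where "w1 = (\<lambda>(w, v). glue lam0 w v) y" "y \<in> words lam0 \<times> U" by (rule imageE)
      moreover define w v where "w = fst y" and "v = snd y"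
      ultimately have wv: "w \<in> words lam0" "v \<in> U" "w1 = glue lam0 w v" by (simp_all add: case_prod_beta mem_Times_iff)
      have "app v x w \<noteq> 0"
        using w1 young_glue[OF wv(1), of v x] app[of x v] x(1) A(1) wv(3) by auto
      then have "app v x \<noteq> 0" by (auto simp: pointwise)
      then show ?thesis using app_in_img[OF wv(2) x(1)] by auto
    qed
    show "tensor_act ?D0 (\<lambda>i j. g $ i $ j) y \<in> img A" if g: "invertible g" and y: "y \<in> img A"
      for g :: "complex ^ 'v ^ 'v" and y
    proof -
      have gG: "g \<in> \<G>" using g by (simp add: \<G>_def)
      have "gB g (app v x) \<in> img A" if v: "v \<in> U" and x: "x \<in> A" for v x
      proof -
        \<comment> \<open>Equivariance expresses \<open>app u (gA g x)\<close> by translates of all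
          contractions; inverting \<open>\<mu>\<close> isolates the translate of a single one and so
          shows invariance of the image.\<close>
        have "(\<Sum>u\<in>U. cscale (\<mu> (matrix_inv g) v u) (\<Sum>w\<in>U. cscale (\<mu> g u w) (app w x))) = app v x"
        proof
          fix j
          have "(\<Sum>u\<in>U. cscale (\<mu> (matrix_inv g) v u) (\<Sum>w\<in>U. cscale (\<mu> g u w) (app w x))) j =
              (\<Sum>w\<in>U. (\<Sum>u\<in>U. \<mu> (matrix_inv g) v u * \<mu> g u w) * app w x j)"
            unfolding pointwise sum_distrib_left sum_distrib_right by (subst sum.swap) (simp add: mult.assoc)
          also have "\<dots> = (\<Sum>w\<in>U. if v = w then app w x j else 0)"
            using inverse[OF gG v] by (intro sum.cong) auto
          finally show "(\<Sum>u\<in>U. cscale (\<mu> (matrix_inv g) v u) (\<Sum>w\<in>U. cscale (\<mu> g u w) (app w x))) j = app v x j"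
            using finU v by simp
        qed
        then have "gB g (app v x) = (\<Sum>u\<in>U. cscale (\<mu> (matrix_inv g) v u) (app u (gA g x)))"
          using equiv[OF _ x, of _ g] by (simp add: fsp.linear_sum[OF linB] fsp.linear_scale[OF linB] cong: sum.cong flip: \<open>_ = app v x\<close>)
        also have "\<dots> \<in> img A"
          by (intro fs.subspace_sum subspace_img fs.subspace_scale app_in_img gAA x)
        finally show ?thesis .
      qed
      then have "gB g ` (\<Union>u\<in>U. app u ` A) \<subseteq> img A" by blast
      then have "fs.span (gB g ` (\<Union>u\<in>U. app u ` A)) \<subseteq> img A"
        by (intro fs.span_minimal subspace_img)
      moreover have "gB g y \<in> fs.span (gB g ` (\<Union>u\<in>U. app u ` A))"
        using fsp.linear_span_image[OF linB, of g "\<Union>u\<in>U. app u ` A"] y by (auto simp: img_def)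
      ultimately show ?thesis by (auto simp: gB_def)
    qed
  qed
  have inv_gA: "gA (matrix_inv g) (gA g x) = x" if "g \<in> \<G>" "x \<in> A" for g x
    unfolding gA_def using A(1) that(2)
    by (intro tensor_act_inverse[OF fin1 mi(2)[OF that(1)]]) (auto simp: supported_def words_def)
  have inv_gB: "gB (matrix_inv g) (gB g y) = y" if "g \<in> \<G>" "y \<in> supported (words lam0)" for g y
    unfolding gB_def using that(2)
    by (intro tensor_act_inverse[OF fin0 mi(2)[OF that(1)]]) (auto simp: supported_def words_def)
  have "\<exists>p q \<gamma>. p > 0 \<and> q > 0 \<and> p * fs.dim A = q * fs.dim (img A) \<and>
    (\<forall>x. (\<forall>m<p. x m \<in> A) \<longrightarrow> (\<forall>n<q. \<forall>j\<in>words lam0. blowup p \<gamma> x n j = 0) \<longrightarrow> (\<forall>m<p. x m = 0))"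
  proof (rule generic_blowup_injective[of A \<G> gA gB \<mu> "\<lambda>g. \<mu> (matrix_inv g)"])
    show "img A \<noteq> {0}" using imgA schur_nonzero[OF part(1) card] by simp
    show "x = 0" if "g \<in> \<G>" "x \<in> A" "gA g x = 0" for g x
      using inv_gA[OF that(1,2)] that(3) fsp.linear_0[OF linA] by metis
    show "y = 0" if "g \<in> \<G>" "y \<in> supported (words lam0)" "gB g y = 0" for g y
      using inv_gB[OF that(1,2)] that(3) fsp.linear_0[OF linB] by metis
    show "gB g y \<in> supported (words lam0)" for g y
      by (simp add: gB_def supported_def tensor_act_def words_def)
    show "\<exists>f\<in>\<G>. \<forall>x\<in>A. gA g (gA h x) = gA f x" if "g \<in> \<G>" "h \<in> \<G>" for g h
    proof (intro bexI ballI)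
      show "g ** h \<in> \<G>" using that by (simp add: \<G>_def invertible_mult)
      show "gA g (gA h x) = gA (g ** h) x" for x
        by (simp add: gA_def tensor_act_comp[OF fin1] matrix_matrix_mult_def)
    qed
    show "\<exists>g\<in>\<G>. \<forall>x\<in>A. gA g x = x"
    proof (intro bexI ballI)
      show "Finite_Cartesian_Product.mat 1 \<in> \<G>" by (simp add: \<G>_def invertible_def)
      show "gA (Finite_Cartesian_Product.mat 1) x = x" if "x \<in> A" for x
      proof -
        have "x w = 0" if "w \<notin> ?D1 \<rightarrow>\<^sub>E UNIV" for w
          using that A(1) \<open>x \<in> A\<close> by (auto simp: supported_def words_def)
        then show ?thesis
          using tensor_act_id[OF fin1, of x] by (simp add: gA_def Finite_Cartesian_Product.mat_def)
      qed
    qed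
    show "K = A" if "fs.subspace K" "K \<subseteq> A" "K \<noteq> {0}" "\<And>g x. g \<in> \<G> \<Longrightarrow> x \<in> K \<Longrightarrow> gA g x \<in> K" for K
      unfolding A_def
      by (rule schur_irreducible[OF fin1 that(1) _ that(3)]) (use that(2,4) in \<open>auto simp: A_def \<G>_def gA_def\<close>)
  qed (use A linA linB gAA equiv inverse in auto)
  then obtain p q \<gamma> where pq: "p > 0" "q > 0" "p * fs.dim A = q * fs.dim (img A)"
    and inj: "\<And>x. (\<forall>m<p. x m \<in> A) \<Longrightarrow> (\<forall>n<q. \<forall>j\<in>words lam0. blowup p \<gamma> x n j = 0) \<Longrightarrow> (\<forall>m<p. x m = 0)"
    by blast
  have blow: "blowup p \<gamma> x n w = (\<Sum>(m, v)\<in>{..<p} \<times> skew_words lam0 lam1.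
      \<gamma> (n, m, v) * young lam0 (contract lam0 v (x m)) w)" if x: "\<forall>m<p. x m \<in> schur lam1" for x n w
  proof -
    have "x m \<in> supported (words lam1)" if "m < p" for m
      using that x A(1) by (auto simp: A_def)
    then show ?thesis
      unfolding blowup_def U_def[symmetric] by (intro sum.cong refl) (auto simp: app)
  qed
  have "\<forall>x. (\<forall>m<p. x m \<in> schur lam1) \<longrightarrow>
      (\<forall>n<q. \<forall>w\<in>words lam0. (\<Sum>(m, v)\<in>{..<p} \<times> skew_words lam0 lam1.
         \<gamma> (n, m, v) * young lam0 (contract lam0 v (x m)) w) = 0) \<longrightarrow> (\<forall>m<p. x m = 0)"
  proof (intro allI impI)
    fix x m
    assume x: "\<forall>m<p. x m \<in> schur lam1" and z: "\<forall>n<q. \<forall>w\<in>words lam0. (\<Sum>(m, v)\<in>{..<p} \<times> skew_words lam0 lam1.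
         \<gamma> (n, m, v) * young lam0 (contract lam0 v (x m)) w) = 0" and m: "m < p"
    from z have "\<forall>n<q. \<forall>j\<in>words lam0. blowup p \<gamma> x n j = 0" unfolding blow[OF x] .
    then show "x m = 0" using inj[of x] x m unfolding A_def by blast
  qed
  moreover have "p * fs.dim (schur lam1 :: ('v filling \<Rightarrow> complex) set) = q * fs.dim (schur lam0 :: ('v filling \<Rightarrow> complex) set)"
    using pq(3)[unfolded imgA] unfolding A_def .
  ultimately show ?thesis using pq(1,2) by blast
qed

section \<open>Polynomial rings and substitution\<close>

lemma mpoly_sum_monomials:
  "(p :: 'x mpoly) = (\<Sum>m\<in>Poly_Mapping.keys p. Poly_Mapping.single m (Poly_Mapping.lookup p m))"
proof (rule poly_mapping_eqI)
  fix k
  have "Poly_Mapping.lookup (\<Sum>m\<in>Poly_Mapping.keys p. Poly_Mapping.single m (Poly_Mapping.lookup p m)) k =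
      (\<Sum>m\<in>Poly_Mapping.keys p. if k = m then Poly_Mapping.lookup p m else 0)"
    by (auto simp: lookup_sum lookup_single when_def intro!: sum.cong)
  also have "\<dots> = Poly_Mapping.lookup p k" by (simp add: in_keys_iff)
  finally show "Poly_Mapping.lookup p k = Poly_Mapping.lookup
      (\<Sum>m\<in>Poly_Mapping.keys p. Poly_Mapping.single m (Poly_Mapping.lookup p m)) k" by simp
qed

lemma Const_zero: "Const 0 = 0" and Const_one: "Const 1 = 1"
  and Const_add: "Const (a + b) = Const a + Const b" and Const_mult: "Const (a * b) = Const a * Const b"
  by (simp_all add: Const_def single_add mult_single)

lemma Const_minus: "Const (- a) = - Const a"
  using Const_add[of a "- a"] by (simp add: Const_zero eq_neg_iff_add_eq_0 add.commute)

lemma Const_sum: "Const (\<Sum>a\<in>A. f a) = (\<Sum>a\<in>A. Const (f a))"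
  by (induction A rule: infinite_finite_induct) (auto simp: Const_zero Const_add)

lemma Const_prod: "Const (\<Prod>a\<in>A. f a) = (\<Prod>a\<in>A. Const (f a))"
  by (induction A rule: infinite_finite_induct) (auto simp: Const_one Const_mult)

lemma Const_of_nat: "Const (of_nat k) = of_nat k"
  by (induction k) (auto simp: Const_zero Const_one Const_add)

lemma Const_of_int: "Const (of_int n) = of_int n"
proof (cases n)
  case (neg k)
  show ?thesis by (simp only: neg of_int_minus of_int_of_nat_eq Const_minus Const_of_nat)
qed (simp add: Const_of_nat)

lemma mpoly_induct [case_names Const Var add mult]:
  assumes const: "\<And>c. P (Const c)" and var: "\<And>x. P (Var x)"
    and add: "\<And>p q. P p \<Longrightarrow> P q \<Longrightarrow> P (p + q)" and mult: "\<And>p q. P p \<Longrightarrow> P q \<Longrightarrow> P (p * q)"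
  shows "P (p :: 'x mpoly)"
proof -
  have one: "P 1" and zero: "P 0" using const[of 1] const[of 0] by (simp_all add: Const_one Const_zero)
  have pow: "P (Poly_Mapping.single (Poly_Mapping.single x n) 1)" for x n
  proof (induction n)
    case (Suc n)
    have "Poly_Mapping.single (Poly_Mapping.single x (Suc n)) (1::complex) =
        Var x * Poly_Mapping.single (Poly_Mapping.single x n) 1"
      by (simp add: Var_def mult_single flip: single_add)
    then show ?case using mult[OF var Suc] by simp
  qed (simp add: one)
  have mon: "P (Poly_Mapping.single m 1)" for m
  proof -
    have "P (Poly_Mapping.single (\<Sum>x\<in>S. Poly_Mapping.single x (Poly_Mapping.lookup m x)) 1)" if "finite S" for S
      using that
    proof (induction S)
      case (insert x S)
      have "Poly_Mapping.single (\<Sum>x\<in>insert x S. Poly_Mapping.single x (Poly_Mapping.lookup m x)) (1::complex) =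
          Poly_Mapping.single (Poly_Mapping.single x (Poly_Mapping.lookup m x)) 1 *
          Poly_Mapping.single (\<Sum>x\<in>S. Poly_Mapping.single x (Poly_Mapping.lookup m x)) 1"
        using insert by (simp add: mult_single)
      then show ?case using mult[OF pow insert.IH] by simp
    qed (simp add: one)
    moreover have "m = (\<Sum>x\<in>Poly_Mapping.keys m. Poly_Mapping.single x (Poly_Mapping.lookup m x))"
    proof (rule poly_mapping_eqI)
      fix k
      have "Poly_Mapping.lookup (\<Sum>x\<in>Poly_Mapping.keys m. Poly_Mapping.single x (Poly_Mapping.lookup m x)) k =
          (\<Sum>x\<in>Poly_Mapping.keys m. if k = x then Poly_Mapping.lookup m x else 0)"
        by (auto simp: lookup_sum lookup_single when_def intro!: sum.cong)
      then show "Poly_Mapping.lookup m k = Poly_Mapping.lookup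
          (\<Sum>x\<in>Poly_Mapping.keys m. Poly_Mapping.single x (Poly_Mapping.lookup m x)) k"
        by (simp add: in_keys_iff)
    qed
    ultimately show ?thesis by (metis finite_keys)
  qed
  have sing: "P (Poly_Mapping.single m c)" for m c
  proof -
    have "Poly_Mapping.single m c = Const c * Poly_Mapping.single m 1" by (simp add: Const_def mult_single)
    then show ?thesis using mult[OF const mon] by simp
  qed
  have "P (\<Sum>m\<in>S. Poly_Mapping.single m (Poly_Mapping.lookup p m))" if "finite S" for S
    using that by (induction S) (auto simp: zero intro: add sing)
  then show ?thesis by (subst mpoly_sum_monomials) simp
qed

text \<open>Evaluation at a point and the action of a group element on \<open>R\<close> are both
  substitutions along a ring map on constants; their homomorphism rules are proved once.\<close>

locale poly_substitution =
  fixes h :: "complex \<Rightarrow> 'a::comm_ring_1" and \<phi> :: "'x \<Rightarrow> 'a"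
  assumes h_one: "h 1 = 1" and h_add: "h (a + b) = h a + h b" and h_mult: "h (a * b) = h a * h b"
begin

abbreviation (input) "S \<equiv> poly_subst h \<phi>"

lemma h_zero: "h 0 = 0"
  using h_add[of 0 0] by simp

definition mon :: "('x \<Rightarrow>\<^sub>0 nat) \<Rightarrow> 'a"
  where "mon m = (\<Prod>x\<in>Poly_Mapping.keys m. \<phi> x ^ Poly_Mapping.lookup m x)"

lemma mon_superset:
  assumes "finite T" "Poly_Mapping.keys m \<subseteq> T"
  shows "mon m = (\<Prod>x\<in>T. \<phi> x ^ Poly_Mapping.lookup m x)"
  unfolding mon_def by (rule prod.mono_neutral_left) (use assms in \<open>auto simp: in_keys_iff\<close>)

lemma mon_add: "mon (m + m') = mon m * mon m'"
proof -
  let ?T = "Poly_Mapping.keys m \<union> Poly_Mapping.keys m'"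
  have "mon (m + m') = (\<Prod>x\<in>?T. \<phi> x ^ Poly_Mapping.lookup (m + m') x)"
    by (rule mon_superset) (use keys_add[of m m'] in auto)
  also have "\<dots> = mon m * mon m'"
    by (simp add: mon_superset[of ?T m] mon_superset[of ?T m'] lookup_add power_add prod.distrib)
  finally show ?thesis .
qed

lemma superset:
  assumes "finite T" "Poly_Mapping.keys p \<subseteq> T"
  shows "S p = (\<Sum>m\<in>T. h (Poly_Mapping.lookup p m) * mon m)"
  unfolding poly_subst_def mon_def[symmetric]
  by (rule sum.mono_neutral_left) (use assms in \<open>auto simp: in_keys_iff h_zero\<close>)

lemma add: "S (p + q) = S p + S q"
proof -
  let ?T = "Poly_Mapping.keys p \<union> Poly_Mapping.keys q"
  have "S (p + q) = (\<Sum>m\<in>?T. h (Poly_Mapping.lookup (p + q) m) * mon m)"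
    by (rule superset) (use keys_add[of p q] in auto)
  then show ?thesis
    by (simp add: superset[of ?T p] superset[of ?T q] lookup_add h_add distrib_right sum.distrib)
qed

lemma zero: "S 0 = 0"
  by (simp add: poly_subst_def)

lemma sum: "S (\<Sum>a\<in>A. f a) = (\<Sum>a\<in>A. S (f a))"
  by (induction A rule: infinite_finite_induct) (auto simp: zero add)

lemma single: "S (Poly_Mapping.single m c) = h c * mon m"
  using superset[of "{m}" "Poly_Mapping.single m c"] by simp

lemma Const: "S (Const c) = h c"
  by (simp add: Const_def single mon_def)

lemma Var: "S (Var x) = \<phi> x"
  by (simp add: Var_def single mon_def h_one)

lemma one: "S 1 = 1"
  using Const[of 1] by (simp add: Const_one h_one)

lemma mult: "S (p * q) = S p * S q"
proof -
  let ?s = "\<lambda>p m. Poly_Mapping.single m (Poly_Mapping.lookup p m)"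
  have "p * q = (\<Sum>m\<in>Poly_Mapping.keys p. ?s p m) * (\<Sum>m\<in>Poly_Mapping.keys q. ?s q m)"
    using mpoly_sum_monomials[of p] mpoly_sum_monomials[of q] by simp
  also have "S \<dots> = (\<Sum>m\<in>Poly_Mapping.keys p. \<Sum>m'\<in>Poly_Mapping.keys q. S (?s p m) * S (?s q m'))"
    by (simp add: sum_product sum mult_single single h_mult mon_add mult_ac)
  also have "\<dots> = S (\<Sum>m\<in>Poly_Mapping.keys p. ?s p m) * S (\<Sum>m\<in>Poly_Mapping.keys q. ?s q m)"
    by (simp add: sum sum_product)
  finally show ?thesis using mpoly_sum_monomials[of p] mpoly_sum_monomials[of q] by simp
qed

lemma minus: "S (- p) = - S p"
  using add[of p "- p"] by (simp add: zero eq_neg_iff_add_eq_0 add.commute)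

lemma prod: "S (\<Prod>a\<in>A. f a) = (\<Prod>a\<in>A. S (f a))"
  by (induction A rule: infinite_finite_induct) (auto simp: one mult)

lemma of_nat: "S (of_nat k) = of_nat k"
  by (induction k) (auto simp: zero one add)

lemma of_int: "S (of_int n) = of_int n"
proof (cases n)
  case (neg k)
  show ?thesis by (simp only: neg of_int_minus of_int_of_nat_eq minus of_nat)
qed (simp add: of_nat)

end

definition evaluate :: "('x \<Rightarrow> complex) \<Rightarrow> 'x mpoly \<Rightarrow> complex"
  where "evaluate x = poly_subst id x"

interpretation ev: poly_substitution id x
  rewrites "poly_subst id x = evaluate x"
  for x
  by unfold_locales (auto simp: evaluate_def)

lemma polyfun_evaluate: "polyfun UNIV (\<lambda>x. evaluate x (p :: 'x mpoly))"
  by (induction p rule: mpoly_induct) (auto simp: ev.Const ev.Var ev.add ev.mult intro: polyfun.intros)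

lemma evaluate_nonzero:
  fixes p :: "'x::finite mpoly"
  assumes "p \<noteq> 0"
  shows "\<exists>x. evaluate x p \<noteq> 0"
proof (rule ccontr)
  assume z: "\<not> ?thesis"
  let ?X = "Poly_Mapping.lookup ` Poly_Mapping.keys p"
  define c where "c \<alpha> = Poly_Mapping.lookup p (Poly_Mapping.Abs_poly_mapping \<alpha>)" for \<alpha>
  have inj: "inj_on Poly_Mapping.lookup (Poly_Mapping.keys p)" by (simp add: inj_on_def poly_mapping_eqI)
  have "evaluate x p = (\<Sum>\<alpha>\<in>?X. c \<alpha> * monomial_fun UNIV \<alpha> x)" for x
    by (simp add: ev.mon_superset[of UNIV] evaluate_def poly_subst_def sum.reindex[OF inj] c_def monomial_fun_def
        poly_substitution.mon_def[OF ev.poly_substitution_axioms, symmetric])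
  then have "(\<Sum>\<alpha>\<in>?X. c \<alpha> * monomial_fun UNIV \<alpha> x) = 0" for x using z by simp
  then have "c \<alpha> = 0" if "\<alpha> \<in> ?X" for \<alpha>
    using monomial_fun_linear_independent[of UNIV ?X c \<alpha>] that by auto
  then have "Poly_Mapping.lookup p m = 0" if "m \<in> Poly_Mapping.keys p" for m
    using that by (force simp: c_def)
  then have "Poly_Mapping.keys p = {}" by (metis all_not_in_conv in_keys_iff)
  then show False using assms by simp
qed

text \<open>Two nonzero polynomials are nonzero at a common point, so their product is nonzero. Used
  to cancel the determinant of the differential.\<close>

lemma mpoly_mult_zero:
  fixes p q :: "'x::finite mpoly"
  assumes "p * q = 0" "p \<noteq> 0"
  shows "q = 0"
proof (rule ccontr)
  assume "q \<noteq> 0"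
  then obtain x y where "evaluate x p \<noteq> 0" "evaluate y q \<noteq> 0" using evaluate_nonzero assms(2) by metis
  then obtain z where "evaluate z p * evaluate z q \<noteq> 0"
    using polyfun_common_nonzero[OF polyfun_evaluate polyfun_evaluate] by blast
  then have "evaluate z (p * q) \<noteq> 0" by (simp add: ev.mult)
  then show False using assms(1) by (simp add: ev.zero)
qed

section \<open>The group action on polynomials and its algebraicity\<close>

interpretation ca: poly_substitution Const "\<lambda>(i, j). \<Sum>a\<in>UNIV. Const (g $ a $ i) * Var (a, j)"
  rewrites "poly_subst Const (\<lambda>(i, j). \<Sum>a\<in>UNIV. Const (g $ a $ i) * Var (a, j)) = coord_act g"
  for g :: "complex ^ 'v::finite ^ 'v"
  by unfold_locales (auto simp: coord_act_def Const_one Const_add Const_mult)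

lemma coord_act_comp: "coord_act (g ** h) p = coord_act g (coord_act h p)"
proof (induction p rule: mpoly_induct)
  case (Var x)
  obtain i j where x: "x = (i, j)" by fastforce
  have "coord_act g (coord_act h (Var (i, j))) =
      (\<Sum>a\<in>UNIV. Const (h $ a $ i) * (\<Sum>b\<in>UNIV. Const (g $ b $ a) * Var (b, j)))"
    by (simp add: ca.Var ca.sum ca.mult ca.Const)
  also have "\<dots> = (\<Sum>b\<in>UNIV. (\<Sum>a\<in>UNIV. Const (g $ b $ a) * Const (h $ a $ i)) * Var (b, j))"
    unfolding sum_distrib_left sum_distrib_right by (subst sum.swap) (simp add: mult_ac)
  also have "\<dots> = coord_act (g ** h) (Var (i, j))"
    by (simp add: ca.Var matrix_matrix_mult_def Const_sum Const_mult)
  finally show ?case by (simp add: x)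
qed (simp_all add: ca.Const ca.add ca.mult)

lemma coord_act_id: "coord_act (Finite_Cartesian_Product.mat 1) p = p"
proof (induction p rule: mpoly_induct)
  case (Var x)
  obtain i j where x: "x = (i, j)" by fastforce
  have "coord_act (Finite_Cartesian_Product.mat 1) (Var (i, j)) =
      (\<Sum>a\<in>UNIV. if a = i then Var (a, j) else 0)"
    unfolding ca.Var prod.case
    by (intro sum.cong) (auto simp: Finite_Cartesian_Product.mat_def Const_zero Const_one)
  then show ?case by (simp add: x)
qed (simp_all add: ca.Const ca.add ca.mult)

text \<open>Double indices are flattened because coactions and square matrices are both indexed by
  initial segments of the natural numbers.\<close>

lemma bij_div_mod:
  "bij_betw (\<lambda>l. (l div n, l mod n)) {..<m * n} ({..<m} \<times> {..<n::nat})"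
proof (rule bij_betw_byWitness[where f'="\<lambda>(i, j). i * n + j"])
  show "(\<lambda>l. (l div n, l mod n)) ` {..<m * n} \<subseteq> {..<m} \<times> {..<n}"
    by (auto simp: less_mult_imp_div_less) (metis gr_zeroI mod_less_divisor mult_is_0 not_less_zero)
  show "(\<lambda>(i, j). i * n + j) ` ({..<m} \<times> {..<n}) \<subseteq> {..<m * n}"
  proof clarsimp
    fix i j assume "i < m" "j < n"
    then have "i * n + j < Suc i * n" by simp
    also have "\<dots> \<le> m * n" using \<open>i < m\<close> by (intro mult_le_mono1) simp
    finally show "i * n + j < m * n" .
  qed
qed auto

lemma sum_div_mod:
  fixes F :: "nat \<Rightarrow> nat \<Rightarrow> 'a::comm_monoid_add"
  shows "(\<Sum>i<m. \<Sum>j<n. F i j) = (\<Sum>l<m * n. F (l div n) (l mod n))"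
  using sum.reindex_bij_betw[OF bij_div_mod, of "\<lambda>(i, j). F i j" n m] by (simp add: sum.cartesian_product)

text \<open>The representations that occur are polynomial, so no power of the determinant has to be
  carried along as a denominator.\<close>

definition polynomial_on_GL :: "(complex ^ 'v::finite ^ 'v \<Rightarrow> complex) \<Rightarrow> bool"
  where "polynomial_on_GL f \<longleftrightarrow> (\<exists>p. \<forall>g. f g = evaluate (\<lambda>(i, j). g $ i $ j) p)"

lemma polynomial_on_GL_regular: "polynomial_on_GL f \<Longrightarrow> regular_on_GL f"
  unfolding polynomial_on_GL_def regular_on_GL_def evaluate_def
  by (metis div_by_1 power_0)

lemma polynomial_on_GL_const: "polynomial_on_GL (\<lambda>_. c)"
  unfolding polynomial_on_GL_def by (intro exI[of _ "Const c"]) (simp add: ev.Const)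

lemma polynomial_on_GL_entry: "polynomial_on_GL (\<lambda>g. g $ i $ j)"
  unfolding polynomial_on_GL_def by (intro exI[of _ "Var (i, j)"]) (simp add: ev.Var)

lemma polynomial_on_GL_mult: "polynomial_on_GL f \<Longrightarrow> polynomial_on_GL f' \<Longrightarrow> polynomial_on_GL (\<lambda>g. f g * f' g)"
  unfolding polynomial_on_GL_def by (metis ev.mult)

lemma polynomial_on_GL_prod:
  "(\<And>a. a \<in> A \<Longrightarrow> polynomial_on_GL (f a)) \<Longrightarrow> polynomial_on_GL (\<lambda>g. \<Prod>a\<in>A. f a g)"
  by (induction A rule: infinite_finite_induct) (auto intro: polynomial_on_GL_const polynomial_on_GL_mult)

text \<open>Coactions of two polynomials are concatenated for the sum and multiplied out for the
  product, so it is enough to know them for constants and variables.\<close>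

lemma coord_act_algebraic:
  fixes r :: "('v::finite, 'w::finite) coord"
  shows "\<exists>(n :: nat) f s. (\<forall>i<n. polynomial_on_GL (f i)) \<and> (\<forall>g. coord_act g r = (\<Sum>i<n. Const (f i g) * s i))"
proof (induction r rule: mpoly_induct)
  case (Const c)
  show ?case
    by (intro exI[of _ 1] exI[of _ "\<lambda>_ _. c"] exI[of _ "\<lambda>_. 1"]) (simp add: ca.Const polynomial_on_GL_const)
next
  case (Var x)
  obtain i j where x: "x = (i, j)" by fastforce
  obtain e :: "nat \<Rightarrow> 'v" where e: "bij_betw e {..<CARD('v)} UNIV"
    using ex_bij_betw_nat_finite[of "UNIV :: 'v set"] by (auto simp: atLeast0LessThan)
  have "coord_act g (Var (i, j)) = (\<Sum>l<CARD('v). Const (g $ e l $ i) * Var (e l, j))" for g :: "complex ^ 'v ^ 'v"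
    using sum.reindex_bij_betw[OF e, of "\<lambda>a. Const (g $ a $ i) * Var (a, j)"] by (simp add: ca.Var)
  then show ?case
    by (intro exI[of _ "CARD('v)"] exI[of _ "\<lambda>l g. g $ e l $ i"] exI[of _ "\<lambda>l. Var (e l, j)"])
       (simp add: x polynomial_on_GL_entry)
next
  case (add p q)
  obtain n :: nat and f s where 1: "\<forall>i<n. polynomial_on_GL (f i)" "\<forall>g. coord_act g p = (\<Sum>i<n. Const (f i g) * s i)"
    using add.IH(1) by blast
  obtain n' :: nat and f' s' where 2: "\<forall>i<n'. polynomial_on_GL (f' i)" "\<forall>g. coord_act g q = (\<Sum>i<n'. Const (f' i g) * s' i)"
    using add.IH(2) by blast
  have split: "(\<Sum>i<n + n'. F i) = (\<Sum>i<n. F i) + (\<Sum>i<n'. F (n + i))" for F :: "nat \<Rightarrow> ('v, 'w) coord"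
    by (induction n') (auto simp: add.assoc)
  show ?case
    using 1 2
    by (intro exI[of _ "n + n'"] exI[of _ "\<lambda>i. if i < n then f i else f' (i - n)"]
          exI[of _ "\<lambda>i. if i < n then s i else s' (i - n)"]) (auto simp: ca.add split)
next
  case (mult p q)
  obtain n :: nat and f s where 1: "\<forall>i<n. polynomial_on_GL (f i)" "\<forall>g. coord_act g p = (\<Sum>i<n. Const (f i g) * s i)"
    using mult.IH(1) by blast
  obtain n' :: nat and f' s' where 2: "\<forall>i<n'. polynomial_on_GL (f' i)" "\<forall>g. coord_act g q = (\<Sum>i<n'. Const (f' i g) * s' i)"
    using mult.IH(2) by blast
  have "coord_act g (p * q) = (\<Sum>l<n * n'. Const (f (l div n') g * f' (l mod n') g) * (s (l div n') * s' (l mod n')))" for g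
  proof -
    have "coord_act g (p * q) = (\<Sum>i<n. \<Sum>j<n'. Const (f i g * f' j g) * (s i * s' j))"
      unfolding ca.mult 1(2)[rule_format] 2(2)[rule_format] sum_product Const_mult
      by (intro sum.cong refl) (simp only: mult_ac)
    also have "\<dots> = (\<Sum>l<n * n'. Const (f (l div n') g * f' (l mod n') g) * (s (l div n') * s' (l mod n')))"
      by (rule sum_div_mod)
    finally show ?thesis .
  qed
  moreover have "polynomial_on_GL (\<lambda>g. f (l div n') g * f' (l mod n') g)" if "l < n * n'" for l
  proof -
    have "n' > 0" using that by (auto intro: gr0I)
    then have "l div n' < n" "l mod n' < n'" using that by (simp_all add: less_mult_imp_div_less)
    then show ?thesis using 1(1) 2(1) by (intro polynomial_on_GL_mult) blast+
  qed
  ultimately show ?case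
    by (intro exI[of _ "n * n'"] exI[of _ "\<lambda>l g. f (l div n') g * f' (l mod n') g"]
          exI[of _ "\<lambda>l. s (l div n') * s' (l mod n')"]) simp
qed

section \<open>Modules over the coordinate ring\<close>

lemma cring_coord_ring: "cring (coord_ring :: ('v, 'w) coord ring)"
proof (rule cringI)
  show "abelian_group (coord_ring :: ('v, 'w) coord ring)"
    by (rule abelian_groupI) (auto simp: coord_ring_def algebra_simps intro: exI[of _ "- _"] add.left_inverse)
  show "Group.comm_monoid (coord_ring :: ('v, 'w) coord ring)"
    by (rule Group.comm_monoidI) (auto simp: coord_ring_def algebra_simps)
qed (simp add: coord_ring_def algebra_simps)

text \<open>The carrier sits in a type that is already an abelian group, so computations use its
  \<open>+\<close> and the record is attached only at the end, as \<open>M\<close>.\<close>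

locale concrete_module =
  fixes C :: "'f::ab_group_add set" and sc :: "('v::finite, 'w::finite) coord \<Rightarrow> 'f \<Rightarrow> 'f"
  assumes zero_C: "0 \<in> C" and add_C: "x \<in> C \<Longrightarrow> y \<in> C \<Longrightarrow> x + y \<in> C" and minus_C: "x \<in> C \<Longrightarrow> - x \<in> C"
    and sc_C: "x \<in> C \<Longrightarrow> sc r x \<in> C"
    and sc_add_left: "sc (r + s) x = sc r x + sc s x" and sc_add_right: "sc r (x + y) = sc r x + sc r y"
    and sc_mult: "sc (r * s) x = sc r (sc s x)" and sc_one: "sc 1 x = x"
begin

definition M :: "(('v, 'w) coord, 'f) module"
  where "M = \<lparr>carrier = C, monoid.mult = undefined, one = undefined, ring.zero = 0, ring.add = (+), module.smult = sc\<rparr>"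

lemma M_simps [simp]: "carrier M = C" "ring.zero M = 0" "ring.add M = (+)" "module.smult M = sc"
  by (simp_all add: M_def)

lemma abelian_group_M: "abelian_group M"
  by (rule abelian_groupI) (auto simp: zero_C add_C add_ac intro: bexI[OF _ minus_C])

lemma module_M: "Module.module coord_ring M"
  by (rule moduleI[OF cring_coord_ring abelian_group_M])
     (auto simp: coord_ring_def sc_C sc_add_left sc_add_right sc_mult sc_one)

lemma finsum_M:
  assumes "\<And>i. i < n \<Longrightarrow> y i \<in> C"
  shows "finsum M y {..<n::nat} = (\<Sum>i<n. y i) \<and> (\<Sum>i<n. y i) \<in> C"
  using assms
proof (induction n)
  case 0
  interpret abelian_group M by (rule abelian_group_M)
  show ?case by (simp add: zero_C)
next
  case (Suc n)
  interpret abelian_group M by (rule abelian_group_M)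
  have "finsum M y (insert n {..<n}) = y n \<oplus>\<^bsub>M\<^esub> finsum M y {..<n}"
    by (rule finsum_insert) (use Suc.prems in \<open>auto simp: less_Suc_eq\<close>)
  then show ?case using Suc by (simp add: lessThan_Suc add.commute add_C)
qed

end

locale concrete_equivariant = concrete_module C sc
  for C :: "'f::ab_group_add set" and sc :: "('v::finite, 'w::finite) coord \<Rightarrow> 'f \<Rightarrow> 'f" +
  fixes act :: "complex ^ 'v ^ 'v \<Rightarrow> 'f \<Rightarrow> 'f"
  assumes act_C: "x \<in> C \<Longrightarrow> act g x \<in> C" and act_add': "act g (x + y) = act g x + act g y"
    and act_id: "x \<in> C \<Longrightarrow> act (Finite_Cartesian_Product.mat 1) x = x"
    and act_comp: "x \<in> C \<Longrightarrow> act (g ** h) x = act g (act h x)"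
    and act_sc: "act g (sc r x) = sc (coord_act g r) (act g x)"
    and act_alg: "x \<in> C \<Longrightarrow> \<exists>(n :: nat) f y. (\<forall>i<n. polynomial_on_GL (f i) \<and> y i \<in> C) \<and>
        (\<forall>g. act g x = (\<Sum>i<n. sc (Const (f i g)) (y i)))"
begin

lemma equivariant_M: "equivariant_module M act"
proof (intro equivariant_module.intro equivariant_module_axioms.intro module_M)
  fix x assume "x \<in> carrier M"
  then obtain n :: nat and f y where f: "\<forall>i<n. polynomial_on_GL (f i) \<and> y i \<in> C"
    "\<forall>g. act g x = (\<Sum>i<n. sc (Const (f i g)) (y i))" using act_alg[of x] by auto
  have "act g x = finsum M (\<lambda>i. Const (f i g) \<odot>\<^bsub>M\<^esub> y i) {..<n}" for g
    using finsum_M[of n "\<lambda>i. sc (Const (f i g)) (y i)"] f sc_C by simp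
  then show "\<exists>(n :: nat) f y. (\<forall>i<n. regular_on_GL (f i) \<and> y i \<in> carrier M) \<and>
      (\<forall>g\<in>GL. act g x = (\<Oplus>\<^bsub>M\<^esub>i\<in>{..<n}. Const (f i g) \<odot>\<^bsub>M\<^esub> y i))"
    using f(1) polynomial_on_GL_regular by (intro exI[of _ n] exI[of _ f] exI[of _ y]) auto
qed (auto simp: act_C act_add' act_id act_comp act_sc)

end

section \<open>Quotients by stable submodules\<close>

locale concrete_quotient = concrete_equivariant C sc act
  for C :: "'f::ab_group_add set" and sc :: "('v::finite, 'w::finite) coord \<Rightarrow> 'f \<Rightarrow> 'f" and act +
  fixes N :: "'f set"
  assumes N_C: "N \<subseteq> C" and zero_N: "0 \<in> N" and add_N: "x \<in> N \<Longrightarrow> y \<in> N \<Longrightarrow> x + y \<in> N"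
    and minus_N: "x \<in> N \<Longrightarrow> - x \<in> N" and sc_N: "x \<in> N \<Longrightarrow> sc r x \<in> N" and act_N: "x \<in> N \<Longrightarrow> act g x \<in> N"
begin

definition coset :: "'f \<Rightarrow> 'f set"
  where "coset x = {y. y - x \<in> N}"

text \<open>The operations act on whole cosets, without representatives. Scaling a coset may yield
  only a part of one; adding \<open>N\<close> completes it. The action \<open>act_Q\<close> is
  formed in the same way.\<close>

definition Q :: "(('v, 'w) coord, 'f set) module"
  where "Q = \<lparr>carrier = coset ` C, monoid.mult = undefined, one = undefined, ring.zero = N,
    ring.add = (\<lambda>A B. {a + b | a b. a \<in> A \<and> b \<in> B}),
    module.smult = (\<lambda>r A. {sc r a + y | a y. a \<in> A \<and> y \<in> N})\<rparr>"

definition act_Q :: "complex ^ 'v ^ 'v \<Rightarrow> 'f set \<Rightarrow> 'f set"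
  where "act_Q g A = {act g a + y | a y. a \<in> A \<and> y \<in> N}"

lemma diff_N: "x \<in> N \<Longrightarrow> y \<in> N \<Longrightarrow> x - y \<in> N"
  using add_N[OF _ minus_N] by fastforce

lemma sc_diff: "sc r (x - y) = sc r x - sc r y"
  using sc_add_right[of r "x - y" y] by (simp add: algebra_simps)

lemma act_diff: "act g (x - y) = act g x - act g y"
  using act_add'[of g "x - y" y] by (simp add: algebra_simps)

lemma coset_self: "x \<in> coset x"
  by (simp add: coset_def zero_N)

lemma coset_eq_iff: "coset x = coset y \<longleftrightarrow> x - y \<in> N"
proof
  assume "coset x = coset y"
  then show "x - y \<in> N" using coset_self[of x] by (simp add: coset_def)
next
  assume xy: "x - y \<in> N"
  have "z - y \<in> N" if "z - x \<in> N" for z using add_N[OF that xy] by simp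
  moreover have "z - x \<in> N" if "z - y \<in> N" for z using diff_N[OF that xy] by simp
  ultimately show "coset x = coset y" by (auto simp: coset_def)
qed

lemma coset_zero: "coset 0 = N"
  by (simp add: coset_def)

lemma Q_simps [simp]: "carrier Q = coset ` C" "ring.zero Q = N"
  by (simp_all add: Q_def)

lemma add_Q [simp]: "coset x \<oplus>\<^bsub>Q\<^esub> coset y = coset (x + y)"
proof -
  have "(a + b) - (x + y) \<in> N" if "a - x \<in> N" "b - y \<in> N" for a b
    using add_N[OF that] by (simp add: algebra_simps)
  moreover have "\<exists>a b. z = a + b \<and> a - x \<in> N \<and> b - y \<in> N" if "z - (x + y) \<in> N" for z
    by (rule exI[of _ "z - y"], rule exI[of _ y]) (use that in \<open>simp add: zero_N algebra_simps\<close>)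
  ultimately show ?thesis by (auto simp: Q_def coset_def)
qed

lemma smult_Q [simp]: "r \<odot>\<^bsub>Q\<^esub> coset x = coset (sc r x)"
proof -
  have "sc r a + y - sc r x \<in> N" if "a - x \<in> N" "y \<in> N" for a y
    using add_N[OF sc_N[OF that(1), of r] that(2)] by (simp add: sc_diff algebra_simps)
  moreover have "\<exists>a y. z = sc r a + y \<and> a - x \<in> N \<and> y \<in> N" if "z - sc r x \<in> N" for z
    by (rule exI[of _ x], rule exI[of _ "z - sc r x"]) (use that in \<open>simp add: zero_N\<close>)
  ultimately show ?thesis by (auto simp: Q_def coset_def)
qed

lemma act_Q_coset [simp]: "act_Q g (coset x) = coset (act g x)"
proof -
  have "act g a + y - act g x \<in> N" if "a - x \<in> N" "y \<in> N" for a y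
    using add_N[OF act_N[OF that(1), of g] that(2)] by (simp add: act_diff algebra_simps)
  moreover have "\<exists>a y. z = act g a + y \<and> a - x \<in> N \<and> y \<in> N" if "z - act g x \<in> N" for z
    by (rule exI[of _ x], rule exI[of _ "z - act g x"]) (use that in \<open>simp add: zero_N\<close>)
  ultimately show ?thesis by (auto simp: act_Q_def coset_def)
qed

lemma abelian_group_Q: "abelian_group Q"
proof (rule abelian_groupI)
  show "\<zero>\<^bsub>Q\<^esub> \<in> carrier Q" using zero_C coset_zero by (auto simp: image_iff)
  fix x assume "x \<in> carrier Q"
  then obtain a where a: "a \<in> C" "x = coset a" by auto
  have z: "ring.zero Q = coset 0" by (simp add: coset_zero)
  show "\<zero>\<^bsub>Q\<^esub> \<oplus>\<^bsub>Q\<^esub> x = x" unfolding z a(2) add_Q by simp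
  show "\<exists>y\<in>carrier Q. y \<oplus>\<^bsub>Q\<^esub> x = \<zero>\<^bsub>Q\<^esub>"
    unfolding z a(2) by (rule bexI[of _ "coset (- a)"]) (use a minus_C in auto)
qed (auto simp: add_C add_ac)

lemma module_Q: "Module.module coord_ring Q"
  by (rule moduleI[OF cring_coord_ring abelian_group_Q])
     (auto simp: coord_ring_def sc_C sc_add_left sc_add_right sc_mult sc_one)

lemma finsum_Q:
  assumes "\<And>i. i < n \<Longrightarrow> y i \<in> C"
  shows "finsum Q (\<lambda>i. coset (y i)) {..<n::nat} = coset (\<Sum>i<n. y i)"
  using assms
proof (induction n)
  case 0
  interpret abelian_group Q by (rule abelian_group_Q)
  show ?case by (simp add: coset_zero)
next
  case (Suc n)
  interpret abelian_group Q by (rule abelian_group_Q)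
  have "finsum Q (\<lambda>i. coset (y i)) (insert n {..<n}) = coset (y n) \<oplus>\<^bsub>Q\<^esub> finsum Q (\<lambda>i. coset (y i)) {..<n}"
    by (rule finsum_insert) (use Suc.prems in \<open>auto simp: less_Suc_eq\<close>)
  then show ?case using Suc by (simp add: lessThan_Suc add.commute)
qed

lemma equivariant_Q: "equivariant_module Q act_Q"
proof (intro equivariant_module.intro equivariant_module_axioms.intro module_Q)
  fix A assume "A \<in> carrier Q"
  then obtain x where x: "x \<in> C" "A = coset x" by auto
  obtain n :: nat and f y where f: "\<forall>i<n. polynomial_on_GL (f i) \<and> y i \<in> C"
    "\<forall>g. act g x = (\<Sum>i<n. sc (Const (f i g)) (y i))" using act_alg[OF x(1)] by auto
  have "act_Q g A = finsum Q (\<lambda>i. Const (f i g) \<odot>\<^bsub>Q\<^esub> coset (y i)) {..<n}" for g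
    using finsum_Q[of n "\<lambda>i. sc (Const (f i g)) (y i)"] f sc_C by (simp add: x(2))
  then show "\<exists>(n :: nat) f y. (\<forall>i<n. regular_on_GL (f i) \<and> y i \<in> carrier Q) \<and>
      (\<forall>g\<in>GL. act_Q g A = (\<Oplus>\<^bsub>Q\<^esub>i\<in>{..<n}. Const (f i g) \<odot>\<^bsub>Q\<^esub> y i))"
    using f(1) polynomial_on_GL_regular
    by (intro exI[of _ n] exI[of _ f] exI[of _ "\<lambda>i. coset (y i)"]) auto
qed (auto simp: act_C act_add' act_id act_comp act_sc)

lemma projection_hom: "equivariant_hom M act Q act_Q coset"
  by (auto simp: equivariant_hom_def)

lemma projection_kernel: "a_kernel M Q coset = N"
  using N_C coset_eq_iff[of _ 0] by (auto simp: a_kernel_def kernel_def coset_zero)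

end

section \<open>Free modules on Schur functors\<close>

context concrete_module
begin

lemma sc_zero_left: "sc 0 x = 0"
  using sc_add_left[of 0 0 x] by simp

lemma sc_zero_right: "sc r 0 = 0"
  using sc_add_right[of r 0 0] by simp

lemma sc_sum: "sc r (\<Sum>a\<in>A. f a) = (\<Sum>a\<in>A. sc r (f a))"
  by (induction A rule: infinite_finite_induct) (simp_all only: sum.infinite sum.empty sum.insert sc_zero_right sc_add_right not_False_eq_True)

lemma sum_C: "(\<And>a. a \<in> A \<Longrightarrow> f a \<in> C) \<Longrightarrow> (\<Sum>a\<in>A. f a) \<in> C"
  by (induction A rule: infinite_finite_induct) (auto simp: zero_C add_C)

text \<open>The form of a coaction as a property of a vector depending on \<open>g\<close>. It is
  stable under sums, so algebraicity can be checked on multiples of generators.\<close>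

definition algebraic_family :: "(complex ^ 'v ^ 'v \<Rightarrow> 'f) \<Rightarrow> bool"
  where "algebraic_family G \<longleftrightarrow> (\<exists>(n :: nat) f y. (\<forall>i<n. polynomial_on_GL (f i) \<and> y i \<in> C) \<and>
        (\<forall>g. G g = (\<Sum>i<n. sc (Const (f i g)) (y i))))"

lemma algebraic_family_scaled:
  assumes "polynomial_on_GL f" "y \<in> C"
  shows "algebraic_family (\<lambda>g. sc (Const (f g)) y)"
  unfolding algebraic_family_def
  by (intro exI[of _ 1] exI[of _ "\<lambda>_. f"] exI[of _ "\<lambda>_. y"]) (use assms in simp)

lemma algebraic_family_add:
  assumes "algebraic_family G" "algebraic_family G'"
  shows "algebraic_family (\<lambda>g. G g + G' g)"
proof -
  obtain n :: nat and f y where 1: "\<forall>i<n. polynomial_on_GL (f i) \<and> y i \<in> C" "\<forall>g. G g = (\<Sum>i<n. sc (Const (f i g)) (y i))"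
    using assms(1) unfolding algebraic_family_def by blast
  obtain n' :: nat and f' y' where 2: "\<forall>i<n'. polynomial_on_GL (f' i) \<and> y' i \<in> C" "\<forall>g. G' g = (\<Sum>i<n'. sc (Const (f' i g)) (y' i))"
    using assms(2) unfolding algebraic_family_def by blast
  have split: "(\<Sum>i<n + n'. F i) = (\<Sum>i<n. F i) + (\<Sum>i<n'. F (n + i))" for F :: "nat \<Rightarrow> 'f"
    by (induction n') (auto simp: add.assoc)
  show ?thesis
    unfolding algebraic_family_def using 1 2
    by (intro exI[of _ "n + n'"] exI[of _ "\<lambda>i. if i < n then f i else f' (i - n)"]
          exI[of _ "\<lambda>i. if i < n then y i else y' (i - n)"]) (auto simp: split)
qed

lemma algebraic_family_sum:
  "(\<And>a. a \<in> A \<Longrightarrow> algebraic_family (G a)) \<Longrightarrow> algebraic_family (\<lambda>g. \<Sum>a\<in>A. G a g)"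
proof (induction A rule: infinite_finite_induct)
  case empty
  show ?case unfolding algebraic_family_def by (intro exI[of _ 0]) simp
next
  case (infinite A)
  then show ?case unfolding algebraic_family_def by (intro exI[of _ 0]) simp
next
  case (insert a A)
  then show ?case by (simp add: algebraic_family_add)
qed

lemma max_ideal_smult_facts:
  shows "max_ideal_smult M \<subseteq> C" "0 \<in> max_ideal_smult M"
    and "r \<in> max_ideal \<Longrightarrow> x \<in> C \<Longrightarrow> sc r x \<in> max_ideal_smult M"
    and "x \<in> max_ideal_smult M \<Longrightarrow> y \<in> max_ideal_smult M \<Longrightarrow> x + y \<in> max_ideal_smult M"
    and "x \<in> max_ideal_smult M \<Longrightarrow> max_ideal_smult M +>\<^bsub>M\<^esub> x = max_ideal_smult M"
proof -
  interpret ab: abelian_group M by (rule abelian_group_M)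
  let ?X = "{r \<odot>\<^bsub>M\<^esub> x | r x. r \<in> max_ideal \<and> x \<in> carrier M}"
  have X: "?X \<subseteq> carrier (add_monoid M)" by (auto simp: sc_C)
  have sub: "subgroup (max_ideal_smult M) (add_monoid M)"
    unfolding max_ideal_smult_def by (rule group.generate_is_subgroup[OF ab.a_group X])
  show C: "max_ideal_smult M \<subseteq> C" using subgroup.subset[OF sub] by simp
  show "0 \<in> max_ideal_smult M" using subgroup.one_closed[OF sub] by simp
  show "r \<in> max_ideal \<Longrightarrow> x \<in> C \<Longrightarrow> sc r x \<in> max_ideal_smult M"
    unfolding max_ideal_smult_def by (rule generate.incl) auto
  show "x \<in> max_ideal_smult M \<Longrightarrow> y \<in> max_ideal_smult M \<Longrightarrow> x + y \<in> max_ideal_smult M"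
    using subgroup.m_closed[OF sub, of x y] by simp
  show "x \<in> max_ideal_smult M \<Longrightarrow> max_ideal_smult M +>\<^bsub>M\<^esub> x = max_ideal_smult M"
    using ab.a_coset_join2[OF _ sub, of x] C by auto
qed

lemma sum_max_ideal_smult:
  "(\<And>a. a \<in> A \<Longrightarrow> f a \<in> max_ideal_smult M) \<Longrightarrow> (\<Sum>a\<in>A. f a) \<in> max_ideal_smult M"
  by (induction A rule: infinite_finite_induct) (auto simp: max_ideal_smult_facts)

end

text \<open>Every representative of the coset \<open>B\<close> is sent into the target's multiple of
  the maximal ideal, so all cosets in the union coincide with the zero coset; and the union is over
  the nonempty set \<open>B\<close>.\<close>

lemma residue_map_zero:
  assumes "concrete_module C sc" "concrete_module C' sc'"
    and "\<And>x. x \<in> C \<Longrightarrow> d x \<in> max_ideal_smult (concrete_module.M C' sc')"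
    and "B \<in> carrier (residue_module (concrete_module.M C sc))"
  shows "residue_map (concrete_module.M C' sc') d B = \<one>\<^bsub>residue_module (concrete_module.M C' sc')\<^esub>"
proof -
  interpret c: concrete_module C sc by fact
  interpret c': concrete_module C' sc' by fact
  obtain a where a: "a \<in> C" "B = (\<Union>h\<in>max_ideal_smult c.M. {h + a})"
    using assms(4) by (auto simp: residue_module_def A_FactGroup_def FactGroup_def RCOSETS_def r_coset_def)
  have "x \<in> C" if "x \<in> B" for x using that a c.max_ideal_smult_facts(1) c.add_C by auto
  then have "max_ideal_smult c'.M +>\<^bsub>c'.M\<^esub> d x = max_ideal_smult c'.M" if "x \<in> B" for x
    using assms(3) c'.max_ideal_smult_facts(5) that by blast
  moreover have "B \<noteq> {}" using a(2) c.max_ideal_smult_facts(2) by auto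
  ultimately have "residue_map c'.M d B = max_ideal_smult c'.M" by (auto simp: residue_map_def)
  then show ?thesis by (simp add: residue_module_def A_FactGroup_def FactGroup_def)
qed

lemma Var_multiple_in_max_ideal: "Var x * p \<in> (max_ideal :: ('v, 'w) coord set)"
proof -
  interpret cring "coord_ring :: ('v, 'w) coord ring" by (rule cring_coord_ring)
  have sub: "range Var \<subseteq> carrier (coord_ring :: ('v, 'w) coord ring)" by (simp add: coord_ring_def)
  have "Var x \<in> (max_ideal :: ('v, 'w) coord set)"
    using genideal_self[OF sub] by (auto simp: max_ideal_def)
  moreover have "ideal (max_ideal :: ('v, 'w) coord set) coord_ring"
    unfolding max_ideal_def by (rule genideal_ideal[OF sub])
  ultimately show ?thesis
    using ideal.I_r_closed[of "max_ideal :: ('v, 'w) coord set" coord_ring "Var x" p]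
    by (simp add: coord_ring_def)
qed

section \<open>Scalar extension of Schur functors\<close>

definition coord_tensors :: "(nat \<Rightarrow> nat) \<Rightarrow> ('v filling \<Rightarrow> ('v, 'w) coord) set"
  where "coord_tensors lam = {T. \<forall>w. w \<notin> words lam \<longrightarrow> T w = 0}"

definition young_unit :: "(nat \<Rightarrow> nat) \<Rightarrow> 'v filling \<Rightarrow> 'v filling \<Rightarrow> complex"
  where "young_unit lam u = young lam (unit_fun u)"

lemma young_unit_schur: "u \<in> words lam \<Longrightarrow> young_unit lam u \<in> schur lam"
  by (auto simp: young_unit_def schur_eq supported_def unit_fun_def)

lemma young_zero: "young lam (\<lambda>_. 0) = (\<lambda>_. 0)"
  by (auto simp: young_eq)

lemma young_Const: "young lam (\<lambda>w. Const (t w)) w = Const (young lam t w)"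
  by (simp add: young_eq Const_sum Const_mult Const_of_int)

lemma young_coord_expand:
  assumes "finite (diagram lam)" "T \<in> coord_tensors lam"
  shows "young lam T w = (\<Sum>u\<in>words lam. T u * Const (young_unit lam u (w :: 'v::finite filling)))"
proof -
  have "T = (\<lambda>w. \<Sum>u\<in>words lam. T u * Const (unit_fun u w))"
  proof
    fix w
    have "(\<Sum>u\<in>words lam. T u * Const (unit_fun u w)) = (\<Sum>u\<in>words lam. if w = u then T u else 0)"
      by (intro sum.cong) (auto simp: unit_fun_def Const_zero Const_one)
    then show "T w = (\<Sum>u\<in>words lam. T u * Const (unit_fun u w))"
      using assms(2) by (simp add: finite_words[OF assms(1)] coord_tensors_def)
  qed
  then have "young lam T w = young lam (\<lambda>w. \<Sum>u\<in>words lam. T u * Const (unit_fun u w)) w" by metis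
  also have "\<dots> = (\<Sum>u\<in>words lam. T u * Const (young_unit lam u w))"
    by (simp only: young_sum_scale young_Const young_unit_def)
  finally show ?thesis .
qed

text \<open>The symmetrizer has integer coefficients and so commutes with extension of scalars; on
  both sides the elements are the polynomial combinations of the symmetrized words
  \<open>young_unit lam u\<close>.\<close>

lemma extend_scalars_schur:
  assumes "finite (diagram lam)"
  shows "extend_scalars (schur lam) = young lam ` (coord_tensors lam :: ('v::finite filling \<Rightarrow> ('v, 'w) coord) set)"
proof
  show "extend_scalars (schur lam) \<subseteq> young lam ` (coord_tensors lam :: ('v filling \<Rightarrow> ('v, 'w) coord) set)"
  proof
    fix F :: "'v filling \<Rightarrow> ('v, 'w) coord"
    assume "F \<in> extend_scalars (schur lam)"
    then obtain A r where A: "F = (\<lambda>i. \<Sum>s\<in>A. r s * Const (s i))" "finite A" "A \<subseteq> schur lam"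
      unfolding extend_scalars_def by blast
    then have "\<forall>s\<in>A. \<exists>t\<in>supported (words lam). s = young lam t" by (auto simp: schur_eq)
    then obtain t where t: "\<And>s. s \<in> A \<Longrightarrow> t s \<in> supported (words lam) \<and> s = young lam (t s)" by metis
    have "F = young lam (\<lambda>w. \<Sum>s\<in>A. r s * Const (t s w))"
    proof
      fix w
      have "r s * Const (s w) = r s * young lam (\<lambda>w. Const (t s w)) w" if "s \<in> A" for s
        using t[OF that] by (metis young_Const)
      then show "F w = young lam (\<lambda>w. \<Sum>s\<in>A. r s * Const (t s w)) w"
        unfolding young_sum_scale A(1) by (rule sum.cong[OF refl])
    qed
    moreover have "(\<lambda>w. \<Sum>s\<in>A. r s * Const (t s w)) \<in> coord_tensors lam"
      using t by (auto simp: coord_tensors_def supported_def Const_zero)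
    ultimately show "F \<in> young lam ` coord_tensors lam" by blast
  qed
  show "young lam ` (coord_tensors lam :: ('v filling \<Rightarrow> ('v, 'w) coord) set) \<subseteq> extend_scalars (schur lam)"
  proof clarify
    fix T :: "'v filling \<Rightarrow> ('v, 'w) coord"
    assume T: "T \<in> coord_tensors lam"
    \<comment> \<open>Different words may have the same symmetrization, while
      \<open>extend_scalars\<close> sums over a set of vectors; the coefficients are therefore
      collected.\<close>
    define r where "r s = (\<Sum>u\<in>{u\<in>words lam. young_unit lam u = s}. T u)" for s
    have "young lam T w = (\<Sum>s\<in>young_unit lam ` words lam. r s * Const (s w))" for w
    proof -
      have "young lam T w = (\<Sum>u\<in>words lam. T u * Const (young_unit lam u w))"
        by (rule young_coord_expand[OF assms T])
      also have "\<dots> = (\<Sum>s\<in>young_unit lam ` words lam. \<Sum>u\<in>{u\<in>words lam. young_unit lam u = s}. T u * Const (young_unit lam u w))"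
        by (rule sum.image_gen[OF finite_words[OF assms]])
      also have "\<dots> = (\<Sum>s\<in>young_unit lam ` words lam. r s * Const (s w))"
        unfolding r_def sum_distrib_right by (intro sum.cong refl) auto
      finally show ?thesis .
    qed
    then have "young lam T = (\<lambda>w. \<Sum>s\<in>young_unit lam ` words lam. r s * Const (s w))" by blast
    then show "young lam T \<in> extend_scalars (schur lam)"
      unfolding extend_scalars_def using finite_words[OF assms] young_unit_schur by blast
  qed
qed

definition schur_carrier :: "(nat \<Rightarrow> nat) \<Rightarrow> nat \<Rightarrow> (nat \<Rightarrow> 'v filling \<Rightarrow> ('v, 'w) coord) set"
  where "schur_carrier lam c = {F. (\<forall>n<c. F n \<in> extend_scalars (schur lam)) \<and> (\<forall>n\<ge>c. F n = (\<lambda>_. 0))}"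

definition schur_scale :: "('v, 'w) coord \<Rightarrow> (nat \<Rightarrow> 'v filling \<Rightarrow> ('v, 'w) coord) \<Rightarrow> nat \<Rightarrow> 'v filling \<Rightarrow> ('v, 'w) coord"
  where "schur_scale r F = (\<lambda>n w. r * F n w)"

definition coord_twist :: "complex ^ 'v ^ 'v \<Rightarrow> ('v filling \<Rightarrow> ('v::finite, 'w) coord) \<Rightarrow> 'v filling \<Rightarrow> ('v, 'w) coord"
  where "coord_twist g T = (\<lambda>u. coord_act g (T u))"

text \<open>The diagonal action splits into a twist of the coefficients by \<open>coord_act\<close>
  and a linear action of the constant matrix \<open>g\<close> on the tensor factors.\<close>

definition coord_tensor_act :: "(nat \<Rightarrow> nat) \<Rightarrow> complex ^ 'v ^ 'v \<Rightarrow> ('v filling \<Rightarrow> ('v::finite, 'w) coord) \<Rightarrow> 'v filling \<Rightarrow> ('v, 'w) coord"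
  where "coord_tensor_act lam g T = tensor_act (diagram lam) (\<lambda>i j. Const (g $ i $ j)) (coord_twist g T)"

lemma schur_free_act_eq: "schur_free_act lam g F n = coord_tensor_act lam g (F n)"
  by (auto simp: schur_free_act_def coord_tensor_act_def tensor_act_def tensor_matrix_def words_def
      coord_twist_def Const_prod Const_zero)

lemma coord_twist_young: "coord_twist g (young lam T) = young lam (coord_twist g T)"
  by (auto simp: coord_twist_def young_eq ca.sum ca.mult ca.of_int)

lemma coord_tensor_act_young: "coord_tensor_act lam g (young lam T) = young lam (coord_tensor_act lam g T)"
  unfolding coord_tensor_act_def coord_twist_young by (rule ext) (rule tensor_act_young)

lemma coord_tensor_act_supported: "coord_tensor_act lam g T \<in> coord_tensors lam"
  by (simp add: coord_tensor_act_def tensor_act_def coord_tensors_def words_def)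

lemma coord_tensor_act_add:
  "coord_tensor_act lam g (\<lambda>w. T w + T' w) w = coord_tensor_act lam g T w + coord_tensor_act lam g T' w"
  by (simp add: coord_tensor_act_def tensor_act_def coord_twist_def ca.add distrib_left sum.distrib)

lemma coord_tensor_act_scale:
  "coord_tensor_act lam g (\<lambda>w. r * T w) w = coord_act g r * coord_tensor_act lam g T w"
  by (simp add: coord_tensor_act_def tensor_act_def coord_twist_def ca.mult sum_distrib_left mult.left_commute)

lemma coord_tensor_act_zero: "coord_tensor_act lam g (\<lambda>_. 0) w = 0"
  using coord_tensor_act_scale[of lam g 0 "\<lambda>_. 0" w] by (simp add: ca.zero)

lemma coord_tensor_act_id:
  fixes T :: "'v::finite filling \<Rightarrow> ('v, 'w) coord"
  assumes "finite (diagram lam)" "T \<in> coord_tensors lam"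
  shows "coord_tensor_act lam (Finite_Cartesian_Product.mat 1) T = T"
proof -
  have "(\<lambda>i j. Const ((Finite_Cartesian_Product.mat 1 :: complex ^ 'v ^ 'v) $ i $ j)) = (\<lambda>i j. if i = j then 1 else 0 :: ('v, 'w) coord)"
    by (auto simp: Finite_Cartesian_Product.mat_def Const_zero Const_one fun_eq_iff)
  then show ?thesis
    using assms tensor_act_id[OF assms(1), of T]
    by (simp add: coord_tensor_act_def coord_twist_def coord_act_id coord_tensors_def words_def)
qed

lemma coord_tensor_act_comp:
  assumes "finite (diagram lam)"
  shows "coord_tensor_act lam (g ** h) T = coord_tensor_act lam g (coord_tensor_act lam h T)"
proof -
  have "coord_twist g (coord_tensor_act lam h T) =
      tensor_act (diagram lam) (\<lambda>i j. Const (h $ i $ j)) (coord_twist g (coord_twist h T))"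
    by (auto simp: coord_twist_def coord_tensor_act_def tensor_act_def ca.sum ca.mult ca.prod ca.Const ca.zero)
  moreover have "coord_twist g (coord_twist h T) = coord_twist (g ** h) T"
    by (simp add: coord_twist_def coord_act_comp)
  ultimately have "coord_tensor_act lam g (coord_tensor_act lam h T) = tensor_act (diagram lam)
      (\<lambda>i j. Const (g $ i $ j)) (tensor_act (diagram lam) (\<lambda>i j. Const (h $ i $ j)) (coord_twist (g ** h) T))"
    by (simp only: coord_tensor_act_def[of lam g])
  also have "\<dots> = tensor_act (diagram lam) (\<lambda>i j. \<Sum>l\<in>UNIV. Const (g $ i $ l) * Const (h $ l $ j)) (coord_twist (g ** h) T)"
    by (rule tensor_act_comp[OF assms])
  also have "(\<lambda>i j. \<Sum>l\<in>UNIV. Const (g $ i $ l) * Const (h $ l $ j)) = (\<lambda>i j. Const ((g ** h) $ i $ j))"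
    by (simp add: matrix_matrix_mult_def Const_sum Const_mult)
  finally show ?thesis by (simp only: coord_tensor_act_def[of lam "g ** h"])
qed

text \<open>Generators go to combinations of generators whose coefficients are products of entries
  of \<open>g\<close>; this is the source of algebraicity of the action on the free modules.\<close>

lemma coord_tensor_act_young_unit:
  assumes "finite (diagram lam)" "u \<in> words lam"
  shows "(coord_tensor_act lam g (\<lambda>w. Const (young_unit lam u w)) w :: ('v::finite, 'w) coord) =
    (\<Sum>v\<in>words lam. Const (\<Prod>b\<in>diagram lam. g $ v b $ u b) * Const (young_unit lam v w))"
proof -
  have "(coord_tensor_act lam g (\<lambda>w. Const (unit_fun u w)) v :: ('v, 'w) coord) = Const (\<Prod>b\<in>diagram lam. g $ v b $ u b)"
    if "v \<in> words lam" for v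
  proof -
    have "(coord_tensor_act lam g (\<lambda>w. Const (unit_fun u w)) v :: ('v, 'w) coord) =
        (\<Sum>u'\<in>words lam. if u' = u then \<Prod>b\<in>diagram lam. Const (g $ v b $ u' b) else 0)"
      using that unfolding coord_tensor_act_def tensor_act_def coord_twist_def words_def
      by (auto simp: ca.Const unit_fun_def Const_one Const_zero intro!: sum.cong)
    then show ?thesis using assms(2) by (simp add: finite_words[OF assms(1)] Const_prod)
  qed
  note val = this
  have "(\<lambda>w. Const (young_unit lam u w) :: ('v, 'w) coord) = young lam (\<lambda>w. Const (unit_fun u w))"
    by (simp add: fun_eq_iff young_Const young_unit_def)
  then have "(coord_tensor_act lam g (\<lambda>w. Const (young_unit lam u w)) w :: ('v, 'w) coord) =
      young lam (coord_tensor_act lam g (\<lambda>w. Const (unit_fun u w))) w"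
    by (simp only: coord_tensor_act_young)
  also have "\<dots> = (\<Sum>v\<in>words lam. coord_tensor_act lam g (\<lambda>w. Const (unit_fun u w)) v * Const (young_unit lam v w))"
    by (rule young_coord_expand[OF assms(1) coord_tensor_act_supported])
  also have "\<dots> = (\<Sum>v\<in>words lam. Const (\<Prod>b\<in>diagram lam. g $ v b $ u b) * Const (young_unit lam v w))"
    by (rule sum.cong[OF refl]) (simp only: val)
  finally show ?thesis .
qed

lemma schur_carrier_young:
  fixes F :: "nat \<Rightarrow> 'v::finite filling \<Rightarrow> ('v, 'w) coord"
  assumes "finite (diagram lam)" "F \<in> schur_carrier lam c"
  obtains T where "\<And>n. T n \<in> coord_tensors lam" "\<And>n. F n = young lam (T n)" "\<And>n. n \<ge> c \<Longrightarrow> T n = (\<lambda>_. 0)"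
proof -
  have "\<exists>T\<in>coord_tensors lam. F n = young lam T \<and> (n \<ge> c \<longrightarrow> T = (\<lambda>_. 0))" for n
  proof (cases "n < c")
    case True
    then show ?thesis using assms(2) by (auto simp: schur_carrier_def extend_scalars_schur[OF assms(1)])
  next
    case False
    then show ?thesis
      using assms(2) by (intro bexI[of _ "\<lambda>_. 0"]) (auto simp: young_zero schur_carrier_def coord_tensors_def)
  qed
  then show ?thesis using that by metis
qed

lemma schur_carrierI:
  fixes F :: "nat \<Rightarrow> 'v::finite filling \<Rightarrow> ('v, 'w) coord"
  assumes "finite (diagram lam)" "\<And>n. n < c \<Longrightarrow> \<exists>T\<in>coord_tensors lam. F n = young lam T"
    and "\<And>n. n \<ge> c \<Longrightarrow> F n = (\<lambda>_. 0)"
  shows "F \<in> schur_carrier lam c"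
  using assms by (auto simp: schur_carrier_def extend_scalars_schur[OF assms(1)])

definition unit_slot :: "nat \<Rightarrow> ('v filling \<Rightarrow> complex) \<Rightarrow> nat \<Rightarrow> 'v filling \<Rightarrow> ('v, 'w) coord"
  where "unit_slot n s = (\<lambda>m w. if m = n then Const (s w) else 0)"

lemma unit_slot_carrier:
  fixes s :: "'v::finite filling \<Rightarrow> complex"
  assumes "finite (diagram lam)" "n < c" "s \<in> schur lam"
  shows "unit_slot n s \<in> (schur_carrier lam c :: (nat \<Rightarrow> 'v filling \<Rightarrow> ('v, 'w) coord) set)"
proof (rule schur_carrierI[OF assms(1)])
  obtain t where t: "t \<in> supported (words lam)" "s = young lam t" using assms(3) by (auto simp: schur_eq)
  show "\<exists>T\<in>coord_tensors lam. unit_slot n s m = young lam T" for m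
  proof (cases "m = n")
    case True
    then show ?thesis
      by (intro bexI[of _ "\<lambda>w. Const (t w)"])
         (use t in \<open>auto simp: unit_slot_def young_Const coord_tensors_def supported_def Const_zero\<close>)
  next
    case False
    then show ?thesis
      by (intro bexI[of _ "\<lambda>_. 0"]) (auto simp: unit_slot_def young_zero coord_tensors_def)
  qed
qed (use assms(2) in \<open>auto simp: unit_slot_def\<close>)

lemma concrete_module_schur:
  assumes "finite (diagram lam)"
  shows "concrete_module (schur_carrier lam c :: (nat \<Rightarrow> 'v::finite filling \<Rightarrow> ('v, 'w::finite) coord) set) schur_scale"
proof
  fix F G :: "nat \<Rightarrow> 'v filling \<Rightarrow> ('v, 'w) coord" and r :: "('v, 'w) coord"
  show "0 \<in> (schur_carrier lam c :: (nat \<Rightarrow> 'v filling \<Rightarrow> ('v, 'w) coord) set)"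
    by (rule schur_carrierI[OF assms])
       (auto simp: zero_fun_def coord_tensors_def young_zero intro!: bexI[of _ "\<lambda>_. 0"])
  assume F: "F \<in> schur_carrier lam c"
  obtain T where T: "\<And>n. T n \<in> coord_tensors lam" "\<And>n. F n = young lam (T n)" "\<And>n. n \<ge> c \<Longrightarrow> T n = (\<lambda>_. 0)"
    by (rule schur_carrier_young[OF assms F]) (rule that)
  have F0: "F n = (\<lambda>_. 0)" if "n \<ge> c" for n using F that by (simp add: schur_carrier_def)
  show "schur_scale r F \<in> schur_carrier lam c"
  proof (rule schur_carrierI[OF assms])
    show "\<exists>T'\<in>coord_tensors lam. schur_scale r F n = young lam T'" for n
      by (intro bexI[of _ "\<lambda>w. r * T n w"])
         (use T(1)[of n] T(2)[of n] in \<open>auto simp: schur_scale_def young_scale coord_tensors_def\<close>)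
  qed (simp add: schur_scale_def F0)
  show "- F \<in> schur_carrier lam c"
  proof (rule schur_carrierI[OF assms])
    show "\<exists>T'\<in>coord_tensors lam. (- F) n = young lam T'" for n
      by (intro bexI[of _ "\<lambda>w. - 1 * T n w"])
         (use T(1)[of n] T(2)[of n] in \<open>auto simp: young_scale[of lam "-1", simplified] coord_tensors_def\<close>)
  qed (rule ext, simp add: F0)
  assume G: "G \<in> schur_carrier lam c"
  obtain T' where T': "\<And>n. T' n \<in> coord_tensors lam" "\<And>n. G n = young lam (T' n)" "\<And>n. n \<ge> c \<Longrightarrow> T' n = (\<lambda>_. 0)"
    by (rule schur_carrier_young[OF assms G]) (rule that)
  have G0: "G n = (\<lambda>_. 0)" if "n \<ge> c" for n using G that by (simp add: schur_carrier_def)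
  show "F + G \<in> schur_carrier lam c"
  proof (rule schur_carrierI[OF assms])
    show "\<exists>S\<in>coord_tensors lam. (F + G) n = young lam S" for n
      by (intro bexI[of _ "\<lambda>w. T n w + T' n w"])
         (use T(1)[of n] T(2)[of n] T'(1)[of n] T'(2)[of n] in
           \<open>auto simp: young_add coord_tensors_def fun_eq_iff plus_fun_def\<close>)
  qed (intro ext, simp only: pointwise, simp add: F0 G0)
qed (auto simp: schur_scale_def fun_eq_iff pointwise algebra_simps)

lemma schur_free_eq:
  assumes "finite (diagram lam)"
  shows "(schur_free lam c :: (('v::finite, 'w::finite) coord, _) module) = concrete_module.M (schur_carrier lam c) schur_scale"
  unfolding concrete_module.M_def[OF concrete_module_schur[OF assms]]
  unfolding schur_free_def schur_carrier_def schur_scale_def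
proof -
  have "(\<lambda>F G n w. F n w + G n w) = ((+) :: (nat \<Rightarrow> 'v filling \<Rightarrow> ('v, 'w) coord) \<Rightarrow> _)"
    by (intro ext) (simp add: pointwise)
  moreover have "(\<lambda>_ _. 0) = (0 :: nat \<Rightarrow> 'v filling \<Rightarrow> ('v, 'w) coord)"
    by (intro ext) (simp add: pointwise)
  ultimately show "\<lparr>carrier = {F. (\<forall>n<c. F n \<in> extend_scalars (schur lam)) \<and> (\<forall>n\<ge>c. F n = (\<lambda>_. 0))},
      monoid.mult = undefined, one = undefined, ring.zero = (\<lambda>_ _. 0), ring.add = (\<lambda>F G n w. F n w + G n w),
      module.smult = (\<lambda>r F n w. r * F n w)\<rparr> =
    \<lparr>carrier = {F. (\<forall>n<c. F n \<in> extend_scalars (schur lam)) \<and> (\<forall>n\<ge>c. F n = (\<lambda>_. 0))},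
      monoid.mult = undefined, one = undefined, ring.zero = 0 :: nat \<Rightarrow> 'v filling \<Rightarrow> ('v, 'w) coord,
      ring.add = (+), module.smult = (\<lambda>r F n w. r * F n w)\<rparr>"
    by simp
qed

lemma concrete_equivariant_schur:
  assumes fin: "finite (diagram lam)"
  shows "concrete_equivariant (schur_carrier lam c :: (nat \<Rightarrow> 'v::finite filling \<Rightarrow> ('v, 'w::finite) coord) set)
    schur_scale (schur_free_act lam)"
proof (intro concrete_equivariant.intro concrete_module_schur[OF fin] concrete_equivariant_axioms.intro)
  interpret concrete_module "schur_carrier lam c :: (nat \<Rightarrow> 'v filling \<Rightarrow> ('v, 'w) coord) set" schur_scale
    by (rule concrete_module_schur[OF fin])
  fix F G :: "nat \<Rightarrow> 'v filling \<Rightarrow> ('v, 'w) coord" and g h :: "complex ^ 'v ^ 'v" and r :: "('v, 'w) coord"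
  show act_add: "schur_free_act lam g (F + G) = schur_free_act lam g F + schur_free_act lam g G" for g F G
    by (auto simp: fun_eq_iff schur_free_act_eq pointwise plus_fun_def coord_tensor_act_add)
  show act_sc: "schur_free_act lam g (schur_scale r F) = schur_scale (coord_act g r) (schur_free_act lam g F)" for g r F
    by (auto simp: fun_eq_iff schur_free_act_eq schur_scale_def coord_tensor_act_scale)
  assume F: "F \<in> schur_carrier lam c"
  obtain T where T: "\<And>n. T n \<in> coord_tensors lam" "\<And>n. F n = young lam (T n)" "\<And>n. n \<ge> c \<Longrightarrow> T n = (\<lambda>_. 0)"
    by (rule schur_carrier_young[OF fin F]) (rule that)
  have F0: "F n = (\<lambda>_. 0)" if "n \<ge> c" for n using F that by (simp add: schur_carrier_def)
  have Fn: "F n \<in> coord_tensors lam" for n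
    unfolding T(2) using T(1)[of n] young_supported[OF fin, of "T n"] by (auto simp: coord_tensors_def)
  show "schur_free_act lam g F \<in> schur_carrier lam c"
    by (rule schur_carrierI[OF fin])
       (auto simp: schur_free_act_eq T(2) coord_tensor_act_young coord_tensor_act_supported, simp add: T(2)[symmetric] F0
         coord_tensor_act_young[symmetric] coord_tensor_act_zero[abs_def])
  show "schur_free_act lam (Finite_Cartesian_Product.mat 1) F = F"
    by (auto simp: schur_free_act_eq coord_tensor_act_id[OF fin Fn])
  show "schur_free_act lam (g ** h) F = schur_free_act lam g (schur_free_act lam h F)"
    by (auto simp: schur_free_act_eq coord_tensor_act_comp[OF fin])
  \<comment> \<open>Generators over the polynomial ring, one for each summand and each word. They
    need not be independent; algebraicity requires only that they generate.\<close>
  define e where "e n u = (unit_slot n (young_unit lam u) :: nat \<Rightarrow> 'v filling \<Rightarrow> ('v, 'w) coord)" for n u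
  have eC: "e n u \<in> schur_carrier lam c" if "n < c" "u \<in> words lam" for n u
    unfolding e_def by (rule unit_slot_carrier[OF fin that(1) young_unit_schur[OF that(2)]])
  have F_eq: "F = (\<Sum>n<c. \<Sum>u\<in>words lam. schur_scale (T n u) (e n u))"
  proof (intro ext)
    fix m w
    have "(\<Sum>n<c. \<Sum>u\<in>words lam. schur_scale (T n u) (e n u)) m w =
        (\<Sum>n<c. \<Sum>u\<in>words lam. T n u * (if m = n then Const (young_unit lam u w) else 0))"
      by (simp add: sum_fun_apply schur_scale_def e_def unit_slot_def)
    also have "\<dots> = (\<Sum>n<c. if m = n then \<Sum>u\<in>words lam. T n u * Const (young_unit lam u w) else 0)"
      by (intro sum.cong) auto
    also have "\<dots> = (if m < c then young lam (T m) w else 0)"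
      by (simp add: young_coord_expand[OF fin T(1)])
    also have "\<dots> = F m w" using F0[of m] T(2)[of m] by auto
    finally show "F m w = (\<Sum>n<c. \<Sum>u\<in>words lam. schur_scale (T n u) (e n u)) m w" by simp
  qed
  have act_sum: "schur_free_act lam g (\<Sum>a\<in>A. H a) = (\<Sum>a\<in>A. schur_free_act lam g (H a))"
    for g and A :: "'z set" and H :: "'z \<Rightarrow> nat \<Rightarrow> 'v filling \<Rightarrow> ('v, 'w) coord"
  proof -
    have z: "schur_free_act lam g 0 = (0 :: nat \<Rightarrow> 'v filling \<Rightarrow> ('v, 'w) coord)"
      using act_add[of g 0 0] by simp
    show ?thesis
      by (induction A rule: infinite_finite_induct) (simp_all only: sum.infinite sum.empty sum.insert z act_add not_False_eq_True)
  qed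
  have act_e: "schur_free_act lam g (e n u) = (\<Sum>v\<in>words lam. schur_scale (Const (\<Prod>b\<in>diagram lam. g $ v b $ u b)) (e n v))"
    if u: "u \<in> words lam" for g n u
  proof (intro ext)
    fix m w
    show "schur_free_act lam g (e n u) m w = (\<Sum>v\<in>words lam. schur_scale (Const (\<Prod>b\<in>diagram lam. g $ v b $ u b)) (e n v)) m w"
      by (cases "m = n")
         (simp_all add: schur_free_act_eq sum_fun_apply schur_scale_def e_def unit_slot_def
           coord_tensor_act_young_unit[OF fin u] coord_tensor_act_zero)
  qed
  have "algebraic_family (\<lambda>g. schur_free_act lam g F)"
    unfolding F_eq act_sum act_sc
  proof (intro algebraic_family_sum)
    fix n and u :: "'v filling" assume n: "n \<in> {..<c}" and u: "u \<in> words lam"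
    obtain l :: nat and f s where f: "\<forall>i<l. polynomial_on_GL (f i)" "\<forall>g. coord_act g (T n u) = (\<Sum>i<l. Const (f i g) * s i)"
      using coord_act_algebraic by blast
    have "schur_scale (coord_act g (T n u)) (schur_free_act lam g (e n u)) =
        (\<Sum>i<l. \<Sum>v\<in>words lam. schur_scale (Const (f i g * (\<Prod>b\<in>diagram lam. g $ v b $ u b))) (schur_scale (s i) (e n v)))" for g
      unfolding act_e[OF u] f(2)[rule_format]
      by (intro ext) (simp add: schur_scale_def sum_fun_apply sum_product Const_mult mult_ac)
    moreover have "algebraic_family (\<lambda>g. \<Sum>i<l. \<Sum>v\<in>words lam.
        schur_scale (Const (f i g * (\<Prod>b\<in>diagram lam. g $ v b $ u b))) (schur_scale (s i) (e n v)))"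
      by (intro algebraic_family_sum algebraic_family_scaled polynomial_on_GL_mult polynomial_on_GL_prod
          polynomial_on_GL_entry sc_C eC) (use f(1) n in auto)
    ultimately show "algebraic_family (\<lambda>g. schur_scale (coord_act g (T n u)) (schur_free_act lam g (e n u)))" by simp
  qed
  then show "\<exists>(n :: nat) f y. (\<forall>i<n. polynomial_on_GL (f i) \<and> y i \<in> schur_carrier lam c) \<and>
      (\<forall>g. schur_free_act lam g F = (\<Sum>i<n. schur_scale (Const (f i g)) (y i)))"
    unfolding algebraic_family_def .
qed

section \<open>The differential\<close>

lemma coord_tensor_act_sum:
  "coord_tensor_act lam g (\<lambda>w. \<Sum>a\<in>A. c a * t a w) w = (\<Sum>a\<in>A. coord_act g (c a) * coord_tensor_act lam g (t a) w)"
proof -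
  have "coord_twist g (\<lambda>w. \<Sum>a\<in>A. c a * t a w) = (\<lambda>w. \<Sum>a\<in>A. coord_act g (c a) * coord_twist g (t a) w)"
    by (simp add: coord_twist_def ca.sum ca.mult)
  then show ?thesis by (simp only: coord_tensor_act_def tensor_act_sum_scale)
qed

lemma coord_twist_contract: "coord_twist g (contract lam0 v T) = contract lam0 v (coord_twist g T)"
  by (auto simp: coord_twist_def contract_def ca.zero)

text \<open>Coordinates with respect to a basis are given as explicit linear forms
  \<open>\<kappa> i\<close> in the coefficients at words, because such forms extend to polynomial
  coefficients at once.\<close>

lemma subspace_coordinates:
  assumes "finite W" "K \<subseteq> supported W" "fs.subspace K"
  shows "\<exists>s \<kappa>. (\<forall>i<fs.dim K. s i \<in> K) \<and> (\<forall>t\<in>K. \<forall>w. t w = (\<Sum>i<fs.dim K. (\<Sum>u\<in>W. \<kappa> i u * t u) * s i w)) \<and>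
    (\<forall>i<fs.dim K. \<forall>j<fs.dim K. (\<Sum>u\<in>W. \<kappa> i u * s j u) = (if i = j then 1 else 0))"
proof -
  obtain B where B: "B \<subseteq> K" "finite B" "fs.independent B" "fs.span B = K" "card B = fs.dim K"
    by (rule finite_basis[OF assms])
  obtain s where s: "bij_betw s {..<fs.dim K} B"
    using B(2,5) by (metis ex_bij_betw_nat_finite atLeast0LessThan)
  have sB: "s i \<in> B" if "i < fs.dim K" for i using s that by (auto simp: bij_betw_def)
  have "\<exists>g. Vector_Spaces.linear cscale (*) g \<and> (\<forall>x\<in>B. g x = (if x = s i then 1 else 0))" for i
    using fsc.linear_independent_extend[OF B(3), of "\<lambda>x. if x = s i then 1 else 0"] by blast
  then obtain g where g: "\<And>i. Vector_Spaces.linear cscale (*) (g i)"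
    "\<And>i x. x \<in> B \<Longrightarrow> g i x = (if x = s i then 1 else 0)" by metis
  define \<kappa> where "\<kappa> i u = g i (unit_fun u)" for i u
  have eval: "(\<Sum>u\<in>W. \<kappa> i u * t u) = g i t" if "t \<in> supported W" for i t
    by (subst (2) supported_sum_unit_fun[OF assms(1) that])
       (simp add: \<kappa>_def fsc.linear_sum[OF g(1)] fsc.linear_scale[OF g(1)] mult.commute)
  have gs: "g i (s j) = (if i = j then 1 else 0)" if "i < fs.dim K" "j < fs.dim K" for i j
    using g(2)[OF sB[OF that(2)], of i] s that by (auto simp: bij_betw_def inj_on_def)
  show ?thesis
  proof (rule exI[of _ s], rule exI[of _ \<kappa>], intro conjI ballI allI impI)
    show "s i \<in> K" if "i < fs.dim K" for i using sB[OF that] B(1) by blast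
    show "(\<Sum>u\<in>W. \<kappa> i u * s j u) = (if i = j then 1 else 0)" if "i < fs.dim K" "j < fs.dim K" for i j
      using eval[of "s j" i] sB[OF that(2)] B(1) assms(2) gs[OF that] by auto
    fix t w assume t: "t \<in> K"
    have "t = (\<Sum>b\<in>B. cscale (fs.representation B t b) b)"
      using fs.sum_representation_eq[OF B(3) _ B(2) order.refl, of t] t B(4) by simp
    also have "\<dots> = (\<Sum>j<fs.dim K. cscale (fs.representation B t (s j)) (s j))"
      by (rule sum.reindex_bij_betw[OF s, symmetric])
    finally have rep: "t = (\<Sum>j<fs.dim K. cscale (fs.representation B t (s j)) (s j))" .
    have "g i t = fs.representation B t (s i)" if i: "i < fs.dim K" for i
    proof -
      have "g i t = (\<Sum>j<fs.dim K. fs.representation B t (s j) * g i (s j))"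
        by (subst rep) (simp add: fsc.linear_sum[OF g(1)] fsc.linear_scale[OF g(1)])
      also have "\<dots> = (\<Sum>j<fs.dim K. if i = j then fs.representation B t (s j) else 0)"
        by (intro sum.cong) (auto simp: gs[OF i])
      finally show ?thesis using i by simp
    qed
    moreover have "t w = (\<Sum>j<fs.dim K. fs.representation B t (s j) * s j w)"
      by (subst rep) (simp add: pointwise)
    ultimately show "t w = (\<Sum>i<fs.dim K. (\<Sum>u\<in>W. \<kappa> i u * t u) * s i w)"
      using eval t assms(2) by (auto intro!: sum.cong)
  qed
qed

text \<open>Both sides are linear over the polynomial ring in the tensor behind \<open>F\<close>,
  and for symmetrized words the identity is the complex one.\<close>

lemma extended_coordinates:
  fixes s :: "nat \<Rightarrow> 'v::finite filling \<Rightarrow> complex" and F :: "'v filling \<Rightarrow> ('v, 'w) coord"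
  assumes fin: "finite (diagram lam)"
    and coords: "\<And>t w. t \<in> schur lam \<Longrightarrow> t w = (\<Sum>i<a. (\<Sum>u\<in>words lam. \<kappa> i u * t u) * s i w)"
    and F: "F \<in> extend_scalars (schur lam)"
  shows "F w = (\<Sum>i<a. (\<Sum>u\<in>words lam. Const (\<kappa> i u) * F u) * Const (s i w))"
proof -
  obtain T where T: "T \<in> coord_tensors lam" "F = young lam T" using F by (auto simp: extend_scalars_schur[OF fin])
  have Fw: "F w = (\<Sum>v\<in>words lam. T v * Const (young_unit lam v w))" for w
    unfolding T(2) by (rule young_coord_expand[OF fin T(1)])
  have "(\<Sum>i<a. (\<Sum>u\<in>words lam. Const (\<kappa> i u) * F u) * Const (s i w)) =
      (\<Sum>i<a. \<Sum>u\<in>words lam. \<Sum>v\<in>words lam. T v * Const (\<kappa> i u * young_unit lam v u * s i w))"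
    unfolding Fw sum_distrib_left sum_distrib_right by (simp add: Const_mult mult_ac)
  also have "\<dots> = (\<Sum>i<a. \<Sum>v\<in>words lam. \<Sum>u\<in>words lam. T v * Const (\<kappa> i u * young_unit lam v u * s i w))"
    by (rule sum.cong[OF refl], rule sum.swap)
  also have "\<dots> = (\<Sum>v\<in>words lam. \<Sum>i<a. \<Sum>u\<in>words lam. T v * Const (\<kappa> i u * young_unit lam v u * s i w))"
    by (rule sum.swap)
  also have "\<dots> = (\<Sum>v\<in>words lam. T v * Const (\<Sum>i<a. (\<Sum>u\<in>words lam. \<kappa> i u * young_unit lam v u) * s i w))"
    by (simp add: Const_sum sum_distrib_left sum_distrib_right)
  also have "\<dots> = F w"
    unfolding Fw by (intro sum.cong refl) (simp only: coords[OF young_unit_schur, symmetric])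
  finally show ?thesis by simp
qed

text \<open>The data delivered by \<open>skew_blowup_injective\<close>, together with an
  identification \<open>\<phi>\<close> of basis indices of \<open>V\<close> with ones of
  \<open>W\<close>.\<close>

locale skew_differential =
  fixes lam0 lam1 :: "nat \<Rightarrow> nat" and c0 c1 :: nat and \<gamma> :: "nat \<times> nat \<times> 'v::finite filling \<Rightarrow> complex"
    and \<phi> :: "'v \<Rightarrow> 'w::finite"
  assumes fin1: "finite (diagram lam1)" and le: "lam0 \<le> lam1" and ne: "skew lam0 lam1 \<noteq> {}"
    and inj: "inj \<phi>" and pos: "c0 > 0" "c1 > 0"
    and dims: "c1 * fs.dim (schur lam1 :: ('v filling \<Rightarrow> complex) set) = c0 * fs.dim (schur lam0 :: ('v filling \<Rightarrow> complex) set)"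
    and blowup_injective: "\<And>x m. \<forall>m<c1. x m \<in> schur lam1 \<Longrightarrow>
      \<forall>n<c0. \<forall>w\<in>words lam0. (\<Sum>(m, v)\<in>{..<c1} \<times> skew_words lam0 lam1.
         \<gamma> (n, m, v) * young lam0 (contract lam0 v (x m)) w) = 0 \<Longrightarrow> m < c1 \<Longrightarrow> x m = 0"
begin

abbreviation "SW \<equiv> skew_words lam0 lam1 :: 'v filling set"
abbreviation "C0 \<equiv> schur_carrier lam0 c0 :: (nat \<Rightarrow> 'v filling \<Rightarrow> ('v, 'w) coord) set"
abbreviation "C1 \<equiv> schur_carrier lam1 c1 :: (nat \<Rightarrow> 'v filling \<Rightarrow> ('v, 'w) coord) set"

lemma fin0: "finite (diagram lam0)"
  using group_mono(1)[OF le] fin1 finite_subset by blast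

lemma finS: "finite (skew lam0 lam1)"
  using fin1 by (simp add: skew_def)

lemma finSW: "finite SW"
  using finS by (auto simp: skew_words_def intro: finite_PiE)

sublocale F0: concrete_equivariant C0 schur_scale "schur_free_act lam0"
  by (rule concrete_equivariant_schur[OF fin0])

sublocale F1: concrete_equivariant C1 schur_scale "schur_free_act lam1"
  by (rule concrete_equivariant_schur[OF fin1])

text \<open>The entry at \<open>(v', v)\<close> of the tensor power, over the skew boxes, of the
  generic matrix. The group moves \<open>v'\<close> and leaves \<open>v\<close> alone.\<close>

definition var_prod :: "'v filling \<Rightarrow> 'v filling \<Rightarrow> ('v, 'w) coord"
  where "var_prod v' v = (\<Prod>b\<in>skew lam0 lam1. Var (v' b, \<phi> (v b)))"

definition summand :: "nat \<times> 'v filling \<times> 'v filling \<Rightarrow> (nat \<Rightarrow> 'v filling \<Rightarrow> ('v, 'w) coord) \<Rightarrow> nat \<Rightarrow> 'v filling \<Rightarrow> ('v, 'w) coord"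
  where "summand = (\<lambda>(m, v, v') F n w. if n < c0
    then Const (\<gamma> (n, m, v)) * young lam0 (contract lam0 v' (F m)) w else 0)"

text \<open>For fixed \<open>v\<close>, summing over \<open>v'\<close> pairs the contractions with
  the entries of the generic tensor power, which is equivariant. As \<open>v\<close> lives on the
  side of \<open>W\<close>, the combination over \<open>v\<close> may have any coefficients
  \<open>\<gamma>\<close>.\<close>

definition diff :: "(nat \<Rightarrow> 'v filling \<Rightarrow> ('v, 'w) coord) \<Rightarrow> nat \<Rightarrow> 'v filling \<Rightarrow> ('v, 'w) coord"
  where "diff F = (\<Sum>\<rho>\<in>{..<c1} \<times> SW \<times> SW. schur_scale (var_prod (snd (snd \<rho>)) (fst (snd \<rho>))) (summand \<rho> F))"

lemma diff_apply:
  assumes "n < c0"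
  shows "diff F n w = (\<Sum>(m, v)\<in>{..<c1} \<times> SW. Const (\<gamma> (n, m, v)) *
    (\<Sum>v'\<in>SW. var_prod v' v * young lam0 (contract lam0 v' (F m)) w))"
proof -
  have "diff F n w = (\<Sum>(m, v, v')\<in>{..<c1} \<times> SW \<times> SW. var_prod v' v * (Const (\<gamma> (n, m, v)) * young lam0 (contract lam0 v' (F m)) w))"
    using assms unfolding diff_def sum_fun_apply
    by (intro sum.cong refl) (auto simp: schur_scale_def summand_def)
  also have "\<dots> = (\<Sum>m<c1. \<Sum>v\<in>SW. \<Sum>v'\<in>SW. var_prod v' v * (Const (\<gamma> (n, m, v)) * young lam0 (contract lam0 v' (F m)) w))"
    by (simp add: sum.cartesian_product)
  also have "\<dots> = (\<Sum>(m, v)\<in>{..<c1} \<times> SW. Const (\<gamma> (n, m, v)) *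
      (\<Sum>v'\<in>SW. var_prod v' v * young lam0 (contract lam0 v' (F m)) w))"
    by (simp add: sum.cartesian_product[symmetric] sum_distrib_left mult.left_commute)
  finally show ?thesis .
qed

lemma summand_C: "summand \<rho> F \<in> C0"
proof -
  obtain m v v' where \<rho>: "\<rho> = (m, v, v')" by (cases \<rho>)
  have "\<exists>T\<in>coord_tensors lam0. summand \<rho> F n = young lam0 T" if "n < c0" for n
  proof (intro bexI)
    show "summand \<rho> F n = young lam0 (\<lambda>w. Const (\<gamma> (n, m, v)) * contract lam0 v' (F m) w)"
      using that by (auto simp: summand_def \<rho> young_scale)
    show "(\<lambda>w. Const (\<gamma> (n, m, v)) * contract lam0 v' (F m) w) \<in> coord_tensors lam0"
      by (simp add: coord_tensors_def contract_def)
  qed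
  then show ?thesis by (rule schur_carrierI[OF fin0]) (auto simp: summand_def \<rho>)
qed

lemma summand_add: "summand \<rho> (F + G) = summand \<rho> F + summand \<rho> G"
proof -
  obtain m v v' where \<rho>: "\<rho> = (m, v, v')" by (cases \<rho>)
  have c: "contract lam0 v' (F m + G m) = (\<lambda>w. contract lam0 v' (F m) w + contract lam0 v' (G m) w)"
    by (auto simp: contract_def pointwise)
  show ?thesis by (intro ext) (simp add: summand_def \<rho> c young_add pointwise distrib_left)
qed

lemma summand_scale: "summand \<rho> (schur_scale r F) = schur_scale r (summand \<rho> F)"
proof -
  obtain m v v' where \<rho>: "\<rho> = (m, v, v')" by (cases \<rho>)
  have c: "contract lam0 v' (\<lambda>w. r * F m w) = (\<lambda>w. r * contract lam0 v' (F m) w)"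
    by (auto simp: contract_def)
  show ?thesis by (intro ext) (simp add: summand_def \<rho> c young_scale schur_scale_def mult.left_commute)
qed

lemma diff_C: "diff F \<in> C0"
  unfolding diff_def by (intro F0.sum_C F0.sc_C summand_C)

lemma diff_add: "diff (F + G) = diff F + diff G"
  by (simp only: diff_def summand_add F0.sc_add_right sum.distrib)

lemma diff_scale: "diff (schur_scale r F) = schur_scale r (diff F)"
  unfolding diff_def summand_scale F0.sc_sum F0.sc_mult[symmetric] by (simp only: mult.commute)

lemma diff_zero: "diff 0 = 0"
  using diff_add[of 0 0] by simp

lemma diff_diff: "diff (F - G) = diff F - diff G"
  using diff_add[of "F - G" G] by (simp add: algebra_simps)

lemma diff_sum: "diff (\<Sum>a\<in>A. f a) = (\<Sum>a\<in>A. diff (f a))"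
  by (induction A rule: infinite_finite_induct) (simp_all only: sum.infinite sum.empty sum.insert diff_zero diff_add not_False_eq_True)

text \<open>The skew shape is nonempty, so every product of variables that occurs has at least one
  factor.\<close>

lemma diff_minimal: "diff F \<in> max_ideal_smult F0.M"
  unfolding diff_def
proof (intro F0.sum_max_ideal_smult F0.max_ideal_smult_facts(3) summand_C)
  fix \<rho> :: "nat \<times> 'v filling \<times> 'v filling"
  obtain b where "b \<in> skew lam0 lam1" using ne by blast
  then show "var_prod (snd (snd \<rho>)) (fst (snd \<rho>)) \<in> max_ideal"
    using Var_multiple_in_max_ideal by (simp add: var_prod_def prod.remove[OF finS])
qed

lemma coord_act_var_prod:
  assumes "v \<in> SW" "v'' \<in> SW"
  shows "coord_act g (var_prod v'' v) =
    (\<Sum>v'\<in>SW. var_prod v' v * (\<Prod>b\<in>skew lam0 lam1. Const (g $ v' b $ v'' b)))"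
proof -
  have "coord_act g (var_prod v'' v) =
      (\<Prod>b\<in>skew lam0 lam1. \<Sum>a\<in>UNIV. Const (g $ a $ v'' b) * Var (a, \<phi> (v b)))"
    by (simp add: var_prod_def ca.prod ca.Var)
  also have "\<dots> = (\<Sum>v'\<in>SW. \<Prod>b\<in>skew lam0 lam1. Const (g $ v' b $ v'' b) * Var (v' b, \<phi> (v b)))"
    unfolding skew_words_def by (rule prod_sum_PiE[OF finS]) simp
  finally show ?thesis by (simp add: var_prod_def prod.distrib mult.commute)
qed

text \<open>Contractions transform under \<open>g\<close> by the tensor power on the skew boxes, and
  the sum over \<open>v'\<close> of its entries against \<open>var_prod v' v\<close> is precisely
  the translate of \<open>var_prod v'' v\<close>, by \<open>coord_act_var_prod\<close>.\<close>

lemma diff_equivariant: "diff (schur_free_act lam1 g F) = schur_free_act lam0 g (diff F)"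
proof (intro ext)
  fix n w
  show "diff (schur_free_act lam1 g F) n w = schur_free_act lam0 g (diff F) n w"
  proof (cases "n < c0")
    case False
    have "G n w = 0" if "G \<in> C0" for G using that False by (simp add: schur_carrier_def)
    from this[OF diff_C, of "schur_free_act lam1 g F"] this[OF F0.act_C[OF diff_C], of g F]
    show ?thesis by simp
  next
    case True
    define A where "A = (\<lambda>i j. Const (g $ i $ j) :: ('v, 'w) coord)"
    define Z where "Z m v = tensor_act (diagram lam0) A (young lam0 (contract lam0 v (coord_twist g (F m)))) w" for m v
    have L: "(\<Sum>v'\<in>SW. var_prod v' v * young lam0 (contract lam0 v' (schur_free_act lam1 g F m)) w) =
        (\<Sum>v''\<in>SW. coord_act g (var_prod v'' v) * Z m v'')" if v: "v \<in> SW" for m v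
    proof -
      have "young lam0 (contract lam0 v' (schur_free_act lam1 g F m)) w =
          (\<Sum>v''\<in>SW. (\<Prod>b\<in>skew lam0 lam1. A (v' b) (v'' b)) * Z m v'')" if v': "v' \<in> SW" for v'
      proof -
        let ?P = "\<lambda>v''. \<Prod>b\<in>skew lam0 lam1. A (v' b) (v'' b)"
        let ?T = "coord_twist g (F m)"
        have "contract lam0 v' (schur_free_act lam1 g F m) =
            tensor_act (diagram lam0) A (\<lambda>w. \<Sum>v''\<in>SW. ?P v'' * contract lam0 v'' ?T w)"
          unfolding schur_free_act_eq coord_tensor_act_def A_def by (rule contract_tensor_act[OF fin1 le v'])
        then have "young lam0 (contract lam0 v' (schur_free_act lam1 g F m)) w =
            tensor_act (diagram lam0) A (young lam0 (\<lambda>w. \<Sum>v''\<in>SW. ?P v'' * contract lam0 v'' ?T w)) w"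
          by (simp only: tensor_act_young)
        also have "young lam0 (\<lambda>w. \<Sum>v''\<in>SW. ?P v'' * contract lam0 v'' ?T w) =
            (\<lambda>w. \<Sum>v''\<in>SW. ?P v'' * young lam0 (contract lam0 v'' ?T) w)"
          by (rule ext) (rule young_sum_scale)
        also have "tensor_act (diagram lam0) A (\<lambda>w. \<Sum>v''\<in>SW. ?P v'' * young lam0 (contract lam0 v'' ?T) w) w =
            (\<Sum>v''\<in>SW. ?P v'' * Z m v'')"
          unfolding Z_def by (rule tensor_act_sum_scale)
        finally show ?thesis .
      qed
      then have "(\<Sum>v'\<in>SW. var_prod v' v * young lam0 (contract lam0 v' (schur_free_act lam1 g F m)) w) =
          (\<Sum>v'\<in>SW. \<Sum>v''\<in>SW. var_prod v' v * (\<Prod>b\<in>skew lam0 lam1. A (v' b) (v'' b)) * Z m v'')"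
        by (simp add: sum_distrib_left mult.assoc)
      also have "\<dots> = (\<Sum>v''\<in>SW. (\<Sum>v'\<in>SW. var_prod v' v * (\<Prod>b\<in>skew lam0 lam1. A (v' b) (v'' b))) * Z m v'')"
        unfolding sum_distrib_right by (rule sum.swap)
      also have "\<dots> = (\<Sum>v''\<in>SW. coord_act g (var_prod v'' v) * Z m v'')"
        by (intro sum.cong refl) (simp add: coord_act_var_prod[OF v] A_def)
      finally show ?thesis .
    qed
    have Zc: "coord_tensor_act lam0 g (young lam0 (contract lam0 v (F m))) w = Z m v" for m v
      by (simp add: Z_def coord_tensor_act_def coord_twist_young coord_twist_contract A_def)
    have "schur_free_act lam0 g (diff F) n w = coord_tensor_act lam0 g (\<lambda>w. \<Sum>mv\<in>{..<c1} \<times> SW. Const (\<gamma> (n, mv)) *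
        (\<Sum>v'\<in>SW. var_prod v' (snd mv) * young lam0 (contract lam0 v' (F (fst mv))) w)) w"
      unfolding schur_free_act_eq using diff_apply[OF True, of F]
      by (intro arg_cong[where f="\<lambda>T. coord_tensor_act lam0 g T w"] ext) (simp add: case_prod_beta)
    also have "\<dots> = (\<Sum>mv\<in>{..<c1} \<times> SW. Const (\<gamma> (n, mv)) *
        (\<Sum>v'\<in>SW. coord_act g (var_prod v' (snd mv)) * Z (fst mv) v'))"
      unfolding coord_tensor_act_sum Zc ca.Const by (rule refl)
    also have "\<dots> = diff (schur_free_act lam1 g F) n w"
      unfolding diff_apply[OF True] by (intro sum.cong refl) (auto simp: L)
    finally show ?thesis by simp
  qed
qed

text \<open>At the identity matrix, for bases identified along \<open>\<phi>\<close>, the entry of \<open>diff\<close> at \<open>(n, m)\<close> is the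
  generic combination with coefficients \<open>\<gamma>\<close> of the contractions.\<close>

definition base_point :: "'v \<times> 'w \<Rightarrow> complex"
  where "base_point = (\<lambda>(i, j). if \<phi> i = j then 1 else 0)"

lemma evaluate_var_prod:
  assumes "v \<in> SW" "v' \<in> SW"
  shows "evaluate base_point (var_prod v' v) = (if v' = v then 1 else 0)"
proof (cases "v' = v")
  case False
  then obtain b where "b \<in> skew lam0 lam1" "v' b \<noteq> v b"
    using PiE_ext[of v' "skew lam0 lam1" "\<lambda>_. UNIV" v] assms unfolding skew_words_def by blast
  then have "(\<Prod>b\<in>skew lam0 lam1. base_point (v' b, \<phi> (v b))) = 0"
    using finS inj by (intro prod_zero) (auto simp: base_point_def inj_eq)
  then show ?thesis using False by (simp add: var_prod_def ev.prod ev.Var)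
qed (simp add: var_prod_def ev.prod ev.Var base_point_def)

text \<open>At the base point the sum over \<open>v'\<close> collapses to \<open>v' = v\<close>, so
  the differential specialises to the complex blow-up whose injectivity is known.\<close>

lemma evaluate_diff_unit_slot:
  assumes n: "n < c0" and m: "m < c1"
  shows "evaluate base_point (diff (unit_slot m s) n w) = (\<Sum>v\<in>SW. \<gamma> (n, m, v) * young lam0 (contract lam0 v s) w)"
proof -
  have ey: "evaluate base_point (young lam0 (contract lam0 v' (unit_slot m s m')) w) =
      (if m' = m then young lam0 (contract lam0 v' s) w else 0)" for v' m'
  proof (cases "m' = m")
    case True
    have "contract lam0 v' (unit_slot m s m' :: 'v filling \<Rightarrow> ('v, 'w) coord) = (\<lambda>w. Const (contract lam0 v' s w))"
      using True by (auto simp: contract_def unit_slot_def Const_zero)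
    then show ?thesis using True by (simp add: young_Const ev.Const)
  next
    case False
    then have "contract lam0 v' (unit_slot m s m' :: 'v filling \<Rightarrow> ('v, 'w) coord) = (\<lambda>w. 0)" by (auto simp: contract_def unit_slot_def)
    then show ?thesis using False by (simp add: young_zero ev.zero)
  qed
  have inner: "(\<Sum>v'\<in>SW. evaluate base_point (var_prod v' v) * Y v') = Y v" if v: "v \<in> SW" for v and Y :: "'v filling \<Rightarrow> complex"
  proof -
    have "(\<Sum>v'\<in>SW. evaluate base_point (var_prod v' v) * Y v') = (\<Sum>v'\<in>SW. if v' = v then Y v' else 0)"
      by (intro sum.cong refl) (simp add: evaluate_var_prod[OF v])
    then show ?thesis using v finSW by simp
  qed
  have "evaluate base_point (diff (unit_slot m s) n w) = (\<Sum>(m', v)\<in>{..<c1} \<times> SW. \<gamma> (n, m', v) *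
      (if m' = m then young lam0 (contract lam0 v s) w else 0))"
    unfolding diff_apply[OF n] ev.sum
    by (intro sum.cong refl) (auto simp: ev.mult ev.sum ev.Const ey inner)
  also have "\<dots> = (\<Sum>m'<c1. if m' = m then \<Sum>v\<in>SW. \<gamma> (n, m', v) * young lam0 (contract lam0 v s) w else 0)"
    unfolding sum.cartesian_product[symmetric] by (intro sum.cong refl) simp
  also have "\<dots> = (\<Sum>v\<in>SW. \<gamma> (n, m, v) * young lam0 (contract lam0 v s) w)" using m by simp
  finally show ?thesis .
qed

text \<open>In bases of the two Schur functors the differential is a square matrix with nonzero
  determinant. Its left adjugate identity gives injectivity after cancelling the determinant, the
  right one a preimage of the determinant times any element.\<close>

lemma diff_injective_and_torsion:
  "(\<forall>F\<in>C1. diff F = 0 \<longrightarrow> F = 0) \<and> (\<exists>r. r \<noteq> 0 \<and> (\<forall>G\<in>C0. schur_scale r G \<in> diff ` C1))"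
proof -
  define a where "a = fs.dim (schur lam1 :: ('v filling \<Rightarrow> complex) set)"
  define b where "b = fs.dim (schur lam0 :: ('v filling \<Rightarrow> complex) set)"
  \<comment> \<open>The common number of coordinates on both sides, by \<open>dims\<close>; this
    makes the matrix square.\<close>
  define N where "N = c0 * b"
  have N1: "N = c1 * a" using dims by (simp add: N_def a_def b_def)
  have "\<exists>s \<kappa>. (\<forall>i<a. s i \<in> (schur lam1 :: ('v filling \<Rightarrow> complex) set)) \<and>
      (\<forall>t\<in>schur lam1. \<forall>w. t w = (\<Sum>i<a. (\<Sum>u\<in>words lam1. \<kappa> i u * t u) * s i w)) \<and>
      (\<forall>i<a. \<forall>j<a. (\<Sum>u\<in>words lam1. \<kappa> i u * s j u) = (if i = j then 1 else 0 :: complex))"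
    unfolding a_def by (rule subspace_coordinates[OF finite_words[OF fin1] schur_supported[OF fin1] subspace_schur])
  then obtain s1 where "\<exists>\<kappa>. (\<forall>i<a. s1 i \<in> (schur lam1 :: ('v filling \<Rightarrow> complex) set)) \<and>
      (\<forall>t\<in>schur lam1. \<forall>w. t w = (\<Sum>i<a. (\<Sum>u\<in>words lam1. \<kappa> i u * t u) * s1 i w)) \<and>
      (\<forall>i<a. \<forall>j<a. (\<Sum>u\<in>words lam1. \<kappa> i u * s1 j u) = (if i = j then 1 else 0 :: complex))" ..
  then obtain \<kappa>1 where sk1: "(\<forall>i<a. s1 i \<in> (schur lam1 :: ('v filling \<Rightarrow> complex) set)) \<and>
      (\<forall>t\<in>schur lam1. \<forall>w. t w = (\<Sum>i<a. (\<Sum>u\<in>words lam1. \<kappa>1 i u * t u) * s1 i w)) \<and>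
      (\<forall>i<a. \<forall>j<a. (\<Sum>u\<in>words lam1. \<kappa>1 i u * s1 j u) = (if i = j then 1 else 0 :: complex))" ..
  have s1: "i < a \<Longrightarrow> s1 i \<in> schur lam1"
    "t \<in> schur lam1 \<Longrightarrow> t w = (\<Sum>i<a. (\<Sum>u\<in>words lam1. \<kappa>1 i u * t u) * s1 i w)"
    "i < a \<Longrightarrow> j < a \<Longrightarrow> (\<Sum>u\<in>words lam1. \<kappa>1 i u * s1 j u) = (if i = j then 1 else 0 :: complex)" for i j w and t :: "'v filling \<Rightarrow> complex"
    by (-, rule conjunct1[OF sk1, rule_format], assumption,
        rule conjunct1[OF conjunct2[OF sk1], rule_format], assumption,
        rule conjunct2[OF conjunct2[OF sk1], rule_format], assumption+)
  have "\<exists>s \<kappa>. (\<forall>i<b. s i \<in> (schur lam0 :: ('v filling \<Rightarrow> complex) set)) \<and>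
      (\<forall>t\<in>schur lam0. \<forall>w. t w = (\<Sum>i<b. (\<Sum>u\<in>words lam0. \<kappa> i u * t u) * s i w)) \<and>
      (\<forall>i<b. \<forall>j<b. (\<Sum>u\<in>words lam0. \<kappa> i u * s j u) = (if i = j then 1 else 0 :: complex))"
    unfolding b_def by (rule subspace_coordinates[OF finite_words[OF fin0] schur_supported[OF fin0] subspace_schur])
  then obtain s0 where "\<exists>\<kappa>. (\<forall>i<b. s0 i \<in> (schur lam0 :: ('v filling \<Rightarrow> complex) set)) \<and>
      (\<forall>t\<in>schur lam0. \<forall>w. t w = (\<Sum>i<b. (\<Sum>u\<in>words lam0. \<kappa> i u * t u) * s0 i w)) \<and>
      (\<forall>i<b. \<forall>j<b. (\<Sum>u\<in>words lam0. \<kappa> i u * s0 j u) = (if i = j then 1 else 0 :: complex))" ..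
  then obtain \<kappa>0 where sk0: "(\<forall>i<b. s0 i \<in> (schur lam0 :: ('v filling \<Rightarrow> complex) set)) \<and>
      (\<forall>t\<in>schur lam0. \<forall>w. t w = (\<Sum>i<b. (\<Sum>u\<in>words lam0. \<kappa>0 i u * t u) * s0 i w)) \<and>
      (\<forall>i<b. \<forall>j<b. (\<Sum>u\<in>words lam0. \<kappa>0 i u * s0 j u) = (if i = j then 1 else 0 :: complex))" ..
  have s0: "i < b \<Longrightarrow> s0 i \<in> schur lam0"
    "t \<in> schur lam0 \<Longrightarrow> t w = (\<Sum>i<b. (\<Sum>u\<in>words lam0. \<kappa>0 i u * t u) * s0 i w)"
    "i < b \<Longrightarrow> j < b \<Longrightarrow> (\<Sum>u\<in>words lam0. \<kappa>0 i u * s0 j u) = (if i = j then 1 else 0 :: complex)" for i j w and t :: "'v filling \<Rightarrow> complex"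
    by (-, rule conjunct1[OF sk0, rule_format], assumption,
        rule conjunct1[OF conjunct2[OF sk0], rule_format], assumption,
        rule conjunct2[OF conjunct2[OF sk0], rule_format], assumption+)
  \<comment> \<open>One index for copy and basis vector: the copy is the quotient, the basis vector
    the remainder, by the dimension of the Schur functor.\<close>
  define E where "E k = (unit_slot (k div a) (s1 (k mod a)) :: nat \<Rightarrow> 'v filling \<Rightarrow> ('v, 'w) coord)" for k
  define co1 where "co1 F k = (\<Sum>u\<in>words lam1. Const (\<kappa>1 (k mod a) u) * F (k div a) u)"
    for F :: "nat \<Rightarrow> 'v filling \<Rightarrow> ('v, 'w) coord" and k
  define co0 where "co0 G r = (\<Sum>u\<in>words lam0. Const (\<kappa>0 (r mod b) u) * G (r div b) u)"
    for G :: "nat \<Rightarrow> 'v filling \<Rightarrow> ('v, 'w) coord" and r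
  have bd1: "k div a < c1" "k mod a < a" if "k < N" for k
    using that unfolding N1 by (auto simp: less_mult_imp_div_less intro!: mod_less_divisor gr0I)
  have bd0: "r div b < c0" "r mod b < b" if "r < N" for r
    using that unfolding N_def by (auto simp: less_mult_imp_div_less intro!: mod_less_divisor gr0I)
  have E_C: "E k \<in> C1" if "k < N" for k
    unfolding E_def by (rule unit_slot_carrier[OF fin1 bd1(1)[OF that] s1(1)[OF bd1(2)[OF that]]])
  have expand1: "F = (\<Sum>k<N. schur_scale (co1 F k) (E k))" if F: "F \<in> C1" for F
  proof (intro ext)
    fix m w
    have "(\<Sum>k<N. schur_scale (co1 F k) (E k)) m w =
        (\<Sum>n<c1. \<Sum>i<a. (\<Sum>u\<in>words lam1. Const (\<kappa>1 i u) * F n u) * (if m = n then Const (s1 i w) else 0))"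
      unfolding N1 sum_div_mod by (simp add: sum_fun_apply schur_scale_def co1_def E_def unit_slot_def)
    also have "\<dots> = (\<Sum>n<c1. if m = n then \<Sum>i<a. (\<Sum>u\<in>words lam1. Const (\<kappa>1 i u) * F n u) * Const (s1 i w) else 0)"
      by (intro sum.cong refl) auto
    also have "\<dots> = F m w"
    proof (cases "m < c1")
      case True
      then have "F m \<in> extend_scalars (schur lam1)" using F by (simp add: schur_carrier_def)
      from extended_coordinates[OF fin1 s1(2) this, of w] True show ?thesis by simp
    next
      case False
      then show ?thesis using F by (simp add: schur_carrier_def)
    qed
    finally show "F m w = (\<Sum>k<N. schur_scale (co1 F k) (E k)) m w" by simp
  qed
  have zero0: "G = 0" if G: "G \<in> C0" and z: "\<And>r. r < N \<Longrightarrow> co0 G r = 0" for G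
  proof (intro ext)
    fix n w
    show "G n w = 0 n w"
    proof (cases "n < c0")
      case True
      then have Gn: "G n \<in> extend_scalars (schur lam0)" using G by (simp add: schur_carrier_def)
      have "(\<Sum>u\<in>words lam0. Const (\<kappa>0 i u) * G n u) = 0" if "i < b" for i
      proof -
        have "n * b + i < Suc n * b" using that by simp
        also have "\<dots> \<le> N" unfolding N_def using True by (intro mult_le_mono1) simp
        finally show ?thesis using z[of "n * b + i"] that by (simp add: co0_def)
      qed
      then show ?thesis
        using extended_coordinates[OF fin0 s0(2) Gn, of w] by (simp add: pointwise)
    next
      case False
      then show ?thesis using G by (simp add: schur_carrier_def pointwise)
    qed
  qed
  define D where "D r k = co0 (diff (E k)) r" for r k
  have co0_sum: "co0 (\<Sum>k<N. schur_scale (f k) (G k)) r = (\<Sum>k<N. co0 (G k) r * f k)" for f G r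
  proof -
    have "co0 (\<Sum>k<N. schur_scale (f k) (G k)) r =
        (\<Sum>u\<in>words lam0. \<Sum>k<N. Const (\<kappa>0 (r mod b) u) * G k (r div b) u * f k)"
      by (simp add: co0_def sum_fun_apply schur_scale_def sum_distrib_left mult_ac)
    also have "\<dots> = (\<Sum>k<N. co0 (G k) r * f k)"
      unfolding co0_def sum_distrib_right by (rule sum.swap)
    finally show ?thesis .
  qed
  have co0_scale: "co0 (schur_scale f G) r = f * co0 G r" for f G r
    by (simp add: co0_def schur_scale_def sum_distrib_left mult.left_commute)
  have co0_diff: "co0 (G - G') r = co0 G r - co0 G' r" for G G' r
    by (simp add: co0_def algebra_simps sum_subtractf)
  have D_diff: "co0 (diff (\<Sum>k<N. schur_scale (f k) (E k))) r = (\<Sum>k<N. D r k * f k)" for f r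
    unfolding diff_sum diff_scale co0_sum D_def ..
  define \<Delta> where "\<Delta> = square_det N D"
  have "evaluate base_point \<Delta> = square_det N (\<lambda>r k. evaluate base_point (D r k))"
    unfolding \<Delta>_def by (rule square_det_hom) (simp_all add: ev.one ev.add ev.mult)
  also have "\<dots> \<noteq> 0"
  proof (rule square_det_nonzero)
    fix x :: "nat \<Rightarrow> complex"
    assume x: "\<And>r. r < N \<Longrightarrow> (\<Sum>k<N. evaluate base_point (D r k) * x k) = 0"
    \<comment> \<open>A kernel vector of the specialised matrix is reassembled into one complex
      tensor for each copy, to which \<open>blowup_injective\<close> applies.\<close>
    define X' where "X' m = (\<Sum>i<a. cscale (x (m * a + i)) (s1 i))" for m
    have X'S: "X' m \<in> schur lam1" for m
      unfolding X'_def by (intro fs.subspace_sum[OF subspace_schur] fs.subspace_scale[OF subspace_schur] s1) simp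
    define L where "L n m t w = (\<Sum>v\<in>SW. \<gamma> (n, m, v) * young lam0 (contract lam0 v t) w)" for n m t w
    have LX: "L n m (X' m) w = (\<Sum>i<a. L n m (s1 i) w * x (m * a + i))" for n m w
    proof -
      have "young lam0 (contract lam0 v (X' m)) w = (\<Sum>i<a. x (m * a + i) * young lam0 (contract lam0 v (s1 i)) w)" for v
        unfolding X'_def
        by (simp add: fsp.linear_sum[OF clinear_contract] fsp.linear_scale[OF clinear_contract]
            fsp.linear_sum[OF clinear_young] fsp.linear_scale[OF clinear_young] pointwise)
      then have "L n m (X' m) w = (\<Sum>v\<in>SW. \<Sum>i<a. \<gamma> (n, m, v) * young lam0 (contract lam0 v (s1 i)) w * x (m * a + i))"
        by (simp add: L_def sum_distrib_left mult_ac)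
      also have "\<dots> = (\<Sum>i<a. L n m (s1 i) w * x (m * a + i))"
        unfolding L_def sum_distrib_right by (rule sum.swap)
      finally show ?thesis .
    qed
    \<comment> \<open>The value of the complex blow-up at \<open>X'\<close>. The kernel equations
      say that its coordinates vanish, hence so does \<open>Y\<close>.\<close>
    define Y where "Y n w = (\<Sum>m<c1. L n m (X' m) w)" for n w
    have YS: "Y n \<in> schur lam0" for n
    proof -
      have "Y n = (\<Sum>m<c1. \<Sum>v\<in>SW. cscale (\<gamma> (n, m, v)) (young lam0 (contract lam0 v (X' m))))"
        by (auto simp: Y_def L_def pointwise)
      also have "\<dots> \<in> schur lam0"
        by (intro fs.subspace_sum[OF subspace_schur] fs.subspace_scale[OF subspace_schur])
           (auto simp: schur_eq supported_def contract_def)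
      finally show ?thesis .
    qed
    have evD: "evaluate base_point (D r k) = (\<Sum>u\<in>words lam0. \<kappa>0 (r mod b) u * L (r div b) (k div a) (s1 (k mod a)) u)"
      if "r < N" "k < N" for r k
      unfolding D_def co0_def E_def L_def
      by (simp add: ev.sum ev.mult ev.Const evaluate_diff_unit_slot[OF bd0(1)[OF that(1)] bd1(1)[OF that(2)]])
    have Y0: "(\<Sum>u\<in>words lam0. \<kappa>0 (r mod b) u * Y (r div b) u) = 0" if r: "r < N" for r
    proof -
      have "(\<Sum>u\<in>words lam0. \<kappa>0 (r mod b) u * Y (r div b) u) =
          (\<Sum>u\<in>words lam0. \<Sum>m<c1. \<Sum>i<a. \<kappa>0 (r mod b) u * L (r div b) m (s1 i) u * x (m * a + i))"
        by (simp add: Y_def LX sum_distrib_left mult.assoc)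
      also have "\<dots> = (\<Sum>u\<in>words lam0. \<Sum>k<N. \<kappa>0 (r mod b) u * L (r div b) (k div a) (s1 (k mod a)) u * x k)"
        unfolding N1 sum_div_mod by (simp add: div_mult_mod_eq)
      also have "\<dots> = (\<Sum>k<N. evaluate base_point (D r k) * x k)"
        by (subst sum.swap) (simp add: evD[OF r] sum_distrib_right)
      finally show ?thesis using x[OF r] by simp
    qed
    have Yz: "Y n w = 0" if n: "n < c0" for n w
    proof -
      have "(\<Sum>u\<in>words lam0. \<kappa>0 i u * Y n u) = 0" if i: "i < b" for i
      proof -
        have "n * b + i < Suc n * b" using i by simp
        also have "\<dots> \<le> N" unfolding N_def using n by (intro mult_le_mono1) simp
        finally show ?thesis using Y0[of "n * b + i"] i by simp
      qed
      then show ?thesis using s0(2)[OF YS[of n], of w] by simp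
    qed
    have X0: "X' m = 0" if "m < c1" for m
    proof (rule blowup_injective[of X' m])
      show "\<forall>n<c0. \<forall>w\<in>words lam0. (\<Sum>(m, v)\<in>{..<c1} \<times> SW. \<gamma> (n, m, v) * young lam0 (contract lam0 v (X' m)) w) = 0"
        using Yz by (simp add: Y_def L_def sum.cartesian_product)
    qed (use X'S that in auto)
    show "\<forall>k<N. x k = 0"
    proof (intro allI impI)
      fix k assume k: "k < N"
      \<comment> \<open>The dual forms \<open>\<kappa>1\<close> read the coefficient
        \<open>x k\<close> off the zero tensor \<open>X' (k div a)\<close>.\<close>
      have "0 = (\<Sum>u\<in>words lam1. \<kappa>1 (k mod a) u * X' (k div a) u)" using X0[OF bd1(1)[OF k]] by (simp add: pointwise)
      also have "\<dots> = (\<Sum>i<a. x (k div a * a + i) * (\<Sum>u\<in>words lam1. \<kappa>1 (k mod a) u * s1 i u))"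
        unfolding X'_def pointwise sum_distrib_left by (subst sum.swap) (simp add: mult.left_commute)
      also have "\<dots> = (\<Sum>i<a. if k mod a = i then x (k div a * a + i) else 0)"
        by (intro sum.cong refl) (simp add: s1(3)[OF bd1(2)[OF k]])
      also have "\<dots> = x k" using bd1(2)[OF k] by simp
      finally show "x k = 0" by simp
    qed
  qed
  finally have "\<Delta> \<noteq> 0" by (auto simp: ev.zero)
  have injective: "F = 0" if F: "F \<in> C1" "diff F = 0" for F
  proof -
    have D0: "(\<Sum>k<N. D r k * co1 F k) = 0" for r
      using D_diff[of "co1 F" r] expand1[OF F(1)] F(2) by (simp add: co0_def pointwise)
    have "co1 F k = 0" if k: "k < N" for k
    proof -
      have "\<Delta> * co1 F k = (\<Sum>l<N. (if k = l then \<Delta> else 0) * co1 F l)"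
        using k by (simp add: if_distrib[of "\<lambda>t. t * _"] cong: if_cong)
      also have "\<dots> = (\<Sum>l<N. (\<Sum>r<N. square_adj N D k r * D r l) * co1 F l)"
        by (intro sum.cong refl) (simp add: square_adj_left[OF k] \<Delta>_def)
      also have "\<dots> = (\<Sum>r<N. square_adj N D k r * (\<Sum>l<N. D r l * co1 F l))"
        unfolding sum_distrib_left sum_distrib_right by (subst sum.swap) (simp add: mult.assoc)
      also have "\<dots> = 0" by (simp add: D0)
      finally show ?thesis using mpoly_mult_zero \<open>\<Delta> \<noteq> 0\<close> by blast
    qed
    then have "(\<Sum>k<N. schur_scale (co1 F k) (E k)) = 0" by (simp add: F0.sc_zero_left)
    then show ?thesis using expand1[OF F(1)] by simp
  qed
  have torsion: "schur_scale \<Delta> G \<in> diff ` C1" if G: "G \<in> C0" for G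
  proof
    \<comment> \<open>The adjugate applied to the coordinates of \<open>G\<close>; its product with
      the matrix of \<open>diff\<close> multiplies them by \<open>\<Delta>\<close>.\<close>
    define f where "f k = (\<Sum>r<N. square_adj N D k r * co0 G r)" for k
    define F where "F = (\<Sum>k<N. schur_scale (f k) (E k))"
    show "F \<in> C1" unfolding F_def by (intro F1.sum_C F1.sc_C E_C) simp
    have "co0 (diff F) r = \<Delta> * co0 G r" if r: "r < N" for r
    proof -
      have "co0 (diff F) r = (\<Sum>k<N. D r k * (\<Sum>l<N. square_adj N D k l * co0 G l))"
        unfolding F_def D_diff f_def ..
      also have "\<dots> = (\<Sum>l<N. (\<Sum>k<N. D r k * square_adj N D k l) * co0 G l)"
        unfolding sum_distrib_left sum_distrib_right by (subst sum.swap) (simp add: mult.assoc)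
      also have "\<dots> = (\<Sum>l<N. if r = l then \<Delta> * co0 G l else 0)"
        by (intro sum.cong refl) (simp add: square_adj_right[OF r] \<Delta>_def)
      also have "\<dots> = \<Delta> * co0 G r" using r by simp
      finally show ?thesis .
    qed
    then have "co0 (schur_scale \<Delta> G - diff F) r = 0" if "r < N" for r
      using that by (simp add: co0_diff co0_scale)
    moreover have "schur_scale \<Delta> G - diff F \<in> C0"
      using F0.add_C[OF F0.sc_C[OF G] F0.minus_C[OF diff_C]] by simp
    ultimately have "schur_scale \<Delta> G - diff F = 0" using zero0 by blast
    then show "schur_scale \<Delta> G = diff F" by simp
  qed
  show ?thesis
    by (intro conjI ballI impI exI[of _ \<Delta>]) (fact injective, fact \<open>\<Delta> \<noteq> 0\<close>, fact torsion)
qed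

text \<open>The module to be resolved is the cokernel of \<open>diff\<close>; equivariance makes the
  image stable, so the action descends.\<close>

sublocale Q: concrete_quotient C0 schur_scale "schur_free_act lam0" "diff ` C1"
proof
  show "diff ` C1 \<subseteq> C0" by (rule image_subsetI) (rule diff_C)
  show "0 \<in> diff ` C1" using imageI[OF F1.zero_C, of diff] by (simp only: diff_zero)
  fix x y r g assume "x \<in> diff ` C1"
  then obtain F where F: "x = diff F" "F \<in> C1" by blast
  have "- x = diff (- F)"
    using diff_diff[of 0 F] by (simp only: F(1) diff_zero diff_0)
  then show "- x \<in> diff ` C1" by (rule image_eqI[OF _ F1.minus_C[OF F(2)]])
  show "schur_scale r x \<in> diff ` C1"
    unfolding F(1) diff_scale[symmetric] by (rule imageI[OF F1.sc_C[OF F(2)]])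
  show "schur_free_act lam0 g x \<in> diff ` C1"
    unfolding F(1) diff_equivariant[symmetric] by (rule imageI[OF F1.act_C[OF F(2)]])
  assume "y \<in> diff ` C1"
  then obtain G where G: "y = diff G" "G \<in> C1" by blast
  show "x + y \<in> diff ` C1"
    unfolding F(1) G(1) diff_add[symmetric] by (rule imageI[OF F1.add_C[OF F(2) G(2)]])
qed

lemma torsion_Q: "torsion_module Q.Q"
proof -
  obtain r where r: "r \<noteq> 0 \<and> (\<forall>G\<in>C0. schur_scale r G \<in> diff ` C1)"
    using conjunct2[OF diff_injective_and_torsion] ..
  have "r \<odot>\<^bsub>Q.Q\<^esub> x = \<zero>\<^bsub>Q.Q\<^esub>" if x: "x \<in> carrier Q.Q" for x
  proof -
    obtain G where "G \<in> C0" "x = Q.coset G" using x by auto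
    moreover have "schur_scale r G - 0 \<in> diff ` C1" using r \<open>G \<in> C0\<close> by simp
    then have "Q.coset (schur_scale r G) = Q.coset 0" by (simp only: Q.coset_eq_iff)
    ultimately show ?thesis by (simp add: Q.coset_zero)
  qed
  then show ?thesis unfolding torsion_module_def using r by blast
qed

lemma resolution:
  "equivariant_minimal_resolution Q.Q Q.act_Q F0.M (schur_free_act lam0) F1.M (schur_free_act lam1) Q.coset diff"
  unfolding equivariant_minimal_resolution_def
proof (intro conjI)
  show "equivariant_hom F1.M (schur_free_act lam1) F0.M (schur_free_act lam0) diff"
    by (auto simp: equivariant_hom_def diff_C diff_add diff_scale diff_equivariant)
  show "inj_on diff (carrier F1.M)"
  proof (rule inj_onI)
    fix F G assume "F \<in> carrier F1.M" "G \<in> carrier F1.M" "diff F = diff G"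
    then have "F - G \<in> C1" "diff (F - G) = 0"
      using F1.add_C[OF _ F1.minus_C, of F G] by (simp_all add: diff_diff)
    then have "F - G = 0" using diff_injective_and_torsion by blast
    then show "F = G" by simp
  qed
  show "\<forall>B\<in>carrier (residue_module F1.M). residue_map F0.M diff B = \<one>\<^bsub>residue_module F0.M\<^esub>"
    by (intro ballI residue_map_zero[OF F1.concrete_module_axioms F0.concrete_module_axioms diff_minimal])
qed (simp_all add: Q.equivariant_Q F0.equivariant_M F1.equivariant_M Q.projection_hom Q.projection_kernel)

end

theorem theorem4p1:
  fixes k :: nat
    and lam0 lam1 :: "nat \<Rightarrow> nat"
  assumes "CARD('v::finite) = k" and "CARD('w::finite) = k" and "k \<ge> 1"
    and "partition_at_most k lam0" and "partition_at_most k lam1"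
    and "lam0 \<le> lam1" and "lam0 \<noteq> lam1"
  shows "\<exists>c0 c1 :: nat. c0 > 0 \<and> c1 > 0 \<and>
    (\<exists>(M :: (('v, 'w) coord, (nat \<Rightarrow> 'v filling \<Rightarrow> ('v, 'w) coord) set) module) act \<epsilon> d.
      torsion_module M \<and>
      equivariant_minimal_resolution M act
        (schur_free lam0 c0) (schur_free_act lam0)
        (schur_free lam1 c1) (schur_free_act lam1) \<epsilon> d)"
proof -
  \<comment> \<open>\<open>p\<close> counts the copies in the source of the blow-up and
    \<open>q\<close> those in its target, so they become \<open>c1\<close> and
    \<open>c0\<close>.\<close>
  obtain p q and \<gamma> :: "nat \<times> nat \<times> 'v filling \<Rightarrow> complex" where pq: "p > 0" "q > 0"
    "p * fs.dim (schur lam1 :: ('v filling \<Rightarrow> complex) set) = q * fs.dim (schur lam0 :: ('v filling \<Rightarrow> complex) set)"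
    "\<forall>x. (\<forall>m<p. x m \<in> schur lam1) \<longrightarrow> (\<forall>n<q. \<forall>w\<in>words lam0. (\<Sum>(m, v)\<in>{..<p} \<times> skew_words lam0 lam1.
         \<gamma> (n, m, v) * young lam0 (contract lam0 v (x m)) w) = 0) \<longrightarrow> (\<forall>m<p. x m = 0)"
    using skew_blowup_injective[OF assms(1,4,5,6)] by blast
  obtain \<phi> :: "'v \<Rightarrow> 'w" where "bij_betw \<phi> UNIV UNIV"
    using assms(1,2) finite_same_card_bij[of "UNIV :: 'v set" "UNIV :: 'w set"] by auto
  then have inj: "inj \<phi>" by (simp add: bij_betw_def)
  \<comment> \<open>The first box beyond row \<open>i\<close> of the smaller diagram belongs to the
    larger one, so there is at least one variable in every entry of the differential.\<close>
  obtain i where "lam0 i \<noteq> lam1 i" using assms(7) by blast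
  then have "(i, lam0 i) \<in> skew lam0 lam1"
    using le_funD[OF assms(6), of i] by (simp add: skew_def diagram_def)
  then have ne: "skew lam0 lam1 \<noteq> {}" by blast
  note fin = finite_diagram[OF assms(4)] finite_diagram[OF assms(5)]
  interpret skew_differential lam0 lam1 q p \<gamma> \<phi>
    by unfold_locales (use fin(2) assms(6) ne inj pq in blast)+
  show ?thesis
    using torsion_Q resolution pq(1,2)
    unfolding schur_free_eq[OF fin(1)] schur_free_eq[OF fin(2)] by blast
qed

end
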